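(* Let $K$ be an algebraically closed field of characteristic zero and let $C\subset\mathbb{P}^2(K)$ be a non-singular plane curve of degree $d\geq 5$ such that $Aut(C)$ contains an element of order $\ell(d-1)$ with $2\leq\ell\leq d-1$. Then $Aut(C)$ is cyclic and contains a homology of period $d-1$. In particular, $C$ has a unique inner Galois point.
   Context: $Aut(C)$ is the full automorphism group of $C$ over $K$, identified with the finite subgroup of $PGL_3(K)$ preserving the defining equation of $C$. A homology of period $n$ is an element of $PGL_3(K)$ of order $n$ which, after a change of coordinates, has the form $\mathrm{diag}(1,\zeta^a,\zeta^b)$ with $\zeta$ a primitive $n$-th root of unity and $ab=0$ (equivalently, it fixes pointwise a line, its axis, and a point off that line, its center). A point $P\in\mathbb{P}^2(K)$ is a Galois point of $C$ if the projection $C\dashrightarrow\mathbb{P}^1$ from $P$ induces a Galois extension of function fields; it is called inner if $P\in C$. *)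

theory Defs
  imports
    "HOL-Analysis.Determinants"
    "HOL-Library.Poly_Mapping"
    "HOL-Computational_Algebra.Polynomial"
    "HOL-Computational_Algebra.Fraction_Field"
    "HOL-Algebra.Coset"
    "HOL-Algebra.Elementary_Groups"
    "HOL-Algebra.Multiplicative_Group"
    "HOL-Algebra.QuotRing"
    "HOL-Algebra.Finite_Extensions"
begin

section \<open>Polynomials in finitely many variables\<close>

text \<open>
  Variables are indexed by a finite type, so that the coordinates of a vector of type
  \<^typ>\<open>'k ^ 'n\<close> and the variables share the same index type. Monomials are exponent vectors.
\<close>

type_synonym ('k, 'n) mpoly = "('n \<Rightarrow>\<^sub>0 nat) \<Rightarrow>\<^sub>0 'k"

definition mp_const :: "'k::zero \<Rightarrow> ('k, 'n) mpoly"
  where "mp_const c = Poly_Mapping.single 0 c"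

definition mp_var :: "'n \<Rightarrow> ('k::zero_neq_one, 'n) mpoly"
  where "mp_var i = Poly_Mapping.single (Poly_Mapping.single i 1) 1"

text \<open>Evaluation at \<open>x\<close> of the polynomial whose coefficients are mapped into a ring by \<open>\<phi>\<close>.\<close>

definition mp_eval :: "('k::zero \<Rightarrow> 'r::comm_ring_1) \<Rightarrow> ('n::finite \<Rightarrow> 'r) \<Rightarrow> ('k, 'n) mpoly \<Rightarrow> 'r"
  where "mp_eval \<phi> x p =
    (\<Sum>m\<in>Poly_Mapping.keys p. \<phi> (Poly_Mapping.lookup p m) *
       (\<Prod>i\<in>UNIV. x i ^ Poly_Mapping.lookup m i))"

definition mp_value :: "('k::comm_ring_1, 'n::finite) mpoly \<Rightarrow> 'k ^ 'n \<Rightarrow> 'k"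
  where "mp_value p v = mp_eval id (\<lambda>i. v $ i) p"

definition mp_subst ::
  "('n::finite \<Rightarrow> ('k::comm_ring_1, 'm) mpoly) \<Rightarrow> ('k, 'n) mpoly \<Rightarrow> ('k, 'm) mpoly"
  where "mp_subst q p = mp_eval mp_const q p"

definition mp_pderiv :: "'n \<Rightarrow> ('k::comm_ring_1, 'n) mpoly \<Rightarrow> ('k, 'n) mpoly"
  where "mp_pderiv i p =
    (\<Sum>m\<in>Poly_Mapping.keys p.
       Poly_Mapping.single (m - Poly_Mapping.single i 1)
         (of_nat (Poly_Mapping.lookup m i) * Poly_Mapping.lookup p m))"

definition homogeneous :: "nat \<Rightarrow> ('k::zero, 'n::finite) mpoly \<Rightarrow> bool"
  where "homogeneous d p \<longleftrightarrow>
    (\<forall>m\<in>Poly_Mapping.keys p. (\<Sum>i\<in>UNIV. Poly_Mapping.lookup m i) = d)"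

definition linear_form :: "'k::comm_ring_1 ^ 'n::finite \<Rightarrow> ('k, 'n) mpoly"
  where "linear_form a = (\<Sum>i\<in>UNIV. mp_const (a $ i) * mp_var i)"


section \<open>Points of the projective plane and plane curves\<close>

text \<open>A point is the set of all its homogeneous coordinate vectors; the zero vector is excluded.\<close>

definition proj_plane :: "('k::field ^ 3) set set"
  where "proj_plane = {{c *s v | c. c \<noteq> 0} | v. v \<noteq> 0}"

text \<open>
  A curve is represented by its defining form. Irreducibility is not required here; for
  non-singular plane curves it is automatic.
\<close>

definition nonsingular_plane_curve :: "nat \<Rightarrow> ('k::field, 3) mpoly \<Rightarrow> bool"
  where "nonsingular_plane_curve d F \<longleftrightarrow>
    F \<noteq> 0 \<and> homogeneous d F \<and>
    (\<forall>v. v \<noteq> 0 \<and> mp_value F v = 0 \<longrightarrow> (\<exists>i. mp_value (mp_pderiv i F) v \<noteq> 0))"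

definition on_curve :: "('k::field, 3) mpoly \<Rightarrow> ('k ^ 3) set \<Rightarrow> bool"
  where "on_curve F P \<longleftrightarrow> (\<forall>v\<in>P. mp_value F v = 0)"


section \<open>The projective linear group and automorphisms of a plane curve\<close>

definition GL3 :: "('k::field ^ 3 ^ 3) monoid"
  where "GL3 = \<lparr>carrier = {A. invertible A}, mult = (**), one = mat 1\<rparr>"

definition scalar_matrices :: "('k::field ^ 3 ^ 3) set"
  where "scalar_matrices = {mat c | c. c \<noteq> 0}"

definition PGL3 :: "('k::field ^ 3 ^ 3) set monoid"
  where "PGL3 = GL3 Mod scalar_matrices"

definition proj_class :: "'k::field ^ 3 ^ 3 \<Rightarrow> ('k ^ 3 ^ 3) set"
  where "proj_class A = scalar_matrices #>\<^bsub>GL3\<^esub> A"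

text \<open>The form \<open>v \<mapsto> F (A v)\<close>.\<close>

definition transform_form :: "'k::field ^ 3 ^ 3 \<Rightarrow> ('k, 3) mpoly \<Rightarrow> ('k, 3) mpoly"
  where "transform_form A F = mp_subst (\<lambda>i. linear_form (row i A)) F"

definition curve_Aut :: "('k::field, 3) mpoly \<Rightarrow> ('k ^ 3 ^ 3) set monoid"
  where "curve_Aut F = PGL3\<lparr>carrier :=
    {proj_class A | A. invertible A \<and> (\<exists>c. c \<noteq> 0 \<and> transform_form A F = mp_const c * F)}\<rparr>"

definition primitive_root_of_unity :: "nat \<Rightarrow> 'k::field \<Rightarrow> bool"
  where "primitive_root_of_unity n z \<longleftrightarrow> n > 0 \<and> z ^ n = 1 \<and> (\<forall>k. 0 < k \<and> k < n \<longrightarrow> z ^ k \<noteq> 1)"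

definition diag3 :: "'k::field \<Rightarrow> 'k \<Rightarrow> 'k \<Rightarrow> 'k ^ 3 ^ 3"
  where "diag3 x y z = (\<chi> i j. if i = j then (vector [x, y, z] :: 'k ^ 3) $ i else 0)"

definition homology :: "nat \<Rightarrow> ('k::field ^ 3 ^ 3) set \<Rightarrow> bool"
  where "homology n g \<longleftrightarrow>
    g \<in> carrier PGL3 \<and> group.ord PGL3 g = n \<and>
    (\<exists>M z a b. invertible M \<and> primitive_root_of_unity n z \<and> a * b = (0::nat) \<and>
       g = proj_class (M ** diag3 1 (z ^ a) (z ^ b) ** matrix_inv M))"


section \<open>Function fields and Galois points\<close>

text \<open>
  The local ring of the projective plane along the curve \<open>F = 0\<close> consists of the quotients of forms
  of equal degree whose denominator does not vanish identically on the curve; its maximal ideal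
  consists of those whose numerator does. For irreducible \<open>F\<close>, the residue field is the function
  field of the curve: its elements are rational functions restricted to the curve.
\<close>

definition curve_local_ring :: "('k::field, 3) mpoly \<Rightarrow> ('k, 3) mpoly fract ring"
  where "curve_local_ring F =
    \<lparr>carrier = {Fract A B | A B. (\<exists>n. homogeneous n A \<and> homogeneous n B) \<and> \<not> F dvd B},
     mult = (*), one = 1, zero = 0, add = (+)\<rparr>"

definition curve_ideal :: "('k::field, 3) mpoly \<Rightarrow> ('k, 3) mpoly fract set"
  where "curve_ideal F =
    {Fract A B | A B. (\<exists>n. homogeneous n A \<and> homogeneous n B) \<and> \<not> F dvd B \<and> F dvd A}"

definition function_field :: "('k::field, 3) mpoly \<Rightarrow> ('k, 3) mpoly fract set ring"
  where "function_field F = curve_local_ring F Quot curve_ideal F"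

definition restrict_to_curve ::
  "('k::field, 3) mpoly \<Rightarrow> ('k, 3) mpoly fract \<Rightarrow> ('k, 3) mpoly fract set"
  where "restrict_to_curve F f = curve_ideal F +>\<^bsub>curve_local_ring F\<^esub> f"

text \<open>
  The image of the function field of the projective line under the pullback along the
  map \<open>[l : m]\<close> from the curve to the line, for linear forms \<open>l\<close>, \<open>m\<close>. A rational function on the
  line is a quotient of binary forms of equal degree; the variables of binary forms are
  indexed by \<open>1\<close> and \<open>2\<close> of type \<^typ>\<open>2\<close>.
\<close>

definition pullback_field ::
  "('k::field, 3) mpoly \<Rightarrow> 'k ^ 3 \<Rightarrow> 'k ^ 3 \<Rightarrow> ('k, 3) mpoly fract set set"
  where "pullback_field F l m =
    (let pull = mp_subst (\<lambda>i::2. if i = 1 then linear_form l else linear_form m) in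
     {restrict_to_curve F (Fract (pull A) (pull B)) | A B.
        (\<exists>n. homogeneous n A \<and> homogeneous n B) \<and> \<not> F dvd pull B})"

text \<open>
  \<open>L\<close> is Galois over \<open>E\<close>: it is algebraic over \<open>E\<close>, and \<open>E\<close> is the fixed field of the group of
  automorphisms of \<open>L\<close> over \<open>E\<close>.
\<close>

definition galois_extension :: "('a, 'b) ring_scheme \<Rightarrow> 'a set \<Rightarrow> bool"
  where "galois_extension L E \<longleftrightarrow>
    field L \<and> subfield E L \<and>
    (\<forall>x\<in>carrier L. ring.algebraic L E x) \<and>
    {x \<in> carrier L. \<forall>\<sigma>\<in>ring_iso L L. (\<forall>e\<in>E. \<sigma> e = e) \<longrightarrow> \<sigma> x = x} = E"

text \<open>
  The projection from \<open>P\<close> is \<open>[l : m]\<close> for any two linear forms \<open>l\<close>, \<open>m\<close> whose only common zero in the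
  plane is \<open>P\<close>. Another choice of \<open>l\<close>, \<open>m\<close> changes the map by an automorphism of the line, so the
  field does not depend on it.
\<close>

definition galois_point :: "('k::field, 3) mpoly \<Rightarrow> ('k ^ 3) set \<Rightarrow> bool"
  where "galois_point F P \<longleftrightarrow>
    P \<in> proj_plane \<and>
    (\<exists>l m. P = {v. v \<noteq> 0 \<and> mp_value (linear_form l) v = 0 \<and> mp_value (linear_form m) v = 0} \<and>
       galois_extension (function_field F) (pullback_field F l m))"

definition inner_galois_point :: "('k::field, 3) mpoly \<Rightarrow> ('k ^ 3) set \<Rightarrow> bool"
  where "inner_galois_point F P \<longleftrightarrow> galois_point F P \<and> on_curve F P"

end

theory Submission
  imports Defs "HOL-Computational_Algebra.Formal_Laurent_Series"
begin

text \<open>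
  A power of the given element is a homology of period \<open>n = d - 1\<close>. In suitable coordinates the
  curve becomes \<open>z^n = g(x)\<close> with \<open>g\<close> squarefree of degree \<open>n + 1\<close>, and the homology multiplies \<open>z\<close>
  by a root of unity; hence the projection to the \<open>x\<close>-line from the point \<open>[0 : 0 : 1]\<close> of the curve
  is Galois. No other point \<open>(x0, z0)\<close> of the curve is an inner Galois point. If \<open>z0 = 0\<close>, the fibre
  of the projection over the tangent direction contains places with different ramification. If
  \<open>z0 \<noteq> 0\<close>, an automorphism over the projection moving the place at infinity to the point
  \<open>(x0, \<zeta> z0)\<close> maps \<open>x - x0\<close> to a function \<open>f\<close> such that \<open>(x - x0)^n f\<close> is regular away from infinity;
  its zeros and its pole force \<open>f (z - \<zeta> \<Lambda>) = c (x - x0)\<close> with \<open>\<Lambda>\<close> linear in \<open>x\<close>, so that a Moebius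
  map permutes the \<open>n\<close>-th roots of unity in an impossible way. Consequently every automorphism fixes
  \<open>[0 : 0 : 1]\<close> and has the form \<open>(x, z) \<mapsto> (\<alpha> x + \<beta>, \<mu> z)\<close>, and \<open>\<alpha> / \<mu>\<close> is an injective character of
  finite exponent.

  The function field is embedded into Laurent series by a parametrisation at infinity, and places
  are parametrisations of the curve by Laurent series.
\<close>


text \<open>A power of the automorphism is a homology because smoothness at a coordinate point i
  forces some monomial X_i^n X_j into the equation. In an eigenbasis this gives \<alpha>_i^n
  \<alpha>_j = c, and the order l n then leaves exactly two equal eigenvalues in the l-th power. The
  real obstacle is uniqueness of the Galois point. Divisors and ramification are replaced by orders
  of Laurent series: two places in one fibre of a projection can be compared once both are
  reparametrised so that the slope has the same expansion, and a Galois extension must then contain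
  an automorphism carrying one to the other. The Moebius condition amounts to three coefficient
  equations; eliminating the unknowns leaves N (N - 3) (N + 1) = 0 for N = n, which is how the
  quartic case separates from n at least 4. The character works because leading coefficients give
  \<alpha>^(n+1) = \<mu>^n, so that \<alpha> = (\<mu>/\<alpha>)^n and \<mu> =
  (\<mu>/\<alpha>)^(n+1): the ratio \<alpha>/\<mu> determines both, and a pure translation cannot
  preserve the roots of g.\<close>

unbundle no Formal_Power_Series.fps_syntax
unbundle Formal_Laurent_Series.fps_syntax

section \<open>Polynomial evaluation and roots of unity\<close>

section \<open>Evaluation of polynomials\<close>

text \<open>Four coefficient maps share these evaluation laws: \<open>mp_const\<close> gives
  substitution, \<open>id\<close> gives values at points, \<open>fls_const\<close> gives values on
  Laurent series, and constant univariate polynomials give the restriction to a line.\<close>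

locale coef_hom =
  fixes \<phi> :: "'k::comm_ring_1 \<Rightarrow> 'r::comm_ring_1"
  assumes zero [simp]: "\<phi> 0 = 0" and one [simp]: "\<phi> 1 = 1"
    and add: "\<phi> (a + b) = \<phi> a + \<phi> b" and mult: "\<phi> (a * b) = \<phi> a * \<phi> b"

lemma sum_monomials: "(\<Sum>m\<in>Poly_Mapping.keys p. Poly_Mapping.single m (Poly_Mapping.lookup p m)) = p"
proof (rule poly_mapping_eqI)
  fix k
  have "Poly_Mapping.lookup (\<Sum>m\<in>Poly_Mapping.keys p. Poly_Mapping.single m (Poly_Mapping.lookup p m)) k
    = (\<Sum>m\<in>Poly_Mapping.keys p. if m = k then Poly_Mapping.lookup p k else 0)"
    by (simp add: lookup_sum lookup_single when_def cong: if_cong sum.cong)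
  also have "\<dots> = Poly_Mapping.lookup p k"
    by (simp add: sum.delta in_keys_iff)
  finally show "Poly_Mapping.lookup (\<Sum>m\<in>Poly_Mapping.keys p. Poly_Mapping.single m (Poly_Mapping.lookup p m)) k
      = Poly_Mapping.lookup p k" .
qed

lemma mp_eval_zero [simp]: "mp_eval \<phi> x 0 = 0"
  by (simp add: mp_eval_def)

context coef_hom
begin

lemma mp_eval_superset:
  assumes "finite A" "Poly_Mapping.keys p \<subseteq> A"
  shows "mp_eval \<phi> x p = (\<Sum>m\<in>A. \<phi> (Poly_Mapping.lookup p m) * (\<Prod>i\<in>UNIV. x i ^ Poly_Mapping.lookup m i))"
  unfolding mp_eval_def using assms
  by (intro sum.mono_neutral_left) (auto simp: in_keys_iff)

lemma mp_eval_add: "mp_eval \<phi> x (p + q) = mp_eval \<phi> x p + mp_eval \<phi> x q"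
proof -
  let ?A = "Poly_Mapping.keys p \<union> Poly_Mapping.keys q"
  have "Poly_Mapping.keys (p + q) \<subseteq> ?A" by (rule Poly_Mapping.keys_add)
  then show ?thesis
    by (simp add: mp_eval_superset[of ?A] lookup_add add sum.distrib[symmetric] distrib_right)
qed

lemma mp_eval_sum: "mp_eval \<phi> x (\<Sum>a\<in>A. f a) = (\<Sum>a\<in>A. mp_eval \<phi> x (f a))"
  by (induction A rule: infinite_finite_induct) (auto simp: mp_eval_add)

lemma mp_eval_single:
  "mp_eval \<phi> x (Poly_Mapping.single m c) = \<phi> c * (\<Prod>i\<in>UNIV. x i ^ Poly_Mapping.lookup m i)"
  by (subst mp_eval_superset[of "{m}"]) (auto simp: lookup_single)

lemma mp_eval_mult: "mp_eval \<phi> x (p * q) = mp_eval \<phi> x p * mp_eval \<phi> x q"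
proof -
  let ?s = "\<lambda>p m. Poly_Mapping.single m (Poly_Mapping.lookup p m)"
  have "p * q = (\<Sum>m\<in>Poly_Mapping.keys p. ?s p m) * (\<Sum>m\<in>Poly_Mapping.keys q. ?s q m)"
    by (simp add: sum_monomials)
  also have "\<dots> = (\<Sum>m\<in>Poly_Mapping.keys p. \<Sum>m'\<in>Poly_Mapping.keys q. ?s p m * ?s q m')"
    by (simp add: sum_product)
  finally have "mp_eval \<phi> x (p * q) = (\<Sum>m\<in>Poly_Mapping.keys p. \<Sum>m'\<in>Poly_Mapping.keys q.
      mp_eval \<phi> x (?s p m) * mp_eval \<phi> x (?s q m'))"
    by (simp add: mp_eval_sum mp_eval_single mult_single lookup_add power_add prod.distrib mult mult_ac)
  also have "\<dots> = mp_eval \<phi> x (\<Sum>m\<in>Poly_Mapping.keys p. ?s p m) * mp_eval \<phi> x (\<Sum>m\<in>Poly_Mapping.keys q. ?s q m)"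
    by (simp only: mp_eval_sum sum_product)
  finally show ?thesis by (simp add: sum_monomials)
qed

lemma mp_eval_const [simp]: "mp_eval \<phi> x (mp_const c) = \<phi> c"
  by (simp add: mp_const_def mp_eval_single)

lemma mp_eval_one [simp]: "mp_eval \<phi> x 1 = 1"
  using mp_eval_single[of x 0 1] by simp

lemma mp_eval_var [simp]: "mp_eval \<phi> x (mp_var i) = x i"
proof -
  have "mp_eval \<phi> x (mp_var i) = (\<Prod>j\<in>UNIV. x j ^ (if i = j then Suc 0 else 0))"
    by (simp add: mp_var_def mp_eval_single lookup_single when_def)
  also have "\<dots> = (\<Prod>j\<in>UNIV. if j = i then x i else 1)"
    by (intro prod.cong) auto
  finally show ?thesis by simp
qed

lemma mp_eval_power: "mp_eval \<phi> x (p ^ k) = mp_eval \<phi> x p ^ k"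
  by (induction k) (auto simp: mp_eval_mult)

lemma mp_eval_prod: "mp_eval \<phi> x (\<Prod>a\<in>A. f a) = (\<Prod>a\<in>A. mp_eval \<phi> x (f a))"
  by (induction A rule: infinite_finite_induct) (auto simp: mp_eval_mult)

lemma uminus: "\<phi> (- a) = - \<phi> a"
  using add[of a "- a"] by (simp add: eq_neg_iff_add_eq_0 add.commute)

lemma mp_eval_uminus: "mp_eval \<phi> x (- p) = - mp_eval \<phi> x p"
  using mp_eval_add[of x p "- p"] by (simp add: eq_neg_iff_add_eq_0 add.commute)

lemma mp_eval_diff: "mp_eval \<phi> x (p - q) = mp_eval \<phi> x p - mp_eval \<phi> x q"
  using mp_eval_add[of x p "- q"] by (simp add: mp_eval_uminus)

lemma mp_eval_linear_form: "mp_eval \<phi> x (linear_form a) = (\<Sum>i\<in>UNIV. \<phi> (a $ i) * x i)"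
  by (simp add: linear_form_def mp_eval_sum mp_eval_mult)

lemmas mp_eval_simps = mp_eval_add mp_eval_sum mp_eval_mult mp_eval_power mp_eval_prod
  mp_eval_uminus mp_eval_diff mp_eval_linear_form

end

interpretation mp_const_hom: coef_hom "mp_const :: 'k::comm_ring_1 \<Rightarrow> ('k, 'n) mpoly"
  by unfold_locales (auto simp: mp_const_def single_add mult_single)

interpretation id_hom: coef_hom "id :: 'k::comm_ring_1 \<Rightarrow> 'k"
  by unfold_locales auto

interpretation fls_hom: coef_hom "fls_const :: 'k::comm_ring_1 \<Rightarrow> 'k fls"
  by unfold_locales (auto simp: fls_plus_const fls_const_mult_const)

interpretation pCons_hom: coef_hom "\<lambda>c::'k::comm_ring_1. [:c:]"
  by unfold_locales (auto simp: one_pCons)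

lemma (in coef_hom) mp_eval_subst:
  "mp_eval \<phi> x (mp_subst q p) = mp_eval \<phi> (\<lambda>i. mp_eval \<phi> x (q i)) p"
  unfolding mp_subst_def
  by (subst (2 3) mp_eval_def) (simp add: mp_eval_simps)

subsection \<open>Homogeneous polynomials\<close>

lemma homogeneous_zero [simp]: "homogeneous N 0"
  by (simp add: homogeneous_def)

lemma homogeneous_add: "homogeneous N p \<Longrightarrow> homogeneous N q \<Longrightarrow> homogeneous N (p + q)"
  unfolding homogeneous_def using Poly_Mapping.keys_add[of p q] by blast

lemma homogeneous_uminus: "homogeneous N p \<Longrightarrow> homogeneous N (- p)"
  unfolding homogeneous_def by (simp add: in_keys_iff)

lemma homogeneous_diff: "homogeneous N p \<Longrightarrow> homogeneous N q \<Longrightarrow> homogeneous N (p - q :: ('k::ab_group_add, 'n::finite) mpoly)"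
  using homogeneous_add[of N p "- q"] homogeneous_uminus[of N q] by simp

lemma homogeneous_sum: "(\<And>a. a \<in> A \<Longrightarrow> homogeneous N (f a)) \<Longrightarrow> homogeneous N (\<Sum>a\<in>A. f a)"
  by (induction A rule: infinite_finite_induct) (auto intro: homogeneous_add)

lemma homogeneous_mult: "homogeneous N p \<Longrightarrow> homogeneous M q \<Longrightarrow> homogeneous (N + M) (p * q)"
  unfolding homogeneous_def
proof
  fix m assume *: "\<forall>m\<in>Poly_Mapping.keys p. (\<Sum>i\<in>UNIV. Poly_Mapping.lookup m i) = N"
    "\<forall>m\<in>Poly_Mapping.keys q. (\<Sum>i\<in>UNIV. Poly_Mapping.lookup m i) = M"
  assume "m \<in> Poly_Mapping.keys (p * q)"
  then obtain a b where "m = a + b" "a \<in> Poly_Mapping.keys p" "b \<in> Poly_Mapping.keys q"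
    using Poly_Mapping.keys_mult[of p q] by blast
  then show "(\<Sum>i\<in>UNIV. Poly_Mapping.lookup m i) = N + M"
    using * by (simp add: lookup_add sum.distrib)
qed

lemma homogeneous_const [simp]: "homogeneous 0 (mp_const c)"
  by (auto simp: homogeneous_def mp_const_def)

lemma homogeneous_one [simp]: "homogeneous 0 1"
  by (auto simp: homogeneous_def)

lemma homogeneous_var [simp]: "homogeneous (Suc 0) (mp_var i)"
  by (auto simp: homogeneous_def mp_var_def lookup_single when_def)

lemma homogeneous_power: "homogeneous N p \<Longrightarrow> homogeneous (N * k) (p ^ k)"
  by (induction k) (auto dest: homogeneous_mult)

lemma homogeneous_var_power [simp]: "homogeneous k (mp_var i ^ k)"
  using homogeneous_power[OF homogeneous_var, of k i] by simp

lemma homogeneous_prod: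
  "(\<And>a. a \<in> A \<Longrightarrow> homogeneous (N a) (f a)) \<Longrightarrow> homogeneous (\<Sum>a\<in>A. N a) (\<Prod>a\<in>A. f a)"
  by (induction A rule: infinite_finite_induct) (auto intro: homogeneous_mult)

lemma homogeneous_const_mult: "homogeneous N p \<Longrightarrow> homogeneous N (mp_const c * p)"
  using homogeneous_mult[of 0 "mp_const c" N p] by simp

lemma homogeneous_linear_form [simp]: "homogeneous (Suc 0) (linear_form a)"
  unfolding linear_form_def by (intro homogeneous_sum homogeneous_const_mult homogeneous_var)

lemma homogeneous_subst:
  assumes "homogeneous N p" "\<And>i. homogeneous (Suc 0) (q i)"
  shows "homogeneous N (mp_subst q p)"
  unfolding mp_subst_def mp_eval_def
proof (intro homogeneous_sum homogeneous_const_mult)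
  fix m assume "m \<in> Poly_Mapping.keys p"
  \<comment> \<open>The factor \<open>Suc 0\<close> brings the degree into the form that
    \<open>homogeneous_power\<close> delivers.\<close>
  then have N: "N = (\<Sum>i\<in>UNIV. Suc 0 * Poly_Mapping.lookup m i)"
    using assms(1) by (simp add: homogeneous_def)
  show "homogeneous N (\<Prod>i\<in>UNIV. q i ^ Poly_Mapping.lookup m i)"
    unfolding N by (intro homogeneous_prod homogeneous_power assms(2))
qed

lemma homogeneous_single: "(\<Sum>i\<in>UNIV. Poly_Mapping.lookup m i) = N \<Longrightarrow> homogeneous N (Poly_Mapping.single m c)"
  by (auto simp: homogeneous_def)

lemma (in coef_hom) mp_eval_homogeneous_scale:
  assumes "homogeneous N p"
  shows "mp_eval \<phi> (\<lambda>i. c * x i) p = c ^ N * mp_eval \<phi> x p"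
proof -
  have "(\<Prod>i\<in>UNIV. (c * x i) ^ Poly_Mapping.lookup m i) = c ^ N * (\<Prod>i\<in>UNIV. x i ^ Poly_Mapping.lookup m i)"
    if "m \<in> Poly_Mapping.keys p" for m
    using assms that by (simp add: homogeneous_def power_mult_distrib prod.distrib flip: power_sum)
  then show ?thesis
    by (simp add: mp_eval_def sum_distrib_left mult_ac cong: sum.cong)
qed

lemma homogeneous_transform: "homogeneous N F \<Longrightarrow> homogeneous N (transform_form A F)"
  unfolding transform_form_def by (intro homogeneous_subst) auto

lemma single_eq_const_mult_vars:
  "Poly_Mapping.single m (c::'k::comm_ring_1) = mp_const c * (\<Prod>i\<in>UNIV. mp_var (i::'n::finite) ^ Poly_Mapping.lookup m i)"
proof -
  have pow: "mp_var i ^ k = Poly_Mapping.single (Poly_Mapping.single i k) (1::'k)" for i :: 'n and k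
    by (induction k) (auto simp: mp_var_def mult_single simp flip: single_add)
  have "(\<Prod>i\<in>A. mp_var i ^ Poly_Mapping.lookup m i) =
    Poly_Mapping.single (\<Sum>i\<in>A. Poly_Mapping.single i (Poly_Mapping.lookup m i)) (1::'k)" if "finite A" for A
    using that by (induction A) (auto simp: pow mult_single)
  moreover have "(\<Sum>i\<in>UNIV. Poly_Mapping.single i (Poly_Mapping.lookup m i)) = m"
    by (rule poly_mapping_eqI) (simp add: lookup_sum lookup_single when_def)
  ultimately show ?thesis by (simp add: mp_const_def mult_single)
qed

subsection \<open>Polynomials as functions over an infinite field\<close>

lemma exponent_3_eqI:
  fixes m m' :: "3 \<Rightarrow>\<^sub>0 nat"
  assumes "Poly_Mapping.lookup m 1 = Poly_Mapping.lookup m' 1"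
    "Poly_Mapping.lookup m 2 = Poly_Mapping.lookup m' 2"
    "Poly_Mapping.lookup m 3 = Poly_Mapping.lookup m' 3"
  shows "m = m'"
proof (rule poly_mapping_eqI)
  fix k :: 3 show "Poly_Mapping.lookup m k = Poly_Mapping.lookup m' k"
    using exhaust_3[of k] assms by auto
qed

text \<open>Kronecker's substitution turns a ternary polynomial into a univariate one without
  identifying monomials.\<close>

lemma mp_value_eq_0_imp:
  fixes p :: "('k::field_char_0, 3) mpoly"
  assumes "\<And>v. mp_value p v = 0"
  shows "p = 0"
proof (rule ccontr)
  assume "p \<noteq> 0"
  let ?K = "Poly_Mapping.keys p"
  let ?l = "Poly_Mapping.lookup :: (3 \<Rightarrow>\<^sub>0 nat) \<Rightarrow> _"
  \<comment> \<open>\<open>N\<close> exceeds every exponent in \<open>p\<close>, so the three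
    exponents of a monomial are the base \<open>N\<close> digits of \<open>e m\<close>.\<close>
  define N where "N = Suc (\<Sum>m\<in>?K. \<Sum>i\<in>UNIV. ?l m i)"
  have N0: "N > 0" by (simp add: N_def)
  have lt: "?l m i < N" if "m \<in> ?K" for m i
  proof -
    have "?l m i \<le> (\<Sum>i\<in>UNIV. ?l m i)" by (intro member_le_sum) auto
    also have "\<dots> \<le> (\<Sum>m\<in>?K. \<Sum>i\<in>UNIV. ?l m i)"
      using that by (intro member_le_sum[of m ?K "\<lambda>m. \<Sum>i\<in>UNIV. ?l m i"]) auto
    finally show ?thesis by (simp add: N_def)
  qed
  define e where "e m = ?l m 1 + N * (?l m 2 + N * ?l m 3)" for m
  have inj: "m = m'" if "m \<in> ?K" "m' \<in> ?K" "e m = e m'" for m m'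
  proof -
    have 1: "?l m 1 = ?l m' 1"
    proof -
      have "e m mod N = ?l m 1" "e m' mod N = ?l m' 1" unfolding e_def using lt that by auto
      with that show ?thesis by simp
    qed
    then have "N * (?l m 2 + N * ?l m 3) = N * (?l m' 2 + N * ?l m' 3)" using that by (simp add: e_def)
    then have e2: "?l m 2 + N * ?l m 3 = ?l m' 2 + N * ?l m' 3" using N0 nat_mult_eq_cancel1 by blast
    have 2: "?l m 2 = ?l m' 2"
    proof -
      have "(?l m 2 + N * ?l m 3) mod N = ?l m 2" "(?l m' 2 + N * ?l m' 3) mod N = ?l m' 2" using lt that by auto
      with e2 show ?thesis by simp
    qed
    then have "N * ?l m 3 = N * ?l m' 3" using e2 by linarith
    then have "?l m 3 = ?l m' 3" using N0 nat_mult_eq_cancel1 by blast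
    with 1 2 show ?thesis by (intro exponent_3_eqI)
  qed
  define q where "q = (\<Sum>m\<in>?K. Polynomial.monom (Poly_Mapping.lookup p m) (e m))"
  have "poly q y = 0" for y
  proof -
    have "y ^ e m = y ^ ?l m 1 * (y ^ N) ^ ?l m 2 * (y ^ (N * N)) ^ ?l m 3" for m
      unfolding e_def power_add power_mult distrib_left by (simp only: mult.assoc power_mult)
    then have "poly q y = mp_value p (vector [y, y ^ N, y ^ (N * N)])"
      unfolding q_def poly_sum poly_monom mp_value_def mp_eval_def UNIV_3
      by (simp add: mult.assoc)
    then show ?thesis by (simp add: assms)
  qed
  then have "q = 0" using poly_all_0_iff_0 by blast
  from \<open>p \<noteq> 0\<close> obtain m0 where m0: "m0 \<in> ?K" by (metis Poly_Mapping.keys_eq_empty ex_in_conv)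
  have "Polynomial.coeff q (e m0) = (\<Sum>m\<in>?K. if m = m0 then Poly_Mapping.lookup p m else 0)"
    unfolding q_def Polynomial.coeff_sum Polynomial.coeff_monom using inj m0 by (intro sum.cong) auto
  also have "\<dots> = Poly_Mapping.lookup p m0" using m0 by (simp add: sum.delta)
  finally show False using m0 \<open>q = 0\<close> by (simp add: in_keys_iff)
qed

lemma mp_value_ext:
  fixes p q :: "('k::field_char_0, 3) mpoly"
  assumes "\<And>v. mp_value p v = mp_value q v"
  shows "p = q"
  using mp_value_eq_0_imp[of "p - q"] assms by (simp add: mp_value_def id_hom.mp_eval_diff)

lemma mp_value_mult: "mp_value (p * q) v = mp_value p v * mp_value q v"
  by (simp add: mp_value_def id_hom.mp_eval_mult)

lemma mp_value_const [simp]: "mp_value (mp_const c) v = c"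
  by (simp add: mp_value_def)

lemma mp_eval_transform:
  fixes \<phi> :: "'k::field \<Rightarrow> 'r::comm_ring_1"
  assumes "coef_hom \<phi>"
  shows "mp_eval \<phi> x (transform_form A F) = mp_eval \<phi> (\<lambda>i. \<Sum>j\<in>UNIV. \<phi> (A $ i $ j) * x j) F"
  by (simp add: transform_form_def coef_hom.mp_eval_subst[OF assms] coef_hom.mp_eval_linear_form[OF assms] row_def)

lemma mp_value_transform: "mp_value (transform_form A F) v = mp_value F (A *v v)"
proof -
  have "($) (A *v v) = (\<lambda>i. \<Sum>j\<in>UNIV. A $ i $ j * v $ j)"
    by (rule ext) (simp add: matrix_vector_mult_def)
  then show ?thesis
    unfolding mp_value_def mp_eval_transform[OF id_hom.coef_hom_axioms] by (simp only: id_apply)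
qed

lemma transform_mult: "transform_form A (p * q) = transform_form A p * transform_form A q"
  by (simp add: transform_form_def mp_subst_def mp_const_hom.mp_eval_mult)

lemma transform_const [simp]: "transform_form A (mp_const c) = mp_const c"
  by (simp add: transform_form_def mp_subst_def)

lemma transform_matrix_mult:
  "transform_form (A ** B) F = transform_form B (transform_form A (F :: ('k::field_char_0, 3) mpoly))"
  by (rule mp_value_ext) (simp add: mp_value_transform matrix_vector_mul_assoc)

lemma transform_mat_1 [simp]: "transform_form (mat 1) F = (F :: ('k::field_char_0, 3) mpoly)"
  by (rule mp_value_ext) (simp add: mp_value_transform)

lemma transform_dvd: "p dvd q \<Longrightarrow> transform_form A p dvd transform_form A q"
  unfolding dvd_def by (auto simp: transform_mult)

lemma mp_value_homogeneous_scale: "homogeneous N F \<Longrightarrow> mp_value F (c *s v) = c ^ N * mp_value F v"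
  using id_hom.mp_eval_homogeneous_scale[of N F c "\<lambda>i. v $ i"] by (simp add: mp_value_def)

section \<open>Primitive roots of unity\<close>

lemma exists_nth_root:
  fixes y :: "'k::alg_closed_field"
  assumes "n > 0"
  shows "\<exists>x. x ^ n = y"
proof -
  let ?p = "Polynomial.monom 1 n - [:y:]"
  have "Polynomial.coeff ?p n = 1" using assms by (cases n) auto
  then have "n \<le> Polynomial.degree ?p" by (intro le_degree) auto
  with assms have "Polynomial.degree ?p > 0" by simp
  then obtain x where "poly ?p x = 0" using alg_closed_imp_poly_has_root by blast
  then show ?thesis by (auto simp: poly_monom)
qed

lemma primitive_root_power_eq_1_iff:
  assumes "primitive_root_of_unity n z"
  shows "z ^ k = 1 \<longleftrightarrow> n dvd k"
proof
  assume "z ^ k = 1"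
  have "z ^ k = (z ^ n) ^ (k div n) * z ^ (k mod n)"
    by (simp flip: power_mult power_add)
  then have "z ^ (k mod n) = 1" using \<open>z ^ k = 1\<close> assms by (simp add: primitive_root_of_unity_def)
  moreover have "k mod n < n" using assms by (simp add: primitive_root_of_unity_def)
  ultimately show "n dvd k" using assms unfolding primitive_root_of_unity_def by (metis dvd_eq_mod_eq_0 neq0_conv)
next
  assume "n dvd k"
  then show "z ^ k = 1" using assms by (auto simp: power_mult primitive_root_of_unity_def)
qed

lemma primitive_rootI:
  assumes "n > 0" "z ^ n = 1" "\<And>k. 0 < k \<Longrightarrow> z ^ k = 1 \<Longrightarrow> n dvd k"
  shows "primitive_root_of_unity n z"
  using assms unfolding primitive_root_of_unity_def by (metis nat_dvd_not_less)

text \<open>Take a zero of 1 + X + ... + X^(p-1). It is a p-th root of unity, and it differs from 1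
  because the value at 1 is p, which is nonzero in characteristic zero; primality leaves p as its
  only possible order.\<close>

lemma exists_primitive_root_of_prime_order:
  assumes "Factorial_Ring.prime (p::nat)"
  shows "\<exists>z::'k::{alg_closed_field, field_char_0}. primitive_root_of_unity p z"
proof -
  have p: "p > 1" using assms by (rule prime_gt_1_nat)
  let ?q = "(\<Sum>k<p. Polynomial.monom 1 k) :: 'k poly"
  have "Polynomial.coeff ?q (p - 1) = (\<Sum>k<p. if k = p - 1 then 1 else 0)"
    by (simp add: Polynomial.coeff_sum)
  also have "\<dots> = 1" using p by (simp add: sum.delta)
  finally have "p - 1 \<le> Polynomial.degree ?q" by (intro le_degree) auto
  then have "Polynomial.degree ?q > 0" using p by simp
  then obtain x where x: "poly ?q x = 0" using alg_closed_imp_poly_has_root by blast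
  then have sum0: "(\<Sum>k<p. x ^ k) = 0" by (simp add: poly_sum poly_monom)
  have ne1: "x \<noteq> 1" using sum0 p by auto
  have xp: "x ^ p = 1" using sum0 power_diff_1_eq[of x p] by simp
  show ?thesis
  proof (intro exI primitive_rootI)
    fix k :: nat assume "0 < k" "x ^ k = 1"
    show "p dvd k"
    proof (rule ccontr)
      assume "\<not> p dvd k"
      then have "coprime k p" using assms prime_imp_coprime coprime_commute by blast
      then obtain a b where ab: "k * a = p * b + 1" using coprime_bezout_strong[of k p] p by auto
      have "x ^ (k * a) = x ^ (p * b) * x" by (simp add: ab)
      then show False using \<open>x ^ k = 1\<close> xp ne1 by (simp add: power_mult)
    qed
  qed (use p xp in auto)
qed

text \<open>Induction removes one prime p from n = p m. If p divides m, a p-th root of a primitive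
  m-th root has order n; otherwise a product of primitive roots of the coprime orders p and m
  does.\<close>

lemma exists_primitive_root:
  assumes "n > 0"
  shows "\<exists>z::'k::{alg_closed_field, field_char_0}. primitive_root_of_unity n z"
  using assms
proof (induction n rule: less_induct)
  case (less n)
  show ?case
  proof (cases "n = 1")
    case True then show ?thesis by (auto simp: primitive_root_of_unity_def)
  next
    case False
    then obtain p where p: "Factorial_Ring.prime p" "p dvd n" using prime_factor_nat by blast
    then obtain m where m: "n = p * m" by (auto simp: dvd_def)
    have p1: "p > 1" using p prime_gt_1_nat by blast
    have m0: "m > 0" "m < n" using m less.prems p1 by auto
    obtain y :: 'k where y: "primitive_root_of_unity m y" using less.IH m0 by blast
    show ?thesis
    proof (cases "p dvd m")
      case True
      obtain x where x: "x ^ p = y" using exists_nth_root[of p y] p1 by auto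
      show ?thesis
      proof (intro exI primitive_rootI)
        show "x ^ n = 1" using y by (simp add: m power_mult x primitive_root_of_unity_def)
        fix k assume "x ^ k = 1"
        then have "y ^ k = 1" by (metis x power_mult mult.commute power_one)
        then have "m dvd k" using y primitive_root_power_eq_1_iff by blast
        then obtain k' where k': "k = p * k'" using True by (metis dvd_def dvd_trans)
        have "y ^ k' = 1" using \<open>x ^ k = 1\<close> by (simp add: k' power_mult x)
        then have "m dvd k'" using y primitive_root_power_eq_1_iff by blast
        then show "n dvd k" by (simp add: m k')
      qed (use less.prems in auto)
    next
      case False
      obtain w :: 'k where w: "primitive_root_of_unity p w" using exists_primitive_root_of_prime_order p by blast
      have cop: "coprime p m" using False p by (simp add: prime_imp_coprime)
      show ?thesis
      proof (intro exI primitive_rootI)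
        have "y ^ n = 1" "w ^ n = 1" using y w by (simp_all add: primitive_root_power_eq_1_iff m)
        then show "(y * w) ^ n = 1" by (simp add: power_mult_distrib)
        fix k assume k: "(y * w) ^ k = 1"
        have "(y * w) ^ (k * m) = 1" "(y * w) ^ (k * p) = 1" by (simp_all add: power_mult k)
        moreover have "y ^ (k * m) = 1" "w ^ (k * p) = 1" using y w by (simp_all add: primitive_root_power_eq_1_iff)
        ultimately have "w ^ (k * m) = 1" "y ^ (k * p) = 1" by (simp_all add: power_mult_distrib)
        then have "p dvd k * m" "m dvd k * p" using y w by (simp_all add: primitive_root_power_eq_1_iff)
        then have "p dvd k" "m dvd k" using cop coprime_dvd_mult_left_iff coprime_commute by blast+
        then show "n dvd k" unfolding m using cop by (rule divides_mult)
      qed (use less.prems in auto)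
    qed
  qed
qed

lemma primitive_root_nonzero: "primitive_root_of_unity n z \<Longrightarrow> z \<noteq> 0"
  by (auto simp: primitive_root_of_unity_def power_0_left split: if_splits)

lemma primitive_root_power_inj:
  assumes "primitive_root_of_unity n z" "z ^ i = z ^ j" "i < n" "j < n"
  shows "i = j"
proof -
  have *: False if "z ^ i = z ^ j" "i < j" "j < n" for i j
  proof -
    have "z ^ j = z ^ (i + (j - i))" using that by simp
    then have "z ^ j = z ^ i * z ^ (j - i)" by (simp only: power_add)
    then have "z ^ (j - i) = 1" using that primitive_root_nonzero[OF assms(1)] by simp
    then have "n dvd j - i" using assms(1) primitive_root_power_eq_1_iff by blast
    then show False using that by (meson dvd_imp_le less_imp_diff_less not_less zero_less_diff)
  qed
  show ?thesis using *[of i j] *[of j i] assms by (metis nat_neq_iff)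
qed

lemma sum_shift: "(\<Sum>k<m. g (Suc k)) + g 0 = (\<Sum>k<m. g k) + (g m :: 'a::comm_monoid_add)"
  by (metis add.commute sum.lessThan_Suc sum.lessThan_Suc_shift)

lemma sum_root_of_unity:
  fixes y :: "'k::field"
  assumes "y ^ n = 1"
  shows "(\<Sum>j<n. y ^ j) = (if y = 1 then of_nat n else 0)"
  using assms power_diff_1_eq[of y n] by auto

section \<open>From an automorphism of order l n to the equation z^n = g(x)\<close>

section \<open>Singular points\<close>

text \<open>The restriction of the form to the line through \<open>v\<close> in direction
  \<open>h\<close>, as a polynomial in the parameter of that line.\<close>

definition line_poly :: "('k::comm_ring_1, 3) mpoly \<Rightarrow> 'k ^ 3 \<Rightarrow> 'k ^ 3 \<Rightarrow> 'k poly"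
  where "line_poly F v h = mp_eval (\<lambda>c. [:c:]) (\<lambda>i. [:v $ i, h $ i:]) F"

lemma poly_line_poly: "poly (line_poly F v h) e = mp_value F (v + e *s h)"
  by (simp add: line_poly_def mp_value_def mp_eval_def poly_sum poly_prod)

text \<open>Vanishing to order two along every line through \<open>v\<close> expresses singularity
  without coordinates, so it passes through linear substitutions without a chain rule.\<close>

definition double_point :: "('k::comm_ring_1, 3) mpoly \<Rightarrow> 'k ^ 3 \<Rightarrow> bool"
  where "double_point F v \<longleftrightarrow> (\<forall>h. [:0, 1:] ^ 2 dvd line_poly F v h)"

lemma
  assumes "invertible A"
  shows matrix_inv_right: "A ** matrix_inv A = mat 1" and matrix_inv_left: "matrix_inv A ** A = mat 1"
  using assms someI_ex[of "\<lambda>B. A ** B = mat 1 \<and> B ** A = mat 1"]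
  unfolding invertible_def matrix_inv_def by blast+

lemma invertible_matrix_inv: "invertible A \<Longrightarrow> invertible (matrix_inv A)"
  unfolding invertible_def using matrix_inv_left matrix_inv_right unfolding invertible_def by blast

lemma pderiv_sum: "pderiv (sum f A) = (\<Sum>a\<in>A. pderiv (f a))"
  using higher_pderiv_sum[of "Suc 0" f A] by simp

lemma line_poly_transform:
  fixes F :: "('k::field_char_0, 3) mpoly"
  shows "line_poly (transform_form M F) v h = line_poly F (M *v v) (M *v h)"
proof -
  have "poly (line_poly (transform_form M F) v h) = poly (line_poly F (M *v v) (M *v h))"
    by (rule ext) (simp add: poly_line_poly mp_value_transform vec.add vec.scale)
  then show ?thesis by (simp add: poly_eq_poly_eq_iff)
qed

lemma double_point_transform:
  fixes F :: "('k::field_char_0, 3) mpoly"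
  assumes "double_point (transform_form M F) v" "invertible M"
  shows "double_point F (M *v v)"
  unfolding double_point_def
proof
  fix h
  from assms(2) have "M *v (matrix_inv M *v h) = h"
    by (simp add: matrix_vector_mul_assoc matrix_inv_right)
  then show "[:0, 1:] ^ 2 dvd line_poly F (M *v v) h"
    using assms(1) unfolding double_point_def line_poly_transform by metis
qed

lemma pderiv_line_poly_axis:
  fixes F :: "('k::field_char_0, 3) mpoly"
  shows "poly (pderiv (line_poly F v (axis i 1))) 0 = mp_value (mp_pderiv i F) v"
proof -
  let ?l = "Poly_Mapping.lookup"
  have 1: "poly (pderiv (\<Prod>j\<in>UNIV. [:v $ j, axis i 1 $ j:] ^ ?l m j)) 0
     = of_nat (?l m i) * (\<Prod>j\<in>UNIV. v $ j ^ ?l (m - Poly_Mapping.single i 1) j)" for m :: "3 \<Rightarrow>\<^sub>0 nat"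
  proof -
    have "(\<Prod>j\<in>UNIV. [:v $ j, axis i 1 $ j:] ^ ?l m j)
       = [:v $ i, 1:] ^ ?l m i * (\<Prod>j\<in>UNIV - {i}. [:v $ j:] ^ ?l m j)"
      by (subst prod.remove[of _ i]) (auto simp: axis_def intro!: prod.cong)
    also have "(\<Prod>j\<in>UNIV - {i}. [:v $ j:] ^ ?l m j) = [:\<Prod>j\<in>UNIV - {i}. v $ j ^ ?l m j:]"
      by (simp add: poly_const_pow prod_to_poly)
    finally have "poly (pderiv (\<Prod>j\<in>UNIV. [:v $ j, axis i 1 $ j:] ^ ?l m j)) 0
       = of_nat (?l m i) * (v $ i ^ (?l m i - 1) * (\<Prod>j\<in>UNIV - {i}. v $ j ^ ?l m j))"
      by (simp add: pderiv_smult pderiv_power pderiv_pCons)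
    also have "v $ i ^ (?l m i - 1) * (\<Prod>j\<in>UNIV - {i}. v $ j ^ ?l m j)
       = (\<Prod>j\<in>UNIV. v $ j ^ ?l (m - Poly_Mapping.single i 1) j)"
      by (subst (2) prod.remove[of _ i]) (auto simp: lookup_minus lookup_single when_def intro!: prod.cong)
    finally show ?thesis .
  qed
  have "poly (pderiv (line_poly F v (axis i 1))) 0 = (\<Sum>m\<in>Poly_Mapping.keys F. ?l F m *
     poly (pderiv (\<Prod>j\<in>UNIV. [:v $ j, axis i 1 $ j:] ^ ?l m j)) 0)"
    by (simp add: line_poly_def mp_eval_def pderiv_sum poly_sum pderiv_smult)
  also have "\<dots> = mp_value (mp_pderiv i F) v"
    unfolding 1 mp_pderiv_def mp_value_def id_hom.mp_eval_sum id_hom.mp_eval_single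
    by (simp add: mult_ac)
  finally show ?thesis .
qed

lemma X2_dvd_iff: "[:0, 1:] ^ 2 dvd (p :: 'k::field_char_0 poly) \<longleftrightarrow> poly p 0 = 0 \<and> poly (pderiv p) 0 = 0"
proof
  assume "[:0, 1:] ^ 2 dvd p"
  then obtain q where "p = [:0,1:]^2 * q" by (auto simp: dvd_def)
  then show "poly p 0 = 0 \<and> poly (pderiv p) 0 = 0"
    by (simp add: pderiv_mult pderiv_power pderiv_pCons power2_eq_square)
next
  assume *: "poly p 0 = 0 \<and> poly (pderiv p) 0 = 0"
  then obtain q where q: "p = [:0,1:] * q" using poly_eq_0_iff_dvd[of p 0] by (auto simp: dvd_def)
  with * have "poly q 0 = 0" by (simp add: pderiv_mult pderiv_pCons)
  then obtain r where r: "q = [:0,1:] * r" using poly_eq_0_iff_dvd[of q 0] by (auto simp: dvd_def)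
  have "p = [:0,1:] ^ 2 * r" unfolding q r power2_eq_square by (rule mult.assoc[symmetric])
  then show "[:0, 1:] ^ 2 dvd p" by (rule dvdI)
qed

lemma nonsingular_imp_no_double_point:
  assumes "nonsingular_plane_curve d (F :: ('k::field_char_0, 3) mpoly)" "v \<noteq> 0"
  shows "\<not> double_point F v"
proof
  assume D: "double_point F v"
  \<comment> \<open>The direction 0 is admissible: there the line polynomial is the constant
    F(v).\<close>
  then have "poly (line_poly F v 0) 0 = 0" unfolding double_point_def X2_dvd_iff by blast
  then have "mp_value F v = 0" by (simp add: poly_line_poly)
  then obtain i where "mp_value (mp_pderiv i F) v \<noteq> 0"
    using assms unfolding nonsingular_plane_curve_def by blast
  with D show False unfolding double_point_def X2_dvd_iff using pderiv_line_poly_axis by metis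
qed

text \<open>Without such a monomial every term has degree at least two in the variables other than
  the i-th, so the form vanishes to order two along every line through the i-th coordinate
  point.\<close>

lemma no_double_point_imp_monomial:
  fixes F :: "('k::field_char_0, 3) mpoly"
  assumes "homogeneous (Suc n) F" "\<not> double_point F (axis i 1)" "n \<ge> 1"
  shows "\<exists>j. Poly_Mapping.single i n + Poly_Mapping.single j 1 \<in> Poly_Mapping.keys F"
proof (rule ccontr)
  assume no: "\<not> ?thesis"
  let ?l = "Poly_Mapping.lookup :: (3 \<Rightarrow>\<^sub>0 nat) \<Rightarrow> _"
  have lt: "(\<Sum>j\<in>UNIV - {i}. ?l m j) \<ge> 2" if m: "m \<in> Poly_Mapping.keys F" for m
  proof (rule ccontr)
    assume "\<not> ?thesis"
    then have le: "(\<Sum>j\<in>UNIV - {i}. ?l m j) \<le> 1" by simp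
    have tot: "?l m i + (\<Sum>j\<in>UNIV - {i}. ?l m j) = Suc n"
      using assms(1) m by (subst sum.remove[symmetric]) (auto simp: homogeneous_def)
    show False
    proof (cases "(\<Sum>j\<in>UNIV - {i}. ?l m j) = 0")
      case True
      then have "?l m j = 0" if "j \<noteq> i" for j using that by simp
      then have "m = Poly_Mapping.single i n + Poly_Mapping.single i 1"
        using tot True by (intro poly_mapping_eqI) (auto simp: lookup_add lookup_single when_def)
      with no m show False by blast
    next
      case False
      then have s1: "(\<Sum>j\<in>UNIV - {i}. ?l m j) = 1" using le by linarith
      then obtain j where "j \<in> UNIV - {i}" and j1: "?l m j = 1"
        and j2: "\<forall>b\<in>UNIV - {i}. j \<noteq> b \<longrightarrow> ?l m b = 0"
        using iffD1[OF sum_eq_1_iff s1] by auto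
      then have j: "j \<noteq> i" "?l m j = 1" "\<And>j'. j' \<noteq> i \<Longrightarrow> j' \<noteq> j \<Longrightarrow> ?l m j' = 0"
        by auto
      have "m = Poly_Mapping.single i n + Poly_Mapping.single j 1"
        using tot s1 j by (intro poly_mapping_eqI) (auto simp: lookup_add lookup_single when_def)
      with no m show False by blast
    qed
  qed
  have "double_point F (axis i 1)"
    unfolding double_point_def line_poly_def mp_eval_def
  proof (intro allI dvd_sum dvd_mult)
    fix h m assume m: "m \<in> Poly_Mapping.keys F"
    have "(\<Prod>j\<in>UNIV - {i}. [:axis i 1 $ j, h $ j:] ^ ?l m j) = (\<Prod>j\<in>UNIV - {i}. [:0, h $ j:] ^ ?l m j)"
      by (intro prod.cong) (auto simp: axis_def)
    also have "\<dots> = (\<Prod>j\<in>UNIV - {i}. ([:0,1:] * [:h $ j:]) ^ ?l m j)" by simp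
    also have "\<dots> = [:0,1:] ^ (\<Sum>j\<in>UNIV - {i}. ?l m j) * (\<Prod>j\<in>UNIV - {i}. [:h $ j:] ^ ?l m j)"
      by (simp only: power_mult_distrib prod.distrib power_sum)
    also have "[:0, 1:] ^ 2 dvd \<dots>" by (intro dvd_mult2 le_imp_power_dvd lt m)
    finally show "[:0, 1:] ^ 2 dvd (\<Prod>j\<in>UNIV. [:axis i 1 $ j, h $ j:] ^ ?l m j)"
      by (subst prod.remove[of _ i]) (auto intro: dvd_mult)
  qed
  with assms(2) show False by blast
qed

text \<open>A diagonal substitution multiplies each monomial by its own weight, so comparing
  coefficients forces weight c on every monomial that occurs.\<close>

lemma semi_invariant_monomial:
  fixes F :: "('k::field_char_0, 3) mpoly"
  assumes "\<And>v. mp_value F (\<chi> i. a i * v $ i) = c * mp_value F v" "m \<in> Poly_Mapping.keys F"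
  shows "(\<Prod>i\<in>UNIV. a i ^ Poly_Mapping.lookup m i) = c"
proof -
  let ?w = "\<lambda>m. \<Prod>i\<in>UNIV. a i ^ Poly_Mapping.lookup m i"
  define G where "G = (\<Sum>m\<in>Poly_Mapping.keys F. Poly_Mapping.single m (?w m * Poly_Mapping.lookup F m))"
  have "G = mp_const c * F"
  proof (rule mp_value_ext)
    fix v
    have "mp_value G v = mp_value F (\<chi> i. a i * v $ i)"
      unfolding G_def mp_value_def id_hom.mp_eval_sum id_hom.mp_eval_single
      by (simp add: mp_eval_def power_mult_distrib prod.distrib mult_ac)
    then show "mp_value G v = mp_value (mp_const c * F) v" by (simp add: assms(1) mp_value_mult)
  qed
  moreover have "Poly_Mapping.lookup G m = ?w m * Poly_Mapping.lookup F m"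
    using assms(2) by (simp add: G_def lookup_sum lookup_single when_def sum.delta)
  moreover have "Poly_Mapping.lookup (mp_const c * F) m = c * Poly_Mapping.lookup F m"
  proof -
    have "mp_const c * F = (\<Sum>m\<in>Poly_Mapping.keys F. Poly_Mapping.single m (c * Poly_Mapping.lookup F m))"
      by (subst (1) sum_monomials[symmetric]) (simp add: mp_const_def sum_distrib_left mult_single)
    then show ?thesis using assms(2) by (simp add: lookup_sum lookup_single when_def sum.delta)
  qed
  ultimately show ?thesis using assms(2) by (simp add: in_keys_iff)
qed

section \<open>Diagonalization of matrices of finite order\<close>

definition cols :: "(3 \<Rightarrow> 'k::field ^ 3) \<Rightarrow> 'k ^ 3 ^ 3"
  where "cols b = (\<chi> i j. b j $ i)"

lemma cols_mult: "cols b *v x = (\<Sum>j\<in>UNIV. x $ j *s b j)"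
  by (simp add: cols_def matrix_vector_mult_def vec_eq_iff mult.commute)

lemma cols_axis: "cols b *v axis i 1 = b i"
  by (simp add: cols_mult axis_def if_distrib[of "\<lambda>c. c *s _"] cong: if_cong)

lemma cols_invertible: "(\<And>v. \<exists>x. v = (\<Sum>j\<in>UNIV. x $ j *s b j)) \<Longrightarrow> invertible (cols b)"
  unfolding invertible_right_inverse matrix_right_invertible_surjective surj_def cols_mult by blast

text \<open>Averaging the vectors A^k v over k < m with weights (w0 z^j)^(-k) gives a vector of the
  eigenspace for w0 z^j. Summed over j these averages give m v, because the sums over roots of unity
  vanish for k \<noteq> 0; so the eigenvectors span.\<close>

lemma eigenbasis_of_finite_order:
  fixes A :: "'k::{alg_closed_field, field_char_0} ^ 3 ^ 3"
  assumes m: "m > 0" and Am: "\<And>v. ((*v) A ^^ m) v = e *s v" and e: "e \<noteq> 0"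
  obtains b :: "3 \<Rightarrow> _" and \<alpha> where "\<And>i. A *v b i = \<alpha> i *s b i" "\<And>v. \<exists>x. v = (\<Sum>j\<in>UNIV. x $ j *s b j)"
proof -
  obtain w0 where w0: "w0 ^ m = e" using exists_nth_root[OF m] by blast
  obtain z :: 'k where z: "primitive_root_of_unity m z" using exists_primitive_root[OF m] by blast
  have nz: "w0 \<noteq> 0" "z \<noteq> 0" using w0 e m primitive_root_nonzero[OF z] by auto
  have zm: "z ^ m = 1" using z by (simp add: primitive_root_of_unity_def)
  define E where "E = {v. \<exists>a. A *v v = a *s v}"
  define w where "w j v = (\<Sum>k<m. inverse (w0 * z ^ j) ^ k *s ((*v) A ^^ k) v)" for j v
  have wE: "w j v \<in> E" for j v
  proof -
    let ?o = "w0 * z ^ j" and ?g = "\<lambda>k. inverse (w0 * z ^ j) ^ k *s ((*v) A ^^ k) v"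
    have o: "?o \<noteq> 0" "?o ^ m = e" using nz by (simp_all add: power_mult_distrib w0 zm power_mult[symmetric] mult.commute[of j])
       (simp add: power_mult zm)
    have "inverse ?o ^ m = inverse e" by (simp only: power_inverse o(2))
    then have "?g m = v" using Am[of v] e by (simp add: vector_smult_assoc)
    moreover have "?g 0 = v" by simp
    \<comment> \<open>The terms for k = 0 and k = m agree because (w0 z^j)^m = e, so shifting the
      index leaves the sum unchanged.\<close>
    moreover have "(\<Sum>k<m. ?g (Suc k)) + ?g 0 = (\<Sum>k<m. ?g k) + ?g m"
      by (rule sum_shift)
    ultimately have shift: "(\<Sum>k<m. ?g (Suc k)) = w j v" by (simp add: w_def)
    have inv: "inverse ?o ^ k = ?o * inverse ?o ^ Suc k" for k
      by (simp only: power_Suc mult.assoc[symmetric] right_inverse[OF o(1)] mult_1_left)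
    have "A *v w j v = (\<Sum>k<m. inverse ?o ^ k *s ((*v) A ^^ Suc k) v)"
      by (simp only: w_def vec.sum vec.scale funpow.simps o_apply)
    also have "\<dots> = (\<Sum>k<m. (?o * inverse ?o ^ Suc k) *s ((*v) A ^^ Suc k) v)"
      by (intro sum.cong refl arg_cong[where f = "\<lambda>c. c *s _"] inv)
    also have "\<dots> = (\<Sum>k<m. ?o *s ?g (Suc k))"
      by (simp only: vector_smult_assoc)
    also have "\<dots> = ?o *s w j v" by (simp only: shift[symmetric] vec.scale_sum_right)
    finally show ?thesis by (auto simp: E_def)
  qed
  have span: "vec.span E = UNIV"
  proof (intro equalityI subsetI UNIV_I)
    fix v :: "'k ^ 3"
    have inner: "(\<Sum>j<m. inverse (w0 * z ^ j) ^ k) = (if k = 0 then of_nat m else 0)" if "k < m" for k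
    proof -
      have "(\<Sum>j<m. inverse (w0 * z ^ j) ^ k) = inverse w0 ^ k * (\<Sum>j<m. (inverse z ^ k) ^ j)"
        by (simp add: sum_distrib_left power_mult_distrib power_inverse power_mult[symmetric] mult.commute)
      also have "(\<Sum>j<m. (inverse z ^ k) ^ j) = (if inverse z ^ k = 1 then of_nat m else 0)"
      proof (rule sum_root_of_unity)
        have "(inverse z ^ k) ^ m = inverse ((z ^ m) ^ k)"
          by (metis power_inverse power_mult mult.commute)
        then show "(inverse z ^ k) ^ m = 1" by (simp add: zm)
      qed
      also have "inverse z ^ k = 1 \<longleftrightarrow> m dvd k"
        using primitive_root_power_eq_1_iff[OF z, of k] by (simp add: power_inverse)
      also have "m dvd k \<longleftrightarrow> k = 0" using that by (auto dest: dvd_imp_le)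
      finally show ?thesis by auto
    qed
    have "(\<Sum>j<m. w j v) = (\<Sum>k<m. (\<Sum>j<m. inverse (w0 * z ^ j) ^ k) *s ((*v) A ^^ k) v)"
      unfolding w_def by (subst sum.swap) (simp add: vec.scale_sum_left)
    also have "\<dots> = (\<Sum>k<m. if k = 0 then of_nat m *s v else 0)"
    proof (intro sum.cong refl)
      fix k assume "k \<in> {..<m}"
      then show "(\<Sum>j<m. inverse (w0 * z ^ j) ^ k) *s ((*v) A ^^ k) v = (if k = 0 then of_nat m *s v else 0)"
        by (subst inner) auto
    qed
    also have "\<dots> = of_nat m *s v" using m by (simp add: sum.delta)
    finally have "v = inverse (of_nat m) *s (\<Sum>j<m. w j v)" using m by (simp add: vector_smult_assoc)
    moreover have "inverse (of_nat m) *s (\<Sum>j<m. w j v) \<in> vec.span E"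
      by (intro vec.span_scale vec.span_sum vec.span_base wE)
    ultimately show "v \<in> vec.span E" by simp
  qed
  obtain B where B: "B \<subseteq> E" "vec.independent B" "E \<subseteq> vec.span B"
    using vec.maximal_independent_subset[of E] by blast
  have spanB: "vec.span B = UNIV" using B(3) span vec.span_mono[of E "vec.span B"] by (auto simp: vec.span_span)
  have cardB: "card B = 3"
    using vec.dim_eq_card_independent[OF B(2)] spanB vec.dim_span[of B] vec_dim_card[where ?'n = 3 and ?'a = 'k] by simp
  then have "finite B" using card.infinite by fastforce
  have "card (UNIV :: 3 set) = card B" using cardB by simp
  then obtain b where b: "bij_betw b (UNIV :: 3 set) B"
    using finite_same_card_bij[of "UNIV :: 3 set" B] \<open>finite B\<close> by auto
  have bE: "b i \<in> E" for i using b B(1) by (auto simp: bij_betw_def)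
  then have "\<forall>i. \<exists>a. A *v b i = a *s b i" by (auto simp: E_def)
  then obtain \<alpha> where al: "\<And>i. A *v b i = \<alpha> i *s b i" by metis
  have sp: "\<exists>x. v = (\<Sum>j\<in>UNIV. x $ j *s b j)" for v
  proof -
    have "v \<in> vec.span B" using spanB by simp
    then obtain u where "v = (\<Sum>y\<in>B. u y *s y)" using vec.span_finite[OF \<open>finite B\<close>] by auto
    also have "\<dots> = (\<Sum>j\<in>UNIV. u (b j) *s b j)" using sum.reindex_bij_betw[OF b, of "\<lambda>y. u y *s y"] by simp
    finally have "v = (\<Sum>j\<in>UNIV. (\<chi> j. u (b j)) $ j *s b j)" by simp
    then show ?thesis by blast
  qed
  show ?thesis
  proof (rule that)
    show "A *v b i = \<alpha> i *s b i" for i by (rule al)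
    show "\<exists>x. v = (\<Sum>j\<in>UNIV. x $ j *s b j)" for v by (rule sp)
  qed
qed

section \<open>Normal form of curves with an automorphism of order l n\<close>

lemma matrix_vector_eqI: "(\<And>v::'k::field^3. A *v v = B *v v) \<Longrightarrow> A = (B :: 'k^3^3)"
  by (simp add: matrix_eq)

lemma matrix_inv_vector_left: "invertible A \<Longrightarrow> matrix_inv A *v (A *v v) = v"
  by (simp add: matrix_vector_mul_assoc matrix_inv_left)

lemma matrix_inv_vector_right: "invertible A \<Longrightarrow> A *v (matrix_inv A *v v) = v"
  by (simp add: matrix_vector_mul_assoc matrix_inv_right)

lemma invertible_ker: "invertible A \<Longrightarrow> A *v v = 0 \<Longrightarrow> v = 0"
  using matrix_inv_vector_left[of A v] by simp

lemma funpow_mult_cols: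
  assumes "\<And>i. A *v b i = \<alpha> i *s b i"
  shows "((*v) A ^^ k) (cols b *v x) = cols b *v (\<chi> i. \<alpha> i ^ k * x $ i)"
proof (induction k)
  case 0 show ?case by simp
next
  case (Suc k)
  have "((*v) A ^^ Suc k) (cols b *v x) = A *v (cols b *v (\<chi> i. \<alpha> i ^ k * x $ i))"
    using Suc by simp
  also have "\<dots> = (\<Sum>j\<in>UNIV. (\<alpha> j ^ k * x $ j) *s (\<alpha> j *s b j))"
    by (simp add: cols_mult vec.sum vec.scale assms)
  also have "\<dots> = cols b *v (\<chi> i. \<alpha> i ^ Suc k * x $ i)"
    by (simp add: cols_mult vector_smult_assoc mult_ac)
  finally show ?case .
qed

lemma distinct3_UNIV:
  fixes a b k :: 3
  assumes "a \<noteq> b" "a \<noteq> k" "b \<noteq> k"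
  shows "UNIV = {a, b, k}"
proof -
  have "card {a, b, k} = card (UNIV :: 3 set)" using assms by simp
  then show ?thesis by (intro card_subset_eq[symmetric]) auto
qed

text \<open>In an eigenbasis, smoothness at the i-th coordinate point supplies a monomial x_i^n x_(j
  i), hence \<alpha>_i^n \<alpha>_(j i) = c. Take l-th powers: \<alpha>_i^(l n) is the same for all
  i, so \<alpha>^l takes a single value \<delta> on the image of j. That image has exactly two
  elements, since three would make A^l scalar and one would make A^n scalar, both against the order
  l n. The remaining eigenvalue of A^l is \<zeta> \<delta>.\<close>

lemma homology_basis:
  fixes F :: "('k::{alg_closed_field, field_char_0}, 3) mpoly" and A :: "'k ^ 3 ^ 3"
  assumes inv: "invertible A" and sem: "\<And>v. mp_value F (A *v v) = c * mp_value F v"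
    and ns: "\<And>v. v \<noteq> 0 \<Longrightarrow> \<not> double_point F v" and hom: "homogeneous (Suc n) F"
    and n: "n \<ge> 2" and l: "l \<ge> 2"
    and ord: "\<And>k. (\<exists>e. \<forall>v. ((*v) A ^^ k) v = e *s v) \<longleftrightarrow> l * n dvd k"
  obtains b \<delta> \<zeta> where "invertible (cols b)" "primitive_root_of_unity n \<zeta>" "\<delta> \<noteq> 0"
    "((*v) A ^^ l) (b 1) = \<delta> *s b 1" "((*v) A ^^ l) (b 2) = \<delta> *s b 2"
    "((*v) A ^^ l) (b 3) = (\<zeta> * \<delta>) *s b 3"
    "\<And>v. mp_value F (((*v) A ^^ l) v) = \<delta> ^ Suc n * mp_value F v"
proof -
  have "\<exists>e. \<forall>v. ((*v) A ^^ (l * n)) v = e *s v" by (rule iffD2[OF ord]) simp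
  then obtain e0 where e0': "\<forall>v. ((*v) A ^^ (l * n)) v = e0 *s v" ..
  then have e0: "((*v) A ^^ (l * n)) v = e0 *s v" for v by (rule spec)
  have inj: "v = 0" if "A *v v = 0" for v
    using inv that by (rule invertible_ker)
  have pow0: "((*v) A ^^ k) v = 0 \<Longrightarrow> v = 0" for k v
    by (induction k) (auto dest: inj)
  have e0nz: "e0 \<noteq> 0"
  proof
    assume "e0 = 0"
    have "((*v) A ^^ (l * n)) (axis 1 1 :: 'k ^ 3) = 0" unfolding e0 \<open>e0 = 0\<close> by simp
    then have "(axis 1 1 :: 'k ^ 3) = 0" by (rule pow0)
    then show False by (simp add: axis_eq_0_iff)
  qed
  have ln0: "l * n > 0" using n l by simp
  have "\<exists>(b :: 3 \<Rightarrow> 'k ^ 3) \<alpha>. (\<forall>i. A *v b i = \<alpha> i *s b i) \<and> (\<forall>v. \<exists>x. v = (\<Sum>j\<in>UNIV. x $ j *s b j))"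
    by (rule eigenbasis_of_finite_order[OF ln0 e0 e0nz]) blast
  then obtain b :: "3 \<Rightarrow> 'k ^ 3" and \<alpha> where b': "\<forall>i. A *v b i = \<alpha> i *s b i"
    and sp': "\<forall>v. \<exists>x. v = (\<Sum>j\<in>UNIV. x $ j *s b j)" by (elim exE conjE)
  have b: "A *v b i = \<alpha> i *s b i" for i using b' by (rule spec)
  have sp: "\<exists>x. v = (\<Sum>j\<in>UNIV. x $ j *s b j)" for v using sp' by (rule spec)
  have invM: "invertible (cols b)" using sp by (rule cols_invertible)
  have bnz: "b i \<noteq> 0" for i
  proof
    assume "b i = 0"
    then have "cols b *v axis i 1 = 0" by (simp add: cols_axis)
    then have "(axis i 1 :: 'k ^ 3) = 0" by (rule invertible_ker[OF invM])
    then show False by (simp add: axis_eq_0_iff)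
  qed
  have anz: "\<alpha> i \<noteq> 0" for i using inj[of "b i"] b[of i] bnz[of i] by auto
  have pw: "((*v) A ^^ k) (cols b *v x) = cols b *v (\<chi> i. \<alpha> i ^ k * x $ i)" for k x
    using b by (rule funpow_mult_cols)
  have powb: "((*v) A ^^ k) (b i) = \<alpha> i ^ k *s b i" for k i
  proof -
    have "(\<chi> j. \<alpha> j ^ k * axis i 1 $ j) = \<alpha> i ^ k *s axis i (1::'k)"
      by (auto simp: vec_eq_iff axis_def)
    then show ?thesis using pw[of k "axis i 1"] by (simp add: cols_axis vec.scale)
  qed
  have scal: "l * n dvd k" if "\<And>i. \<alpha> i ^ k = e" for k e
  proof -
    have "((*v) A ^^ k) v = e *s v" for v
    proof -
      obtain x where x: "v = cols b *v x" using sp[of v] by (auto simp: cols_mult)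
      have "(\<chi> i. e * x $ i) = e *s x" by (simp add: vec_eq_iff)
      then show ?thesis unfolding x pw that by (simp add: vec.scale)
    qed
    then show ?thesis using ord by blast
  qed
  have aln: "\<alpha> i ^ (l * n) = e0" for i
    using powb[of "l * n" i] e0[of "b i"] bnz[of i] by (simp add: vec.scale_right_imp_eq)
  define F0 where "F0 = transform_form (cols b) F"
  have hom0: "homogeneous (Suc n) F0" unfolding F0_def using hom by (rule homogeneous_transform)
  have sem0: "mp_value F0 (\<chi> i. \<alpha> i * v $ i) = c * mp_value F0 v" for v
    using pw[of 1 v] sem[of "cols b *v v"] by (simp add: F0_def mp_value_transform)
  have "\<not> double_point F0 (axis i 1)" for i
    using double_point_transform[of "cols b" F "axis i 1"] invM ns[of "b i"] bnz by (auto simp: F0_def cols_axis)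
  then have "\<exists>j. Poly_Mapping.single i n + Poly_Mapping.single j 1 \<in> Poly_Mapping.keys F0" for i
    using no_double_point_imp_monomial[OF hom0] n by simp
  then obtain j where j: "\<And>i. Poly_Mapping.single i n + Poly_Mapping.single (j i) 1 \<in> Poly_Mapping.keys F0"
    by metis
  have aj: "\<alpha> i ^ n * \<alpha> (j i) = c" for i
  proof -
    have "(\<Prod>k\<in>UNIV. \<alpha> k ^ Poly_Mapping.lookup (Poly_Mapping.single i n + Poly_Mapping.single (j i) 1) k)
      = (\<Prod>k\<in>UNIV. if k = i then \<alpha> i ^ n else 1) * (\<Prod>k\<in>UNIV. if k = j i then \<alpha> (j i) else 1)"
      unfolding prod.distrib[symmetric] by (intro prod.cong) (auto simp: lookup_add lookup_single when_def power_add)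
    then show ?thesis using semi_invariant_monomial[OF sem0 j[of i]] by simp
  qed
  define \<delta> where "\<delta> = c ^ l / e0"
  have dj: "\<alpha> (j i) ^ l = \<delta>" for i
  proof -
    have "c ^ l = \<alpha> i ^ (l * n) * \<alpha> (j i) ^ l"
      by (simp add: aj[of i, symmetric] power_mult_distrib power_mult[symmetric] mult.commute)
    then show ?thesis using e0nz by (simp add: \<delta>_def aln)
  qed
  have "\<exists>k. \<alpha> k ^ l \<noteq> \<delta>"
  proof (rule ccontr)
    assume "\<not> ?thesis"
    then have "l * n dvd l" by (intro scal) auto
    then have "l * n \<le> l" using l by (intro dvd_imp_le) auto
    then show False using n l by simp
  qed
  then obtain k where k: "\<alpha> k ^ l \<noteq> \<delta>" by blast
  then have kj: "k \<noteq> j i" for i using dj by metis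
  have "\<exists>i i'. j i \<noteq> j i'"
  proof (rule ccontr)
    assume "\<not> ?thesis"
    then have "\<alpha> i ^ n = c / \<alpha> (j 1)" for i using aj[of i] anz[of "j 1"] by (metis nonzero_mult_div_cancel_right)
    then have "l * n dvd n" by (rule scal)
    then have "l * n \<le> n" using n by (intro dvd_imp_le) auto
    then show False using n l by simp
  qed
  then obtain i i' where ii: "j i \<noteq> j i'" by blast
  have U: "UNIV = {j i, j i', k}" using distinct3_UNIV[OF ii] kj by metis
  define \<zeta> where "\<zeta> = \<alpha> k ^ l / \<delta>"
  have dnz: "\<delta> \<noteq> 0" using dj[of 1] anz[of "j 1"] by auto
  \<comment> \<open>This identity makes \<zeta> an n-th root of unity and turns the factor c^l =
    \<delta> e0 into \<delta>^(n+1).\<close>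
  have dn: "\<delta> ^ n = e0" by (simp add: dj[of 1, symmetric] power_mult[symmetric] aln)
  have kz: "\<alpha> k ^ l = \<zeta> * \<delta>" using dnz by (simp add: \<zeta>_def)
  have prim: "primitive_root_of_unity n \<zeta>"
  proof (rule primitive_rootI)
    show "n > 0" using n by simp
    show "\<zeta> ^ n = 1" unfolding \<zeta>_def power_divide dn power_mult[symmetric] aln using e0nz by simp
    fix r assume "\<zeta> ^ r = 1"
    then have kr: "\<alpha> k ^ (l * r) = \<delta> ^ r" by (simp add: power_mult kz power_mult_distrib)
    have "\<alpha> m ^ (l * r) = \<delta> ^ r" for m
    proof -
      have "m \<in> {j i, j i', k}" using U by blast
      then show ?thesis using kr dj by (auto simp: power_mult)
    qed
    then have "l * n dvd l * r" by (rule scal)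
    then show "n dvd r" using l by simp
  qed
  \<comment> \<open>The basis is reordered so that the centre of the homology becomes the third
    coordinate point.\<close>
  define b' where "b' = (\<lambda>m::3. if m = 1 then b (j i) else if m = 2 then b (j i') else b k)"
  have "\<exists>x. v = (\<Sum>m\<in>UNIV. x $ m *s b' m)" for v
  proof -
    obtain x where x: "v = (\<Sum>m\<in>UNIV. x $ m *s b m)" using sp by blast
    have "v = x $ (j i) *s b (j i) + x $ (j i') *s b (j i') + x $ k *s b k"
      unfolding x U using ii kj kj[symmetric] by (simp add: add.assoc)
    also have "\<dots> = (\<Sum>m\<in>UNIV. vector [x $ j i, x $ j i', x $ k] $ m *s b' m)"
      by (simp add: sum_3 b'_def)
    finally show ?thesis by blast
  qed
  then have "invertible (cols b')" by (rule cols_invertible)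
  moreover have "((*v) A ^^ l) (b' 1) = \<delta> *s b' 1" "((*v) A ^^ l) (b' 2) = \<delta> *s b' 2"
    "((*v) A ^^ l) (b' 3) = (\<zeta> * \<delta>) *s b' 3"
    unfolding b'_def by (simp_all add: powb dj kz)
  moreover have "mp_value F (((*v) A ^^ r) v) = c ^ r * mp_value F v" for r v
    by (induction r) (auto simp: sem)
  then have "mp_value F (((*v) A ^^ l) v) = \<delta> ^ Suc n * mp_value F v" for v
    using e0nz dn by (simp add: \<delta>_def)
  ultimately show ?thesis using prim dnz that by blast
qed

text \<open>The homogenisation of z^n - g(x) in degree n + 1. The homogenising variable is
  \<open>mp_var 2\<close>; x and z are the quotients of \<open>mp_var 1\<close> and
  \<open>mp_var 3\<close> by it.\<close>

definition normal_form :: "nat \<Rightarrow> 'k::comm_ring_1 poly \<Rightarrow> ('k, 3) mpoly"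
  where "normal_form n g = mp_var 3 ^ n * mp_var 2 -
    (\<Sum>k\<le>Suc n. mp_const (Polynomial.coeff g k) * mp_var 1 ^ k * mp_var 2 ^ (Suc n - k))"

lemma (in coef_hom) mp_eval_normal_form:
  "mp_eval \<phi> x (normal_form n g) = x 3 ^ n * x 2 - (\<Sum>k\<le>Suc n. \<phi> (Polynomial.coeff g k) * x 1 ^ k * x 2 ^ (Suc n - k))"
  unfolding normal_form_def by (simp only: mp_eval_simps mp_eval_const mp_eval_var)

lemma mp_value_normal_form:
  "mp_value (normal_form n g) v = v $ 3 ^ n * v $ 2 -
    (\<Sum>k\<le>Suc n. Polynomial.coeff g k * v $ 1 ^ k * v $ 2 ^ (Suc n - k))"
  unfolding mp_value_def id_hom.mp_eval_normal_form by simp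

lemma homogeneous_normal_form: "homogeneous (Suc n) (normal_form n g)"
proof -
  have 1: "homogeneous (n + 1) (mp_var 3 ^ n * mp_var 2 :: ('a, 3) mpoly)"
    by (intro homogeneous_mult) (simp_all flip: One_nat_def add: homogeneous_var[unfolded One_nat_def[symmetric]])
  have 2: "homogeneous (0 + k + (Suc n - k)) (mp_const c * mp_var 1 ^ k * mp_var 2 ^ (Suc n - k) :: ('a, 3) mpoly)" for c k
    by (intro homogeneous_mult homogeneous_const homogeneous_var_power)
  show ?thesis
    unfolding normal_form_def
  proof (intro homogeneous_diff homogeneous_sum)
    fix k assume "k \<in> {..Suc n}"
    then show "homogeneous (Suc n) (mp_const (Polynomial.coeff g k) * mp_var 1 ^ k * mp_var 2 ^ (Suc n - k) :: ('a, 3) mpoly)"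
      using 2[of k] by simp
  qed (use 1 in simp)
qed

lemma prod_3: "prod f (UNIV :: 3 set) = f 1 * f 2 * f 3"
  unfolding UNIV_3 by (simp add: mult.assoc)

lemma vec3_eqI: "v $ 1 = w $ 1 \<Longrightarrow> v $ 2 = w $ 2 \<Longrightarrow> v $ 3 = w $ 3 \<Longrightarrow> v = (w :: 'a ^ 3)"
  by (simp add: vec_eq_iff forall_3)

lemma degree_eq_3: "homogeneous N F \<Longrightarrow> m \<in> Poly_Mapping.keys F \<Longrightarrow>
    Poly_Mapping.lookup m 1 + Poly_Mapping.lookup m 2 + Poly_Mapping.lookup m 3 = (N::nat)"
  for F :: "('k::zero, 3) mpoly"
  unfolding homogeneous_def sum_3 by blast

text \<open>The hypotheses \<open>1\<close>, \<open>2\<close> and \<open>3\<close> say that the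
  three partial derivatives vanish at (x, y, z). The coefficients form a function \<open>c\<close>
  and not a polynomial because the lemma is applied before the top coefficient is known to be
  nonzero.\<close>

lemma double_point_binary:
  fixes F :: "('k::field_char_0, 3) mpoly"
  assumes F: "\<And>v. mp_value F v = v $ 3 ^ n * v $ 2 - (\<Sum>k\<le>Suc n. c k * v $ 1 ^ k * v $ 2 ^ (Suc n - k))"
    and 0: "mp_value F (vector [x, y, z]) = 0"
    and 1: "(\<Sum>k\<le>Suc n. c k * (of_nat k * x ^ (k - 1) * y ^ (Suc n - k))) = 0"
    and 2: "z ^ n - (\<Sum>k\<le>Suc n. c k * (x ^ k * (of_nat (Suc n - k) * y ^ (Suc n - k - 1)))) = 0"
    and 3: "of_nat n * z ^ (n - 1) * y = 0"
  shows "double_point F (vector [x, y, z])"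
  unfolding double_point_def
proof
  fix h :: "'k ^ 3"
  let ?v = "vector [x, y, z] :: 'k ^ 3"
  define p where "p = [:z, h $ 3:] ^ n * [:y, h $ 2:] -
     (\<Sum>k\<le>Suc n. Polynomial.smult (c k) ([:x, h $ 1:] ^ k * [:y, h $ 2:] ^ (Suc n - k)))"
  have "poly (line_poly F ?v h) = poly p"
  proof
    fix e show "poly (line_poly F ?v h) e = poly p e"
      unfolding poly_line_poly F p_def by (simp add: poly_sum algebra_simps)
  qed
  then have lp: "line_poly F ?v h = p" by (simp add: poly_eq_poly_eq_iff)
  have d: "poly (pderiv ([:a, r:] ^ k * [:b, s:] ^ i)) 0 =
     (of_nat k * a ^ (k - 1) * b ^ i) * r + (a ^ k * (of_nat i * b ^ (i - 1))) * s" for k i and a b r s :: 'k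
    by (simp add: pderiv_mult pderiv_power pderiv_pCons algebra_simps)
  have d1: "poly (pderiv ([:z, h $ 3:] ^ n * [:y, h $ 2:])) 0 = of_nat n * z ^ (n - 1) * y * h $ 3 + z ^ n * h $ 2"
    using d[of z "h $ 3" n y "h $ 2" 1] by (simp only: power_one_right of_nat_1 diff_self_eq_0 power_0 mult_1_left mult_1_right)
  have "poly (pderiv p) 0 = of_nat n * z ^ (n - 1) * y * h $ 3 + z ^ n * h $ 2 -
     (\<Sum>k\<le>Suc n. c k * ((of_nat k * x ^ (k - 1) * y ^ (Suc n - k)) * h $ 1 +
        (x ^ k * (of_nat (Suc n - k) * y ^ (Suc n - k - 1))) * h $ 2))"
    unfolding p_def pderiv_diff pderiv_sum pderiv_smult poly_diff poly_sum poly_smult d d1 ..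
  also have "\<dots> = of_nat n * z ^ (n - 1) * y * h $ 3 -
      (\<Sum>k\<le>Suc n. c k * (of_nat k * x ^ (k - 1) * y ^ (Suc n - k))) * h $ 1 +
      (z ^ n - (\<Sum>k\<le>Suc n. c k * (x ^ k * (of_nat (Suc n - k) * y ^ (Suc n - k - 1))))) * h $ 2"
    by (simp only: distrib_left sum.distrib left_diff_distrib sum_distrib_right mult.assoc) (simp add: algebra_simps)
  also have "\<dots> = 0" unfolding 1 2 3 by simp
  finally have "poly (pderiv p) 0 = 0" .
  moreover have "poly p 0 = 0" using 0 poly_line_poly[of F ?v h 0] lp by simp
  ultimately show "[:0, 1:] ^ 2 dvd line_poly F ?v h" unfolding X2_dvd_iff lp by blast
qed


text \<open>Invariance under the homology leaves only the powers z^0 and z^n, so the equation is z^n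
  L(x, y) plus a binary form. Smoothness at the centre gives L \<noteq> 0, and L is taken as the
  coordinate y. Smoothness on y = 0 gives the binary form full degree in x, and smoothness on z = 0
  makes it squarefree.\<close>

lemma normal_form_exists:
  fixes F :: "('k::{alg_closed_field, field_char_0}, 3) mpoly" and A :: "'k ^ 3 ^ 3"
  assumes inv: "invertible (cols b)" and \<zeta>: "primitive_root_of_unity n \<zeta>" and \<delta>: "\<delta> \<noteq> 0"
    and b: "((*v) A ^^ l) (b 1) = \<delta> *s b 1" "((*v) A ^^ l) (b 2) = \<delta> *s b 2"
      "((*v) A ^^ l) (b 3) = (\<zeta> * \<delta>) *s b 3"
    and sem: "\<And>v. mp_value F (((*v) A ^^ l) v) = \<delta> ^ Suc n * mp_value F v"
    and ns: "\<And>v. v \<noteq> 0 \<Longrightarrow> \<not> double_point F v" and hom: "homogeneous (Suc n) F"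
    and n: "n \<ge> 2"
  obtains M g c where "invertible M" "c \<noteq> 0" "transform_form M F = mp_const c * normal_form n g"
    "Polynomial.degree g = Suc n" "Polynomial.coeff g (Suc n) = 1" "\<And>x. poly g x = 0 \<Longrightarrow> poly (pderiv g) x \<noteq> 0"
proof -
  let ?l = "Poly_Mapping.lookup :: (3 \<Rightarrow>\<^sub>0 nat) \<Rightarrow> _"
  let ?M1 = "cols b"
  define F1 where "F1 = transform_form ?M1 F"
  let ?a = "\<lambda>i::3. if i = 3 then \<zeta> * \<delta> else \<delta>"
  have T: "((*v) A ^^ l) (?M1 *v x) = ?M1 *v (\<chi> i. ?a i * x $ i)" for x
  proof -
    have add: "((*v) A ^^ l) (v + w) = ((*v) A ^^ l) v + ((*v) A ^^ l) w" for v w :: "'k ^ 3"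
      by (induction l) (auto simp: vec.add)
    have sc: "((*v) A ^^ l) (c *s v) = c *s ((*v) A ^^ l) v" for c and v :: "'k ^ 3"
      by (induction l) (auto simp: vec.scale)
    show ?thesis
      by (simp add: cols_mult sum_3 add sc b vector_smult_assoc mult_ac)
  qed
  have hom1: "homogeneous (Suc n) F1" unfolding F1_def using hom by (rule homogeneous_transform)
  have sem1: "mp_value F1 (\<chi> i. ?a i * v $ i) = \<delta> ^ Suc n * mp_value F1 v" for v
    unfolding F1_def mp_value_transform T[symmetric] sem ..
  have m3: "?l m 3 = 0 \<or> ?l m 3 = n" if m: "m \<in> Poly_Mapping.keys F1" for m
  proof -
    have "\<delta> ^ ?l m 1 * (\<delta> ^ ?l m 2 * (\<zeta> * \<delta>) ^ ?l m 3) = \<delta> ^ Suc n"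
    proof -
      have "(\<Prod>i\<in>UNIV. ?a i ^ ?l m i) = \<delta> ^ Suc n"
        by (rule semi_invariant_monomial[where a = ?a and F = F1, OF sem1 m])
      then show ?thesis unfolding prod_3 by (simp add: mult.assoc del: power_Suc)
    qed
    moreover have "\<delta> ^ ?l m 1 * (\<delta> ^ ?l m 2 * (\<zeta> * \<delta>) ^ ?l m 3) = \<zeta> ^ ?l m 3 * \<delta> ^ (?l m 1 + ?l m 2 + ?l m 3)"
      by (simp add: power_add power_mult_distrib mult_ac)
    ultimately have "\<zeta> ^ ?l m 3 * \<delta> ^ Suc n = \<delta> ^ Suc n" using degree_eq_3[OF hom1 m] by simp
    then have "\<zeta> ^ ?l m 3 = 1" using \<delta> by simp
    then have "n dvd ?l m 3" using primitive_root_power_eq_1_iff[OF \<zeta>] by blast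
    then obtain q where q: "?l m 3 = n * q" by (auto simp: dvd_def)
    \<comment> \<open>The exponent of z is a multiple of n and at most n + 1 < 2 n.\<close>
    have "n * q < n * 2" using degree_eq_3[OF hom1 m] q n by linarith
    then have "q < 2" by simp
    then have "q = 0 \<or> q = 1" by linarith
    with q show ?thesis by auto
  qed
  have b3: "b 3 \<noteq> 0"
  proof
    assume "b 3 = 0"
    then have "cols b *v axis 3 1 = 0" by (simp add: cols_axis)
    then have "(axis 3 1 :: 'k ^ 3) = 0" by (rule invertible_ker[OF inv])
    then show False by (simp add: axis_eq_0_iff)
  qed
  have "\<not> double_point F1 (axis 3 1)"
    using double_point_transform[of "cols b" F "axis 3 1"] inv ns[OF b3] by (auto simp: F1_def cols_axis)
  then obtain j where j: "Poly_Mapping.single 3 n + Poly_Mapping.single j 1 \<in> Poly_Mapping.keys F1"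
    using no_double_point_imp_monomial[OF hom1] n by auto
  have "j \<noteq> 3" using m3[OF j] n by (auto simp: lookup_add lookup_single)
  then have j12: "j = 1 \<or> j = 2" using exhaust_3[of j] by blast
  let ?e = "\<lambda>j::3. Poly_Mapping.single (3::3) n + Poly_Mapping.single j (1::nat)"
  define \<alpha> where "\<alpha> = Poly_Mapping.lookup F1 (?e 1)"
  define \<beta> where "\<beta> = Poly_Mapping.lookup F1 (?e 2)"
  have ab: "\<alpha> \<noteq> 0 \<or> \<beta> \<noteq> 0" using j j12 by (auto simp: \<alpha>_def \<beta>_def in_keys_iff)
  have e12: "?e 1 \<noteq> ?e 2"
  proof
    assume "?e 1 = ?e 2"
    then have "?l (?e 1) 1 = ?l (?e 2) 1" by simp
    then show False by (simp add: lookup_add lookup_single)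
  qed
  have F1: "mp_value F1 v = v $ 3 ^ n * (\<alpha> * v $ 1 + \<beta> * v $ 2) + mp_value F1 (vector [v $ 1, v $ 2, 0])" for v
  proof -
    let ?t = "\<lambda>v m. Poly_Mapping.lookup F1 m * (\<Prod>i\<in>UNIV. v $ i ^ ?l m i)"
    let ?K = "{m\<in>Poly_Mapping.keys F1. ?l m 3 = 0}"
    have sub: "Poly_Mapping.keys F1 \<subseteq> ?K \<union> {?e 1, ?e 2}"
    proof
      fix m assume m: "m \<in> Poly_Mapping.keys F1"
      show "m \<in> ?K \<union> {?e 1, ?e 2}"
      proof (cases "?l m 3 = 0")
        case False
        then have "?l m 3 = n" using m3[OF m] by simp
        then have s: "?l m 1 + ?l m 2 = 1" "?l m 3 = n" using degree_eq_3[OF hom1 m] by auto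
        then have "?l m 1 = 1 \<and> ?l m 2 = 0 \<or> ?l m 1 = 0 \<and> ?l m 2 = 1" by linarith
        then have "m = ?e 1 \<or> m = ?e 2"
        proof (elim disjE conjE)
          assume "?l m 1 = 1" "?l m 2 = 0"
          then have "m = ?e 1" using s by (intro exponent_3_eqI) (simp_all add: lookup_add lookup_single)
          then show ?thesis ..
        next
          assume "?l m 1 = 0" "?l m 2 = 1"
          then have "m = ?e 2" using s by (intro exponent_3_eqI) (simp_all add: lookup_add lookup_single)
          then show ?thesis ..
        qed
        then show ?thesis by blast
      qed (use m in simp)
    qed
    have dis: "?K \<inter> {?e 1, ?e 2} = {}" using n by (auto simp: lookup_add lookup_single)
    have val: "mp_value F1 v = (\<Sum>m\<in>?K. ?t v m) + (?t v (?e 1) + ?t v (?e 2))" for v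
    proof -
      have "mp_value F1 v = (\<Sum>m\<in>?K \<union> {?e 1, ?e 2}. ?t v m)"
        unfolding mp_value_def by (subst id_hom.mp_eval_superset[OF _ sub]) auto
      also have "\<dots> = (\<Sum>m\<in>?K. ?t v m) + (\<Sum>m\<in>{?e 1, ?e 2}. ?t v m)"
        by (rule sum.union_disjoint) (use dis in auto)
      finally show ?thesis using e12 by simp
    qed
    have "(\<Sum>m\<in>?K. ?t v m) = (\<Sum>m\<in>?K. ?t (vector [v $ 1, v $ 2, 0]) m)"
      by (intro sum.cong) (auto simp: prod_3)
    moreover have "?t v (?e 1) = v $ 3 ^ n * (\<alpha> * v $ 1)" "?t v (?e 2) = v $ 3 ^ n * (\<beta> * v $ 2)" for v
      by (simp_all add: prod_3 lookup_add lookup_single \<alpha>_def \<beta>_def mult_ac)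
    ultimately show ?thesis using n unfolding val[of v] val[of "vector [v $ 1, v $ 2, 0]"]
      by (simp add: algebra_simps power_0_left)
  qed
  text \<open>Coordinates in which the coefficient of \<open>Z^n\<close> is \<open>Y\<close>.\<close>
  define r where "r = (\<lambda>i::3. if i = 3 then axis 3 1 else if \<beta> \<noteq> 0
     then (if i = 1 then vector [1, - \<alpha> / \<beta>, 0] else vector [0, 1 / \<beta>, 0])
     else (if i = 1 then vector [0, 1, 0] else vector [1 / \<alpha>, 0, 0]) :: 'k ^ 3)"
  have ax3: "(axis 3 1 :: 'k ^ 3) = vector [0, 0, 1]" by (intro vec3_eqI) (simp_all add: axis_def)
  have "\<exists>x. v = (\<Sum>j\<in>UNIV. x $ j *s r j)" for v
  proof (cases "\<beta> = 0")
    case True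
    then show ?thesis using ab
      by (intro exI[of _ "vector [v $ 2, \<alpha> * v $ 1, v $ 3]"] vec3_eqI) (simp_all add: sum_3 r_def ax3)
  next
    case False
    then show ?thesis
      by (intro exI[of _ "vector [v $ 1, \<alpha> * v $ 1 + \<beta> * v $ 2, v $ 3]"] vec3_eqI)
         (simp_all add: sum_3 r_def ax3 field_simps)
  qed
  then have invN: "invertible (cols r)" by (rule cols_invertible)
  define F2 where "F2 = transform_form (cols r) F1"
  have hom2: "homogeneous (Suc n) F2" unfolding F2_def using hom1 by (rule homogeneous_transform)
  have F2a: "mp_value F2 v = v $ 3 ^ n * v $ 2 + mp_value F2 (vector [v $ 1, v $ 2, 0])" for v
  proof -
    let ?w = "cols r *v v"
    have w: "?w $ 3 = v $ 3" "\<alpha> * ?w $ 1 + \<beta> * ?w $ 2 = v $ 2"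
      using ab by (auto simp: cols_mult sum_3 r_def ax3 field_simps)
    have "vector [?w $ 1, ?w $ 2, 0] = cols r *v vector [v $ 1, v $ 2, 0]"
      by (intro vec3_eqI) (simp_all add: cols_mult sum_3 r_def ax3)
    then show ?thesis using F1[of ?w] w by (simp add: F2_def mp_value_transform)
  qed
  let ?m = "\<lambda>k. Poly_Mapping.single (1::3) k + Poly_Mapping.single 2 (Suc n - k)"
  define c where "c k = - Poly_Mapping.lookup F2 (?m k)" for k
  have F2b: "mp_value F2 (vector [x, y, 0]) = - (\<Sum>k\<le>Suc n. c k * x ^ k * y ^ (Suc n - k))" for x y
  proof -
    let ?K = "{m\<in>Poly_Mapping.keys F2. ?l m 3 \<noteq> 0}"
    let ?t = "\<lambda>m. Poly_Mapping.lookup F2 m * (\<Prod>i\<in>UNIV. (vector [x, y, 0] :: 'k ^ 3) $ i ^ ?l m i)"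
    have lm: "?l (?m k) 1 = k" "?l (?m k) 2 = Suc n - k" "?l (?m k) 3 = 0" for k
      by (simp_all add: lookup_add lookup_single)
    have sub: "Poly_Mapping.keys F2 \<subseteq> ?m ` {..Suc n} \<union> ?K"
    proof
      fix m assume m: "m \<in> Poly_Mapping.keys F2"
      show "m \<in> ?m ` {..Suc n} \<union> ?K"
      proof (cases "?l m 3 = 0")
        case True
        then have "?l m 1 \<le> Suc n" "m = ?m (?l m 1)"
          using degree_eq_3[OF hom2 m] by (auto intro!: exponent_3_eqI simp: lm)
        then show ?thesis by blast
      qed (use m in simp)
    qed
    have "mp_value F2 (vector [x, y, 0]) = (\<Sum>m\<in>?m ` {..Suc n} \<union> ?K. ?t m)"
      unfolding mp_value_def by (subst id_hom.mp_eval_superset[OF _ sub]) auto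
    also have "\<dots> = (\<Sum>m\<in>?m ` {..Suc n}. ?t m) + (\<Sum>m\<in>?K. ?t m)"
      by (rule sum.union_disjoint) (auto simp: lm)
    also have "(\<Sum>m\<in>?K. ?t m) = 0" by (intro sum.neutral) (auto simp: prod_3)
    also have "(\<Sum>m\<in>?m ` {..Suc n}. ?t m) = (\<Sum>k\<le>Suc n. ?t (?m k))"
      by (subst sum.reindex) (auto intro!: inj_onI dest: arg_cong[where f = "\<lambda>m. ?l m 1"] simp: lm)
    also have "\<dots> = - (\<Sum>k\<le>Suc n. c k * x ^ k * y ^ (Suc n - k))"
      unfolding sum_negf[symmetric] by (intro sum.cong) (auto simp: prod_3 lm c_def mult_ac)
    finally show ?thesis by simp
  qed
  have F2: "mp_value F2 v = v $ 3 ^ n * v $ 2 - (\<Sum>k\<le>Suc n. c k * v $ 1 ^ k * v $ 2 ^ (Suc n - k))" for v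
    using F2a[of v] F2b[of "v $ 1" "v $ 2"] by simp
  have ns2: "\<not> double_point F2 v" if "v \<noteq> 0" for v
  proof
    assume "double_point F2 v"
    then have "double_point F1 (cols r *v v)" unfolding F2_def using invN by (rule double_point_transform)
    then have "double_point F (?M1 *v (cols r *v v))" unfolding F1_def using inv by (rule double_point_transform)
    moreover have "?M1 *v (cols r *v v) \<noteq> 0" using that invertible_ker[OF inv] invertible_ker[OF invN] by metis
    ultimately show False using ns by blast
  qed
  have vne: "vector [x, y, z] \<noteq> (0 :: 'k ^ 3)" if "x \<noteq> 0 \<or> y \<noteq> 0" for x y z
    using that by (auto simp: vec_eq_iff forall_3)
  have top: "c (Suc n) \<noteq> 0"
  proof
    assume c0: "c (Suc n) = 0"
    \<comment> \<open>If the top coefficient vanished, (1 : 0 : z) would lie on the curve for every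
      z; this choice of z makes the derivative in y vanish there too.\<close>
    obtain z where z: "z ^ n = c n" using exists_nth_root[of n "c n"] n by auto
    have S1: "(\<Sum>k\<le>Suc n. c k * 1 ^ k * 0 ^ (Suc n - k)) = c (Suc n)"
      by (subst sum.remove[of _ "Suc n"]) (auto intro!: sum.neutral)
    have S2: "(\<Sum>k\<le>Suc n. c k * (of_nat k * 1 ^ (k - 1) * 0 ^ (Suc n - k))) = c (Suc n) * of_nat (Suc n)"
      by (subst sum.remove[of _ "Suc n"]) (auto intro!: sum.neutral)
    have S3: "(\<Sum>k\<le>Suc n. c k * (1 ^ k * (of_nat (Suc n - k) * 0 ^ (Suc n - k - 1)))) = c n"
      by (subst sum.remove[of _ n]) (auto intro!: sum.neutral simp: power_0_left le_Suc_eq split: if_splits)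
    have "double_point F2 (vector [1, 0, z])"
    proof (rule double_point_binary[OF F2])
      show "mp_value F2 (vector [1, 0, z]) = 0" using S1 c0 by (simp only: F2 vector_3) simp
      show "(\<Sum>k\<le>Suc n. c k * (of_nat k * 1 ^ (k - 1) * 0 ^ (Suc n - k))) = 0" unfolding S2 c0 by simp
      show "z ^ n - (\<Sum>k\<le>Suc n. c k * (1 ^ k * (of_nat (Suc n - k) * 0 ^ (Suc n - k - 1)))) = 0"
        unfolding S3 z by simp
    qed simp
    then show False using ns2 vne by force
  qed
  define g0 where "g0 = (\<Sum>k\<le>Suc n. Polynomial.monom (c k) k)"
  have cg0: "Polynomial.coeff g0 k = (if k \<le> Suc n then c k else 0)" for k
    by (simp add: g0_def Polynomial.coeff_sum)
  have deg0: "Polynomial.degree g0 = Suc n"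
    by (rule antisym) (auto intro!: degree_le le_degree simp: cg0 top)
  have pg0: "poly g0 x = (\<Sum>k\<le>Suc n. c k * x ^ k)" for x
    by (simp add: g0_def poly_sum poly_monom)
  have pd0: "poly (pderiv g0) x = (\<Sum>k\<le>Suc n. c k * (of_nat k * x ^ (k - 1)))" for x
    unfolding g0_def pderiv_sum poly_sum pderiv_monom poly_monom by (intro sum.cong) (auto simp: mult_ac)
  have sqf: "poly (pderiv g0) x \<noteq> 0" if x: "poly g0 x = 0" for x
  proof
    assume d: "poly (pderiv g0) x = 0"
    \<comment> \<open>Euler's relation at y = 1: the derivative of the binary form in y is (n + 1) g
      - x g', so it vanishes at a double root as well.\<close>
    have e: "c k * (x ^ k * of_nat (Suc n - k)) = of_nat (Suc n) * (c k * x ^ k) - x * (c k * (of_nat k * x ^ (k - 1)))"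
      if "k \<le> Suc n" for k
    proof (cases k)
      case (Suc i)
      then show ?thesis using that by (simp add: of_nat_diff algebra_simps)
    qed simp
    have "(\<Sum>k\<le>Suc n. c k * (x ^ k * of_nat (Suc n - k))) =
      (\<Sum>k\<le>Suc n. of_nat (Suc n) * (c k * x ^ k) - x * (c k * (of_nat k * x ^ (k - 1))))"
      by (intro sum.cong refl e) simp
    also have "\<dots> = of_nat (Suc n) * poly g0 x - x * poly (pderiv g0) x"
      by (simp only: pg0 pd0 sum_subtractf sum_distrib_left)
    finally have S: "(\<Sum>k\<le>Suc n. c k * (x ^ k * of_nat (Suc n - k))) = 0" using x d by simp
    have "double_point F2 (vector [x, 1, 0])"
    proof (rule double_point_binary[OF F2])
      show "mp_value F2 (vector [x, 1, 0]) = 0" using x n by (simp add: F2 pg0 power_0_left del: sum.atMost_Suc)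
      show "(\<Sum>k\<le>Suc n. c k * (of_nat k * x ^ (k - 1) * 1 ^ (Suc n - k))) = 0"
        using d by (simp only: pd0 power_one mult_1_right)
      show "0 ^ n - (\<Sum>k\<le>Suc n. c k * (x ^ k * (of_nat (Suc n - k) * 1 ^ (Suc n - k - 1)))) = 0"
        using S n by (simp only: power_one mult_1_right) simp
      show "of_nat n * 0 ^ (n - 1) * 1 = (0 :: 'k)" using n by (simp add: power_0_left)
    qed
    then show False using ns2 vne[of x 1] by force
  qed
  \<comment> \<open>Scaling z by an n-th root of the leading coefficient lets that coefficient be
    divided out of the whole form, which makes \<open>g\<close> monic.\<close>
  define \<gamma> where "\<gamma> = c (Suc n)"
  have g0: "\<gamma> \<noteq> 0" using top by (simp add: \<gamma>_def)
  obtain t where t: "t ^ n = \<gamma>" using exists_nth_root[of n \<gamma>] n by auto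
  have t0: "t \<noteq> 0" using t g0 n by auto
  let ?s = "\<lambda>i::3. if i = 3 then t *s axis 3 1 else axis i (1::'k)"
  have invS: "invertible (cols ?s)"
  proof (rule cols_invertible)
    fix v :: "'k ^ 3"
    show "\<exists>x. v = (\<Sum>j\<in>UNIV. x $ j *s ?s j)" using t0
      by (intro exI[of _ "vector [v $ 1, v $ 2, v $ 3 / t]"] vec3_eqI) (simp_all add: sum_3 axis_def)
  qed
  have Sv: "cols ?s *v v = vector [v $ 1, v $ 2, t * v $ 3]" for v
    by (intro vec3_eqI) (simp_all add: cols_mult sum_3 axis_def mult.commute)
  define g where "g = Polynomial.smult (inverse \<gamma>) g0"
  have tF: "transform_form (?M1 ** (cols r ** cols ?s)) F = mp_const \<gamma> * normal_form n g"
  proof (rule mp_value_ext)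
    fix v
    have "mp_value (transform_form (?M1 ** (cols r ** cols ?s)) F) v = mp_value F2 (cols ?s *v v)"
      by (simp add: mp_value_transform F2_def F1_def matrix_vector_mul_assoc matrix_mul_assoc)
    also have "\<dots> = \<gamma> * (v $ 3 ^ n * v $ 2) - (\<Sum>k\<le>Suc n. c k * v $ 1 ^ k * v $ 2 ^ (Suc n - k))"
      unfolding F2 Sv by (simp add: power_mult_distrib t del: sum.atMost_Suc)
    also have "(\<Sum>k\<le>Suc n. c k * v $ 1 ^ k * v $ 2 ^ (Suc n - k)) =
      \<gamma> * (\<Sum>k\<le>Suc n. Polynomial.coeff g k * v $ 1 ^ k * v $ 2 ^ (Suc n - k))"
      unfolding sum_distrib_left using g0 by (intro sum.cong) (auto simp: g_def cg0)
    finally show "mp_value (transform_form (?M1 ** (cols r ** cols ?s)) F) v = mp_value (mp_const \<gamma> * normal_form n g) v"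
      by (simp only: mp_value_mult mp_value_normal_form mp_value_const right_diff_distrib)
  qed
  show ?thesis
  proof (rule that)
    show "invertible (?M1 ** (cols r ** cols ?s))" using inv invN invS by (intro invertible_mult)
    show "Polynomial.degree g = Suc n" using g0 by (simp add: g_def deg0)
    show "Polynomial.coeff g (Suc n) = 1" using g0 by (simp add: g_def cg0 \<gamma>_def)
    show "poly (pderiv g) x \<noteq> 0" if "poly g x = 0" for x
      using that g0 sqf[of x] by (simp add: g_def pderiv_smult)
  qed (use g0 tF in auto)
qed

section \<open>The function field of z^n = g(x) inside Laurent series\<close>

section \<open>Laurent series\<close>

text \<open>Exactly one term attains the least order, so its leading coefficient cannot
  cancel.\<close>

lemma fls_sum_distinct_subdegrees:
  fixes f :: "'i \<Rightarrow> 'k::field fls"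
  assumes "finite I" "I \<noteq> {}" "\<And>i. i \<in> I \<Longrightarrow> f i \<noteq> 0" "inj_on (\<lambda>i. fls_subdegree (f i)) I"
  shows "(\<Sum>i\<in>I. f i) \<noteq> 0" and "i \<in> I \<Longrightarrow> fls_subdegree (\<Sum>i\<in>I. f i) \<le> fls_subdegree (f i)"
proof -
  let ?m = "Min ((\<lambda>i. fls_subdegree (f i)) ` I)"
  obtain i0 where i0: "i0 \<in> I" "fls_subdegree (f i0) = ?m"
    using Min_in[of "(\<lambda>i. fls_subdegree (f i)) ` I"] assms(1,2) by fastforce
  have le: "?m \<le> fls_subdegree (f i)" if "i \<in> I" for i using assms(1) that by (intro Min_le) auto
  have "f i $$ ?m = 0" if "i \<in> I - {i0}" for i
  proof -
    have "fls_subdegree (f i) \<noteq> ?m" using inj_onD[OF assms(4), of i i0] i0 that by auto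
    then have "?m < fls_subdegree (f i)" using le[of i] that by auto
    then show ?thesis by simp
  qed
  then have "(\<Sum>i\<in>I. f i) $$ ?m = f i0 $$ ?m"
    unfolding fls_nth_sum by (subst sum.remove[OF assms(1) i0(1)]) (simp add: sum.neutral)
  also have "\<dots> \<noteq> 0" using assms(3)[OF i0(1)] i0(2) by (metis nth_fls_subdegree_nonzero)
  finally have nz: "(\<Sum>i\<in>I. f i) $$ ?m \<noteq> 0" .
  then show "(\<Sum>i\<in>I. f i) \<noteq> 0" by auto
  assume "i \<in> I"
  then show "fls_subdegree (\<Sum>i\<in>I. f i) \<le> fls_subdegree (f i)" using le fls_subdegree_leI[OF nz] by fastforce
qed

abbreviation fc :: "'k::field fls \<Rightarrow> 'k fps \<Rightarrow> 'k fls" where "fc \<equiv> fls_compose_fps"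

lemma fc_sum:
  assumes "H \<noteq> 0" "fps_nth H 0 = 0"
  shows "fc (\<Sum>a\<in>A. f a) H = (\<Sum>a\<in>A. fc (f a) H)"
  by (induction A rule: infinite_finite_induct) (auto simp: fls_compose_fps_add assms)

subsection \<open>Evaluation of univariate polynomials at a Laurent series\<close>

definition pev :: "'k::field poly \<Rightarrow> 'k fls \<Rightarrow> 'k fls"
  where "pev p \<xi> = poly (map_poly fls_const p) \<xi>"

lemma pev_0 [simp]: "pev 0 \<xi> = 0" by (simp add: pev_def)

lemma pev_pCons: "pev (pCons a p) \<xi> = fls_const a + \<xi> * pev p \<xi>"
  by (simp add: pev_def map_poly_pCons)

lemma pev_const [simp]: "pev [:a:] \<xi> = fls_const a"
  by (simp add: pev_pCons)

lemma pev_1 [simp]: "pev 1 \<xi> = 1"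
  by (simp add: pev_def)

lemma pev_add: "pev (p + q) \<xi> = pev p \<xi> + pev q \<xi>"
  by (induction p q rule: poly_induct2) (auto simp: pev_pCons fls_hom.add algebra_simps simp del: fls_plus_const)

lemma pev_smult: "pev (Polynomial.smult c p) \<xi> = fls_const c * pev p \<xi>"
  by (induction p) (auto simp: pev_pCons fls_hom.mult algebra_simps simp del: fls_const_mult_const)

lemma pev_mult: "pev (p * q) \<xi> = pev p \<xi> * pev q \<xi>"
  by (induction p) (auto simp: pev_pCons pev_add pev_smult algebra_simps)

lemma pev_uminus: "pev (- p) \<xi> = - pev p \<xi>"
  using pev_add[of p "- p" \<xi>] by (simp add: eq_neg_iff_add_eq_0 add.commute)

lemma pev_diff: "pev (p - q) \<xi> = pev p \<xi> - pev q \<xi>"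
  using pev_add[of p "- q" \<xi>] by (simp add: pev_uminus)

lemma pev_sum: "pev (\<Sum>a\<in>A. f a) \<xi> = (\<Sum>a\<in>A. pev (f a) \<xi>)"
  by (induction A rule: infinite_finite_induct) (auto simp: pev_add)

lemma pev_power: "pev (p ^ k) \<xi> = pev p \<xi> ^ k"
  by (induction k) (auto simp: pev_mult)

lemma pev_X [simp]: "pev [:0, 1:] \<xi> = \<xi>"
  by (simp add: pev_pCons)

lemma pev_monom: "pev (Polynomial.monom c k) \<xi> = fls_const c * \<xi> ^ k"
  by (induction k) (auto simp: monom_0 monom_Suc pev_pCons)

lemma pev_altdef:
  assumes "Polynomial.degree p \<le> N"
  shows "pev p \<xi> = (\<Sum>k\<le>N. fls_const (Polynomial.coeff p k) * \<xi> ^ k)"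
  by (subst poly_as_sum_of_monoms'[OF assms, symmetric]) (simp add: pev_sum pev_monom)

lemma pev_fc:
  assumes "H \<noteq> 0" "fps_nth H 0 = 0"
  shows "fc (pev p \<xi>) H = pev p (fc \<xi> H)"
  by (induction p) (auto simp: pev_pCons assms fls_compose_fps_add fls_compose_fps_mult)

lemma pev_fps:
  "pev p (fps_to_fls a) = fps_to_fls (fps_compose (fps_of_poly p) a)" if "fps_nth a 0 = 0"
  by (induction p) (use that in \<open>auto simp: pev_pCons fps_of_poly_pCons fps_compose_add_distrib
      fps_compose_mult_distrib fls_times_fps_to_fls\<close>)

definition nonconst :: "'k::field fls \<Rightarrow> bool"
  where "nonconst \<xi> \<longleftrightarrow> (\<forall>c. \<xi> \<noteq> fls_const c)"

lemma nonconstI: "f $$ k \<noteq> 0 \<Longrightarrow> k \<noteq> 0 \<Longrightarrow> nonconst f"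
  by (auto simp: nonconst_def)

lemma nonconst_subdegree: "fls_subdegree f \<noteq> 0 \<Longrightarrow> nonconst f"
  by (auto simp: nonconst_def)

text \<open>Over an algebraically closed field a polynomial splits into factors X - a, and none of
  them vanishes at a nonconstant series. Nonconstant series are thus transcendental over K.\<close>

lemma pev_nonzero:
  fixes p :: "'k::alg_closed_field poly"
  assumes "nonconst \<xi>" "p \<noteq> 0"
  shows "pev p \<xi> \<noteq> 0"
  using assms(2)
proof (induction "Polynomial.degree p" arbitrary: p rule: less_induct)
  case less
  show ?case
  proof (cases "Polynomial.degree p = 0")
    case True
    then obtain a where "p = [:a:]" by (rule degree_eq_zeroE)
    then show ?thesis using less.prems by simp
  next
    case False
    then obtain a where "poly p a = 0" using alg_closed_imp_poly_has_root by blast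
    then obtain q where q: "p = [:- a, 1:] * q" by (auto simp: poly_eq_0_iff_dvd dvd_def)
    have q0: "q \<noteq> 0" using less.prems q by auto
    then have "Polynomial.degree q < Polynomial.degree p" unfolding q by (subst degree_mult_eq) auto
    then have "pev q \<xi> \<noteq> 0" using less.hyps q0 by blast
    moreover have "pev [:- a, 1:] \<xi> = \<xi> - fls_const a" by (simp add: pev_pCons flip: fls_const_uminus)
    ultimately show ?thesis using assms(1) unfolding q pev_mult nonconst_def by simp
  qed
qed

lemma pev_subdegree_neg:
  assumes "fls_subdegree \<xi> < 0" "p \<noteq> 0"
  shows "fls_subdegree (pev p \<xi>) = int (Polynomial.degree p) * fls_subdegree \<xi> \<and> pev p \<xi> \<noteq> 0"
  using assms(2)
proof (induction p)
  case (pCons a p)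
  have xi0: "\<xi> \<noteq> 0" using assms(1) by auto
  show ?case
  proof (cases "p = 0")
    case True with pCons show ?thesis by (simp add: pev_pCons)
  next
    case False
    then have IH: "fls_subdegree (pev p \<xi>) = int (Polynomial.degree p) * fls_subdegree \<xi>" "pev p \<xi> \<noteq> 0"
      using pCons.IH by auto
    have nz: "\<xi> * pev p \<xi> \<noteq> 0" using IH xi0 by simp
    have s: "fls_subdegree (\<xi> * pev p \<xi>) = int (Polynomial.degree (pCons a p)) * fls_subdegree \<xi>"
      using IH xi0 False by (simp add: algebra_simps)
    have neg: "int (Polynomial.degree (pCons a p)) * fls_subdegree \<xi> < 0" using assms(1) False by (simp add: mult_pos_neg)
    then have "fls_subdegree (pev (pCons a p) \<xi>) = fls_subdegree (\<xi> * pev p \<xi>)"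
      unfolding pev_pCons using s neg by (intro fls_subdegree_add_eq2 nz) simp
    moreover have "pev (pCons a p) \<xi> \<noteq> 0"
    proof
      assume "pev (pCons a p) \<xi> = 0"
      then have "fls_subdegree (pev (pCons a p) \<xi>) = 0" by simp
      then show False using calculation s neg by linarith
    qed
    ultimately show ?thesis using s by simp
  qed
qed simp

section \<open>The curve \<open>z^n = g(x)\<close> over Laurent series\<close>

definition pt :: "'r::comm_ring_1 \<Rightarrow> 'r \<Rightarrow> 3 \<Rightarrow> 'r"
  where "pt \<xi> \<eta> = (\<lambda>i. if i = 1 then \<xi> else if i = 2 then 1 else \<eta>)"

lemma pt_simps [simp]: "pt \<xi> \<eta> 1 = \<xi>" "pt \<xi> \<eta> 2 = 1" "pt \<xi> \<eta> 3 = \<eta>"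
  by (simp_all add: pt_def)

abbreviation ev :: "('n::finite \<Rightarrow> 'k::field fls) \<Rightarrow> ('k, 'n) mpoly \<Rightarrow> 'k fls"
  where "ev \<equiv> mp_eval fls_const"

locale superelliptic =
  fixes n :: nat and g :: "'k::{alg_closed_field, field_char_0} poly"
  assumes n4: "n \<ge> 4" and degree_g: "Polynomial.degree g = Suc n" and monic: "Polynomial.coeff g (Suc n) = 1"
    and sqf: "poly g c = 0 \<Longrightarrow> poly (pderiv g) c \<noteq> 0"
begin

lemma n0: "n > 0" using n4 by simp

definition curve :: "'k fls \<Rightarrow> 'k fls \<Rightarrow> bool"
  where "curve \<xi> \<eta> \<longleftrightarrow> \<eta> ^ n = pev g \<xi>"

text \<open>\<open>P\<close> lists the coefficients of an element of K[x, z] / (z^n - g) in the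
  basis 1, z, ..., z^(n-1) over K[x]; its entries from index n on are ignored.\<close>

definition val :: "(nat \<Rightarrow> 'k poly) \<Rightarrow> 'k fls \<Rightarrow> 'k fls \<Rightarrow> 'k fls"
  where "val P \<xi> \<eta> = (\<Sum>j<n. pev (P j) \<xi> * \<eta> ^ j)"

lemma ev_normal_form: "curve \<xi> \<eta> \<longleftrightarrow> ev (pt \<xi> \<eta>) (normal_form n g) = 0"
  unfolding curve_def fls_hom.mp_eval_normal_form pt_simps power_one mult_1_right
  using pev_altdef[of g "Suc n" \<xi>] degree_g by simp

text \<open>Powers of z are reduced by z^n = g(x). The coefficients depend on \<open>A\<close>
  alone, so one \<open>P\<close> serves all points of the curve at once.\<close>

lemma ev_val: "\<exists>P. \<forall>\<xi> \<eta>. curve \<xi> \<eta> \<longrightarrow> ev (pt \<xi> \<eta>) A = val P \<xi> \<eta>"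
proof -
  let ?l = "Poly_Mapping.lookup :: (3 \<Rightarrow>\<^sub>0 nat) \<Rightarrow> _"
  define P where "P j = (\<Sum>m\<in>Poly_Mapping.keys A. if ?l m 3 mod n = j then
     Polynomial.smult (Poly_Mapping.lookup A m) (Polynomial.monom 1 (?l m 1) * g ^ (?l m 3 div n)) else 0)" for j
  show ?thesis
  proof (intro exI allI impI)
    fix \<xi> \<eta> assume c: "curve \<xi> \<eta>"
    have "val P \<xi> \<eta> = (\<Sum>j<n. \<Sum>m\<in>Poly_Mapping.keys A. (if ?l m 3 mod n = j then
      fls_const (Poly_Mapping.lookup A m) * (\<xi> ^ ?l m 1 * pev g \<xi> ^ (?l m 3 div n)) * \<eta> ^ j else 0))"
      unfolding val_def P_def pev_sum sum_distrib_right
      by (intro sum.cong) (auto simp: pev_smult pev_mult pev_monom pev_power)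
    also have "\<dots> = (\<Sum>m\<in>Poly_Mapping.keys A. \<Sum>j<n. (if ?l m 3 mod n = j then
      fls_const (Poly_Mapping.lookup A m) * (\<xi> ^ ?l m 1 * pev g \<xi> ^ (?l m 3 div n)) * \<eta> ^ j else 0))"
      by (rule sum.swap)
    also have "\<dots> = (\<Sum>m\<in>Poly_Mapping.keys A. fls_const (Poly_Mapping.lookup A m) *
       (\<xi> ^ ?l m 1 * pev g \<xi> ^ (?l m 3 div n)) * \<eta> ^ (?l m 3 mod n))"
      using n0 by (simp add: sum.delta)
    also have "\<dots> = ev (pt \<xi> \<eta>) A"
      unfolding mp_eval_def
    proof (intro sum.cong refl)
      fix m
      have "\<eta> ^ ?l m 3 = pev g \<xi> ^ (?l m 3 div n) * \<eta> ^ (?l m 3 mod n)"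
      proof -
        have "\<eta> ^ ?l m 3 = \<eta> ^ (n * (?l m 3 div n) + ?l m 3 mod n)" by simp
        also have "\<dots> = (\<eta> ^ n) ^ (?l m 3 div n) * \<eta> ^ (?l m 3 mod n)" by (simp only: power_add power_mult)
        finally show ?thesis using c by (simp only: curve_def)
      qed
      then show "fls_const (Poly_Mapping.lookup A m) * (\<xi> ^ ?l m 1 * pev g \<xi> ^ (?l m 3 div n)) * \<eta> ^ (?l m 3 mod n) =
        fls_const (Poly_Mapping.lookup A m) * (\<Prod>i\<in>UNIV. pt \<xi> \<eta> i ^ ?l m i)"
        by (simp add: prod_3 mult.assoc)
    qed
    finally show "ev (pt \<xi> \<eta>) A = val P \<xi> \<eta>" ..
  qed
qed

text \<open>Powers of \<open>mp_var 2\<close> pad the form to any sufficiently large degree without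
  changing its affine values. This allows a numerator and a denominator to be given the same
  degree.\<close>

lemma val_ev:
  "\<exists>N. \<forall>M\<ge>N. \<exists>A. homogeneous M A \<and> (\<forall>\<xi> \<eta>. ev (pt \<xi> \<eta>) A = val P \<xi> \<eta>)"
proof (intro exI allI impI)
  let ?N = "n + (\<Sum>j<n. Polynomial.degree (P j))"
  fix M assume M: "?N \<le> M"
  define A :: "('k, 3) mpoly" where "A = (\<Sum>j<n. \<Sum>k\<le>Polynomial.degree (P j).
     mp_const (Polynomial.coeff (P j) k) * mp_var 1 ^ k * mp_var 3 ^ j * mp_var 2 ^ (M - k - j))"
  have "homogeneous M A"
    unfolding A_def
  proof (intro homogeneous_sum)
    fix j k assume jk: "j \<in> {..<n}" "k \<in> {..Polynomial.degree (P j)}"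
    have "Polynomial.degree (P j) \<le> (\<Sum>j<n. Polynomial.degree (P j))"
      using jk by (intro member_le_sum[of j]) auto
    then have e: "0 + k + j + (M - k - j) = M" using M jk by auto
    have "homogeneous (0 + k + j + (M - k - j))
      (mp_const (Polynomial.coeff (P j) k) * mp_var 1 ^ k * mp_var 3 ^ j * mp_var 2 ^ (M - k - j) :: ('k, 3) mpoly)"
      by (intro homogeneous_mult homogeneous_const homogeneous_var_power)
    then show "homogeneous M (mp_const (Polynomial.coeff (P j) k) * mp_var 1 ^ k * mp_var 3 ^ j * mp_var 2 ^ (M - k - j) :: ('k, 3) mpoly)"
      unfolding e .
  qed
  moreover have "ev (pt \<xi> \<eta>) A = val P \<xi> \<eta>" for \<xi> \<eta>
    unfolding A_def val_def fls_hom.mp_eval_simps fls_hom.mp_eval_const fls_hom.mp_eval_var pt_simps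
      pev_altdef[OF order_refl] by (simp add: sum_distrib_right)
  ultimately show "homogeneous M A \<and> (\<forall>\<xi> \<eta>. ev (pt \<xi> \<eta>) A = val P \<xi> \<eta>)" by blast
qed

lemma val_add: "val (\<lambda>j. P j + Q j) \<xi> \<eta> = val P \<xi> \<eta> + val Q \<xi> \<eta>"
  by (simp add: val_def pev_add distrib_right sum.distrib)

lemma val_diff: "val (\<lambda>j. P j - Q j) \<xi> \<eta> = val P \<xi> \<eta> - val Q \<xi> \<eta>"
  by (simp add: val_def pev_diff left_diff_distrib sum_subtractf)

lemma val_poly_mult: "val (\<lambda>j. D * P j) \<xi> \<eta> = pev D \<xi> * val P \<xi> \<eta>"
  by (simp add: val_def pev_mult sum_distrib_left mult.assoc)

lemma val_poly: "val (\<lambda>j. if j = 0 then D else 0) \<xi> \<eta> = pev D \<xi>"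
proof -
  have "val (\<lambda>j. if j = 0 then D else 0) \<xi> \<eta> = (\<Sum>j<n. if j = 0 then pev D \<xi> else 0)"
    unfolding val_def by (intro sum.cong) auto
  then show ?thesis using n0 by (simp add: sum.delta)
qed

lemma val_z: "val (\<lambda>j. if j = 1 then 1 else 0) \<xi> \<eta> = \<eta>"
proof -
  have "val (\<lambda>j. if j = 1 then 1 else 0) \<xi> \<eta> = (\<Sum>j<n. if j = 1 then \<eta> else 0)"
    unfolding val_def by (intro sum.cong) auto
  then show ?thesis using n4 by (simp add: sum.delta)
qed

lemma val_mult: "\<exists>R. \<forall>\<xi> \<eta>. curve \<xi> \<eta> \<longrightarrow> val P \<xi> \<eta> * val Q \<xi> \<eta> = val R \<xi> \<eta>"
proof -
  obtain A where A: "\<forall>\<xi> \<eta>. ev (pt \<xi> \<eta>) A = val P \<xi> \<eta>" using val_ev[of P] by blast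
  obtain B where B: "\<forall>\<xi> \<eta>. ev (pt \<xi> \<eta>) B = val Q \<xi> \<eta>" using val_ev[of Q] by blast
  show ?thesis using ev_val[of "A * B"] by (simp add: fls_hom.mp_eval_mult A B)
qed

lemma val_prod:
  assumes "finite I"
  shows "\<exists>R. \<forall>\<xi> \<eta>. curve \<xi> \<eta> \<longrightarrow> (\<Prod>i\<in>I. val (P i) \<xi> \<eta>) = val R \<xi> \<eta>"
  using assms
proof (induction I rule: finite_induct)
  case empty
  show ?case using val_poly[of 1] by (intro exI[of _ "\<lambda>j. if j = 0 then 1 else 0"]) simp
next
  case (insert i I)
  then obtain R where R: "\<forall>\<xi> \<eta>. curve \<xi> \<eta> \<longrightarrow> (\<Prod>i\<in>I. val (P i) \<xi> \<eta>) = val R \<xi> \<eta>" by blast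
  obtain S where "\<forall>\<xi> \<eta>. curve \<xi> \<eta> \<longrightarrow> val (P i) \<xi> \<eta> * val R \<xi> \<eta> = val S \<xi> \<eta>" using val_mult[of "P i" R] by blast
  then show ?case using insert R by (intro exI[of _ S]) auto
qed

subsection \<open>The generic point and the place at infinity\<close>

text \<open>Put x = T^(-n). The equation becomes z^n = T^(-n (n + 1)) G(T^n), where G is the
  reversed polynomial with constant coefficient 1; so z is T^(-n-1) times an n-th root of G, taken
  at T^n.\<close>

definition root_ghat :: "'k fps" where
  "root_ghat = fps_radical (\<lambda>_ _. 1) n (fps_of_poly (reflect_poly g))"

definition X0 :: "'k fls" where "X0 = fls_X_inv ^ n"
definition Z0 :: "'k fls" where "Z0 = fls_X_inv ^ Suc n * fps_to_fls (fps_compose root_ghat (fps_X ^ n))"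

lemma root_ghat_power: "root_ghat ^ n = fps_of_poly (reflect_poly g)"
proof -
  obtain k where k: "n = Suc k" using n0 by (cases n) auto
  have "fps_nth (fps_of_poly (reflect_poly g)) 0 = 1" using degree_g monic by simp
  then have "fps_radical (\<lambda>_ _. 1) (Suc k) (fps_of_poly (reflect_poly g)) ^ Suc k = fps_of_poly (reflect_poly g)"
    by (intro iffD1[OF power_radical]) auto
  then show ?thesis unfolding root_ghat_def unfolding k .
qed

lemma root_ghat_0: "fps_nth root_ghat 0 \<noteq> 0"
proof
  assume "fps_nth root_ghat 0 = 0"
  then have "fps_nth (root_ghat ^ n) 0 = 0" using n0 by (simp add: fps_power_zeroth)
  then show False using degree_g monic by (simp add: root_ghat_power)
qed

lemma X_inv_power: "fls_X_inv ^ k * fls_X ^ k = (1 :: 'k fls)"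
  by (simp flip: power_mult_distrib fls_inverse_X)

lemma subdegree_X0: "fls_subdegree X0 = - int n" by (simp add: X0_def)

lemma nonconst_X0: "nonconst X0" using n0 by (intro nonconst_subdegree) (simp add: subdegree_X0)

lemma curve_generic: "curve X0 Z0"
proof -
  let ?h = "fps_to_fls (fps_compose (fps_of_poly (reflect_poly g)) (fps_X ^ n)) :: 'k fls"
  have Xn: "fps_nth (fps_X ^ n :: 'k fps) 0 = 0" using n0 by (simp add: fps_power_zeroth)
  have "fps_to_fls (fps_compose root_ghat (fps_X ^ n)) ^ n = ?h"
    by (simp add: fps_to_fls_power[symmetric] fps_compose_power[OF Xn] root_ghat_power)
  then have 1: "Z0 ^ n = fls_X_inv ^ (n * Suc n) * ?h"
    unfolding Z0_def power_mult_distrib power_mult[symmetric] mult.commute[of "Suc n" n] by simp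
  have h: "?h = (\<Sum>k\<le>Suc n. fls_const (Polynomial.coeff g (Suc n - k)) * (fls_X ^ n) ^ k)"
  proof -
    have "?h = pev (reflect_poly g) (fls_X ^ n)"
      using pev_fps[OF Xn, of "reflect_poly g"] by (simp add: fps_to_fls_power)
    also have "\<dots> = (\<Sum>k\<le>Suc n. fls_const (Polynomial.coeff (reflect_poly g) k) * (fls_X ^ n) ^ k)"
      using degree_reflect_poly_le[of g] degree_g by (intro pev_altdef) simp
    also have "\<dots> = (\<Sum>k\<le>Suc n. fls_const (Polynomial.coeff g (Suc n - k)) * (fls_X ^ n) ^ k)"
      by (intro sum.cong) (auto simp: coeff_reflect_poly degree_g)
    finally show ?thesis .
  qed
  have "pev g X0 = (\<Sum>k\<le>Suc n. fls_const (Polynomial.coeff g k) * (fls_X_inv ^ n) ^ k)"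
    unfolding X0_def using degree_g by (intro pev_altdef) simp
  also have "\<dots> = (\<Sum>k\<le>Suc n. fls_const (Polynomial.coeff g (Suc n - k)) * (fls_X_inv ^ n) ^ (Suc n - k))"
    by (rule sum.reindex_bij_witness[of _ "\<lambda>k. Suc n - k" "\<lambda>k. Suc n - k"]) auto
  also have "\<dots> = fls_X_inv ^ (n * Suc n) * ?h"
    unfolding h sum_distrib_left
  proof (intro sum.cong refl)
    fix k assume k: "k \<in> {..Suc n}"
    have "fls_X_inv ^ (n * Suc n) = (fls_X_inv ^ n) ^ (Suc n - k) * (fls_X_inv ^ n :: 'k fls) ^ k"
      using k by (simp flip: power_mult power_add) (simp flip: distrib_left)
    moreover have "(fls_X_inv ^ n) ^ k * (fls_X ^ n) ^ k = (1 :: 'k fls)"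
      by (simp only: power_mult[symmetric] X_inv_power)
    ultimately show "fls_const (Polynomial.coeff g (Suc n - k)) * (fls_X_inv ^ n) ^ (Suc n - k) =
      fls_X_inv ^ (n * Suc n) * (fls_const (Polynomial.coeff g (Suc n - k)) * (fls_X ^ n) ^ k)"
      by (simp add: mult.assoc mult.left_commute)
  qed
  finally show ?thesis using 1 by (simp add: curve_def)
qed

lemma subdegree_Z0: "fls_subdegree Z0 = - int (Suc n)" and Z0_nonzero: "Z0 \<noteq> 0"
proof -
  have "fps_nth (fps_compose root_ghat (fps_X ^ n)) 0 = fps_nth root_ghat 0" by simp
  then have nz: "fps_nth (fps_compose root_ghat (fps_X ^ n)) 0 \<noteq> 0" using root_ghat_0 by simp
  then have "subdegree (fps_compose root_ghat (fps_X ^ n)) = 0" by (rule subdegree_eq_0)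
  moreover have "fps_to_fls (fps_compose root_ghat (fps_X ^ n)) \<noteq> 0" using nz by (metis fps_to_fls_eq_0_iff fps_zero_nth)
  ultimately show "fls_subdegree Z0 = - int (Suc n)"
    unfolding Z0_def by (simp add: fls_subdegree_fls_to_fps del: power_Suc)
  show "Z0 \<noteq> 0" unfolding Z0_def using \<open>fps_to_fls _ \<noteq> 0\<close> by (simp del: power_Suc)
qed

text \<open>At infinity x has order -n and z has order -(n + 1), so the j-th summand has order
  congruent to -j modulo n. The summands therefore cannot cancel: 1, z, ..., z^(n-1) are independent
  over K[x], and the order of the sum bounds every coefficient degree.\<close>

lemma val_subdegree_generic:
  assumes "j < n" "P j \<noteq> 0"
  shows "val P X0 Z0 \<noteq> 0"
    and "fls_subdegree (val P X0 Z0) \<le> - int (n * Polynomial.degree (P j) + Suc n * j)"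
proof -
  let ?f = "\<lambda>j. pev (P j) X0 * Z0 ^ j" and ?I = "{j. j < n \<and> P j \<noteq> 0}"
  have X0neg: "fls_subdegree X0 < 0" using n0 by (simp add: subdegree_X0)
  have f: "?f j \<noteq> 0" "fls_subdegree (?f j) = - int (n * Polynomial.degree (P j) + Suc n * j)" if "j \<in> ?I" for j
    using pev_subdegree_neg[OF X0neg, of "P j"] that Z0_nonzero
    by (auto simp: fls_subdegree_pow subdegree_X0 subdegree_Z0 algebra_simps)
  have inj: "inj_on (\<lambda>j. fls_subdegree (?f j)) ?I"
  proof (rule inj_onI)
    fix i j assume i: "i \<in> ?I" and j: "j \<in> ?I" and "fls_subdegree (?f i) = fls_subdegree (?f j)"
    then have "n * Polynomial.degree (P i) + Suc n * i = n * Polynomial.degree (P j) + Suc n * j"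
      using f[OF i] f[OF j] by linarith
    then have "(n * (Polynomial.degree (P i) + i) + i) mod n = (n * (Polynomial.degree (P j) + j) + j) mod n"
      by (simp add: algebra_simps)
    then show "i = j" using i j by simp
  qed
  have S: "val P X0 Z0 = (\<Sum>j\<in>?I. ?f j)"
    unfolding val_def by (rule sum.mono_neutral_right) auto
  have jI: "j \<in> ?I" using assms by simp
  show "val P X0 Z0 \<noteq> 0" unfolding S
    by (rule fls_sum_distinct_subdegrees(1)) (use jI f inj in auto)
  have "fls_subdegree (\<Sum>j\<in>?I. ?f j) \<le> fls_subdegree (?f j)"
    by (rule fls_sum_distinct_subdegrees(2)) (use jI f inj in auto)
  then show "fls_subdegree (val P X0 Z0) \<le> - int (n * Polynomial.degree (P j) + Suc n * j)"
    unfolding S f(2)[OF jI] .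
qed

lemma val_generic_eq_0: "val P X0 Z0 = 0 \<Longrightarrow> j < n \<Longrightarrow> P j = 0"
  using val_subdegree_generic(1) by blast

text \<open>The point (\<open>X0\<close>, \<open>Z0\<close>) is generic: a relation there has zero
  coefficients and so holds everywhere.\<close>

lemma val_eq_0: "val P X0 Z0 = 0 \<Longrightarrow> val P \<xi> \<eta> = 0"
  by (simp add: val_def val_generic_eq_0)

end

section \<open>The field of quotients of forms of equal degree\<close>

text \<open>The index type is left open. At a point of the plane this is the function field of its
  closure; at a pair of series it is the subfield generated over K by their ratio.\<close>

definition quot :: "('n::finite \<Rightarrow> 'k::field fls) \<Rightarrow> 'k fls set"
  where "quot w = {ev w A / ev w B | A B N. homogeneous N A \<and> homogeneous N B \<and> ev w B \<noteq> 0}"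

lemma quotI: "homogeneous N A \<Longrightarrow> homogeneous N B \<Longrightarrow> ev w B \<noteq> 0 \<Longrightarrow> ev w A / ev w B \<in> quot w"
  unfolding quot_def by blast

lemma quotE:
  assumes "f \<in> quot w"
  obtains A B N where "homogeneous N A" "homogeneous N B" "ev w B \<noteq> 0" "f = ev w A / ev w B"
  using assms unfolding quot_def by blast

lemma quot_const: "fls_const c \<in> quot w"
  using quotI[of 0 "mp_const c" 1 w] by simp

lemma quot_0: "0 \<in> quot w" and quot_1: "1 \<in> quot w"
  using quot_const[of 0 w] quot_const[of 1 w] by simp_all

lemma quot_add: "f \<in> quot w \<Longrightarrow> h \<in> quot w \<Longrightarrow> f + h \<in> quot w"
proof (elim quotE)
  fix A B N C D M
  assume *: "homogeneous N A" "homogeneous N B" "ev w B \<noteq> 0" "f = ev w A / ev w B"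
    "homogeneous M C" "homogeneous M D" "ev w D \<noteq> 0" "h = ev w C / ev w D"
  have "f + h = ev w (A * D + B * C) / ev w (B * D)"
    unfolding *(4,8) using *(3,7) by (simp add: fls_hom.mp_eval_add fls_hom.mp_eval_mult field_simps)
  then show ?thesis
    using * quotI[of "N + M" "A * D + B * C" "B * D" w]
    by (auto intro: homogeneous_add homogeneous_mult simp: fls_hom.mp_eval_mult)
qed

lemma quot_mult: "f \<in> quot w \<Longrightarrow> h \<in> quot w \<Longrightarrow> f * h \<in> quot w"
proof (elim quotE)
  fix A B N C D M
  assume *: "homogeneous N A" "homogeneous N B" "ev w B \<noteq> 0" "f = ev w A / ev w B"
    "homogeneous M C" "homogeneous M D" "ev w D \<noteq> 0" "h = ev w C / ev w D"
  have "f * h = ev w (A * C) / ev w (B * D)"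
    using * by (simp add: fls_hom.mp_eval_mult)
  then show ?thesis
    using * quotI[of "N + M" "A * C" "B * D" w]
    by (auto intro: homogeneous_mult simp: fls_hom.mp_eval_mult)
qed

lemma quot_inverse: "f \<in> quot w \<Longrightarrow> inverse f \<in> quot w"
proof (elim quotE)
  fix A B N
  assume *: "homogeneous N A" "homogeneous N B" "ev w B \<noteq> 0" "f = ev w A / ev w B"
  then show ?thesis
    using quotI[of N B A w] quot_0[of w] by (cases "ev w A = 0") auto
qed

lemma quot_uminus: "f \<in> quot w \<Longrightarrow> - f \<in> quot w"
  using quot_mult[OF quot_const[of "-1" w], of f] by simp

lemma quot_diff: "f \<in> quot w \<Longrightarrow> h \<in> quot w \<Longrightarrow> f - h \<in> quot w"
  using quot_add[of f w "- h"] quot_uminus[of h w] by simp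

lemma quot_divide: "f \<in> quot w \<Longrightarrow> h \<in> quot w \<Longrightarrow> f / h \<in> quot w"
  using quot_mult[of f w "inverse h"] quot_inverse[of h w] by (simp add: divide_inverse)

lemma quot_power: "f \<in> quot w \<Longrightarrow> f ^ k \<in> quot w"
  by (induction k) (auto intro: quot_1 quot_mult)

lemma quot_sum: "(\<And>a. a \<in> A \<Longrightarrow> f a \<in> quot w) \<Longrightarrow> (\<Sum>a\<in>A. f a) \<in> quot w"
  by (induction A rule: infinite_finite_induct) (auto intro: quot_add quot_0)

lemma quot_prod: "(\<And>a. a \<in> A \<Longrightarrow> f a \<in> quot w) \<Longrightarrow> (\<Prod>a\<in>A. f a) \<in> quot w"
  by (induction A rule: infinite_finite_induct) (auto intro: quot_mult quot_1)

lemma quot_pev: "f \<in> quot w \<Longrightarrow> pev p f \<in> quot w"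
  by (induction p) (auto simp: pev_pCons intro: quot_0 quot_add quot_const quot_mult)

lemma pev_pCons_0_1 [simp]: "pev (pCons 0 1) \<xi> = \<xi>"
  by (simp add: pev_pCons)

context superelliptic
begin

lemma curve_fc:
  assumes "curve \<xi> \<eta>" "H \<noteq> 0" "fps_nth H 0 = 0"
  shows "curve (fc \<xi> H) (fc \<eta> H)"
  using assms(1) unfolding curve_def
  by (simp add: fls_compose_fps_power[OF assms(2,3), symmetric] pev_fc[OF assms(2,3), symmetric])

lemma val_fc:
  assumes "H \<noteq> 0" "fps_nth H 0 = 0"
  shows "fc (val P \<xi> \<eta>) H = val P (fc \<xi> H) (fc \<eta> H)"
  using assms by (simp add: val_def fc_sum fls_compose_fps_mult fls_compose_fps_power pev_fc)

lemma curve_scale: "curve \<xi> \<eta> \<Longrightarrow> c ^ n = 1 \<Longrightarrow> curve \<xi> (fls_const c * \<eta>)"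
  by (simp add: curve_def power_mult_distrib flip: fls_const_power)

lemma val_scale: "val P \<xi> (fls_const c * \<eta>) = val (\<lambda>j. Polynomial.smult (c ^ j) (P j)) \<xi> \<eta>"
  by (simp add: val_def pev_smult power_mult_distrib mult_ac flip: fls_const_power)

text \<open>Since x = T^(-n), substituting c T for T with c^n = 1 fixes x and multiplies z by 1/c.
  Deck transformations thus become substitutions in the parameter.\<close>

definition scaling :: "'k \<Rightarrow> 'k fps" where "scaling c = fps_const c * fps_X"

lemma scaling_nonzero: "c \<noteq> 0 \<Longrightarrow> scaling c \<noteq> 0" "fps_nth (scaling c) 0 = 0"
  by (auto simp: scaling_def)

lemma fc_scaling_X0: "c \<noteq> 0 \<Longrightarrow> c ^ n = 1 \<Longrightarrow> fc X0 (scaling c) = X0"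
  and fc_scaling_Z0: "c \<noteq> 0 \<Longrightarrow> c ^ n = 1 \<Longrightarrow> fc Z0 (scaling c) = fls_const (inverse c) * Z0"
proof -
  assume c: "c \<noteq> 0" "c ^ n = 1"
  note s = scaling_nonzero(1)[OF c(1)] scaling_nonzero(2)[of c]
  have "fc fls_X_inv (scaling c) = inverse (fps_to_fls (scaling c))"
    using fls_compose_fps_inverse[OF s, of fls_X] by (simp add: fls_inverse_X)
  also have "\<dots> = fls_const (inverse c) * fls_X_inv"
    by (simp add: scaling_def fls_times_fps_to_fls fls_inverse_X fls_inverse_const)
  finally have Xi: "fc fls_X_inv (scaling c) = fls_const (inverse c) * fls_X_inv" .
  have ic: "inverse c ^ n = 1" by (simp add: power_inverse c)
  then have fic: "fls_const (inverse c) ^ n = 1" by (simp flip: fls_const_power)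
  show "fc X0 (scaling c) = X0"
    by (simp add: X0_def fls_compose_fps_power[OF s] Xi power_mult_distrib fic)
  have Xn: "fps_nth (fps_X ^ n :: 'k fps) 0 = 0" using n0 by (simp add: fps_power_zeroth)
  have "fps_compose (fps_compose root_ghat (fps_X ^ n)) (scaling c) = fps_compose root_ghat (fps_compose (fps_X ^ n) (scaling c))"
    using s Xn by (simp add: fps_compose_assoc)
  also have "fps_compose (fps_X ^ n) (scaling c) = fps_X ^ n"
  proof -
    have "fps_compose (fps_X ^ n) (scaling c) = (fps_compose fps_X (scaling c)) ^ n"
      by (rule fps_compose_power[OF s(2), symmetric])
    also have "\<dots> = (fps_const c * fps_X) ^ n" using s(2) by (simp add: scaling_def)
    also have "\<dots> = fps_X ^ n" by (simp add: power_mult_distrib fps_const_power c)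
    finally show ?thesis .
  qed
  finally have r: "fps_compose (fps_compose root_ghat (fps_X ^ n)) (scaling c) = fps_compose root_ghat (fps_X ^ n)" .
  show "fc Z0 (scaling c) = fls_const (inverse c) * Z0"
    unfolding Z0_def fls_compose_fps_mult[OF s] fls_compose_fps_power[OF s] Xi fls_compose_fps_to_fls[OF s] r
    by (simp add: power_mult_distrib fic mult_ac)
qed

lemma fc_scaling_val:
  assumes "c \<noteq> 0" "c ^ n = 1"
  shows "fc (val P X0 Z0) (scaling c) = val P X0 (fls_const (inverse c) * Z0)"
  using val_fc[OF scaling_nonzero(1)[OF assms(1)] scaling_nonzero(2)] fc_scaling_X0 fc_scaling_Z0 assms by simp

text \<open>Multiplying the argument \<open>Z0\<close> by the primitive root multiplies the j-th
  coefficient by the j-th power of that root, so invariance leaves only the coefficient at j =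
  0.\<close>

lemma fixed_by_scaling:
  assumes z: "primitive_root_of_unity n z" and f: "val R X0 (fls_const z * Z0) = val R X0 Z0"
  shows "\<And>j. j < n \<Longrightarrow> j \<noteq> 0 \<Longrightarrow> R j = 0" "val R \<xi> \<eta> = pev (R 0) \<xi>"
proof -
  have "val (\<lambda>j. Polynomial.smult (z ^ j) (R j) - R j) X0 Z0 = 0"
    using f by (simp add: val_diff val_scale)
  then have *: "Polynomial.smult (z ^ j) (R j) - R j = 0" if "j < n" for j
    using val_generic_eq_0[of "\<lambda>j. Polynomial.smult (z ^ j) (R j) - R j"] that by blast
  have "R j = 0" if "j < n" "j \<noteq> 0" for j
  proof (rule ccontr)
    assume "R j \<noteq> 0"
    have "Polynomial.smult (z ^ j - 1) (R j) = 0" using *[OF that(1)] by (simp add: smult_diff_left)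
    then have "z ^ j = 1" using \<open>R j \<noteq> 0\<close> by simp
    then have "n dvd j" using primitive_root_power_eq_1_iff[OF z] by blast
    then show False using that by (auto dest: dvd_imp_le)
  qed
  then show R0: "\<And>j. j < n \<Longrightarrow> j \<noteq> 0 \<Longrightarrow> R j = 0" .
  have "val R \<xi> \<eta> = val (\<lambda>j. if j = 0 then R 0 else 0) \<xi> \<eta>"
    unfolding val_def by (intro sum.cong) (auto simp: R0)
  then show "val R \<xi> \<eta> = pev (R 0) \<xi>" by (simp add: val_poly)
qed

text \<open>D is the norm to K[x]. The product of the n conjugates obtained by multiplying the
  second coordinate by roots of unity is invariant, hence a polynomial in x alone; Q is the product
  of the conjugates other than P. Denominators can thereby be moved into K[x], uniformly on the
  curve.\<close>

lemma val_norm: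
  assumes "val P X0 Z0 \<noteq> 0"
  shows "\<exists>Q D. D \<noteq> 0 \<and> (\<forall>\<xi> \<eta>. curve \<xi> \<eta> \<longrightarrow> val P \<xi> \<eta> * val Q \<xi> \<eta> = pev D \<xi>)"
proof -
  obtain z :: 'k where z: "primitive_root_of_unity n z" using exists_primitive_root[OF n0] by blast
  have z0: "z \<noteq> 0" "z ^ n = 1" using primitive_root_nonzero[OF z] z by (auto simp: primitive_root_of_unity_def)
  define C where "C i = (\<lambda>j. Polynomial.smult ((z ^ i) ^ j) (P j))" for i
  have C: "val (C i) \<xi> \<eta> = val P \<xi> (fls_const (z ^ i) * \<eta>)" for i \<xi> \<eta>
    unfolding C_def val_scale ..
  define f where "f i = val (C i) X0 Z0" for i
  have iz: "inverse z \<noteq> 0" "inverse z ^ n = 1" using z0 by (auto simp: power_inverse)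
  have shift: "fc (f i) (scaling (inverse z)) = f (Suc i)" for i
  proof -
    have "fc (f i) (scaling (inverse z)) = val (C i) X0 (fls_const z * Z0)"
      unfolding f_def using fc_scaling_val[OF iz, of "C i"] by simp
    then show ?thesis by (simp add: C f_def mult.assoc[symmetric] mult.commute[of z])
  qed
  have fnz: "f i \<noteq> 0" for i
  proof (induction i)
    case 0 show ?case using assms by (simp add: f_def C)
  next
    case (Suc i)
    then show ?case unfolding shift[symmetric]
      using fls_compose_fps_eq_0_iff[OF scaling_nonzero(1)[OF iz(1)] scaling_nonzero(2)] by blast
  qed
  have f0n: "f n = f 0" by (simp add: f_def C z0)
  obtain R where R: "\<forall>\<xi> \<eta>. curve \<xi> \<eta> \<longrightarrow> (\<Prod>i\<in>{..<n}. val (C i) \<xi> \<eta>) = val R \<xi> \<eta>"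
    using val_prod[of "{..<n}" C] by blast
  obtain Q where Q: "\<forall>\<xi> \<eta>. curve \<xi> \<eta> \<longrightarrow> (\<Prod>i\<in>{..<n} - {0}. val (C i) \<xi> \<eta>) = val Q \<xi> \<eta>"
    using val_prod[of "{..<n} - {0}" C] by blast
  have R0: "val R X0 Z0 = (\<Prod>i<n. f i)" using R curve_generic by (simp add: f_def)
  have "val R X0 (fls_const z * Z0) = fc (val R X0 Z0) (scaling (inverse z))"
    using fc_scaling_val[OF iz, of R] by simp
  also have "\<dots> = (\<Prod>i<n. f (Suc i))"
  proof -
    have "fc (\<Prod>i\<in>I. f i) (scaling (inverse z)) = (\<Prod>i\<in>I. f (Suc i))" if "finite I" for I
      using that by (induction I)
        (auto simp: shift fls_compose_fps_mult[OF scaling_nonzero(1)[OF iz(1)] scaling_nonzero(2)])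
    then show ?thesis by (simp add: R0)
  qed
  also have "\<dots> = (\<Prod>i<n. f i)"
  proof -
    \<comment> \<open>The substitution permutes the n factors cyclically.\<close>
    have "f 0 * (\<Prod>i<n. f (Suc i)) = (\<Prod>i<n. f i) * f n"
      by (metis prod.lessThan_Suc prod.lessThan_Suc_shift)
    then show ?thesis using f0n fnz[of 0] by simp
  qed
  finally have inv: "val R X0 (fls_const z * Z0) = val R X0 Z0" by (simp add: R0)
  have D: "val R \<xi> \<eta> = pev (R 0) \<xi>" for \<xi> \<eta> by (rule fixed_by_scaling(2)[OF z inv])
  have "val R X0 Z0 \<noteq> 0" unfolding R0 using fnz by simp
  then have "R 0 \<noteq> 0" using D[of X0 Z0] by auto
  moreover have "val P \<xi> \<eta> * val Q \<xi> \<eta> = pev (R 0) \<xi>" if "curve \<xi> \<eta>" for \<xi> \<eta>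
  proof -
    have "pev (R 0) \<xi> = (\<Prod>i\<in>{..<n}. val (C i) \<xi> \<eta>)" using R that by (simp add: D)
    also have "\<dots> = val (C 0) \<xi> \<eta> * (\<Prod>i\<in>{..<n} - {0}. val (C i) \<xi> \<eta>)"
      using n0 by (intro prod.remove) auto
    finally show ?thesis using Q that by (simp add: C)
  qed
  ultimately show ?thesis by blast
qed

definition S :: "'k fls set" where "S = quot (pt X0 Z0)"

lemma S_iff: "f \<in> S \<longleftrightarrow> (\<exists>P D. D \<noteq> 0 \<and> f = val P X0 Z0 / pev D X0)"
proof
  assume "f \<in> S"
  then obtain A B N where AB: "homogeneous N A" "homogeneous N B" "ev (pt X0 Z0) B \<noteq> 0"
    "f = ev (pt X0 Z0) A / ev (pt X0 Z0) B" unfolding S_def by (elim quotE)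
  obtain P where P: "ev (pt X0 Z0) A = val P X0 Z0" using ev_val[of A] curve_generic by blast
  obtain Q where Q: "ev (pt X0 Z0) B = val Q X0 Z0" using ev_val[of B] curve_generic by blast
  obtain Q' D where D: "D \<noteq> 0" "val Q X0 Z0 * val Q' X0 Z0 = pev D X0"
    using val_norm[of Q] AB(3) Q curve_generic by auto
  obtain R where R: "val P X0 Z0 * val Q' X0 Z0 = val R X0 Z0" using val_mult[of P Q'] curve_generic by blast
  have "val Q' X0 Z0 \<noteq> 0" using D(2) pev_nonzero[OF nonconst_X0 D(1)] by auto
  then have "f = (val P X0 Z0 * val Q' X0 Z0) / (val Q X0 Z0 * val Q' X0 Z0)" using AB P Q by simp
  then show "\<exists>P D. D \<noteq> 0 \<and> f = val P X0 Z0 / pev D X0" using D R by auto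
next
  assume "\<exists>P D. D \<noteq> 0 \<and> f = val P X0 Z0 / pev D X0"
  then obtain P D where D: "D \<noteq> 0" "f = val P X0 Z0 / pev D X0" by blast
  obtain N where N: "\<forall>M\<ge>N. \<exists>A. homogeneous M A \<and> (\<forall>\<xi> \<eta>. ev (pt \<xi> \<eta>) A = val P \<xi> \<eta>)" using val_ev by blast
  obtain N' where N': "\<forall>M\<ge>N'. \<exists>A. homogeneous M A \<and> (\<forall>\<xi> \<eta>. ev (pt \<xi> \<eta>) A = val (\<lambda>j. if j = 0 then D else 0) \<xi> \<eta>)"
    using val_ev by blast
  obtain A where A: "homogeneous (max N N') A" "ev (pt X0 Z0) A = val P X0 Z0" using N by (metis max.cobounded1)
  obtain B where B: "homogeneous (max N N') B" "ev (pt X0 Z0) B = pev D X0" using N' by (metis max.cobounded2 val_poly)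
  show "f \<in> S" unfolding S_def D(2) A(2)[symmetric] B(2)[symmetric]
    using pev_nonzero[OF nonconst_X0 D(1)] by (intro quotI[OF A(1) B(1)]) (simp add: B)
qed

subsection \<open>Embeddings of the function field into Laurent series\<close>

text \<open>Expansion at a place: the homomorphism from the function field to Laurent series that
  sends x to \<xi> and z to \<eta>. By \<open>emb_val\<close> the chosen representation does not
  matter.\<close>

definition emb :: "'k fls \<Rightarrow> 'k fls \<Rightarrow> 'k fls \<Rightarrow> 'k fls"
  where "emb \<xi> \<eta> f = (SOME r. \<exists>P D. D \<noteq> 0 \<and> f = val P X0 Z0 / pev D X0 \<and> r = val P \<xi> \<eta> / pev D \<xi>)"

text \<open>The parameter need not be a uniformiser: composing with a power of it is allowed and
  serves to equalise ramification. A nonconstant \<xi> keeps denominators from K[x] nonzero.\<close>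

definition place :: "'k fls \<Rightarrow> 'k fls \<Rightarrow> bool"
  where "place \<xi> \<eta> \<longleftrightarrow> curve \<xi> \<eta> \<and> nonconst \<xi>"

text \<open>Equal fractions give, after cross-multiplication, a relation at the generic point, and
  by \<open>val_eq_0\<close> such a relation holds at every pair of series.\<close>

lemma emb_val:
  assumes "nonconst \<xi>" "D \<noteq> 0"
  shows "emb \<xi> \<eta> (val P X0 Z0 / pev D X0) = val P \<xi> \<eta> / pev D \<xi>"
proof -
  have uniq: "val P' \<xi> \<eta> / pev D' \<xi> = val P \<xi> \<eta> / pev D \<xi>"
    if D': "D' \<noteq> 0" and eq: "val P X0 Z0 / pev D X0 = val P' X0 Z0 / pev D' X0" for P' D'
  proof -
    have "val (\<lambda>j. D' * P j - D * P' j) X0 Z0 = 0"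
      using eq pev_nonzero[OF nonconst_X0 assms(2)] pev_nonzero[OF nonconst_X0 D']
      by (simp add: val_diff val_poly_mult field_simps)
    then have "val (\<lambda>j. D' * P j - D * P' j) \<xi> \<eta> = 0" by (rule val_eq_0)
    then show ?thesis using pev_nonzero[OF assms] pev_nonzero[OF assms(1) D']
      by (simp add: val_diff val_poly_mult field_simps)
  qed
  show ?thesis unfolding emb_def
  proof (rule some_equality)
    show "\<exists>P' D'. D' \<noteq> 0 \<and> val P X0 Z0 / pev D X0 = val P' X0 Z0 / pev D' X0 \<and>
      val P \<xi> \<eta> / pev D \<xi> = val P' \<xi> \<eta> / pev D' \<xi>" using assms(2) by blast
  qed (use uniq in blast)
qed

lemma SE:
  assumes "f \<in> S"
  obtains P D where "D \<noteq> 0" "f = val P X0 Z0 / pev D X0"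
  using assms S_iff by blast

lemma emb_add:
  assumes "place \<xi> \<eta>" "f \<in> S" "h \<in> S"
  shows "emb \<xi> \<eta> (f + h) = emb \<xi> \<eta> f + emb \<xi> \<eta> h"
proof -
  have nc: "nonconst \<xi>" using assms by (simp add: place_def)
  obtain P D where f: "D \<noteq> 0" "f = val P X0 Z0 / pev D X0" using assms(2) by (rule SE)
  obtain Q E where h: "E \<noteq> 0" "h = val Q X0 Z0 / pev E X0" using assms(3) by (rule SE)
  have *: "val P \<xi> \<eta> / pev D \<xi> + val Q \<xi> \<eta> / pev E \<xi> =
     val (\<lambda>j. E * P j + D * Q j) \<xi> \<eta> / pev (D * E) \<xi>" if "nonconst \<xi>" for \<xi> \<eta>
    using pev_nonzero[OF that f(1)] pev_nonzero[OF that h(1)]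
    by (simp add: val_add val_poly_mult pev_mult field_simps)
  have "D * E \<noteq> 0" using f h by simp
  show ?thesis
    unfolding f(2) h(2) *[OF nonconst_X0] emb_val[OF nc f(1)] emb_val[OF nc h(1)] emb_val[OF nc \<open>D * E \<noteq> 0\<close>] *[OF nc] ..
qed

lemma emb_mult:
  assumes "place \<xi> \<eta>" "f \<in> S" "h \<in> S"
  shows "emb \<xi> \<eta> (f * h) = emb \<xi> \<eta> f * emb \<xi> \<eta> h"
proof -
  have nc: "nonconst \<xi>" and c: "curve \<xi> \<eta>" using assms by (simp_all add: place_def)
  obtain P D where f: "D \<noteq> 0" "f = val P X0 Z0 / pev D X0" using assms(2) by (rule SE)
  obtain Q E where h: "E \<noteq> 0" "h = val Q X0 Z0 / pev E X0" using assms(3) by (rule SE)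
  obtain R where R: "\<forall>\<xi> \<eta>. curve \<xi> \<eta> \<longrightarrow> val P \<xi> \<eta> * val Q \<xi> \<eta> = val R \<xi> \<eta>" using val_mult by blast
  have *: "val P \<xi> \<eta> / pev D \<xi> * (val Q \<xi> \<eta> / pev E \<xi>) = val R \<xi> \<eta> / pev (D * E) \<xi>"
    if "curve \<xi> \<eta>" for \<xi> \<eta>
    using R that by (simp add: pev_mult)
  have "D * E \<noteq> 0" using f h by simp
  show ?thesis
    unfolding f(2) h(2) *[OF curve_generic] emb_val[OF nc f(1)] emb_val[OF nc h(1)] emb_val[OF nc \<open>D * E \<noteq> 0\<close>] *[OF c] ..
qed

lemma emb_pev_X0: "nonconst \<xi> \<Longrightarrow> emb \<xi> \<eta> (pev p X0) = pev p \<xi>"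
  using emb_val[of \<xi> 1 \<eta> "\<lambda>j. if j = 0 then p else 0"] by (simp add: val_poly)

lemma emb_const: "nonconst \<xi> \<Longrightarrow> emb \<xi> \<eta> (fls_const c) = fls_const c"
  using emb_pev_X0[of \<xi> \<eta> "[:c:]"] by simp

lemma emb_0: "nonconst \<xi> \<Longrightarrow> emb \<xi> \<eta> 0 = 0" and emb_1: "nonconst \<xi> \<Longrightarrow> emb \<xi> \<eta> 1 = 1"
  using emb_const[of \<xi> \<eta> 0] emb_const[of \<xi> \<eta> 1] by simp_all

lemma emb_X0: "nonconst \<xi> \<Longrightarrow> emb \<xi> \<eta> X0 = \<xi>"
  using emb_pev_X0[of \<xi> \<eta> "[:0, 1:]"] by simp

lemma emb_Z0: "nonconst \<xi> \<Longrightarrow> emb \<xi> \<eta> Z0 = \<eta>"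
  using emb_val[of \<xi> 1 \<eta> "\<lambda>j. if j = 1 then 1 else 0"] unfolding val_z by simp

lemma S_const: "fls_const c \<in> S" and S_0: "0 \<in> S" and S_1: "1 \<in> S"
  by (simp_all add: S_def quot_const quot_0 quot_1)

lemma val_in_S: "val P X0 Z0 \<in> S"
  unfolding S_iff by (intro exI[of _ P] exI[of _ 1]) simp

lemma X0_in_S: "X0 \<in> S"
  using val_in_S[of "\<lambda>j. if j = 0 then [:0, 1:] else 0"] by (simp add: val_poly)

lemma Z0_in_S: "Z0 \<in> S"
  using val_in_S[of "\<lambda>j. if j = 1 then 1 else 0"] unfolding val_z .

lemmas S_closed = quot_add[of _ "pt X0 Z0", folded S_def] quot_mult[of _ "pt X0 Z0", folded S_def]
  quot_uminus[of _ "pt X0 Z0", folded S_def] quot_diff[of _ "pt X0 Z0", folded S_def]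
  quot_inverse[of _ "pt X0 Z0", folded S_def] quot_divide[of _ "pt X0 Z0", folded S_def]
  quot_power[of _ "pt X0 Z0", folded S_def] quot_pev[of _ "pt X0 Z0", folded S_def]
  S_const S_0 S_1 X0_in_S Z0_in_S val_in_S

lemma emb_uminus: "place \<xi> \<eta> \<Longrightarrow> f \<in> S \<Longrightarrow> emb \<xi> \<eta> (- f) = - emb \<xi> \<eta> f"
  using emb_add[of \<xi> \<eta> f "- f"] S_closed emb_0[of \<xi> \<eta>] by (simp add: eq_neg_iff_add_eq_0 add.commute place_def)

lemma emb_diff: "place \<xi> \<eta> \<Longrightarrow> f \<in> S \<Longrightarrow> h \<in> S \<Longrightarrow> emb \<xi> \<eta> (f - h) = emb \<xi> \<eta> f - emb \<xi> \<eta> h"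
  using emb_add[of \<xi> \<eta> f "- h"] emb_uminus[of \<xi> \<eta> h] S_closed by simp

lemma emb_eq_0_iff:
  assumes "place \<xi> \<eta>" "f \<in> S"
  shows "emb \<xi> \<eta> f = 0 \<longleftrightarrow> f = 0"
proof
  assume *: "emb \<xi> \<eta> f = 0"
  show "f = 0"
  proof (rule ccontr)
    assume "f \<noteq> 0"
    have "emb \<xi> \<eta> (f * inverse f) = 0" using emb_mult[OF assms, of "inverse f"] assms S_closed * by simp
    then show False using \<open>f \<noteq> 0\<close> emb_1[of \<xi> \<eta>] assms by (simp add: place_def)
  qed
qed (use assms emb_0 in \<open>auto simp: place_def\<close>)

lemma emb_inverse:
  assumes "place \<xi> \<eta>" "f \<in> S"
  shows "emb \<xi> \<eta> (inverse f) = inverse (emb \<xi> \<eta> f)"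
proof (cases "f = 0")
  case True then show ?thesis using emb_0 assms by (simp add: place_def)
next
  case False
  have "emb \<xi> \<eta> f * emb \<xi> \<eta> (inverse f) = emb \<xi> \<eta> 1"
    using emb_mult[OF assms, of "inverse f"] assms S_closed False by simp
  then have "emb \<xi> \<eta> f * emb \<xi> \<eta> (inverse f) = 1" using emb_1 assms by (simp add: place_def)
  then show ?thesis by (metis inverse_unique)
qed

lemma emb_divide: "place \<xi> \<eta> \<Longrightarrow> f \<in> S \<Longrightarrow> h \<in> S \<Longrightarrow> emb \<xi> \<eta> (f / h) = emb \<xi> \<eta> f / emb \<xi> \<eta> h"
  using emb_mult[of \<xi> \<eta> f "inverse h"] emb_inverse[of \<xi> \<eta> h] S_closed by (simp add: divide_inverse)

lemma emb_power: "place \<xi> \<eta> \<Longrightarrow> f \<in> S \<Longrightarrow> emb \<xi> \<eta> (f ^ k) = emb \<xi> \<eta> f ^ k"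
  by (induction k) (auto simp: emb_mult S_closed emb_1 place_def)

lemma emb_pev: "place \<xi> \<eta> \<Longrightarrow> f \<in> S \<Longrightarrow> emb \<xi> \<eta> (pev p f) = pev p (emb \<xi> \<eta> f)"
  by (induction p) (auto simp: pev_pCons emb_mult emb_add S_closed emb_0 emb_const place_def)

lemma emb_prod:
  assumes "place \<xi> \<eta>" "\<And>a. a \<in> A \<Longrightarrow> f a \<in> S"
  shows "emb \<xi> \<eta> (\<Prod>a\<in>A. f a) = (\<Prod>a\<in>A. emb \<xi> \<eta> (f a))"
  using assms(2)
proof (induction A rule: infinite_finite_induct)
  case (insert a A)
  then have "(\<Prod>a\<in>A. f a) \<in> S" unfolding S_def by (intro quot_prod) auto
  then show ?case using insert emb_mult[OF assms(1)] by simp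
qed (use assms(1) emb_1 in \<open>auto simp: place_def\<close>)

lemma emb_generic: "f \<in> S \<Longrightarrow> emb X0 Z0 f = f"
  by (elim SE) (simp add: emb_val nonconst_X0)

lemma nonconst_fc:
  assumes "nonconst \<xi>" "H \<noteq> 0" "fps_nth H 0 = 0"
  shows "nonconst (fc \<xi> H)"
  unfolding nonconst_def
proof (intro allI notI)
  fix c assume "fc \<xi> H = fls_const c"
  then have "fc (\<xi> - fls_const c) H = 0" by (simp add: fls_compose_fps_diff assms)
  then have "\<xi> = fls_const c" using fls_compose_fps_eq_0_iff[OF assms(2,3)] by simp
  then show False using assms(1) unfolding nonconst_def by blast
qed

lemma place_fc: "place \<xi> \<eta> \<Longrightarrow> H \<noteq> 0 \<Longrightarrow> fps_nth H 0 = 0 \<Longrightarrow> place (fc \<xi> H) (fc \<eta> H)"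
  unfolding place_def using curve_fc nonconst_fc by blast

lemma emb_fc:
  assumes "place \<xi> \<eta>" "f \<in> S" "H \<noteq> 0" "fps_nth H 0 = 0"
  shows "emb (fc \<xi> H) (fc \<eta> H) f = fc (emb \<xi> \<eta> f) H"
proof -
  have nc: "nonconst \<xi>" "nonconst (fc \<xi> H)" using assms nonconst_fc by (auto simp: place_def)
  obtain P D where f: "D \<noteq> 0" "f = val P X0 Z0 / pev D X0" using assms(2) by (rule SE)
  show ?thesis unfolding f(2) emb_val[OF nc(1) f(1)] emb_val[OF nc(2) f(1)]
    using assms by (simp add: fls_compose_fps_divide val_fc pev_fc)
qed

lemma place_generic: "place X0 Z0"
  using curve_generic nonconst_X0 by (simp add: place_def)

end

section \<open>Comparison with the residue field of the local ring along the curve\<close>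

section \<open>The function field as a field of Laurent series\<close>

text \<open>This takes the place of irreducibility: divisibility of forms by F is vanishing at a
  point over a field, so F behaves like a prime on forms.\<close>

definition generic :: "('k::field, 3) mpoly \<Rightarrow> (3 \<Rightarrow> 'k fls) \<Rightarrow> bool"
  where "generic F w \<longleftrightarrow> (\<forall>N A. homogeneous N A \<longrightarrow> (F dvd A \<longleftrightarrow> ev w A = 0))"

definition subset_ring :: "'a::comm_ring_1 set \<Rightarrow> 'a ring"
  where "subset_ring C = \<lparr>carrier = C, mult = (*), one = 1, zero = 0, add = (+)\<rparr>"

lemma subset_ring_simps [simp]:
  "carrier (subset_ring C) = C" "mult (subset_ring C) = (*)" "one (subset_ring C) = 1"
  "zero (subset_ring C) = 0" "add (subset_ring C) = (+)"
  by (simp_all add: subset_ring_def)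

lemma cring_subset_ring:
  assumes "0 \<in> C" "1 \<in> C" "\<And>a b. a \<in> C \<Longrightarrow> b \<in> C \<Longrightarrow> a + b \<in> C" "\<And>a. a \<in> C \<Longrightarrow> - a \<in> C"
    "\<And>a b. a \<in> C \<Longrightarrow> b \<in> C \<Longrightarrow> a * b \<in> C"
  shows "cring (subset_ring C)"
proof (rule cringI)
  show "abelian_group (subset_ring C)"
  proof (rule abelian_groupI)
    fix x assume "x \<in> carrier (subset_ring C)"
    then show "\<exists>y\<in>carrier (subset_ring C). y \<oplus>\<^bsub>subset_ring C\<^esub> x = \<zero>\<^bsub>subset_ring C\<^esub>"
      using assms(4) by (intro bexI[of _ "- x"]) auto
  qed (use assms in \<open>auto simp: algebra_simps\<close>)
  show "comm_monoid (subset_ring C)"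
    by (rule comm_monoidI) (use assms in \<open>auto simp: algebra_simps\<close>)
qed (auto simp: algebra_simps)

lemma field_subset_ring:
  fixes C :: "'a::field set"
  assumes "0 \<in> C" "1 \<in> C" "\<And>a b. a \<in> C \<Longrightarrow> b \<in> C \<Longrightarrow> a + b \<in> C" "\<And>a. a \<in> C \<Longrightarrow> - a \<in> C"
    "\<And>a b. a \<in> C \<Longrightarrow> b \<in> C \<Longrightarrow> a * b \<in> C" "\<And>a. a \<in> C \<Longrightarrow> inverse a \<in> C"
  shows "field (subset_ring C)"
proof -
  interpret cring "subset_ring C" using assms by (intro cring_subset_ring) auto
  show ?thesis
  proof (rule cring_fieldI2)
    fix a assume "a \<in> carrier (subset_ring C)" "a \<noteq> \<zero>\<^bsub>subset_ring C\<^esub>"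
    then show "\<exists>b\<in>carrier (subset_ring C). a \<otimes>\<^bsub>subset_ring C\<^esub> b = \<one>\<^bsub>subset_ring C\<^esub>"
      using assms(6) by (intro bexI[of _ "inverse a"]) auto
  qed simp
qed

lemma field_quot: "field (subset_ring (quot w))"
  by (rule field_subset_ring) (auto intro: quot_0 quot_1 quot_add quot_mult quot_uminus quot_inverse)

lemma subset_ring_uminus:
  assumes "cring (subset_ring C)" "a \<in> C" "- a \<in> C"
  shows "\<ominus>\<^bsub>subset_ring C\<^esub> a = - a"
proof -
  interpret cring "subset_ring C" by fact
  show ?thesis using minus_equality[of "- a" a] assms by simp
qed

lemma subfield_subset_ring:
  fixes C E :: "'a::field set"
  assumes "field (subset_ring C)" "E \<subseteq> C" "1 \<in> E" "\<And>a b. a \<in> E \<Longrightarrow> b \<in> E \<Longrightarrow> a + b \<in> E" "\<And>a. a \<in> E \<Longrightarrow> - a \<in> E"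
    "\<And>a b. a \<in> E \<Longrightarrow> b \<in> E \<Longrightarrow> a * b \<in> E" "\<And>a. a \<in> E \<Longrightarrow> inverse a \<in> E"
  shows "subfield E (subset_ring C)"
proof -
  interpret field "subset_ring C" by fact
  show ?thesis
  proof (rule subfieldI')
    show "subring E (subset_ring C)"
    proof (rule subringI)
      fix h assume h: "h \<in> E"
      have "\<ominus>\<^bsub>subset_ring C\<^esub> h = - h"
        using h assms(2) assms(5)[OF h] by (intro subset_ring_uminus is_cring) auto
      then show "\<ominus>\<^bsub>subset_ring C\<^esub> h \<in> E" using assms(5)[OF h] by simp
    qed (use assms in auto)
    fix k assume k: "k \<in> E - {\<zero>\<^bsub>subset_ring C\<^esub>}"
    then have "inv\<^bsub>subset_ring C\<^esub> k = inverse k"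
      using assms(2,7) by (intro comm_inv_char) auto
    then show "inv\<^bsub>subset_ring C\<^esub> k \<in> E" using k assms(7) by simp
  qed
qed

subsection \<open>Transport of Galois extensions\<close>

text \<open>Conjugation with h turns automorphisms of L into automorphisms of L', and algebraic
  relations are carried over coefficientwise.\<close>

lemma galois_transport:
  assumes iso: "h \<in> ring_iso L L'" and L': "field L'" and gal: "galois_extension L E"
  shows "galois_extension L' (h ` E)"
proof -
  have L: "field L" and E: "subfield E L" and alg: "\<And>x. x \<in> carrier L \<Longrightarrow> ring.algebraic L E x"
    and fixd: "{x \<in> carrier L. \<forall>\<sigma>\<in>ring_iso L L. (\<forall>e\<in>E. \<sigma> e = e) \<longrightarrow> \<sigma> x = x} = E"
    using gal unfolding galois_extension_def by auto
  interpret L: field L by fact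
  interpret L': field L' by fact
  interpret h: ring_hom_ring L L' h
    using iso by (intro ring_hom_ringI2 L.ring_axioms L'.ring_axioms) (auto simp: ring_iso_def)
  have bij: "bij_betw h (carrier L) (carrier L')" using iso by (simp add: ring_iso_def)
  have Ec: "E \<subseteq> carrier L" using subfieldE(3)[OF E] .
  have inj: "inj_on h (carrier L)" using bij by (rule bij_betw_imp_inj_on)
  have sf: "subfield (h ` E) L'" using h.img_is_subfield(2)[OF E] L'.one_not_zero by simp
  have "ring.algebraic L' (h ` E) x'" if x': "x' \<in> carrier L'" for x'
  proof -
    obtain x where x: "x \<in> carrier L" "x' = h x" using bij x' unfolding bij_betw_def by blast
    obtain p where p: "p \<in> carrier (univ_poly L E)" "p \<noteq> []" "ring.eval L p x = \<zero>\<^bsub>L\<^esub>"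
      using L.algebraicE[OF subfieldE(1)[OF E] x(1)] alg[OF x(1)] unfolding over_def by blast
    have pE: "set p \<subseteq> E" "hd p \<noteq> \<zero>\<^bsub>L\<^esub>"
      using p(1,2) unfolding univ_poly_carrier[symmetric] polynomial_def by auto
    have "hd p \<in> carrier L" using pE p(2) Ec by (metis hd_in_set subsetD)
    then have "h (hd p) \<noteq> \<zero>\<^bsub>L'\<^esub>" using pE(2) inj h.hom_zero L.zero_closed by (metis inj_onD)
    then have "map h p \<in> carrier (univ_poly L' (h ` E))"
      using pE p(2) unfolding univ_poly_carrier[symmetric] polynomial_def by (auto simp: hd_map)
    moreover have "ring.eval L' (map h p) x' = \<zero>\<^bsub>L'\<^esub>"
      using h.eval_hom'[OF x(1), of p] pE(1) Ec p(3) x(2) by auto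
    ultimately show ?thesis using L'.algebraicI[of "map h p" "h ` E" x'] p(2) unfolding over_def by simp
  qed
  moreover have "{x \<in> carrier L'. \<forall>\<sigma>\<in>ring_iso L' L'. (\<forall>e\<in>h ` E. \<sigma> e = e) \<longrightarrow> \<sigma> x = x} = h ` E"
  proof (intro equalityI subsetI)
    fix x' assume "x' \<in> {x \<in> carrier L'. \<forall>\<sigma>\<in>ring_iso L' L'. (\<forall>e\<in>h ` E. \<sigma> e = e) \<longrightarrow> \<sigma> x = x}"
    then have x': "x' \<in> carrier L'" "\<And>\<sigma>. \<sigma> \<in> ring_iso L' L' \<Longrightarrow> (\<And>e. e \<in> E \<Longrightarrow> \<sigma> (h e) = h e) \<Longrightarrow> \<sigma> x' = x'" by auto
    obtain x where x: "x \<in> carrier L" "x' = h x" using bij x'(1) unfolding bij_betw_def by blast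
    have "\<sigma> x = x" if s: "\<sigma> \<in> ring_iso L L" "\<forall>e\<in>E. \<sigma> e = e" for \<sigma>
    proof -
      let ?s = "h \<circ> (\<sigma> \<circ> inv_into (carrier L) h)"
      have "?s \<in> ring_iso L' L'"
        using ring_iso_set_trans[OF ring_iso_set_trans[OF ring_iso_set_sym[OF L.ring_axioms iso] s(1)] iso] by simp
      moreover have inv: "inv_into (carrier L) h (h y) = y" if "y \<in> carrier L" for y
        using inj that by (rule inv_into_f_f)
      then have "?s (h e) = h e" if "e \<in> E" for e using that s(2) Ec by auto
      ultimately have "?s x' = x'" using x'(2) by blast
      then have "h (\<sigma> x) = h x" using x inv by simp
      moreover have "\<sigma> x \<in> carrier L" using s(1) x(1) by (auto simp: ring_iso_def ring_hom_def)
      ultimately show ?thesis using inj x(1) by (metis inj_onD)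
    qed
    then have "x \<in> E" using fixd x(1) by blast
    then show "x' \<in> h ` E" using x by blast
  qed (use Ec in auto)
  ultimately show ?thesis using sf L' unfolding galois_extension_def by auto
qed

subsection \<open>The residue field at the generic point\<close>

abbreviation pencil :: "(3 \<Rightarrow> 'k::field fls) \<Rightarrow> 'k ^ 3 \<Rightarrow> 'k ^ 3 \<Rightarrow> 2 \<Rightarrow> 'k fls"
  where "pencil w l m \<equiv> \<lambda>i. if i = 1 then ev w (linear_form l) else ev w (linear_form m)"

text \<open>Evaluation at the generic point maps the local ring onto \<open>quot w\<close>, with
  kernel the ideal of the curve, so the first isomorphism theorem identifies the residue field. The
  pullback field becomes the field of quotients at the pair of linear forms.\<close>

lemma function_field_iso:
  fixes F :: "('k::field, 3) mpoly"
  assumes gen: "generic F w"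
  obtains \<Psi> where "\<Psi> \<in> ring_iso (function_field F) (subset_ring (quot w))"
    "\<And>l m. \<Psi> ` pullback_field F l m = quot (pencil w l m)"
    "field (function_field F)" "\<And>l m. pullback_field F l m \<subseteq> carrier (function_field F)"
proof -
  let ?R = "curve_local_ring F"
  have dvd: "F dvd A \<longleftrightarrow> ev w A = 0" if "homogeneous N A" for N A
    using gen that unfolding generic_def by blast
  have R: "?R = subset_ring {Fract A B | A B. (\<exists>n. homogeneous n A \<and> homogeneous n B) \<and> \<not> F dvd B}"
    (is "_ = subset_ring ?C") by (simp add: curve_local_ring_def subset_ring_def)
  have CI: "Fract A B \<in> ?C" if "homogeneous N A" "homogeneous N B" "\<not> F dvd B" for N A B
    using that by blast
  have cr: "cring ?R"
    unfolding R
  proof (rule cring_subset_ring)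
    have one: "\<not> F dvd 1" using dvd[of 0 1] by simp
    show "0 \<in> ?C" unfolding Zero_fract_def using one by (intro CI[of 0]) auto
    show "1 \<in> ?C" unfolding One_fract_def using one by (intro CI[of 0]) auto
    fix a b assume "a \<in> ?C" "b \<in> ?C"
    then obtain A B N C D M where AB: "homogeneous N A" "homogeneous N B" "\<not> F dvd B" "a = Fract A B"
      "homogeneous M C" "homogeneous M D" "\<not> F dvd D" "b = Fract C D" by blast
    have "B \<noteq> 0" "D \<noteq> 0" using AB by auto
    have BD: "\<not> F dvd B * D" using dvd[OF AB(2)] dvd[OF AB(6)] dvd[OF homogeneous_mult[OF AB(2,6)]] AB
      by (simp add: fls_hom.mp_eval_mult)
    show "a + b \<in> ?C"
      unfolding AB(4,8) add_fract[OF \<open>B \<noteq> 0\<close> \<open>D \<noteq> 0\<close>]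
      using homogeneous_mult[OF AB(5,2)] homogeneous_mult[OF AB(1,6)] homogeneous_mult[OF AB(2,6)] BD
      by (intro CI[of "N + M"] homogeneous_add) (auto simp: add.commute)
    show "a * b \<in> ?C"
      unfolding AB(4,8) mult_fract
      using homogeneous_mult[OF AB(1,5)] homogeneous_mult[OF AB(2,6)] BD by (intro CI[of "N + M"]) auto
    show "- a \<in> ?C"
      unfolding AB(4) minus_fract using AB by (intro CI[of N] homogeneous_uminus) auto
  qed
  define h where "h f = (SOME r. \<exists>A B N. homogeneous N A \<and> homogeneous N B \<and> \<not> F dvd B \<and> f = Fract A B \<and> r = ev w A / ev w B)" for f
  have h: "h (Fract A B) = ev w A / ev w B" if AB: "homogeneous N A" "homogeneous N B" "\<not> F dvd B" for N A B
    unfolding h_def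
  proof (rule some_equality)
    show "\<exists>A' B' N'. homogeneous N' A' \<and> homogeneous N' B' \<and> \<not> F dvd B' \<and> Fract A B = Fract A' B' \<and>
      ev w A / ev w B = ev w A' / ev w B'" using AB by blast
    fix r assume "\<exists>A' B' N'. homogeneous N' A' \<and> homogeneous N' B' \<and> \<not> F dvd B' \<and> Fract A B = Fract A' B' \<and> r = ev w A' / ev w B'"
    then obtain A' B' N' where *: "homogeneous N' B'" "\<not> F dvd B'" "Fract A B = Fract A' B'" "r = ev w A' / ev w B'" by blast
    have "B \<noteq> 0" "B' \<noteq> 0" using AB * by auto
    then have "A * B' = A' * B" using *(3) by (simp add: eq_fract)
    then have "ev w A * ev w B' = ev w A' * ev w B" by (metis fls_hom.mp_eval_mult)
    moreover have "ev w B \<noteq> 0" "ev w B' \<noteq> 0" using dvd[OF AB(2)] dvd[OF *(1)] AB * by auto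
    ultimately show "r = ev w A / ev w B" unfolding *(4) by (simp add: field_simps)
  qed
  let ?Q = "subset_ring (quot w)"
  have Q: "field ?Q" by (rule field_quot)
  have hom: "h \<in> ring_hom ?R ?Q"
  proof (rule ring_hom_memI)
    fix a assume "a \<in> carrier ?R"
    then obtain A B N where AB: "homogeneous N A" "homogeneous N B" "\<not> F dvd B" "a = Fract A B" unfolding R by auto
    show "h a \<in> carrier ?Q" unfolding AB(4) h[OF AB(1-3)]
      using quotI[OF AB(1,2)] dvd[OF AB(2)] AB(3) by simp
    fix b assume "b \<in> carrier ?R"
    then obtain C D M where CD: "homogeneous M C" "homogeneous M D" "\<not> F dvd D" "b = Fract C D" unfolding R by auto
    have "B \<noteq> 0" "D \<noteq> 0" using AB CD by auto
    have nz: "ev w B \<noteq> 0" "ev w D \<noteq> 0" using AB CD dvd by auto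
    have BD: "\<not> F dvd B * D" using dvd[OF homogeneous_mult[OF AB(2) CD(2)]] nz by (simp add: fls_hom.mp_eval_mult)
    have "h (a * b) = h a * h b"
      unfolding AB(4) CD(4) mult_fract h[OF AB(1-3)] h[OF CD(1-3)]
        h[OF homogeneous_mult[OF AB(1) CD(1)] homogeneous_mult[OF AB(2) CD(2)] BD]
      by (simp add: fls_hom.mp_eval_mult)
    then show "h (a \<otimes>\<^bsub>?R\<^esub> b) = h a \<otimes>\<^bsub>?Q\<^esub> h b" by (simp add: R)
    have "homogeneous (N + M) (A * D + C * B)"
      using homogeneous_mult[OF AB(1) CD(2)] homogeneous_mult[OF CD(1) AB(2)] by (auto intro: homogeneous_add simp: add.commute)
    then have "h (a + b) = h a + h b"
      unfolding AB(4) CD(4) add_fract[OF \<open>B \<noteq> 0\<close> \<open>D \<noteq> 0\<close>] h[OF AB(1-3)] h[OF CD(1-3)]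
      using h[of "N + M" "A * D + C * B" "B * D"] homogeneous_mult[OF AB(2) CD(2)] BD nz
      by (simp add: fls_hom.mp_eval_mult fls_hom.mp_eval_add field_simps)
    then show "h (a \<oplus>\<^bsub>?R\<^esub> b) = h a \<oplus>\<^bsub>?Q\<^esub> h b" by (simp add: R)
  next
    have "h 1 = 1" unfolding One_fract_def using h[of 0 1 1] dvd[of 0 1] by simp
    then show "h \<one>\<^bsub>?R\<^esub> = \<one>\<^bsub>?Q\<^esub>" by (simp add: R)
  qed
  interpret R: cring ?R by fact
  interpret Q: field ?Q by fact
  interpret h: ring_hom_ring ?R ?Q h by (intro ring_hom_ringI2 R.ring_axioms Q.ring_axioms hom)
  have img: "h ` carrier ?R = carrier ?Q"
  proof (intro equalityI subsetI)
    fix y assume "y \<in> carrier ?Q"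
    then obtain A B N where AB: "homogeneous N A" "homogeneous N B" "ev w B \<noteq> 0" "y = ev w A / ev w B"
      by (auto elim: quotE)
    have B: "\<not> F dvd B" using dvd AB by auto
    have "Fract A B \<in> carrier ?R" unfolding R using CI[OF AB(1,2) B] by simp
    then show "y \<in> h ` carrier ?R" using h[OF AB(1,2) B] AB(4) by (metis image_eqI)
  next
    fix y assume "y \<in> h ` carrier ?R"
    then obtain x where "x \<in> carrier ?R" "y = h x" by (rule imageE)
    then show "y \<in> carrier ?Q" using ring_hom_memE(1)[OF hom] by simp
  qed
  have ker: "a_kernel ?R ?Q h = curve_ideal F"
  proof (intro equalityI subsetI)
    fix a assume "a \<in> a_kernel ?R ?Q h"
    then have a: "a \<in> carrier ?R" "h a = 0" unfolding a_kernel_def' subset_ring_simps by blast+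
    then obtain A B N where AB: "homogeneous N A" "homogeneous N B" "\<not> F dvd B" "a = Fract A B"
      unfolding R subset_ring_simps by blast
    have "ev w A = 0" using a(2) h[OF AB(1-3)] AB dvd by auto
    then have "F dvd A" using dvd[OF AB(1)] by simp
    then show "a \<in> curve_ideal F" unfolding curve_ideal_def using AB by blast
  next
    fix a assume "a \<in> curve_ideal F"
    then obtain A B N where AB: "homogeneous N A" "homogeneous N B" "\<not> F dvd B" "F dvd A" "a = Fract A B"
      unfolding curve_ideal_def by blast
    have "h a = 0" using h[OF AB(1-3)] dvd[OF AB(1)] AB by simp
    moreover have "a \<in> carrier ?R" unfolding R AB(5) using CI[OF AB(1-3)] by simp
    ultimately show "a \<in> a_kernel ?R ?Q h" unfolding a_kernel_def' subset_ring_simps by blast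
  qed
  let ?P = "\<lambda>Y. the_elem (h ` Y)"
  have iso: "?P \<in> ring_iso (function_field F) ?Q"
    using h.FactRing_iso_set[OF img] unfolding ker function_field_def .
  have ideal: "ideal (curve_ideal F) ?R" using h.kernel_is_ideal unfolding ker .
  have FR: "ring (function_field F)"
    unfolding function_field_def by (rule ideal.quotient_is_ring[OF ideal])
  interpret FF: ring "function_field F" by (rule FR)
  have inviso: "inv_into (carrier (function_field F)) ?P \<in> ring_iso ?Q (function_field F)"
    by (rule ring_iso_set_sym[OF FF.ring_axioms iso])
  then interpret I: ring_hom_ring ?Q "function_field F" "inv_into (carrier (function_field F)) ?P"
    by (intro ring_hom_ringI2 FR Q.ring_axioms) (simp add: ring_iso_def)
  \<comment> \<open>The field property of the residue ring is carried back along the isomorphism;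
    maximality of the ideal is a consequence of it.\<close>
  have FFf: "field (function_field F)"
    using Q.ring_iso_imp_img_field[OF inviso] I.hom_zero by simp
  have rc: "restrict_to_curve F f \<in> carrier (function_field F)" if "f \<in> carrier ?R" for f
    using ring_hom_memE(1)[OF ideal.rcos_ring_hom[OF ideal] that] unfolding restrict_to_curve_def function_field_def .
  have restrict: "?P (restrict_to_curve F (Fract A B)) = ev w A / ev w B"
    if AB: "homogeneous N A" "homogeneous N B" "\<not> F dvd B" for N A B
    using h.the_elem_simp[of "Fract A B"] CI[OF AB] h[OF AB] unfolding ker restrict_to_curve_def by (simp add: R)
  have pb: "?P ` pullback_field F l m = quot (pencil w l m)" for l m
  proof -
    let ?q = "\<lambda>i::2. if i = 1 then linear_form l else linear_form m"
    let ?pull = "mp_subst ?q"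
    have evp: "ev w (?pull A) = ev (pencil w l m) A" for A
      unfolding fls_hom.mp_eval_subst by (simp add: if_distrib cong: if_cong)
    have hp: "homogeneous N (?pull A)" if "homogeneous N A" for N A
      using that by (intro homogeneous_subst) auto
    have pf: "pullback_field F l m = {restrict_to_curve F (Fract (?pull A) (?pull B)) | A B.
        (\<exists>n. homogeneous n A \<and> homogeneous n B) \<and> \<not> F dvd ?pull B}"
      by (simp add: pullback_field_def Let_def)
    show ?thesis
    proof (intro equalityI subsetI)
      fix y assume "y \<in> ?P ` pullback_field F l m"
      then obtain A B N where AB: "homogeneous N A" "homogeneous N B" "\<not> F dvd ?pull B"
        "y = ?P (restrict_to_curve F (Fract (?pull A) (?pull B)))" unfolding pf by auto
      have "y = ev (pencil w l m) A / ev (pencil w l m) B"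
        unfolding AB(4) restrict[OF hp[OF AB(1)] hp[OF AB(2)] AB(3)] evp ..
      moreover have "ev (pencil w l m) B \<noteq> 0" using dvd[OF hp[OF AB(2)]] AB(3) by (simp add: evp)
      ultimately show "y \<in> quot (pencil w l m)" using quotI[OF AB(1,2)] by simp
    next
      fix y assume "y \<in> quot (pencil w l m)"
      then obtain A B N where AB: "homogeneous N A" "homogeneous N B" "ev (pencil w l m) B \<noteq> 0"
        "y = ev (pencil w l m) A / ev (pencil w l m) B" by (elim quotE)
      have B: "\<not> F dvd ?pull B" using dvd[OF hp[OF AB(2)]] AB(3) by (simp add: evp)
      have "y = ?P (restrict_to_curve F (Fract (?pull A) (?pull B)))"
        unfolding AB(4) restrict[OF hp[OF AB(1)] hp[OF AB(2)] B] evp ..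
      then show "y \<in> ?P ` pullback_field F l m" unfolding pf using AB B by blast
    qed
  qed
  have "pullback_field F l m \<subseteq> carrier (function_field F)" for l m
  proof
    let ?pull = "mp_subst (\<lambda>i::2. if i = 1 then linear_form l else linear_form m)"
    fix y assume "y \<in> pullback_field F l m"
    then obtain A B N where AB: "homogeneous N A" "homogeneous N B" "\<not> F dvd ?pull B"
      "y = restrict_to_curve F (Fract (?pull A) (?pull B))" unfolding pullback_field_def Let_def by auto
    have "homogeneous N (?pull A)" "homogeneous N (?pull B)" using AB(1,2) by (auto intro: homogeneous_subst)
    then have "Fract (?pull A) (?pull B) \<in> carrier ?R" unfolding R using CI AB(3) by simp
    then show "y \<in> carrier (function_field F)" unfolding AB(4) by (rule rc)
  qed
  then show ?thesis by (rule that[OF iso pb FFf])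
qed

lemma function_field_galois_iff:
  fixes F :: "('k::field, 3) mpoly"
  assumes gen: "generic F w"
  shows "galois_extension (function_field F) (pullback_field F l m) \<longleftrightarrow>
    galois_extension (subset_ring (quot w)) (quot (pencil w l m))"
proof -
  obtain \<Psi> where P: "\<Psi> \<in> ring_iso (function_field F) (subset_ring (quot w))"
    "\<And>l m. \<Psi> ` pullback_field F l m = quot (pencil w l m)"
    "field (function_field F)" "\<And>l m. pullback_field F l m \<subseteq> carrier (function_field F)"
    by (rule function_field_iso[OF gen]) blast
  show ?thesis
  proof
    assume "galois_extension (function_field F) (pullback_field F l m)"
    then have "galois_extension (subset_ring (quot w)) (\<Psi> ` pullback_field F l m)"
      by (rule galois_transport[OF P(1) field_quot])
    then show "galois_extension (subset_ring (quot w)) (quot (pencil w l m))" by (simp only: P(2))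
  next
    assume g: "galois_extension (subset_ring (quot w)) (quot (pencil w l m))"
    interpret FF: field "function_field F" by (rule P(3))
    let ?I = "inv_into (carrier (function_field F)) \<Psi>"
    have inj: "inj_on \<Psi> (carrier (function_field F))" using P(1) by (simp add: ring_iso_def bij_betw_def)
    have "galois_extension (function_field F) (?I ` quot (pencil w l m))"
      by (rule galois_transport[OF ring_iso_set_sym[OF FF.ring_axioms P(1)] P(3) g])
    moreover have "?I ` quot (pencil w l m) = pullback_field F l m"
      unfolding P(2)[symmetric] using inj P(4) by (rule inv_into_image_cancel)
    ultimately show "galois_extension (function_field F) (pullback_field F l m)" by simp
  qed
qed

section \<open>Generic points\<close>

definition mact :: "'k::field ^ 3 ^ 3 \<Rightarrow> (3 \<Rightarrow> 'k fls) \<Rightarrow> 3 \<Rightarrow> 'k fls"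
  where "mact M w = (\<lambda>i. \<Sum>j\<in>UNIV. fls_const (M $ i $ j) * w j)"

lemma ev_mact: "ev (mact M w) A = ev w (transform_form M A)"
  unfolding mp_eval_transform[OF fls_hom.coef_hom_axioms] mact_def ..

lemma transform_matrix_inv:
  fixes A :: "('k::field_char_0, 3) mpoly"
  assumes "invertible M"
  shows "transform_form (matrix_inv M) (transform_form M A) = A" "transform_form M (transform_form (matrix_inv M) A) = A"
  by (simp_all flip: transform_matrix_mult add: matrix_inv_left[OF assms] matrix_inv_right[OF assms])

lemma generic_mact:
  fixes F :: "('k::field_char_0, 3) mpoly"
  assumes gen: "generic G w" and M: "invertible M" and c: "c \<noteq> 0" and F: "transform_form M F = mp_const c * G"
  shows "generic F (mact M w)"
  unfolding generic_def
proof (intro allI impI)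
  fix N and A :: "('k, 3) mpoly" assume A: "homogeneous N A"
  have cc: "mp_const c * mp_const (inverse c) = (1 :: ('k, 3) mpoly)"
    using c mp_const_hom.mult[of c "inverse c", symmetric] by simp
  have "F dvd A \<longleftrightarrow> G dvd transform_form M A"
  proof
    assume "F dvd A"
    then have "mp_const c * G dvd transform_form M A" unfolding F[symmetric] by (rule transform_dvd)
    then show "G dvd transform_form M A" by (rule dvd_mult_right)
  next
    assume "G dvd transform_form M A"
    then obtain q where "transform_form M A = G * q" by (auto simp: dvd_def)
    also have "\<dots> = (mp_const c * mp_const (inverse c)) * (G * q)" by (simp add: cc)
    also have "\<dots> = transform_form M F * (mp_const (inverse c) * q)" unfolding F by (simp only: mult_ac)
    finally have "transform_form M F dvd transform_form M A" by (rule dvdI)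
    then have "transform_form (matrix_inv M) (transform_form M F) dvd transform_form (matrix_inv M) (transform_form M A)"
      by (rule transform_dvd)
    then show "F dvd A" unfolding transform_matrix_inv[OF M] .
  qed
  also have "\<dots> \<longleftrightarrow> ev (mact M w) A = 0"
    using gen homogeneous_transform[OF A, of M] unfolding generic_def ev_mact by blast
  finally show "F dvd A \<longleftrightarrow> ev (mact M w) A = 0" .
qed

lemma quot_mact_subset: "quot (mact M w) \<subseteq> quot w"
proof
  fix f assume "f \<in> quot (mact M w)"
  then obtain A B N where AB: "homogeneous N A" "homogeneous N B" "ev (mact M w) B \<noteq> 0" "f = ev (mact M w) A / ev (mact M w) B"
    by (elim quotE)
  then show "f \<in> quot w" unfolding ev_mact
    using quotI[OF homogeneous_transform homogeneous_transform] by blast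
qed

lemma mact_matrix_inv:
  assumes "invertible M"
  shows "mact (matrix_inv M) (mact M w) = w"
proof
  fix i
  have "mact (matrix_inv M) (mact M w) i = (\<Sum>k\<in>UNIV. fls_const ((matrix_inv M ** M) $ i $ k) * w k)"
    unfolding mact_def matrix_matrix_mult_def
    by (simp add: sum_3 fls_hom.add fls_hom.mult algebra_simps del: fls_plus_const fls_const_mult_const)
  also have "\<dots> = (\<Sum>k\<in>UNIV. (if k = i then w i else 0))"
    unfolding matrix_inv_left[OF assms] by (intro sum.cong) (auto simp: mat_def)
  finally show "mact (matrix_inv M) (mact M w) i = w i" by simp
qed

lemma quot_mact:
  assumes "invertible M"
  shows "quot (mact M w) = quot w"
  using quot_mact_subset[of M w] quot_mact_subset[of "matrix_inv M" "mact M w"] mact_matrix_inv[OF assms] by auto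

lemma pencil_mact: "pencil (mact M w) l m = pencil w (transpose M *v l) (transpose M *v m)"
proof -
  have "ev (mact M w) (linear_form l) = ev w (linear_form (transpose M *v l))" for l
    unfolding fls_hom.mp_eval_linear_form mact_def
    by (simp add: sum_3 matrix_vector_mult_def transpose_def fls_hom.add fls_hom.mult algebra_simps del: fls_plus_const fls_const_mult_const)
  then show ?thesis by (simp only:)
qed

lemma mp_value_linear_form: "mp_value (linear_form l) v = (\<Sum>i\<in>UNIV. l $ i * v $ i)"
  by (simp add: mp_value_def id_hom.mp_eval_linear_form)

definition zeros :: "'k::field ^ 3 \<Rightarrow> 'k ^ 3 \<Rightarrow> ('k ^ 3) set"
  where "zeros l m = {v. v \<noteq> 0 \<and> mp_value (linear_form l) v = 0 \<and> mp_value (linear_form m) v = 0}"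

abbreviation pencil_galois :: "(3 \<Rightarrow> 'k::field fls) \<Rightarrow> 'k ^ 3 \<Rightarrow> 'k ^ 3 \<Rightarrow> bool"
  where "pencil_galois w l m \<equiv> galois_extension (subset_ring (quot w)) (quot (pencil w l m))"

lemma galois_point_iff:
  assumes "generic F w"
  shows "galois_point F P \<longleftrightarrow> P \<in> proj_plane \<and> (\<exists>l m. P = zeros l m \<and> pencil_galois w l m)"
  unfolding galois_point_def zeros_def function_field_galois_iff[OF assms] ..

lemma linear_form_transpose:
  fixes l v :: "'k::field ^ 3" and M :: "'k ^ 3 ^ 3"
  shows "mp_value (linear_form (transpose M *v l)) v = mp_value (linear_form l) (M *v v)"
  unfolding mp_value_linear_form by (simp add: sum_3 matrix_vector_mult_def transpose_def algebra_simps)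

lemma zeros_transpose:
  assumes "invertible M"
  shows "zeros (transpose M *v l) (transpose M *v m) = {v. M *v v \<in> zeros l m}"
  unfolding zeros_def linear_form_transpose using invertible_ker[OF assms] by auto

definition point :: "'k::field ^ 3 \<Rightarrow> ('k ^ 3) set"
  where "point v = {c *s v | c. c \<noteq> 0}"

lemma proj_plane_iff: "P \<in> proj_plane \<longleftrightarrow> (\<exists>v. v \<noteq> 0 \<and> P = point v)"
  unfolding proj_plane_def point_def by blast

lemma point_preimage:
  assumes "invertible M"
  shows "{v. M *v v \<in> point x} = point (matrix_inv M *v x)"
proof (intro equalityI subsetI)
  fix v assume "v \<in> {v. M *v v \<in> point x}"
  then obtain c where c: "c \<noteq> 0" "M *v v = c *s x" by (auto simp: point_def)
  then have "v = c *s (matrix_inv M *v x)"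
    using matrix_inv_vector_left[OF assms, of v] by (simp add: vec.scale)
  with c show "v \<in> point (matrix_inv M *v x)" by (auto simp: point_def)
next
  fix v assume "v \<in> point (matrix_inv M *v x)"
  then obtain c where "c \<noteq> 0" "v = c *s (matrix_inv M *v x)" by (auto simp: point_def)
  then show "v \<in> {v. M *v v \<in> point x}"
    by (auto simp: point_def vec.scale matrix_inv_vector_right[OF assms])
qed

lemma point_nonzero: "x \<noteq> 0 \<Longrightarrow> invertible M \<Longrightarrow> matrix_inv M *v x \<noteq> 0"
  using matrix_inv_vector_right[of M x] by auto

lemma point_self: "v \<in> point v"
  unfolding point_def by (auto intro: exI[of _ 1])

lemma point_eq_iff: "point v = point w \<longleftrightarrow> (\<exists>c. c \<noteq> 0 \<and> v = c *s w)"
proof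
  assume "point v = point w"
  then have "v \<in> point w" using point_self[of v] by simp
  then show "\<exists>c. c \<noteq> 0 \<and> v = c *s w" by (auto simp: point_def)
next
  assume "\<exists>c. c \<noteq> 0 \<and> v = c *s w"
  then obtain c where c: "c \<noteq> 0" "v = c *s w" by blast
  show "point v = point w"
  proof (intro equalityI subsetI)
    fix x assume "x \<in> point v"
    then obtain b where "b \<noteq> 0" "x = b *s v" by (auto simp: point_def)
    then have "x = (b * c) *s w" "b * c \<noteq> 0" using c by (simp_all add: vector_smult_assoc)
    then show "x \<in> point w" unfolding point_def by blast
  next
    fix x assume "x \<in> point w"
    then obtain b where "b \<noteq> 0" "x = b *s w" by (auto simp: point_def)
    then have "x = (b / c) *s v" "b / c \<noteq> 0" using c by (simp_all add: vector_smult_assoc)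
    then show "x \<in> point v" unfolding point_def by blast
  qed
qed

lemma galois_point_preimage:
  assumes gen: "generic F w" and gen': "generic G (mact M w)" and M: "invertible M" and P: "galois_point G P"
  shows "galois_point F {v. M *v v \<in> P}"
proof -
  obtain l m where lm: "P \<in> proj_plane" "P = zeros l m" "pencil_galois (mact M w) l m"
    using P unfolding galois_point_iff[OF gen'] by blast
  have "pencil_galois w (transpose M *v l) (transpose M *v m)"
    using lm(3) unfolding quot_mact[OF M] pencil_mact .
  moreover have "{v. M *v v \<in> P} = zeros (transpose M *v l) (transpose M *v m)"
    unfolding lm(2) zeros_transpose[OF M] ..
  moreover have "{v. M *v v \<in> P} \<in> proj_plane"
    using lm(1) point_preimage[OF M] point_nonzero[OF _ M] unfolding proj_plane_iff by metis
  ultimately show ?thesis unfolding galois_point_iff[OF gen] by blast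
qed

section \<open>The generic point of the normal form\<close>

context superelliptic
begin

text \<open>Forms are reduced in the first variable, in contrast to \<open>val\<close>, which
  reduces in the third. The normal form has leading coefficient -1 in \<open>mp_var 1\<close>,
  whereas its coefficient at \<open>mp_var 3 ^ n\<close> is \<open>mp_var 2\<close>, which cannot be
  divided out within forms.\<close>

definition reduced :: "nat \<Rightarrow> ('k, 3) mpoly \<Rightarrow> bool"
  where "reduced N R \<longleftrightarrow> homogeneous N R \<and> (\<forall>m\<in>Poly_Mapping.keys R. Poly_Mapping.lookup m 1 \<le> n)"

lemma reduced_0: "reduced N 0"
  by (simp add: reduced_def)

lemma reduced_add: "reduced N p \<Longrightarrow> reduced N q \<Longrightarrow> reduced N (p + q)"
  unfolding reduced_def using Poly_Mapping.keys_add[of p q] by (auto intro: homogeneous_add)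

lemma reduced_sum: "(\<And>a. a \<in> A \<Longrightarrow> reduced N (f a)) \<Longrightarrow> reduced N (\<Sum>a\<in>A. f a)"
  by (induction A rule: infinite_finite_induct) (auto intro: reduced_add reduced_0)

lemma reduced_const_mult: "reduced N p \<Longrightarrow> reduced N (mp_const c * p)"
proof -
  assume r: "reduced N p"
  have "Poly_Mapping.keys (mp_const c * p) \<subseteq> Poly_Mapping.keys p"
    using Poly_Mapping.keys_mult[of "mp_const c" p] by (auto simp: mp_const_def split: if_splits)
  with r show ?thesis unfolding reduced_def by (auto intro: homogeneous_const_mult)
qed

abbreviation NF :: "('k, 3) mpoly" where "NF \<equiv> normal_form n g"

lemma monomial_single:
  "mp_var 1 ^ a * mp_var 2 ^ b * mp_var 3 ^ c =
    (Poly_Mapping.single (Poly_Mapping.single 1 a + Poly_Mapping.single 2 b + Poly_Mapping.single 3 c) 1 :: ('k, 3) mpoly)"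
  unfolding single_eq_const_mult_vars prod_3
  by (simp add: lookup_add lookup_single mp_const_def)

text \<open>One division step trades x^(n+1) for y z^n and terms with smaller powers of x, all of
  the same total degree.\<close>

lemma reduce_monomial:
  "\<exists>Q R. mp_var 1 ^ a * mp_var 2 ^ b * mp_var 3 ^ c = Q * NF + R \<and> reduced (a + b + c) R"
proof (induction a arbitrary: b c rule: less_induct)
  case (less a)
  let ?x = "mp_var 1 :: ('k, 3) mpoly" and ?y = "mp_var 2 :: ('k, 3) mpoly" and ?z = "mp_var 3 :: ('k, 3) mpoly"
  show ?case
  proof (cases "a \<le> n")
    case True
    have "reduced (a + b + c) (?x ^ a * ?y ^ b * ?z ^ c)"
      unfolding reduced_def monomial_single using True
      by (auto intro!: homogeneous_single simp: sum_3 lookup_add lookup_single)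
    then show ?thesis by (intro exI[of _ 0] exI[of _ "?x ^ a * ?y ^ b * ?z ^ c"]) simp
  next
    case False
    then obtain a' where a: "a = a' + Suc n" by (metis add.commute not_less_eq_eq le_Suc_ex)
    have "\<exists>Q R. ?x ^ a' * ?y ^ Suc b * ?z ^ (c + n) = Q * NF + R \<and> reduced (a' + Suc b + (c + n)) R"
      using a by (intro less.IH) simp
    then obtain Q0 R0 where 0: "?x ^ a' * ?y ^ Suc b * ?z ^ (c + n) = Q0 * NF + R0" "reduced (a + b + c) R0"
      unfolding a by (auto simp: ac_simps)
    have H: "\<exists>Q R. ?x ^ (a' + k) * ?y ^ (b + (Suc n - k)) * ?z ^ c = Q * NF + R \<and> reduced (a' + k + (b + (Suc n - k)) + c) R"
      if "k \<le> n" for k using that a by (intro less.IH) simp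
    have "\<forall>k. \<exists>Q R. k \<le> n \<longrightarrow> ?x ^ (a' + k) * ?y ^ (b + (Suc n - k)) * ?z ^ c = Q * NF + R \<and> reduced (a + b + c) R"
    proof (intro allI)
      fix k
      show "\<exists>Q R. k \<le> n \<longrightarrow> ?x ^ (a' + k) * ?y ^ (b + (Suc n - k)) * ?z ^ c = Q * NF + R \<and> reduced (a + b + c) R"
      proof (cases "k \<le> n")
        case True
        then have e: "a' + k + (b + (Suc n - k)) + c = a + b + c" unfolding a by simp
        show ?thesis using H[OF True] unfolding e by blast
      qed simp
    qed
    then obtain Q R where QR: "\<And>k. k \<le> n \<Longrightarrow> ?x ^ (a' + k) * ?y ^ (b + (Suc n - k)) * ?z ^ c = Q k * NF + R k"
      "\<And>k. k \<le> n \<Longrightarrow> reduced (a + b + c) (R k)" by metis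
    let ?g = "\<lambda>k. mp_const (Polynomial.coeff g k) :: ('k, 3) mpoly"
    have "mp_const 1 = (1 :: ('k, 3) mpoly)" by simp
    then have NF: "?x ^ Suc n = ?z ^ n * ?y - (\<Sum>k\<le>n. ?g k * ?x ^ k * ?y ^ (Suc n - k)) - NF"
      unfolding normal_form_def sum.atMost_Suc monic by simp
    have "?x ^ a * ?y ^ b * ?z ^ c = ?x ^ a' * ?y ^ b * ?z ^ c * ?x ^ Suc n"
      unfolding a power_add by (simp only: mult_ac)
    also have "\<dots> = ?x ^ a' * ?y ^ Suc b * ?z ^ (c + n) -
       (\<Sum>k\<le>n. ?g k * (?x ^ (a' + k) * ?y ^ (b + (Suc n - k)) * ?z ^ c)) - ?x ^ a' * ?y ^ b * ?z ^ c * NF"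
    proof -
      have 1: "?x ^ a' * ?y ^ b * ?z ^ c * (?z ^ n * ?y) = ?x ^ a' * ?y ^ Suc b * ?z ^ (c + n)"
        by (simp only: power_add power_Suc mult_ac)
      have 2: "?x ^ a' * ?y ^ b * ?z ^ c * (\<Sum>k\<le>n. ?g k * ?x ^ k * ?y ^ (Suc n - k)) =
        (\<Sum>k\<le>n. ?g k * (?x ^ (a' + k) * ?y ^ (b + (Suc n - k)) * ?z ^ c))"
        unfolding sum_distrib_left by (intro sum.cong refl) (simp only: power_add mult_ac)
      show ?thesis by (subst NF) (simp only: right_diff_distrib 1 2)
    qed
    also have "(\<Sum>k\<le>n. ?g k * (?x ^ (a' + k) * ?y ^ (b + (Suc n - k)) * ?z ^ c)) = (\<Sum>k\<le>n. ?g k * (Q k * NF + R k))"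
      using QR(1) by (intro sum.cong) auto
    also have "\<dots> = (\<Sum>k\<le>n. ?g k * Q k) * NF + (\<Sum>k\<le>n. ?g k * R k)"
      by (simp only: sum_distrib_right sum.distrib distrib_left mult.assoc)
    also have "?x ^ a' * ?y ^ Suc b * ?z ^ (c + n) - ((\<Sum>k\<le>n. ?g k * Q k) * NF + (\<Sum>k\<le>n. ?g k * R k)) - ?x ^ a' * ?y ^ b * ?z ^ c * NF
      = (Q0 - (\<Sum>k\<le>n. ?g k * Q k) - ?x ^ a' * ?y ^ b * ?z ^ c) * NF + (R0 + (\<Sum>k\<le>n. mp_const (- 1) * (?g k * R k)))"
    proof -
      have m1: "mp_const (- 1) = (- 1 :: ('k, 3) mpoly)" using mp_const_hom.uminus[of 1] by simp
      show ?thesis unfolding 0(1) m1 by (simp add: algebra_simps sum_negf)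
    qed
    finally have "?x ^ a * ?y ^ b * ?z ^ c = (Q0 - (\<Sum>k\<le>n. ?g k * Q k) - ?x ^ a' * ?y ^ b * ?z ^ c) * NF +
      (R0 + (\<Sum>k\<le>n. mp_const (- 1) * (?g k * R k)))" .
    moreover have "reduced (a + b + c) (R0 + (\<Sum>k\<le>n. mp_const (- 1) * (?g k * R k)))"
      using 0(2) QR(2) by (intro reduced_add reduced_sum reduced_const_mult) auto
    ultimately show ?thesis by blast
  qed
qed

lemma reduce:
  assumes "homogeneous N A"
  shows "\<exists>Q R. A = Q * NF + R \<and> reduced N R"
proof -
  let ?l = "Poly_Mapping.lookup :: (3 \<Rightarrow>\<^sub>0 nat) \<Rightarrow> _"
  have "\<forall>m. \<exists>Q R. m \<in> Poly_Mapping.keys A \<longrightarrow>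
     mp_var 1 ^ ?l m 1 * mp_var 2 ^ ?l m 2 * mp_var 3 ^ ?l m 3 = Q * NF + R \<and> reduced N R"
    using reduce_monomial degree_eq_3[OF assms] by metis
  then obtain Q R where QR: "\<And>m. m \<in> Poly_Mapping.keys A \<Longrightarrow>
     mp_var 1 ^ ?l m 1 * mp_var 2 ^ ?l m 2 * mp_var 3 ^ ?l m 3 = Q m * NF + R m"
     "\<And>m. m \<in> Poly_Mapping.keys A \<Longrightarrow> reduced N (R m)" by metis
  have "A = (\<Sum>m\<in>Poly_Mapping.keys A. mp_const (Poly_Mapping.lookup A m) * (Q m * NF + R m))"
  proof -
    have "A = (\<Sum>m\<in>Poly_Mapping.keys A. Poly_Mapping.single m (Poly_Mapping.lookup A m))" by (rule sum_monomials[symmetric])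
    also have "\<dots> = (\<Sum>m\<in>Poly_Mapping.keys A. mp_const (Poly_Mapping.lookup A m) * (Q m * NF + R m))"
      unfolding single_eq_const_mult_vars prod_3 using QR(1) by (intro sum.cong) auto
    finally show ?thesis .
  qed
  also have "\<dots> = (\<Sum>m\<in>Poly_Mapping.keys A. mp_const (Poly_Mapping.lookup A m) * Q m) * NF +
     (\<Sum>m\<in>Poly_Mapping.keys A. mp_const (Poly_Mapping.lookup A m) * R m)"
    by (simp only: sum_distrib_right sum.distrib distrib_left mult.assoc)
  finally have A: "A = (\<Sum>m\<in>Poly_Mapping.keys A. mp_const (Poly_Mapping.lookup A m) * Q m) * NF +
     (\<Sum>m\<in>Poly_Mapping.keys A. mp_const (Poly_Mapping.lookup A m) * R m)" .
  have "reduced N (\<Sum>m\<in>Poly_Mapping.keys A. mp_const (Poly_Mapping.lookup A m) * R m)"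
    using QR(2) by (intro reduced_sum reduced_const_mult)
  with A show ?thesis by blast
qed

text \<open>Together with the fixed total degree, the order at infinity tells reduced monomials
  apart, so their values cannot cancel.\<close>

lemma ev_reduced_nonzero:
  assumes "reduced N R" "R \<noteq> 0"
  shows "ev (pt X0 Z0) R \<noteq> 0"
proof -
  let ?l = "Poly_Mapping.lookup :: (3 \<Rightarrow>\<^sub>0 nat) \<Rightarrow> _"
  let ?f = "\<lambda>m. fls_const (Poly_Mapping.lookup R m) * (X0 ^ ?l m 1 * Z0 ^ ?l m 3)"
  have E: "ev (pt X0 Z0) R = (\<Sum>m\<in>Poly_Mapping.keys R. ?f m)"
    unfolding mp_eval_def prod_3 by simp
  have X0nz: "X0 \<noteq> 0" using subdegree_X0 n0 by auto
  have sub: "fls_subdegree (?f m) = - int (n * ?l m 1 + Suc n * ?l m 3)" "?f m \<noteq> 0" if "m \<in> Poly_Mapping.keys R" for m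
    using that X0nz Z0_nonzero by (auto simp: fls_subdegree_pow subdegree_X0 subdegree_Z0 in_keys_iff algebra_simps)
  have "inj_on (\<lambda>m. fls_subdegree (?f m)) (Poly_Mapping.keys R)"
  proof (rule inj_onI)
    fix m m' assume m: "m \<in> Poly_Mapping.keys R" "m' \<in> Poly_Mapping.keys R" and "fls_subdegree (?f m) = fls_subdegree (?f m')"
    then have eq: "n * ?l m 1 + Suc n * ?l m 3 = n * ?l m' 1 + Suc n * ?l m' 3" using sub by (simp only: neg_equal_iff_equal of_nat_eq_iff)
    have le: "?l m 1 \<le> n" "?l m' 1 \<le> n" using assms(1) m by (auto simp: reduced_def)
    \<comment> \<open>Modulo n + 1 the order n a + (n + 1) c determines a, because a \<le> n. The
      equation is rearranged so that no subtraction of naturals occurs.\<close>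
    have "Suc n * (?l m 1 + ?l m 3) + ?l m' 1 = Suc n * (?l m' 1 + ?l m' 3) + ?l m 1" using eq by (simp add: algebra_simps)
    then have "(Suc n * (?l m 1 + ?l m 3) + ?l m' 1) mod Suc n = (Suc n * (?l m' 1 + ?l m' 3) + ?l m 1) mod Suc n" by (rule arg_cong)
    then have 1: "?l m 1 = ?l m' 1" using le by (simp only: mod_mult_self4 mod_less less_Suc_eq_le)
    have "Suc n * ?l m 3 = Suc n * ?l m' 3" using eq unfolding 1 by (simp only: add_left_cancel)
    then have 3: "?l m 3 = ?l m' 3" using nat_mult_eq_cancel1[of "Suc n"] by blast
    have "?l m 1 + ?l m 2 + ?l m 3 = ?l m' 1 + ?l m' 2 + ?l m' 3"
      using degree_eq_3[of N R] assms(1) m unfolding reduced_def by metis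
    then show "m = m'" using 1 3 by (intro exponent_3_eqI) auto
  qed
  then show ?thesis unfolding E using sub(2) assms(2) by (intro fls_sum_distinct_subdegrees(1)) auto
qed

lemma generic_normal_form: "generic NF (pt X0 Z0)"
  unfolding generic_def
proof (intro allI impI iffI)
  fix N A assume A: "homogeneous N (A :: ('k, 3) mpoly)"
  have NF0: "ev (pt X0 Z0) NF = 0" using curve_generic ev_normal_form by blast
  show "ev (pt X0 Z0) A = 0" if "NF dvd A"
    using that NF0 by (auto simp: dvd_def fls_hom.mp_eval_mult)
  obtain Q R where QR: "A = Q * NF + R" "reduced N R" using reduce[OF A] by blast
  show "NF dvd A" if "ev (pt X0 Z0) A = 0"
  proof -
    have "ev (pt X0 Z0) R = 0" using that NF0 unfolding QR(1) by (simp add: fls_hom.mp_eval_add fls_hom.mp_eval_mult)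
    then have "R = 0" using ev_reduced_nonzero[OF QR(2)] by blast
    then show ?thesis using QR(1) by simp
  qed
qed

end

section \<open>Places, conjugation over a projection, and the exclusion of affine points\<close>

section \<open>Places of the curve\<close>

abbreviation reg :: "'k::field fls \<Rightarrow> bool" where "reg f \<equiv> 0 \<le> fls_subdegree f"

lemma regE:
  assumes "reg f"
  obtains a where "f = fps_to_fls a"
  using fls_regpart_to_fls_trivial[OF assms] that by metis

lemma reg_fps [simp]: "reg (fps_to_fls a)"
  by (rule fls_subdegree_fls_to_fps_gt0)

lemma reg_add: "reg f \<Longrightarrow> reg h \<Longrightarrow> reg (f + h)"
  by (elim regE) (simp flip: fps_to_fls_plus)

lemma reg_diff: "reg f \<Longrightarrow> reg h \<Longrightarrow> reg (f - h)"
  by (elim regE) (simp flip: fps_to_fls_minus)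

lemma reg_mult: "reg f \<Longrightarrow> reg h \<Longrightarrow> reg (f * h)"
  by (elim regE) (simp flip: fls_times_fps_to_fls)

lemma reg_power: "reg f \<Longrightarrow> reg (f ^ k)"
  by (induction k) (auto intro: reg_mult)

lemma reg_pev: "reg f \<Longrightarrow> reg (pev p f)"
  by (induction p) (auto simp: pev_pCons intro: reg_add reg_mult)

lemma reg_inverse: "f $$ 0 \<noteq> 0 \<Longrightarrow> reg f \<Longrightarrow> reg (inverse f)"
  using fls_subdegree_leI[of f 0] by (cases "f = 0") auto

lemma reg_divide: "reg f \<Longrightarrow> h $$ 0 \<noteq> 0 \<Longrightarrow> reg h \<Longrightarrow> reg (f / h)"
  unfolding divide_inverse by (intro reg_mult reg_inverse)

lemma nth0_mult: "reg f \<Longrightarrow> reg h \<Longrightarrow> (f * h) $$ 0 = f $$ 0 * h $$ 0"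
  by (elim regE) (simp flip: fls_times_fps_to_fls)

lemma nth0_power: "reg f \<Longrightarrow> (f ^ k) $$ 0 = (f $$ 0) ^ k"
  by (induction k) (auto simp: nth0_mult reg_power)

lemma nth0_pev: "reg f \<Longrightarrow> pev p f $$ 0 = poly p (f $$ 0)"
  by (induction p) (auto simp: pev_pCons nth0_mult reg_pev)

lemma nth0_divide:
  assumes "reg f" "reg h" "h $$ 0 \<noteq> 0"
  shows "(f / h) $$ 0 = f $$ 0 / h $$ 0"
proof -
  have "h \<noteq> 0" using assms(3) by auto
  then have "(f / h * h) $$ 0 = f $$ 0" by simp
  then show ?thesis using assms nth0_mult[OF reg_divide[OF assms(1,3,2)] assms(2)] by (simp add: field_simps)
qed

lemma nth0_pos: "fls_subdegree f > 0 \<Longrightarrow> f $$ 0 = 0"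
  by simp

lemma pev_pcompose: "pev (pcompose p q) \<xi> = pev p (pev q \<xi>)"
  by (induction p) (auto simp: pcompose_pCons pev_pCons pev_add pev_mult)

lemma pev_fps_X: "pev p fls_X = fps_to_fls (fps_of_poly p)"
  using pev_fps[of fps_X p] by simp

text \<open>The reciprocal has a simple zero and hence a compositional inverse, which is the change
  of parameter sought. That \<open>H\<close> has order 1 means that orders are preserved under
  it.\<close>

lemma fc_fls_inverse_reparam:
  fixes T :: "'k::field fls"
  assumes "fls_subdegree T = - 1"
  obtains H where "H \<noteq> 0" "fps_nth H 0 = 0" "subdegree H = 1" "fc T H = fls_X_inv"
proof -
  have T0: "T \<noteq> 0" using assms by auto
  then have s: "fls_subdegree (inverse T) = 1" using assms by simp
  then have "reg (inverse T)" by simp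
  then obtain a where a: "inverse T = fps_to_fls a" by (rule regE)
  have "inverse T $$ 1 \<noteq> 0" using s T0 by (metis nth_fls_subdegree_nonzero nonzero_imp_inverse_nonzero)
  moreover have "inverse T $$ 0 = 0" using s by simp
  ultimately have a01: "fps_nth a 0 = 0" "fps_nth a 1 \<noteq> 0" unfolding a by auto
  let ?H = "fps_inv a"
  have H0: "fps_nth ?H 0 = 0" by (simp add: fps_inv_def)
  have comp: "fps_compose a ?H = fps_X" using a01 by (rule fps_inv_right)
  have Hnz: "?H \<noteq> 0"
  proof
    assume "?H = 0"
    then have "fps_compose a ?H = fps_const (fps_nth a 0)" by simp
    then show False using comp a01 by (simp add: fps_X_neq_zero)
  qed
  have "fc (inverse T) ?H = fls_X" unfolding a using H0 Hnz comp by simp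
  then have "fc T ?H = inverse fls_X" using fls_compose_fps_inverse[OF Hnz H0, of T] by (metis inverse_inverse_eq)
  then have T: "fc T ?H = fls_X_inv" by (simp add: fls_inverse_X)
  have "fls_subdegree (fc T ?H) = - 1" unfolding T by simp
  then have "subdegree ?H = 1" using subdegree_fls_compose_fps[of ?H T] Hnz H0 assms by simp
  then show ?thesis using that[OF Hnz H0 _ T] by simp
qed

lemma poly_root_in_finite_set:
  fixes p :: "'a::idom poly"
  assumes "p \<noteq> 0" "finite A" "\<And>a. a \<in> A \<Longrightarrow> poly p a = 0" "card A \<ge> Polynomial.degree p" "poly p b = 0"
  shows "b \<in> A"
proof (rule ccontr)
  assume "b \<notin> A"
  have "card (insert b A) \<le> card {x. poly p x = 0}"
    using assms poly_roots_finite[OF assms(1)] by (intro card_mono) auto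
  then show False using card_poly_roots_bound[OF assms(1)] assms(2,4) \<open>b \<notin> A\<close> by simp
qed

context superelliptic
begin

lemma emb_sum:
  assumes "place \<xi> \<eta>" "\<And>a. a \<in> A \<Longrightarrow> f a \<in> S"
  shows "emb \<xi> \<eta> (\<Sum>a\<in>A. f a) = (\<Sum>a\<in>A. emb \<xi> \<eta> (f a))"
  using assms(2)
proof (induction A rule: infinite_finite_induct)
  case (insert a A)
  then have "(\<Sum>a\<in>A. f a) \<in> S" unfolding S_def by (intro quot_sum) auto
  then show ?case using insert emb_add[OF assms(1)] by simp
qed (use assms(1) emb_0 in \<open>auto simp: place_def\<close>)

lemma S_prod: "(\<And>a. a \<in> A \<Longrightarrow> f a \<in> S) \<Longrightarrow> (\<Prod>a\<in>A. f a) \<in> S"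
  unfolding S_def by (rule quot_prod)

lemma S_sum: "(\<And>a. a \<in> A \<Longrightarrow> f a \<in> S) \<Longrightarrow> (\<Sum>a\<in>A. f a) \<in> S"
  unfolding S_def by (rule quot_sum)

lemma emb_ev_S:
  fixes s :: "'n::finite \<Rightarrow> 'k fls"
  assumes "place \<xi> \<eta>" "\<And>i. s i \<in> S"
  shows "ev s A \<in> S" "emb \<xi> \<eta> (ev s A) = ev (\<lambda>i. emb \<xi> \<eta> (s i)) A"
proof -
  have nc: "nonconst \<xi>" using assms(1) by (simp add: place_def)
  have m: "fls_const (Poly_Mapping.lookup A m) * (\<Prod>i\<in>UNIV. s i ^ Poly_Mapping.lookup m i) \<in> S" for m
    using assms(2) by (intro S_closed S_prod)
  then show "ev s A \<in> S" unfolding mp_eval_def by (intro S_sum)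
  have "(\<Prod>i\<in>UNIV. s i ^ Poly_Mapping.lookup m i) \<in> S" for m :: "'n \<Rightarrow>\<^sub>0 nat"
    using assms(2) by (intro S_closed S_prod)
  then show "emb \<xi> \<eta> (ev s A) = ev (\<lambda>i. emb \<xi> \<eta> (s i)) A"
    unfolding mp_eval_def emb_sum[OF assms(1) m]
    by (intro sum.cong) (simp_all add: emb_mult[OF assms(1)] emb_prod[OF assms(1)] emb_power[OF assms(1)]
        emb_const[OF nc] S_closed assms(2))
qed

lemma emb_val_S:
  assumes "place \<xi> \<eta>" "a \<in> S" "b \<in> S"
  shows "val P a b \<in> S" "emb \<xi> \<eta> (val P a b) = val P (emb \<xi> \<eta> a) (emb \<xi> \<eta> b)"
proof -
  have m: "pev (P j) a * b ^ j \<in> S" for j using assms by (intro S_closed)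
  then show "val P a b \<in> S" unfolding val_def by (intro S_sum)
  show "emb \<xi> \<eta> (val P a b) = val P (emb \<xi> \<eta> a) (emb \<xi> \<eta> b)"
    unfolding val_def emb_sum[OF assms(1) m]
    using assms by (intro sum.cong) (simp_all add: emb_mult emb_pev emb_power S_closed)
qed

subsection \<open>Field automorphisms\<close>

definition autos :: "('k fls \<Rightarrow> 'k fls) set"
  where "autos = {\<sigma> \<in> ring_iso (subset_ring S) (subset_ring S). \<forall>c. \<sigma> (fls_const c) = fls_const c}"

lemma autosD:
  assumes "\<sigma> \<in> autos"
  shows "a \<in> S \<Longrightarrow> \<sigma> a \<in> S" "a \<in> S \<Longrightarrow> b \<in> S \<Longrightarrow> \<sigma> (a + b) = \<sigma> a + \<sigma> b"
    "a \<in> S \<Longrightarrow> b \<in> S \<Longrightarrow> \<sigma> (a * b) = \<sigma> a * \<sigma> b" "\<sigma> (fls_const c) = fls_const c"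
    "\<sigma> 0 = 0" "\<sigma> 1 = 1" "bij_betw \<sigma> S S"
  using assms ring_iso_memE[of \<sigma> "subset_ring S" "subset_ring S"] unfolding autos_def
  by auto (metis fls_const_0)

lemma autos_diff: "\<sigma> \<in> autos \<Longrightarrow> a \<in> S \<Longrightarrow> b \<in> S \<Longrightarrow> \<sigma> (a - b) = \<sigma> a - \<sigma> b"
  using autosD(2)[of \<sigma> "a - b" b] S_closed by (simp add: eq_diff_eq)

lemma autos_inj: "\<sigma> \<in> autos \<Longrightarrow> a \<in> S \<Longrightarrow> b \<in> S \<Longrightarrow> \<sigma> a = \<sigma> b \<Longrightarrow> a = b"
  using autosD(7)[of \<sigma>] by (auto simp: bij_betw_def dest: inj_onD)

lemma autos_power: "\<sigma> \<in> autos \<Longrightarrow> a \<in> S \<Longrightarrow> \<sigma> (a ^ k) = \<sigma> a ^ k"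
  by (induction k) (auto simp: autosD S_closed)

lemma autos_pev: "\<sigma> \<in> autos \<Longrightarrow> a \<in> S \<Longrightarrow> \<sigma> (pev p a) = pev p (\<sigma> a)"
  by (induction p) (auto simp: pev_pCons autosD S_closed)

lemma autos_sum: "\<sigma> \<in> autos \<Longrightarrow> (\<And>a. a \<in> A \<Longrightarrow> f a \<in> S) \<Longrightarrow> \<sigma> (\<Sum>a\<in>A. f a) = (\<Sum>a\<in>A. \<sigma> (f a))"
  by (induction A rule: infinite_finite_induct) (auto simp: autosD S_sum)

lemma autos_prod: "\<sigma> \<in> autos \<Longrightarrow> (\<And>a. a \<in> A \<Longrightarrow> f a \<in> S) \<Longrightarrow> \<sigma> (\<Prod>a\<in>A. f a) = (\<Prod>a\<in>A. \<sigma> (f a))"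
  by (induction A rule: infinite_finite_induct) (auto simp: autosD S_prod)

lemma autos_val:
  assumes "\<sigma> \<in> autos" "a \<in> S" "b \<in> S"
  shows "\<sigma> (val P a b) = val P (\<sigma> a) (\<sigma> b)"
  unfolding val_def using assms
  by (subst autos_sum) (auto simp: autosD autos_pev autos_power S_closed)

lemma autos_divide: "\<sigma> \<in> autos \<Longrightarrow> a \<in> S \<Longrightarrow> b \<in> S \<Longrightarrow> \<sigma> (a / b) = \<sigma> a / \<sigma> b"
proof (cases "b = 0")
  case False
  assume *: "\<sigma> \<in> autos" "a \<in> S" "b \<in> S"
  have "\<sigma> (a / b) * \<sigma> b = \<sigma> a" using False * autosD(3)[of \<sigma> "a / b" b] S_closed by simp
  moreover have "\<sigma> b \<noteq> 0" using autos_inj[of \<sigma> b 0] autosD(5)[of \<sigma>] False * S_closed by auto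
  ultimately show ?thesis by (simp add: field_simps)
qed (simp add: autosD)

text \<open>An automorphism followed by expansion at a place is again expansion at a place, the one
  parametrised by the expansions of the images of x and z.\<close>

lemma autos_place:
  assumes s: "\<sigma> \<in> autos" and p: "place \<xi> \<eta>"
  shows "place (emb \<xi> \<eta> (\<sigma> X0)) (emb \<xi> \<eta> (\<sigma> Z0))"
    and "f \<in> S \<Longrightarrow> emb \<xi> \<eta> (\<sigma> f) = emb (emb \<xi> \<eta> (\<sigma> X0)) (emb \<xi> \<eta> (\<sigma> Z0)) f"
proof -
  have nc: "nonconst \<xi>" using p by (simp add: place_def)
  note SX = autosD(1)[OF s X0_in_S] autosD(1)[OF s Z0_in_S]
  have "\<sigma> Z0 ^ n = pev g (\<sigma> X0)"
    using curve_generic autos_power[OF s Z0_in_S, of n] autos_pev[OF s X0_in_S, of g] by (simp add: curve_def)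
  then have "emb \<xi> \<eta> (\<sigma> Z0) ^ n = pev g (emb \<xi> \<eta> (\<sigma> X0))"
    using emb_power[OF p SX(2)] emb_pev[OF p SX(1)] by metis
  moreover have "nonconst (emb \<xi> \<eta> (\<sigma> X0))"
    unfolding nonconst_def
  proof (intro allI notI)
    fix c assume "emb \<xi> \<eta> (\<sigma> X0) = fls_const c"
    then have "emb \<xi> \<eta> (\<sigma> X0 - fls_const c) = 0" using emb_diff[OF p SX(1) S_const] emb_const[OF nc] by simp
    then have "\<sigma> X0 = fls_const c" using emb_eq_0_iff[OF p] SX S_closed by auto
    then have "\<sigma> X0 = \<sigma> (fls_const c)" using autosD(4)[OF s] by simp
    then have "X0 = fls_const c" using autos_inj[OF s X0_in_S S_const] by simp
    then show False using nonconst_X0 by (auto simp: nonconst_def)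
  qed
  ultimately show pl: "place (emb \<xi> \<eta> (\<sigma> X0)) (emb \<xi> \<eta> (\<sigma> Z0))" by (simp add: place_def curve_def)
  assume "f \<in> S"
  then obtain P D where f: "D \<noteq> 0" "f = val P X0 Z0 / pev D X0" by (rule SE)
  have "\<sigma> f = val P (\<sigma> X0) (\<sigma> Z0) / pev D (\<sigma> X0)"
    unfolding f(2) using autos_divide[OF s] autos_val[OF s] autos_pev[OF s] S_closed by simp
  then have "emb \<xi> \<eta> (\<sigma> f) = val P (emb \<xi> \<eta> (\<sigma> X0)) (emb \<xi> \<eta> (\<sigma> Z0)) / pev D (emb \<xi> \<eta> (\<sigma> X0))"
    using emb_divide[OF p emb_val_S(1)[OF p SX] S_closed(8)[OF SX(1)]] emb_val_S(2)[OF p SX] emb_pev[OF p SX(1)] by simp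
  also have "\<dots> = emb (emb \<xi> \<eta> (\<sigma> X0)) (emb \<xi> \<eta> (\<sigma> Z0)) f"
    unfolding f(2) by (rule emb_val[symmetric]) (use pl f in \<open>auto simp: place_def\<close>)
  finally show "emb \<xi> \<eta> (\<sigma> f) = emb (emb \<xi> \<eta> (\<sigma> X0)) (emb \<xi> \<eta> (\<sigma> Z0)) f" .
qed

definition gal_group :: "'k fls set \<Rightarrow> ('k fls \<Rightarrow> 'k fls) set"
  where "gal_group E = {\<sigma> \<in> ring_iso (subset_ring S) (subset_ring S). \<forall>e\<in>E. \<sigma> e = e}"

lemma gal_group_autos: "(\<And>c. fls_const c \<in> E) \<Longrightarrow> \<sigma> \<in> gal_group E \<Longrightarrow> \<sigma> \<in> autos"
  by (auto simp: gal_group_def autos_def)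

text \<open>The values at \<open>c \<in> K\<close> of the polynomial whose roots are the conjugates of \<open>u\<close> lie in the fixed field.\<close>

lemma galois_transitive:
  assumes gal: "galois_extension (subset_ring S) E" and const: "\<And>c. fls_const c \<in> E"
    and p0: "place \<xi>0 \<eta>0" and p1: "place \<xi>1 \<eta>1"
    and agree: "\<And>e. e \<in> E \<Longrightarrow> emb \<xi>0 \<eta>0 e = emb \<xi>1 \<eta>1 e"
    and u: "u \<in> S" and fin: "finite ((\<lambda>\<sigma>. \<sigma> u) ` gal_group E)"
  shows "\<exists>\<sigma>\<in>gal_group E. emb \<xi>1 \<eta>1 (\<sigma> u) = emb \<xi>0 \<eta>0 u"
proof -
  let ?G = "gal_group E"
  let ?O = "(\<lambda>\<sigma>. \<sigma> u) ` ?G"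
  have nc: "nonconst \<xi>0" "nonconst \<xi>1" using p0 p1 by (simp_all add: place_def)
  have ES: "E \<subseteq> S" using gal unfolding galois_extension_def by (auto dest: subfieldE(3))
  have fixd: "a \<in> E" if "a \<in> S" "\<And>\<sigma>. \<sigma> \<in> ?G \<Longrightarrow> \<sigma> a = a" for a
    using gal that unfolding galois_extension_def gal_group_def by auto
  have au: "\<sigma> \<in> autos" if "\<sigma> \<in> ?G" for \<sigma> using gal_group_autos[OF const that] .
  have OS: "?O \<subseteq> S" using au autosD(1) u by blast
  have comp: "\<tau> \<circ> \<sigma> \<in> ?G" if "\<tau> \<in> ?G" "\<sigma> \<in> ?G" for \<tau> \<sigma>
    using that ring_iso_set_trans[of \<sigma> _ _ \<tau>] by (auto simp: gal_group_def)
  have idG: "id \<in> ?G" by (auto simp: gal_group_def ring_iso_def ring_hom_def)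
  have perm: "\<tau> ` ?O = ?O" if t: "\<tau> \<in> ?G" for \<tau>
  proof (rule card_subset_eq[OF fin])
    show "\<tau> ` ?O \<subseteq> ?O" using comp[OF t] by (auto simp: image_iff) (metis comp_apply)
    have "inj_on \<tau> ?O" using autosD(7)[OF au[OF t]] OS by (auto simp: bij_betw_def intro: inj_on_subset)
    then show "card (\<tau> ` ?O) = card ?O" by (rule card_image)
  qed
  \<comment> \<open>Values at constants stand in for the coefficients of the conjugate polynomial,
    so that invariance is just a permutation of factors.\<close>
  define y where "y c = (\<Prod>a\<in>?O. fls_const c - a)" for c
  have yS: "y c \<in> S" for c unfolding y_def using OS by (intro S_prod S_closed) auto
  have yE: "y c \<in> E" for c
  proof (rule fixd[OF yS])
    fix \<tau> assume t: "\<tau> \<in> ?G"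
    have inj: "inj_on \<tau> ?O" using autosD(7)[OF au[OF t]] OS by (auto simp: bij_betw_def intro: inj_on_subset)
    have "\<tau> (y c) = (\<Prod>a\<in>?O. \<tau> (fls_const c - a))"
      unfolding y_def using OS by (intro autos_prod[OF au[OF t]] S_closed) auto
    also have "\<dots> = (\<Prod>a\<in>?O. fls_const c - \<tau> a)"
      using OS autos_diff[OF au[OF t]] autosD(4)[OF au[OF t]] S_closed by (intro prod.cong) auto
    also have "\<dots> = (\<Prod>a\<in>\<tau> ` ?O. fls_const c - a)" using inj by (simp add: prod.reindex)
    finally show "\<tau> (y c) = y c" unfolding perm[OF t] y_def .
  qed
  define q where "q \<phi> = (\<Prod>a\<in>?O. [:- \<phi> a, 1:])" for \<phi> :: "'k fls \<Rightarrow> 'k fls"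
  have qy: "poly (q (emb \<xi> \<eta>)) (fls_const c) = emb \<xi> \<eta> (y c)" if p: "place \<xi> \<eta>" for \<xi> \<eta> c
  proof -
    have "emb \<xi> \<eta> (y c) = (\<Prod>a\<in>?O. emb \<xi> \<eta> (fls_const c - a))"
      unfolding y_def using OS by (intro emb_prod[OF p] S_closed) auto
    also have "\<dots> = (\<Prod>a\<in>?O. fls_const c - emb \<xi> \<eta> a)"
    proof (rule prod.cong[OF refl])
      fix a assume "a \<in> ?O"
      then have "a \<in> S" using OS by blast
      then show "emb \<xi> \<eta> (fls_const c - a) = fls_const c - emb \<xi> \<eta> a"
        using emb_diff[OF p S_const] emb_const p by (simp add: place_def)
    qed
    finally show ?thesis by (simp add: q_def poly_prod)
  qed
  \<comment> \<open>Two polynomials that agree at the infinitely many constants are equal.\<close>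
  have "q (emb \<xi>0 \<eta>0) = q (emb \<xi>1 \<eta>1)"
  proof (rule ccontr)
    assume "q (emb \<xi>0 \<eta>0) \<noteq> q (emb \<xi>1 \<eta>1)"
    then have "finite {x. poly (q (emb \<xi>0 \<eta>0) - q (emb \<xi>1 \<eta>1)) x = 0}" by (intro poly_roots_finite) simp
    moreover have "range (fls_const :: 'k \<Rightarrow> 'k fls) \<subseteq> {x. poly (q (emb \<xi>0 \<eta>0) - q (emb \<xi>1 \<eta>1)) x = 0}"
      using qy[OF p0] qy[OF p1] agree[OF yE] by auto
    ultimately have "finite (range (fls_const :: 'k \<Rightarrow> 'k fls))" by (rule rev_finite_subset)
    moreover have "inj (fls_const :: 'k \<Rightarrow> 'k fls)" by (auto intro!: injI simp: fls_eq_iff split: if_splits)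
    ultimately show False using finite_imageD infinite_UNIV_char_0 by blast
  qed
  moreover have "poly (q (emb \<xi>0 \<eta>0)) (emb \<xi>0 \<eta>0 u) = 0"
  proof -
    have "u \<in> ?O" using idG by (auto simp: image_iff intro: bexI[of _ id])
    then show ?thesis unfolding q_def poly_prod using fin by (intro prod_zero bexI[of _ u]) auto
  qed
  ultimately have "poly (q (emb \<xi>1 \<eta>1)) (emb \<xi>0 \<eta>0 u) = 0" by simp
  then have "\<exists>a\<in>?O. emb \<xi>0 \<eta>0 u = emb \<xi>1 \<eta>1 a"
    unfolding q_def poly_prod using fin by (auto simp: prod_zero_iff)
  then show ?thesis by auto
qed

subsection \<open>Places over finite points\<close>

text \<open>Above x = c with g(c) nonzero, x - c is a parameter and z is an n-th root of g(c + T);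
  its multiples by roots of unity give the other places of the fibre.\<close>

lemma place_at_regular:
  assumes "\<eta>0 ^ n = poly g c" "\<eta>0 \<noteq> 0"
  obtains Z where "fps_nth Z 0 = \<eta>0" "\<And>w. w ^ n = 1 \<Longrightarrow> place (fls_const c + fls_X) (fls_const w * fps_to_fls Z)"
    "Z ^ n = fps_of_poly (pcompose g [:c, 1:])"
proof -
  obtain k where k: "n = Suc k" using n0 by (cases n) auto
  let ?a = "fps_of_poly (pcompose g [:c, 1:])"
  have a0: "fps_nth ?a 0 = poly g c" by (simp add: poly_pcompose flip: poly_0_coeff_0)
  have gc: "poly g c \<noteq> 0" using assms by (metis power_eq_0_iff)
  define Z where "Z = fps_radical (\<lambda>_ _. \<eta>0) n ?a"
  have "fps_radical (\<lambda>_ _. \<eta>0) (Suc k) ?a ^ Suc k = ?a"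
    using a0 gc assms(1) unfolding k by (intro iffD1[OF power_radical]) auto
  then have Zn: "Z ^ n = ?a" unfolding Z_def unfolding k .
  have Z0: "fps_nth Z 0 = \<eta>0" unfolding Z_def using n0 by simp
  have x: "fls_const c + fls_X = pev [:c, 1:] fls_X" by (simp add: pev_pCons)
  have g': "pev g (fls_const c + fls_X) = fps_to_fls ?a" unfolding x pev_pcompose[symmetric] by (rule pev_fps_X)
  have "place (fls_const c + fls_X) (fls_const w * fps_to_fls Z)" if "w ^ n = 1" for w
    unfolding place_def
  proof
    show "nonconst (fls_const c + fls_X)" by (rule nonconstI[of _ 1]) auto
    show "curve (fls_const c + fls_X) (fls_const w * fps_to_fls Z)"
      unfolding curve_def power_mult_distrib g' using that
      by (simp add: Zn flip: fls_const_power fps_to_fls_power)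
  qed
  then show ?thesis using that[OF Z0 _ Zn] by blast
qed

text \<open>At a simple zero of g the parameter is z itself, and x - c is recovered from z^n = g(x)
  by inverting the series g(c + X), whose linear coefficient is g'(c).\<close>

lemma place_at_root:
  assumes "poly g c = 0"
  obtains G where "fps_nth G 0 = 0" "fps_nth G 1 \<noteq> 0" "place (fls_const c + fps_to_fls (fps_compose G (fps_X ^ n))) fls_X"
proof -
  let ?a = "fps_of_poly (pcompose g [:c, 1:])"
  have a0: "fps_nth ?a 0 = 0" using assms by (simp add: poly_pcompose flip: poly_0_coeff_0)
  have a1: "fps_nth ?a 1 \<noteq> 0"
  proof -
    have "fps_nth ?a 1 = poly (pderiv (pcompose g [:c, 1:])) 0"
      by (simp add: poly_0_coeff_0 coeff_pderiv)
    also have "\<dots> = poly (pderiv g) c" by (simp add: pderiv_pcompose poly_pcompose pderiv_pCons)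
    finally show ?thesis using sqf[OF assms] by simp
  qed
  let ?G = "fps_inv ?a"
  have G0: "fps_nth ?G 0 = 0" by (simp add: fps_inv_def)
  have comp: "fps_compose ?a ?G = fps_X" using a0 a1 by (rule fps_inv_right)
  have G1: "fps_nth ?G 1 \<noteq> 0"
  proof
    assume "fps_nth ?G 1 = 0"
    then have "fps_nth (fps_compose ?a ?G) 1 = 0" using G0 by (simp add: fps_compose_nth)
    then show False using comp by simp
  qed
  have Xn: "fps_nth (fps_X ^ n :: 'k fps) 0 = 0" using n0 by (simp add: fps_power_zeroth)
  let ?Y = "fps_compose ?G (fps_X ^ n)"
  have Y0: "fps_nth ?Y 0 = 0" using G0 by simp
  have aY: "fps_compose ?a ?Y = fps_X ^ n" using fps_compose_assoc[OF Xn G0, of ?a] comp Xn by simp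
  have x: "fls_const c + fps_to_fls ?Y = pev [:c, 1:] (fps_to_fls ?Y)" by (simp add: pev_pCons)
  have g': "pev g (fls_const c + fps_to_fls ?Y) = fls_X ^ n"
  proof -
    have "pev g (fls_const c + fps_to_fls ?Y) = pev (pcompose g [:c, 1:]) (fps_to_fls ?Y)"
      by (simp only: x pev_pcompose)
    also have "\<dots> = fls_X ^ n" unfolding pev_fps[OF Y0] aY by (simp add: fps_to_fls_power)
    finally show ?thesis .
  qed
  have "nonconst (fls_const c + fps_to_fls ?Y)"
    unfolding nonconst_def
  proof (intro allI notI)
    fix d assume d: "fls_const c + fps_to_fls ?Y = fls_const d"
    have "fps_to_fls ?Y = fls_const d - fls_const c" using d by (simp add: algebra_simps)
    then have "fps_to_fls ?Y $$ 0 = d - c" by simp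
    then have "?Y = 0" using d Y0 by simp
    then show False using aY n0 by (metis Xn a0 fps_compose_0_right fps_const_0_eq_0 fps_X_neq_zero power_not_zero)
  qed
  then have "place (fls_const c + fps_to_fls ?Y) fls_X" using g' by (simp add: place_def curve_def)
  then show ?thesis using that G0 G1 by blast
qed

text \<open>The coordinate ring is integrally closed.\<close>

lemma regular_function_is_polynomial:
  assumes h: "h \<in> S" and z: "primitive_root_of_unity n z"
    and R1: "\<And>c. poly g c \<noteq> 0 \<Longrightarrow> \<exists>Z. fps_nth Z 0 \<noteq> 0 \<and> (\<forall>i<n. place (fls_const c + fls_X) (fls_const (z ^ i) * fps_to_fls Z) \<and>
        reg (emb (fls_const c + fls_X) (fls_const (z ^ i) * fps_to_fls Z) h))"
    and R2: "\<And>c. poly g c = 0 \<Longrightarrow> \<exists>G. fps_nth G 0 = 0 \<and> place (fls_const c + fps_to_fls (fps_compose G (fps_X ^ n))) fls_X \<and>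
        reg (emb (fls_const c + fps_to_fls (fps_compose G (fps_X ^ n))) fls_X h)"
  shows "\<exists>P. h = val P X0 Z0"
proof -
  \<comment> \<open>Induction on the degree of the denominator: at a root c of D, regularity forces
    P_j(c) = 0 for all j < n, so a factor X - c cancels.\<close>
  have main: "D \<noteq> 0 \<Longrightarrow> h * pev D X0 = val P X0 Z0 \<Longrightarrow> \<exists>P. h = val P X0 Z0" for D P
  proof (induction "Polynomial.degree D" arbitrary: D P rule: less_induct)
    case less
    show ?case
    proof (cases "Polynomial.degree D = 0")
      case True
      then obtain d where d: "D = [:d:]" by (rule degree_eq_zeroE)
      then have d0: "d \<noteq> 0" using less.prems by simp
      have "val (\<lambda>j. [:inverse d:] * P j) X0 Z0 = fls_const (inverse d) * (h * fls_const d)"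
        unfolding val_poly_mult using less.prems(2) by (simp add: d)
      also have "\<dots> = h * (fls_const (inverse d) * fls_const d)" by (simp only: mult_ac)
      also have "\<dots> = h" using d0 by simp
      finally show ?thesis by metis
    next
      case False
      then obtain c where c: "poly D c = 0" using alg_closed_imp_poly_has_root by blast
      then obtain D1 where D1: "D = [:- c, 1:] * D1" by (auto simp: poly_eq_0_iff_dvd dvd_def)
      have D10: "D1 \<noteq> 0" using less.prems(1) D1 by auto
      have rt: "poly (P j) c = 0" if j: "j < n" for j
      proof (cases "poly g c = 0")
        case False
        then obtain Z where Z: "fps_nth Z 0 \<noteq> 0" and pl: "\<And>i. i < n \<Longrightarrow> place (fls_const c + fls_X) (fls_const (z ^ i) * fps_to_fls Z)"
          and rg: "\<And>i. i < n \<Longrightarrow> reg (emb (fls_const c + fls_X) (fls_const (z ^ i) * fps_to_fls Z) h)"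
          using R1 by blast
        let ?x = "fls_const c + fls_X :: 'k fls"
        have rx: "reg ?x" "?x $$ 0 = c" by (auto intro: reg_add)
        \<comment> \<open>This polynomial of degree below n vanishes at the n distinct values of the
          second coordinate above c, so it is zero.\<close>
        define q where "q = (\<Sum>j<n. Polynomial.monom (poly (P j) c) j)"
        have cq: "Polynomial.coeff q j = (if j < n then poly (P j) c else 0)" for j
          by (simp add: q_def Polynomial.coeff_sum sum.delta)
        have "poly q (z ^ i * fps_nth Z 0) = 0" if i: "i < n" for i
        proof -
          let ?y = "fls_const (z ^ i) * fps_to_fls Z"
          have ry: "reg ?y" "?y $$ 0 = z ^ i * fps_nth Z 0" by (auto intro: reg_mult simp: nth0_mult)
          have "emb ?x ?y h * pev D ?x = val P ?x ?y"
          proof -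
            have "emb ?x ?y (h * pev D X0) = emb ?x ?y (val P X0 Z0)" using less.prems(2) by simp
            then show ?thesis
              using emb_mult[OF pl[OF i] h] emb_pev[OF pl[OF i]] emb_val_S(2)[OF pl[OF i]] S_closed
                emb_X0[of ?x ?y] emb_Z0[of ?x ?y] pl[OF i] by (simp add: place_def)
          qed
          then have "val P ?x ?y $$ 0 = (emb ?x ?y h * pev D ?x) $$ 0" by simp
          also have "\<dots> = 0" using rx by (simp add: nth0_mult[OF rg[OF i] reg_pev[OF rx(1)]] nth0_pev c)
          finally have "val P ?x ?y $$ 0 = 0" .
          moreover have "val P ?x ?y $$ 0 = (\<Sum>j<n. poly (P j) c * (z ^ i * fps_nth Z 0) ^ j)"
            unfolding val_def fls_nth_sum using rx ry
            by (intro sum.cong) (simp_all add: nth0_mult reg_pev reg_power nth0_pev nth0_power)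
          ultimately show ?thesis by (simp add: q_def poly_sum poly_monom)
        qed
        moreover have "inj_on (\<lambda>i. z ^ i * fps_nth Z 0) {..<n}"
          using Z by (auto intro!: inj_onI primitive_root_power_inj[OF z])
        then have "card ((\<lambda>i. z ^ i * fps_nth Z 0) ` {..<n}) = n" by (simp add: card_image)
        ultimately have cd: "q \<noteq> 0 \<Longrightarrow> n \<le> card {x. poly q x = 0}"
          using card_mono[OF poly_roots_finite[of q], of "(\<lambda>i. z ^ i * fps_nth Z 0) ` {..<n}"] by auto
        have "Polynomial.degree q \<le> n - 1" by (rule degree_le) (auto simp: cq)
        then have "q = 0" using cd card_poly_roots_bound[of q] n0 by (cases "q = 0") auto
        then show ?thesis using cq[of j] j by simp
      next
        case True
        then obtain G where G: "fps_nth G 0 = 0" and pl: "place (fls_const c + fps_to_fls (fps_compose G (fps_X ^ n))) fls_X"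
          and rg: "reg (emb (fls_const c + fps_to_fls (fps_compose G (fps_X ^ n))) fls_X h)" using R2 by blast
        let ?Y = "fps_to_fls (fps_compose G (fps_X ^ n)) :: 'k fls"
        let ?x = "fls_const c + ?Y"
        define G' where "G' = fps_shift 1 G"
        have "G = fps_X * G'" unfolding G'_def by (rule fps_ext) (simp add: G)
        then have Y: "?Y = fls_X ^ n * fps_to_fls (fps_compose G' (fps_X ^ n))"
          using n0 by (simp add: fps_compose_mult_distrib fps_power_zeroth fls_times_fps_to_fls fps_to_fls_power)
        have rx: "reg ?x" by (auto intro: reg_add)
        \<comment> \<open>At a branch point x - c is divisible by T^n, so a polynomial in x equals
          its value at c plus T^n times a regular series.\<close>
        have ex: "\<exists>R. reg R \<and> pev p ?x = fls_const (poly p c) + fls_X ^ n * R" for p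
        proof -
          have "poly (p - [:poly p c:]) c = 0" by simp
          then obtain q where q: "p - [:poly p c:] = [:- c, 1:] * q" unfolding poly_eq_0_iff_dvd by (auto simp: dvd_def)
          then have "p = [:poly p c:] + [:- c, 1:] * q" by (simp add: algebra_simps)
          then have "pev p ?x = fls_const (poly p c) + pev [:- c, 1:] ?x * pev q ?x" by (metis pev_add pev_mult pev_const)
          also have "pev [:- c, 1:] ?x = ?Y" by (simp add: pev_pCons)
          finally have "pev p ?x = fls_const (poly p c) + fls_X ^ n * (fps_to_fls (fps_compose G' (fps_X ^ n)) * pev q ?x)"
            unfolding Y by (simp only: mult.assoc)
          moreover have "reg (fps_to_fls (fps_compose G' (fps_X ^ n)) * pev q ?x)" using rx by (intro reg_mult reg_pev) auto
          ultimately show ?thesis by blast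
        qed
        have eq: "emb ?x fls_X h * pev D ?x = val P ?x fls_X"
        proof -
          have "emb ?x fls_X (h * pev D X0) = emb ?x fls_X (val P X0 Z0)" using less.prems(2) by simp
          then show ?thesis
            using emb_mult[OF pl h] emb_pev[OF pl] emb_val_S(2)[OF pl] S_closed
              emb_X0[of ?x fls_X] emb_Z0[of ?x fls_X] pl by (simp add: place_def)
        qed
        obtain R0 where R0: "reg R0" "pev D ?x = fls_X ^ n * R0" using ex[of D] c by auto
        have "\<forall>j. \<exists>R. reg R \<and> pev (P j) ?x = fls_const (poly (P j) c) + fls_X ^ n * R" using ex by blast
        then obtain R where "\<forall>j. reg (R j) \<and> pev (P j) ?x = fls_const (poly (P j) c) + fls_X ^ n * R j"
          using choice[of "\<lambda>j R. reg R \<and> pev (P j) ?x = fls_const (poly (P j) c) + fls_X ^ n * R"] by blast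
        then have R: "\<And>j. reg (R j)" "\<And>j. pev (P j) ?x = fls_const (poly (P j) c) + fls_X ^ n * R j" by blast+
        \<comment> \<open>Modulo T^n only the sum of the P_j(c) T^j is left, and since j < n its
          coefficients are separated by the powers of T.\<close>
        have "(\<Sum>j<n. fls_const (poly (P j) c) * fls_X ^ j) = fls_X ^ n * (emb ?x fls_X h * R0 - (\<Sum>j<n. R j * fls_X ^ j))"
        proof -
          have "val P ?x fls_X = (\<Sum>j<n. fls_const (poly (P j) c) * fls_X ^ j) + fls_X ^ n * (\<Sum>j<n. R j * fls_X ^ j)"
            unfolding val_def R(2) by (simp only: distrib_right sum.distrib sum_distrib_left mult.assoc)
          then show ?thesis using eq unfolding R0(2) by (simp add: algebra_simps)
        qed
        moreover have "reg (emb ?x fls_X h * R0 - (\<Sum>j<n. R j * fls_X ^ j))"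
        proof -
          have "reg (\<Sum>j\<in>A. R j * fls_X ^ j)" if "finite A" for A
            using that by (induction A) (auto intro!: reg_add reg_mult R(1))
          then show ?thesis using rg R0(1) by (intro reg_diff reg_mult) auto
        qed
        then obtain W where "emb ?x fls_X h * R0 - (\<Sum>j<n. R j * fls_X ^ j) = fps_to_fls W" by (rule regE)
        ultimately have "(\<Sum>j<n. fls_const (poly (P j) c) * fls_X ^ j) = fps_to_fls (fps_X ^ n * W)"
          by (simp add: fls_times_fps_to_fls fps_to_fls_power)
        then have "(\<Sum>j'<n. fls_const (poly (P j') c) * fls_X ^ j') $$ int j = fps_nth (fps_X ^ n * W) j"
          by simp
        also have "\<dots> = 0" using j by (simp add: fps_X_power_mult_nth)
        also have "(\<Sum>j'<n. fls_const (poly (P j') c) * fls_X ^ j') $$ int j = (\<Sum>j'<n. if j' = j then poly (P j) c else 0)"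
          unfolding fls_nth_sum by (intro sum.cong) auto
        finally show ?thesis using j by (simp add: sum.delta)
      qed
      then have "\<forall>j. \<exists>q. j < n \<longrightarrow> P j = [:- c, 1:] * q" unfolding poly_eq_0_iff_dvd by (auto simp: dvd_def)
      then obtain P1 where P1: "\<And>j. j < n \<Longrightarrow> P j = [:- c, 1:] * P1 j" by metis
      have "val P X0 Z0 = val (\<lambda>j. [:- c, 1:] * P1 j) X0 Z0" unfolding val_def using P1 by (intro sum.cong) auto
      also have "\<dots> = pev [:- c, 1:] X0 * val P1 X0 Z0" by (rule val_poly_mult)
      finally have "pev [:- c, 1:] X0 * (h * pev D1 X0) = pev [:- c, 1:] X0 * val P1 X0 Z0"
        using less.prems(2) unfolding D1 pev_mult by (simp only: mult_ac)
      moreover have "pev [:- c, 1:] X0 \<noteq> 0" by (rule pev_nonzero[OF nonconst_X0]) simp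
      ultimately have "h * pev D1 X0 = val P1 X0 Z0" by (metis mult_left_cancel)
      moreover have "Polynomial.degree D1 < Polynomial.degree D" unfolding D1 using D10 by (subst degree_mult_eq) auto
      ultimately show ?thesis using less.hyps D10 by blast
    qed
  qed
  obtain P D where "D \<noteq> 0" "h = val P X0 Z0 / pev D X0" using h by (rule SE)
  then show ?thesis using main[of D P] pev_nonzero[OF nonconst_X0, of D] by simp
qed

end

section \<open>Two computations with roots of unity\<close>

lemma fps_X_power_dvd_nth: "fps_X ^ n dvd f \<Longrightarrow> k < n \<Longrightarrow> fps_nth f k = (0 :: 'k::field)"
  by (auto simp: dvd_def fps_X_power_mult_nth)

lemma fps_X_power_dvd_poly: "fps_X ^ n dvd fps_of_poly q \<Longrightarrow> Polynomial.degree q < n \<Longrightarrow> q = (0 :: 'k::field poly)"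
proof (rule poly_eqI)
  fix k assume *: "fps_X ^ n dvd fps_of_poly q" "Polynomial.degree q < n"
  show "Polynomial.coeff q k = Polynomial.coeff 0 k"
  proof (cases "k < n")
    case True then show ?thesis using fps_X_power_dvd_nth[OF *(1)] by simp
  next
    case False then show ?thesis using *(2) by (simp add: coeff_eq_0)
  qed
qed

lemma power_diff_sum: "(a - b) * (\<Sum>j<n. a ^ (n - 1 - j) * b ^ j) = a ^ n - (b :: 'a::comm_ring_1) ^ n"
  using power_diff_sumr2[of b n a] by (simp add: algebra_simps)

lemma dvd_power_diff: "d dvd a - b \<Longrightarrow> d dvd a ^ k - (b :: 'a::comm_ring_1) ^ k"
  using power_diff_sum[of a b k] by (metis dvd_mult2)

lemma fps_unit_dvd_cancel:
  assumes "fps_nth U 0 \<noteq> 0" "d dvd f * U"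
  shows "d dvd (f :: 'k::field fps)"
proof -
  have "d dvd f * U * inverse U" using assms(2) by (rule dvd_mult2)
  also have "f * U * inverse U = f * (inverse U * U)" by (simp only: mult_ac)
  also have "\<dots> = f" using inverse_mult_eq_1[OF assms(1)] by simp
  finally show ?thesis .
qed

text \<open>Discrete Fourier inversion recovers \<open>p j * Z^j\<close> from the values at \<open>\<zeta>^i Z\<close>,
  all but one of which vanish to order \<open>n\<close>.\<close>

lemma fourier_vanishing:
  fixes Z :: "'k::field_char_0 fps" and p :: "nat \<Rightarrow> 'k poly" and n :: nat and \<zeta> :: 'k
  defines "V \<equiv> \<lambda>i. \<Sum>j<n. fps_of_poly (p j) * (fps_const (\<zeta> ^ i) * Z) ^ j"
  assumes n: "n \<ge> 4" and \<zeta>: "primitive_root_of_unity n \<zeta>" and Z0: "fps_nth Z 0 \<noteq> 0"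
    and deg: "\<And>j. j < n \<Longrightarrow> Polynomial.degree (p j) \<le> n - 1 - j"
    and V: "\<And>i. i < n \<Longrightarrow> i \<noteq> 1 \<Longrightarrow> fps_X ^ n dvd V i" and V2: "fps_X ^ Suc n dvd V 2"
    and nz: "\<exists>j<n. p j \<noteq> 0"
  shows "\<exists>c \<Lambda>. c \<noteq> 0 \<and> Polynomial.degree \<Lambda> \<le> 1 \<and> poly \<Lambda> 0 = fps_nth Z 0 \<and>
    (\<forall>j<n. p j = Polynomial.smult (c * inverse \<zeta> ^ Suc j) (\<Lambda> ^ (n - 1 - j))) \<and>
    fps_X ^ Suc n dvd fps_of_poly (\<Lambda> ^ n) - Z ^ n"
proof -
  have z0: "\<zeta> \<noteq> 0" "\<zeta> ^ n = 1" using primitive_root_nonzero[OF \<zeta>] \<zeta> by (auto simp: primitive_root_of_unity_def)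
  let ?f = "\<lambda>j. fps_of_poly (p j)"
  have fourier: "(\<Sum>i<n. fps_const (inverse \<zeta> ^ (i * j)) * V i) = fps_const (of_nat n) * (?f j * Z ^ j)" if j: "j < n" for j
  proof -
    have "(\<Sum>i<n. fps_const (inverse \<zeta> ^ (i * j)) * V i) =
      (\<Sum>i<n. \<Sum>k<n. fps_const ((\<zeta> ^ k * inverse \<zeta> ^ j) ^ i) * (?f k * Z ^ k))"
      unfolding V_def sum_distrib_left
    proof (intro sum.cong refl)
      fix i k
      have "fps_const ((\<zeta> ^ k * inverse \<zeta> ^ j) ^ i) = fps_const (inverse \<zeta> ^ (i * j)) * fps_const (\<zeta> ^ i) ^ k"
        by (simp add: power_mult_distrib power_mult[symmetric] mult.commute fps_const_power)
      then show "fps_const (inverse \<zeta> ^ (i * j)) * (?f k * (fps_const (\<zeta> ^ i) * Z) ^ k) =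
        fps_const ((\<zeta> ^ k * inverse \<zeta> ^ j) ^ i) * (?f k * Z ^ k)"
        by (simp add: power_mult_distrib mult_ac)
    qed
    also have "\<dots> = (\<Sum>k<n. fps_const (\<Sum>i<n. (\<zeta> ^ k * inverse \<zeta> ^ j) ^ i) * (?f k * Z ^ k))"
    proof (subst sum.swap, intro sum.cong refl)
      fix k
      have "fps_const (\<Sum>i\<in>A. (\<zeta> ^ k * inverse \<zeta> ^ j) ^ i) = (\<Sum>i\<in>A. fps_const ((\<zeta> ^ k * inverse \<zeta> ^ j) ^ i))" for A :: "nat set"
        by (induction A rule: infinite_finite_induct) (auto simp flip: fps_const_add)
      then show "(\<Sum>i<n. fps_const ((\<zeta> ^ k * inverse \<zeta> ^ j) ^ i) * (?f k * Z ^ k)) =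
        fps_const (\<Sum>i<n. (\<zeta> ^ k * inverse \<zeta> ^ j) ^ i) * (?f k * Z ^ k)"
        by (simp only: sum_distrib_right)
    qed
    also have "\<dots> = (\<Sum>k<n. if k = j then fps_const (of_nat n) * (?f j * Z ^ j) else 0)"
    proof (intro sum.cong refl)
      fix k assume k: "k \<in> {..<n}"
      have "(\<zeta> ^ k * inverse \<zeta> ^ j) ^ n = 1"
        by (simp add: power_mult_distrib power_mult[symmetric] mult.commute[of _ n] power_inverse)
           (simp add: power_mult z0)
      then have "(\<Sum>i<n. (\<zeta> ^ k * inverse \<zeta> ^ j) ^ i) = (if \<zeta> ^ k * inverse \<zeta> ^ j = 1 then of_nat n else 0)"
        by (rule sum_root_of_unity)
      also have "\<zeta> ^ k * inverse \<zeta> ^ j = 1 \<longleftrightarrow> \<zeta> ^ k = \<zeta> ^ j"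
        using z0 by (simp add: power_inverse field_simps)
      also have "\<zeta> ^ k = \<zeta> ^ j \<longleftrightarrow> k = j" using primitive_root_power_inj[OF \<zeta>] k j by auto
      finally show "fps_const (\<Sum>i<n. (\<zeta> ^ k * inverse \<zeta> ^ j) ^ i) * (?f k * Z ^ k) =
        (if k = j then fps_const (of_nat n) * (?f j * Z ^ j) else 0)" by simp
    qed
    finally show ?thesis using j by (simp add: sum.delta)
  qed
  \<comment> \<open>All V_i with i \<noteq> 1 drop out modulo T^n, so n \<zeta>^j p_j Z^j has the
    same residue V_1 for every j.\<close>
  have 1: "fps_X ^ n dvd fps_const (of_nat n) * (fps_const (\<zeta> ^ j) * ?f j * Z ^ j) - V 1" if j: "j < n" for j
  proof -
    have "fps_const (of_nat n) * (?f j * Z ^ j) = fps_const (inverse \<zeta> ^ j) * V 1 + (\<Sum>i\<in>{..<n} - {1}. fps_const (inverse \<zeta> ^ (i * j)) * V i)"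
      unfolding fourier[OF j, symmetric] using n by (subst sum.remove[of _ 1]) auto
    then have "fps_const (\<zeta> ^ j) * (fps_const (of_nat n) * (?f j * Z ^ j)) =
      fps_const (\<zeta> ^ j) * fps_const (inverse \<zeta> ^ j) * V 1 + fps_const (\<zeta> ^ j) * (\<Sum>i\<in>{..<n} - {1}. fps_const (inverse \<zeta> ^ (i * j)) * V i)"
      by (simp only: distrib_left mult.assoc)
    also have "fps_const (\<zeta> ^ j) * fps_const (inverse \<zeta> ^ j) = 1" using z0 by (simp add: power_inverse)
    finally have "fps_const (of_nat n) * (fps_const (\<zeta> ^ j) * ?f j * Z ^ j) - V 1 =
      fps_const (\<zeta> ^ j) * (\<Sum>i\<in>{..<n} - {1}. fps_const (inverse \<zeta> ^ (i * j)) * V i)"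
      by (simp add: mult_ac)
    also have "fps_X ^ n dvd \<dots>" by (intro dvd_mult dvd_sum V) auto
    finally show ?thesis .
  qed
  \<comment> \<open>The degree bound at j = n - 1 leaves a constant. Comparing every j with this one
    gives \<zeta>^j p_j = \<zeta>^(-1) c Z^(n-1-j) modulo T^n.\<close>
  define c where "c = Polynomial.coeff (p (n - 1)) 0"
  have pn: "p (n - 1) = [:c:]"
    using deg[of "n - 1"] n unfolding c_def by (intro poly_eqI) (auto simp: coeff_pCons coeff_eq_0 split: nat.splits)
  have zi: "\<zeta> ^ (n - 1) = inverse \<zeta>"
  proof -
    have "\<zeta> ^ (n - 1) * \<zeta> = 1" using z0(2) n by (metis power_minus_mult not_gr_zero not_numeral_le_zero)
    then show ?thesis using z0(1) by (simp add: field_simps)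
  qed
  have 2: "fps_X ^ n dvd fps_of_poly (Polynomial.smult (\<zeta> ^ j) (p j)) - fps_const (inverse \<zeta> * c) * Z ^ (n - 1 - j)" if j: "j < n" for j
  proof (rule fps_unit_dvd_cancel)
    show "fps_nth (fps_const (of_nat n) * Z ^ j) 0 \<noteq> 0" using n Z0 by (simp add: fps_power_zeroth)
    have "fps_X ^ n dvd (fps_const (of_nat n) * (fps_const (\<zeta> ^ j) * ?f j * Z ^ j) - V 1) -
      (fps_const (of_nat n) * (fps_const (\<zeta> ^ (n - 1)) * ?f (n - 1) * Z ^ (n - 1)) - V 1)"
      using n by (intro dvd_diff[OF 1[OF j] 1]) simp
    also have "Z ^ (n - 1) = Z ^ (n - 1 - j) * Z ^ j" using j by (simp flip: power_add)
    also have "(fps_const (of_nat n) * (fps_const (\<zeta> ^ j) * ?f j * Z ^ j) - V 1) -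
      (fps_const (of_nat n) * (fps_const (\<zeta> ^ (n - 1)) * ?f (n - 1) * (Z ^ (n - 1 - j) * Z ^ j)) - V 1) =
      (fps_of_poly (Polynomial.smult (\<zeta> ^ j) (p j)) - fps_const (inverse \<zeta> * c) * Z ^ (n - 1 - j)) * (fps_const (of_nat n) * Z ^ j)"
      unfolding zi pn fps_of_poly_const fps_of_poly_smult by (simp add: algebra_simps)
    finally show "fps_X ^ n dvd (fps_of_poly (Polynomial.smult (\<zeta> ^ j) (p j)) - fps_const (inverse \<zeta> * c) * Z ^ (n - 1 - j)) * (fps_const (of_nat n) * Z ^ j)" .
  qed
  have degs: "Polynomial.degree (Polynomial.smult a (p j)) < n" if "j < n" for a j
    using deg[OF that] degree_smult_le[of a "p j"] n by linarith
  have c0: "c \<noteq> 0"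
  proof
    assume "c = 0"
    have "p j = 0" if j: "j < n" for j
    proof -
      have "Polynomial.smult (\<zeta> ^ j) (p j) = 0"
        using 2[OF j] \<open>c = 0\<close> by (intro fps_X_power_dvd_poly[of n] degs[OF j]) simp
      then show ?thesis using z0 by simp
    qed
    then show False using nz by blast
  qed
  \<comment> \<open>At j = n - 2 the congruence is linear in Z, so this polynomial of degree at most
    one agrees with Z modulo T^n. The other congruences then become equalities because all degrees
    are below n.\<close>
  define \<Lambda> where "\<Lambda> = Polynomial.smult (\<zeta> / c) (Polynomial.smult (\<zeta> ^ (n - 2)) (p (n - 2)))"
  have LZ: "fps_X ^ n dvd fps_of_poly \<Lambda> - Z"
  proof -
    have "fps_X ^ n dvd fps_const (\<zeta> / c) * (fps_of_poly (Polynomial.smult (\<zeta> ^ (n - 2)) (p (n - 2))) - fps_const (inverse \<zeta> * c) * Z ^ (n - 1 - (n - 2)))"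
      using n by (intro dvd_mult 2) auto
    also have "n - 1 - (n - 2) = 1" using n by simp
    also have "fps_const (\<zeta> / c) * (fps_of_poly (Polynomial.smult (\<zeta> ^ (n - 2)) (p (n - 2))) - fps_const (inverse \<zeta> * c) * Z ^ 1) =
      fps_of_poly \<Lambda> - fps_const (\<zeta> / c * (inverse \<zeta> * c)) * Z"
      unfolding \<Lambda>_def fps_of_poly_smult[of "\<zeta> / c"] right_diff_distrib fps_const_mult[symmetric] power_one_right by (simp only: mult.assoc)
    also have "\<zeta> / c * (inverse \<zeta> * c) = 1" using z0 c0 by simp
    finally show ?thesis by simp
  qed
  have dL: "Polynomial.degree \<Lambda> \<le> 1"
  proof -
    have "Polynomial.degree \<Lambda> \<le> Polynomial.degree (p (n - 2))" unfolding \<Lambda>_def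
      using degree_smult_le order_trans by blast
    also have "\<dots> \<le> 1" using deg[of "n - 2"] n by simp
    finally show ?thesis .
  qed
  have L0: "poly \<Lambda> 0 = fps_nth Z 0"
    using fps_X_power_dvd_nth[OF LZ, of 0] n by (simp add: poly_0_coeff_0)
  have 3: "p j = Polynomial.smult (c * inverse \<zeta> ^ Suc j) (\<Lambda> ^ (n - 1 - j))" if j: "j < n" for j
  proof -
    let ?q = "Polynomial.smult (\<zeta> ^ j) (p j) - Polynomial.smult (inverse \<zeta> * c) (\<Lambda> ^ (n - 1 - j))"
    have "fps_X ^ n dvd (fps_of_poly (Polynomial.smult (\<zeta> ^ j) (p j)) - fps_const (inverse \<zeta> * c) * Z ^ (n - 1 - j)) -
       fps_const (inverse \<zeta> * c) * (fps_of_poly \<Lambda> ^ (n - 1 - j) - Z ^ (n - 1 - j))"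
      by (intro dvd_diff dvd_mult 2[OF j] dvd_power_diff LZ)
    also have "\<dots> = fps_of_poly ?q"
      by (simp only: fps_of_poly_diff fps_of_poly_smult fps_of_poly_power right_diff_distrib) (simp add: algebra_simps)
    finally have d: "fps_X ^ n dvd fps_of_poly ?q" .
    have "Polynomial.degree (\<Lambda> ^ (n - 1 - j)) \<le> 1 * (n - 1 - j)"
      using dL by (meson degree_power_le le_trans mult_le_mono1)
    then have "Polynomial.degree (Polynomial.smult (inverse \<zeta> * c) (\<Lambda> ^ (n - 1 - j))) < n"
      using degree_smult_le[of "inverse \<zeta> * c" "\<Lambda> ^ (n - 1 - j)"] n by linarith
    with degs[OF j] have "Polynomial.degree ?q < n" by (rule degree_diff_less)
    with d have "?q = 0" by (rule fps_X_power_dvd_poly)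
    then have "Polynomial.smult (inverse \<zeta> ^ j) (Polynomial.smult (\<zeta> ^ j) (p j)) = Polynomial.smult (inverse \<zeta> ^ j) (Polynomial.smult (inverse \<zeta> * c) (\<Lambda> ^ (n - 1 - j)))"
      by simp
    moreover have "inverse \<zeta> ^ j * \<zeta> ^ j = 1" using z0 by (simp add: power_inverse)
    ultimately show ?thesis by (simp add: mult_ac)
  qed
  \<comment> \<open>Now V_2 is a geometric sum in \<Lambda> and \<zeta> Z. Multiplied by \<Lambda> -
    \<zeta> Z it telescopes, and its extra order of vanishing becomes the congruence of \<Lambda>^n
    and Z^n modulo T^(n+1).\<close>
  have "(fps_of_poly \<Lambda> - fps_const \<zeta> * Z) * V 2 = fps_const (c * inverse \<zeta>) * (fps_of_poly \<Lambda> ^ n - (fps_const \<zeta> * Z) ^ n)"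
  proof -
    have "V 2 = fps_const (c * inverse \<zeta>) * (\<Sum>j<n. fps_of_poly \<Lambda> ^ (n - 1 - j) * (fps_const \<zeta> * Z) ^ j)"
      unfolding V_def sum_distrib_left
    proof (intro sum.cong refl)
      fix j assume "j \<in> {..<n}"
      then have j: "j < n" by simp
      have cc: "c * inverse \<zeta> ^ Suc j * (\<zeta> ^ 2) ^ j = c * inverse \<zeta> * \<zeta> ^ j"
        using z0 by (simp add: power_inverse power2_eq_square power_mult_distrib field_simps)
      have "?f j * (fps_const (\<zeta> ^ 2) * Z) ^ j = fps_const (c * inverse \<zeta> ^ Suc j * (\<zeta> ^ 2) ^ j) * (fps_of_poly \<Lambda> ^ (n - 1 - j) * Z ^ j)"
        by (subst 3[OF j]) (simp only: fps_of_poly_smult fps_of_poly_power power_mult_distrib fps_const_power fps_const_mult[symmetric] mult_ac)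
      also have "\<dots> = fps_const (c * inverse \<zeta>) * (fps_of_poly \<Lambda> ^ (n - 1 - j) * (fps_const \<zeta> * Z) ^ j)"
        unfolding cc by (simp only: power_mult_distrib fps_const_power fps_const_mult[symmetric] mult_ac)
      finally show "?f j * (fps_const (\<zeta> ^ 2) * Z) ^ j = fps_const (c * inverse \<zeta>) * (fps_of_poly \<Lambda> ^ (n - 1 - j) * (fps_const \<zeta> * Z) ^ j)" .
    qed
    then have "(fps_of_poly \<Lambda> - fps_const \<zeta> * Z) * V 2 = fps_const (c * inverse \<zeta>) *
      ((fps_of_poly \<Lambda> - fps_const \<zeta> * Z) * (\<Sum>j<n. fps_of_poly \<Lambda> ^ (n - 1 - j) * (fps_const \<zeta> * Z) ^ j))"
      by (simp only: mult.left_commute)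
    then show ?thesis unfolding power_diff_sum .
  qed
  also have "(fps_const \<zeta> * Z) ^ n = Z ^ n" by (simp add: power_mult_distrib fps_const_power z0)
  finally have eq: "(fps_of_poly \<Lambda> - fps_const \<zeta> * Z) * V 2 = (fps_of_poly (\<Lambda> ^ n) - Z ^ n) * fps_const (c * inverse \<zeta>)"
    by (simp only: fps_of_poly_power mult_ac)
  have "fps_X ^ Suc n dvd (fps_of_poly \<Lambda> - fps_const \<zeta> * Z) * V 2" using V2 by (rule dvd_mult)
  then have d: "fps_X ^ Suc n dvd (fps_of_poly (\<Lambda> ^ n) - Z ^ n) * fps_const (c * inverse \<zeta>)" unfolding eq .
  have "fps_nth (fps_const (c * inverse \<zeta>)) 0 \<noteq> 0" using c0 z0 by simp
  from this d have "fps_X ^ Suc n dvd (fps_of_poly (\<Lambda> ^ n) - Z ^ n)" by (rule fps_unit_dvd_cancel)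
  moreover have "\<forall>j<n. p j = Polynomial.smult (c * inverse \<zeta> ^ Suc j) (\<Lambda> ^ (n - 1 - j))"
    by (intro allI impI 3)
  ultimately have "c \<noteq> 0 \<and> Polynomial.degree \<Lambda> \<le> 1 \<and> poly \<Lambda> 0 = fps_nth Z 0 \<and>
    (\<forall>j<n. p j = Polynomial.smult (c * inverse \<zeta> ^ Suc j) (\<Lambda> ^ (n - 1 - j))) \<and>
    fps_X ^ Suc n dvd fps_of_poly (\<Lambda> ^ n) - Z ^ n"
    using c0 dL L0 by (intro conjI)
  then show ?thesis by (rule exI[of _ c, OF exI[of _ \<Lambda>]])
qed

text \<open>For \<open>n = 3\<close> the hypotheses can be satisfied: the quartic case has curves with four inner Galois points.\<close>

lemma no_moebius_symmetry:
  fixes \<zeta> \<kappa> :: "'k::field_char_0"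
  assumes n: "n \<ge> 4" and \<zeta>: "primitive_root_of_unity n \<zeta>" and k0: "\<kappa> \<noteq> 0" and kn: "(1 + \<kappa>) ^ n = 1"
    and ki: "\<And>i. i < n \<Longrightarrow> i \<noteq> 1 \<Longrightarrow> (1 + \<kappa> * (\<zeta> ^ i - 1) / (\<zeta> ^ i - \<zeta>)) ^ n = 1"
  shows False
proof -
  have z0: "\<zeta> \<noteq> 0" "\<zeta> ^ n = 1" using primitive_root_nonzero[OF \<zeta>] \<zeta> by (auto simp: primitive_root_of_unity_def)
  have z1: "\<zeta> \<noteq> 1"
    using primitive_root_power_inj[OF \<zeta>, of 0 1] n by auto
  have zi: "\<zeta> ^ i \<noteq> \<zeta>" if "i < n" "i \<noteq> 1" for i
    using primitive_root_power_inj[OF \<zeta>, of i 1] n that by auto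
  define a where "a = 1 + \<kappa>"
  have a0: "a \<noteq> 0" using kn n by (auto simp: a_def power_0_left)
  let ?b = "- (\<zeta> + \<kappa>)"
  \<comment> \<open>Clearing denominators in \<open>ki\<close> shows that q vanishes at every n-th
    root of unity other than \<zeta>, just as r = (X^n - 1) / (X - \<zeta>) does.\<close>
  define q where "q = [:?b, a:] ^ n - [:- \<zeta>, 1:] ^ n"
  define r where "r = (\<Sum>k<n. Polynomial.monom (\<zeta> ^ (n - 1 - k)) k)"
  have cr: "Polynomial.coeff r k = (if k < n then \<zeta> ^ (n - 1 - k) else 0)" for k
    by (simp add: r_def Polynomial.coeff_sum sum.delta)
  have pr: "poly r x * (\<zeta> - x) = 1 - x ^ n" for x
    using power_diff_sum[of \<zeta> x n] by (simp add: r_def poly_sum poly_monom z0 mult_ac)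
  have rq: "poly q (\<zeta> ^ i) = 0" "poly r (\<zeta> ^ i) = 0" if i: "i < n" "i \<noteq> 1" for i
  proof -
    have d: "\<zeta> ^ i - \<zeta> \<noteq> 0" using zi[OF i] by simp
    have "\<zeta> ^ i * a + ?b = (\<zeta> ^ i - \<zeta>) * (1 + \<kappa> * (\<zeta> ^ i - 1) / (\<zeta> ^ i - \<zeta>))"
      using d by (simp add: a_def field_simps)
    then have "(?b + \<zeta> ^ i * a) ^ n = (\<zeta> ^ i - \<zeta>) ^ n" using ki[OF i] by (simp add: power_mult_distrib add.commute)
    then show "poly q (\<zeta> ^ i) = 0" by (simp add: q_def algebra_simps)
    have "(\<zeta> ^ i) ^ n = 1" by (metis mult.commute power_mult power_one z0(2))
    then show "poly r (\<zeta> ^ i) = 0" using pr[of "\<zeta> ^ i"] zi[OF i] by simp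
  qed
  have cq: "Polynomial.coeff q k = of_nat (n choose k) * (a ^ k * ?b ^ (n - k) - (- \<zeta>) ^ (n - k))" if "k \<le> n" for k
    unfolding q_def Polynomial.coeff_diff coeff_linear_poly_power[OF that] by (simp add: algebra_simps)
  have dq: "Polynomial.degree q \<le> n"
    unfolding q_def using degree_power_le[of "[:?b, a:]" n] degree_power_le[of "[:- \<zeta>, 1:]" n]
    by (intro degree_diff_le) (auto split: if_splits intro: order_trans)
  define L where "L = Polynomial.coeff q (n - 1)"
  define p where "p = q - Polynomial.smult L r"
  \<comment> \<open>The coefficient of X^n in q is a^n - 1 = 0 and that of X^(n-1) has been
    subtracted, so p has degree at most n - 2 but n - 1 zeros.\<close>
  have "p = 0"
  proof (rule ccontr)
    assume p0: "p \<noteq> 0"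
    have "Polynomial.coeff p k = 0" if kk: "k > n - 2" for k
    proof -
      consider "k = n - 1" | "k = n" | "k > n" using kk n by linarith
      then show ?thesis
      proof cases
        case 1 then show ?thesis using n by (simp add: p_def L_def cr)
      next
        case 2 then show ?thesis using kn by (simp add: p_def cr cq a_def)
      next
        case 3 then show ?thesis using dq by (simp add: p_def cr coeff_eq_0)
      qed
    qed
    then have dp: "Polynomial.degree p \<le> n - 2" by (intro degree_le) auto
    let ?A = "(\<lambda>i. \<zeta> ^ i) ` ({..<n} - {1})"
    have "inj_on (\<lambda>i. \<zeta> ^ i) ({..<n} - {1})" using primitive_root_power_inj[OF \<zeta>] by (auto intro!: inj_onI)
    then have "card ?A = n - 1" using n by (simp add: card_image)
    moreover have "card ?A \<le> card {x. poly p x = 0}"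
      using poly_roots_finite[OF p0] rq by (intro card_mono) (auto simp: p_def)
    ultimately show False using card_poly_roots_bound[OF p0] dp n by linarith
  qed
  then have coe: "Polynomial.coeff q k = L * Polynomial.coeff r k" for k
    by (metis p_def coeff_smult eq_iff_diff_eq_0)
  define \<alpha> where "\<alpha> = (\<zeta> + \<kappa>) / a"
  have an: "a ^ n = 1" using kn by (simp add: a_def)
  \<comment> \<open>The coefficients of q = L r at X^(n-1), X^(n-2) and X^(n-3), where \<alpha> is
    the zero of the linear factor in q: three equations for L and \<alpha>, so elimination leaves a
    condition on n alone.\<close>
  have j: "of_nat (n choose j) * (- 1) ^ j * (\<alpha> ^ j - \<zeta> ^ j) = L * \<zeta> ^ (j - 1)" if j: "1 \<le> j" "j \<le> 3" for j
  proof -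
    have "n choose (n - j) = n choose j" using j n by (intro binomial_symmetric[symmetric]) linarith
    moreover have "a ^ (n - j) * ?b ^ j = (- 1) ^ j * \<alpha> ^ j"
    proof -
      have "a ^ (n - j) * a ^ j = 1" using j n an by (simp flip: power_add)
      then have "a ^ (n - j) = inverse (a ^ j)" by (metis inverse_unique mult.commute)
      moreover have "?b ^ j = (- 1) ^ j * (\<zeta> + \<kappa>) ^ j" by (rule power_minus)
      ultimately show ?thesis using a0 by (simp add: \<alpha>_def power_divide field_simps)
    qed
    moreover have "(- \<zeta>) ^ j = (- 1) ^ j * \<zeta> ^ j" by (rule power_minus)
    moreover have "n - (n - j) = j" "n - 1 - (n - j) = j - 1" using j n by auto
    ultimately show ?thesis using cq[of "n - j"] coe[of "n - j"] cr[of "n - j"] j n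
      by (simp add: algebra_simps)
  qed
  define N where "N = (of_nat n :: 'k)"
  have b1: "of_nat (n choose 1) = N" by (simp add: N_def)
  have b2: "2 * of_nat (n choose 2) = N * (N - 1)"
  proof -
    have "Suc 1 * (Suc (n - 1) choose Suc 1) = Suc (n - 1) * ((n - 1) choose 1)" by (rule Suc_times_binomial)
    then have "2 * (n choose 2) = n * (n - 1)" using n by (simp add: numeral_2_eq_2)
    then have "of_nat (2 * (n choose 2)) = (of_nat (n * (n - 1)) :: 'k)" by simp
    then show ?thesis using n by (simp add: N_def of_nat_diff)
  qed
  have b3: "6 * of_nat (n choose 3) = N * (N - 1) * (N - 2)"
  proof -
    have "(Suc 2) * (Suc (n - 1) choose Suc 2) = Suc (n - 1) * ((n - 1) choose 2)" by (rule Suc_times_binomial)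
    then have 1: "3 * (n choose 3) = n * ((n - 1) choose 2)" using n by (simp add: numeral_3_eq_3 numeral_2_eq_2)
    have "Suc (n - 2) = n - 1" using n by simp
    then have "Suc 1 * ((n - 1) choose Suc 1) = (n - 1) * ((n - 2) choose 1)" by (metis Suc_times_binomial)
    then have 2: "2 * ((n - 1) choose 2) = (n - 1) * (n - 2)" by (simp only: Suc_1 choose_one)
    have "6 * (n choose 3) = 2 * (3 * (n choose 3))" by simp
    also have "\<dots> = n * (2 * ((n - 1) choose 2))" unfolding 1 by simp
    also have "\<dots> = n * (n - 1) * (n - 2)" unfolding 2 by (simp only: mult.assoc)
    finally have "6 * (n choose 3) = n * (n - 1) * (n - 2)" .
    then have "of_nat (6 * (n choose 3)) = (of_nat (n * (n - 1) * (n - 2)) :: 'k)" by (simp only:)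
    then show ?thesis using n by (simp add: N_def of_nat_diff)
  qed
  define D where "D = \<alpha> - \<zeta>"
  have D0: "D \<noteq> 0"
  proof
    assume "D = 0"
    then have "\<zeta> + \<kappa> = \<zeta> * a" using a0 by (simp add: D_def \<alpha>_def field_simps)
    then have "\<kappa> * (1 - \<zeta>) = 0" by (simp add: a_def algebra_simps)
    then show False using k0 z1 by simp
  qed
  have Nnz: "N \<noteq> 0" "N - 1 \<noteq> 0" "N - 3 \<noteq> 0" "N + 1 \<noteq> 0"
  proof -
    show "N \<noteq> 0" using n by (simp add: N_def)
    show "N - 1 \<noteq> 0" using n by (simp add: N_def)
    show "N - 3 \<noteq> 0"
    proof
      assume "N - 3 = 0"
      then have "(of_nat n :: 'k) = of_nat 3" by (simp add: N_def)
      then have "n = 3" by (rule of_nat_eq_iff[THEN iffD1])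
      then show False using n by simp
    qed
    have "N + 1 = of_nat (Suc n)" by (simp add: N_def)
    then show "N + 1 \<noteq> 0" by (simp only: of_nat_neq_0 not_False_eq_True)
  qed
  have L: "L = - N * D" using j[of 1] b1 by (simp add: D_def algebra_simps)
  have ND: "N * D \<noteq> 0" using Nnz D0 by simp
  have e2: "(N - 1) * (\<alpha> + \<zeta>) = - 2 * \<zeta>"
  proof -
    have "2 * (of_nat (n choose 2) * (\<alpha> ^ 2 - \<zeta> ^ 2)) = 2 * (L * \<zeta>)" using j[of 2] by simp
    then have "(2 * of_nat (n choose 2)) * (\<alpha> ^ 2 - \<zeta> ^ 2) = 2 * (L * \<zeta>)" by (simp only: mult.assoc)
    then have "(N * D) * ((N - 1) * (\<alpha> + \<zeta>)) = (N * D) * (- 2 * \<zeta>)"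
      unfolding b2 L by (simp add: D_def power2_eq_square algebra_simps)
    then show ?thesis by (rule iffD1[OF mult_left_cancel[OF ND]])
  qed
  have e3: "(N - 1) * (N - 2) * (\<alpha> ^ 2 + \<alpha> * \<zeta> + \<zeta> ^ 2) = 6 * \<zeta> ^ 2"
  proof -
    have "- (6 * (of_nat (n choose 3) * (\<alpha> ^ 3 - \<zeta> ^ 3))) = 6 * (L * \<zeta> ^ 2)" using j[of 3] by simp
    then have "- ((6 * of_nat (n choose 3)) * (\<alpha> ^ 3 - \<zeta> ^ 3)) = 6 * (L * \<zeta> ^ 2)" by (simp only: mult.assoc)
    then have "(N * D) * ((N - 1) * (N - 2) * (\<alpha> ^ 2 + \<alpha> * \<zeta> + \<zeta> ^ 2)) = (N * D) * (6 * \<zeta> ^ 2)"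
      unfolding b3 L by (simp add: D_def power2_eq_square power3_eq_cube algebra_simps)
    then show ?thesis by (rule iffD1[OF mult_left_cancel[OF ND]])
  qed
  have al: "(N - 1) * \<alpha> = - (N + 1) * \<zeta>" using e2 by (simp add: algebra_simps)
  have "(N - 1) * 6 * \<zeta> ^ 2 = (N - 2) * (((N - 1) * \<alpha>) ^ 2 + ((N - 1) * \<alpha>) * ((N - 1) * \<zeta>) + ((N - 1) * \<zeta>) ^ 2)"
  proof -
    have "(N - 1) * (6 * \<zeta> ^ 2) = (N - 1) * ((N - 1) * (N - 2) * (\<alpha> ^ 2 + \<alpha> * \<zeta> + \<zeta> ^ 2))" unfolding e3 ..
    then show ?thesis by (simp add: power2_eq_square algebra_simps)
  qed
  \<comment> \<open>Inserting the value of \<alpha> leaves N (N - 3) (N + 1) = 0, impossible for n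
    \<ge> 4 in characteristic zero.\<close>
  then have "\<zeta> ^ 2 * (N * (N - 3) * (N + 1)) = 0"
    unfolding al by (simp add: power2_eq_square algebra_simps)
  then show False using Nnz z0 by simp
qed

section \<open>Projections from points of the normal form\<close>

context superelliptic
begin

definition uu :: "'k \<Rightarrow> 'k fls" where "uu x = X0 - fls_const x"
text \<open>The slope of the line from (x, z) to the generic point, hence a coordinate for the
  projection from (x, z).\<close>

definition tt :: "'k \<Rightarrow> 'k \<Rightarrow> 'k fls" where "tt x z = (Z0 - fls_const z) / uu x"

lemma uu_nonzero: "uu x \<noteq> 0"
  using nonconst_X0 by (auto simp: uu_def nonconst_def)

lemma uu_in_S: "uu x \<in> S" and tt_in_S: "tt x z \<in> S"
  by (simp_all add: uu_def tt_def S_closed)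

lemma tt_uu: "tt x z * uu x = Z0 - fls_const z"
  using uu_nonzero by (simp add: tt_def)

lemma X0_uu: "X0 = fls_const x + uu x" and Z0_tt: "Z0 = fls_const z + uu x * tt x z"
  using tt_uu[of x z] by (simp_all add: uu_def mult.commute)

lemma emb_uu: "place \<xi> \<eta> \<Longrightarrow> emb \<xi> \<eta> (uu x) = \<xi> - fls_const x"
  unfolding uu_def using emb_diff[OF _ X0_in_S S_const] emb_X0 emb_const by (simp add: place_def)

lemma emb_tt: "place \<xi> \<eta> \<Longrightarrow> emb \<xi> \<eta> (tt x z) = (\<eta> - fls_const z) / (\<xi> - fls_const x)"
proof -
  assume p: "place \<xi> \<eta>"
  have "emb \<xi> \<eta> (Z0 - fls_const z) = \<eta> - fls_const z"
    using emb_diff[OF p Z0_in_S S_const] emb_Z0 emb_const p by (simp add: place_def)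
  moreover have "Z0 - fls_const z \<in> S" by (intro S_closed)
  ultimately show ?thesis unfolding tt_def using emb_divide[OF p _ uu_in_S] emb_uu[OF p] by simp
qed

end

locale projection = superelliptic n g for n and g :: "'k::{alg_closed_field, field_char_0} poly" +
  fixes x0 z0 :: 'k and l m :: "'k ^ 3"
  assumes zeros: "zeros l m = point (vector [x0, 1, z0])"
begin

abbreviation "E \<equiv> quot (pencil (pt X0 Z0) l m)"

text \<open>If the minor vanished, the two forms would have a further common zero (a : 0 : b), but
  the only one has second coordinate 1.\<close>

lemma zeros_at_point:
  "l $ 1 * x0 + l $ 2 + l $ 3 * z0 = 0" "m $ 1 * x0 + m $ 2 + m $ 3 * z0 = 0" "l $ 1 * m $ 3 - l $ 3 * m $ 1 \<noteq> 0"
proof -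
  let ?q = "vector [x0, 1, z0] :: 'k ^ 3"
  have q: "?q \<in> zeros l m" using zeros point_self[of ?q] by simp
  then show "l $ 1 * x0 + l $ 2 + l $ 3 * z0 = 0" "m $ 1 * x0 + m $ 2 + m $ 3 * z0 = 0"
    by (simp_all add: zeros_def mp_value_linear_form sum_3)
  show "l $ 1 * m $ 3 - l $ 3 * m $ 1 \<noteq> 0"
  proof
    assume D: "l $ 1 * m $ 3 - l $ 3 * m $ 1 = 0"
    have "\<exists>a b. (a \<noteq> 0 \<or> b \<noteq> 0) \<and> l $ 1 * a + l $ 3 * b = 0 \<and> m $ 1 * a + m $ 3 * b = 0"
    proof (cases "l $ 1 = 0 \<and> l $ 3 = 0")
      case True
      show ?thesis
      proof (cases "m $ 1 = 0 \<and> m $ 3 = 0")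
        case True with \<open>l $ 1 = 0 \<and> l $ 3 = 0\<close> show ?thesis by (intro exI[of _ 1] exI[of _ 0]) simp
      next
        case False with True show ?thesis by (intro exI[of _ "- m $ 3"] exI[of _ "m $ 1"]) auto
      qed
    next
      case False
      then show ?thesis using D by (intro exI[of _ "- l $ 3"] exI[of _ "l $ 1"]) (auto simp: algebra_simps)
    qed
    then obtain a b where ab: "a \<noteq> 0 \<or> b \<noteq> 0" "l $ 1 * a + l $ 3 * b = 0" "m $ 1 * a + m $ 3 * b = 0" by blast
    let ?v = "vector [a, 0, b] :: 'k ^ 3"
    have "?v \<noteq> 0" using ab(1) by (auto simp: vec_eq_iff forall_3)
    then have "?v \<in> zeros l m" using ab by (simp add: zeros_def mp_value_linear_form sum_3)
    then obtain c where "c \<noteq> 0" "?v = c *s ?q" unfolding zeros by (auto simp: point_def)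
    then have "?v $ 2 = c * ?q $ 2" by simp
    then show False using \<open>c \<noteq> 0\<close> by simp
  qed
qed

text \<open>Both forms vanish at the centre, so each is x - x0 times an affine function of the
  slope; the common factor cancels in quotients of equal degree.\<close>

lemma pencil_eq:
  "pencil (pt X0 Z0) l m = (\<lambda>i. uu x0 * (if i = 1 then fls_const (l $ 1) + fls_const (l $ 3) * tt x0 z0
     else fls_const (m $ 1) + fls_const (m $ 3) * tt x0 z0))"
proof -
  have *: "ev (pt X0 Z0) (linear_form a) = uu x0 * (fls_const (a $ 1) + fls_const (a $ 3) * tt x0 z0)"
    if "a $ 1 * x0 + a $ 2 + a $ 3 * z0 = 0" for a :: "'k ^ 3"
  proof -
    have a2: "a $ 2 = - (a $ 1 * x0) - a $ 3 * z0" using that by (simp add: algebra_simps eq_neg_iff_add_eq_0)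
    have "uu x0 * (fls_const (a $ 1) + fls_const (a $ 3) * tt x0 z0) = fls_const (a $ 1) * uu x0 + fls_const (a $ 3) * (tt x0 z0 * uu x0)"
      by (simp add: algebra_simps)
    also have "\<dots> = fls_const (a $ 1) * X0 + fls_const (a $ 2) + fls_const (a $ 3) * Z0"
      unfolding tt_uu unfolding a2 uu_def by (simp add: algebra_simps flip: fls_minus_const)
    finally show ?thesis by (simp add: fls_hom.mp_eval_linear_form sum_3)
  qed
  show ?thesis using *[OF zeros_at_point(1)] *[OF zeros_at_point(2)] by (simp add: fun_eq_iff)
qed

lemma tt_in_E: "tt x0 z0 \<in> E"
proof -
  let ?D = "l $ 1 * m $ 3 - l $ 3 * m $ 1"
  let ?p = "pencil (pt X0 Z0) l m"
  \<comment> \<open>Cramer's rule: the two values are in the ratio of the slope to 1.\<close>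
  define A :: "('k, 2) mpoly" where "A = mp_const (l $ 1) * mp_var 2 - mp_const (m $ 1) * mp_var 1"
  define B :: "('k, 2) mpoly" where "B = mp_const (m $ 3) * mp_var 1 - mp_const (l $ 3) * mp_var 2"
  have hA: "homogeneous (Suc 0) A" "homogeneous (Suc 0) B"
    unfolding A_def B_def by (intro homogeneous_diff homogeneous_const_mult homogeneous_var)+
  have 21: "(2::2) \<noteq> 1" by simp
  have D: "fls_const (l $ 1) * fls_const (m $ 3) - fls_const (l $ 3) * fls_const (m $ 1) = fls_const ?D"
    by (simp flip: fls_minus_const)
  have "ev ?p A = uu x0 * tt x0 z0 * (fls_const (l $ 1) * fls_const (m $ 3) - fls_const (l $ 3) * fls_const (m $ 1))"
    unfolding pencil_eq A_def fls_hom.mp_eval_diff fls_hom.mp_eval_mult fls_hom.mp_eval_const fls_hom.mp_eval_var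
    using 21 by (simp add: algebra_simps del: fls_const_mult_const)
  then have evA: "ev ?p A = uu x0 * tt x0 z0 * fls_const ?D" unfolding D .
  have "ev ?p B = uu x0 * (fls_const (l $ 1) * fls_const (m $ 3) - fls_const (l $ 3) * fls_const (m $ 1))"
    unfolding pencil_eq B_def fls_hom.mp_eval_diff fls_hom.mp_eval_mult fls_hom.mp_eval_const fls_hom.mp_eval_var
    using 21 by (simp add: algebra_simps del: fls_const_mult_const)
  then have evB: "ev ?p B = uu x0 * fls_const ?D" unfolding D .
  have nz: "ev ?p B \<noteq> 0" unfolding evB using uu_nonzero zeros_at_point(3) by simp
  have "ev ?p A / ev ?p B = tt x0 z0" unfolding evA evB using uu_nonzero[of x0] zeros_at_point(3) by simp
  then show ?thesis using quotI[OF hA nz] by simp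
qed

text \<open>After cancelling powers of x - x0, an element of \<open>E\<close> is a rational function
  of the slope.\<close>

lemma emb_agree_on_E:
  assumes p: "place \<xi> \<eta>" "place \<xi>' \<eta>'" and t: "emb \<xi> \<eta> (tt x0 z0) = emb \<xi>' \<eta>' (tt x0 z0)" and e: "e \<in> E"
  shows "emb \<xi> \<eta> e = emb \<xi>' \<eta>' e"
proof -
  obtain A B N where AB: "homogeneous N A" "homogeneous N B" "ev (pencil (pt X0 Z0) l m) B \<noteq> 0"
    "e = ev (pencil (pt X0 Z0) l m) A / ev (pencil (pt X0 Z0) l m) B" using e by (elim quotE)
  let ?a = "\<lambda>i::2. if i = 1 then l $ 1 else m $ 1" and ?b = "\<lambda>i::2. if i = 1 then l $ 3 else m $ 3"
  let ?s = "\<lambda>T i. fls_const (?a i) + fls_const (?b i) * T"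
  have pe: "pencil (pt X0 Z0) l m = (\<lambda>i. uu x0 * ?s (tt x0 z0) i)" unfolding pencil_eq by (rule ext) simp
  have e: "e = ev (?s (tt x0 z0)) A / ev (?s (tt x0 z0)) B"
    unfolding AB(4) pe fls_hom.mp_eval_homogeneous_scale[OF AB(1)] fls_hom.mp_eval_homogeneous_scale[OF AB(2)]
    using uu_nonzero[of x0] by simp
  have sS: "?s (tt x0 z0) i \<in> S" for i by (intro S_closed tt_in_S)
  have es: "(\<lambda>i. emb \<xi> \<eta> (?s (tt x0 z0) i)) = ?s (emb \<xi> \<eta> (tt x0 z0))" if "place \<xi> \<eta>" for \<xi> \<eta>
  proof
    fix i :: 2
    have "fls_const (?b i) * tt x0 z0 \<in> S" by (intro S_closed tt_in_S)
    then show "emb \<xi> \<eta> (?s (tt x0 z0) i) = ?s (emb \<xi> \<eta> (tt x0 z0)) i"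
      using emb_add[OF that S_const, of "fls_const (?b i) * tt x0 z0" "?a i"] emb_mult[OF that S_const tt_in_S, of "?b i"]
        emb_const that by (simp add: place_def)
  qed
  have "emb \<xi> \<eta> e = ev (?s (emb \<xi> \<eta> (tt x0 z0))) A / ev (?s (emb \<xi> \<eta> (tt x0 z0))) B" if p: "place \<xi> \<eta>" for \<xi> \<eta>
    unfolding e emb_divide[OF p emb_ev_S(1)[OF p sS] emb_ev_S(1)[OF p sS]] emb_ev_S(2)[OF p sS] es[OF p] ..
  then show ?thesis using p t by simp
qed

lemma const_in_E: "fls_const c \<in> E"
  by (rule quot_const)

text \<open>An automorphism over the projection fixes the slope, so it moves the generic point along
  its line through the centre.\<close>

lemma conjugate:
  assumes s: "\<sigma> \<in> gal_group E"
  shows "\<sigma> (uu x0) \<in> S" "\<sigma> (uu x0) \<noteq> 0" "\<sigma> X0 = fls_const x0 + \<sigma> (uu x0)" "\<sigma> Z0 = fls_const z0 + \<sigma> (uu x0) * tt x0 z0"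
    "(fls_const z0 + \<sigma> (uu x0) * tt x0 z0) ^ n = pev g (fls_const x0 + \<sigma> (uu x0))"
proof -
  have a: "\<sigma> \<in> autos" using gal_group_autos[OF const_in_E s] .
  show "\<sigma> (uu x0) \<in> S" using autosD(1)[OF a uu_in_S] .
  show "\<sigma> (uu x0) \<noteq> 0" using autos_inj[OF a uu_in_S S_0] autosD(5)[OF a] uu_nonzero by auto
  show X: "\<sigma> X0 = fls_const x0 + \<sigma> (uu x0)"
    using autosD(2)[OF a S_const uu_in_S, of x0 x0] autosD(4)[OF a] X0_uu[of x0] by simp
  have "\<sigma> (tt x0 z0) = tt x0 z0" using s tt_in_E by (simp add: gal_group_def)
  moreover have "uu x0 * tt x0 z0 \<in> S" by (intro S_closed uu_in_S tt_in_S)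
  ultimately show Z: "\<sigma> Z0 = fls_const z0 + \<sigma> (uu x0) * tt x0 z0"
    using autosD(2)[OF a S_const, of "uu x0 * tt x0 z0" z0] autosD(3)[OF a uu_in_S tt_in_S] autosD(4)[OF a] Z0_tt[of z0 x0] by simp
  have "\<sigma> Z0 ^ n = pev g (\<sigma> X0)"
    using curve_generic autos_power[OF a Z0_in_S, of n] autos_pev[OF a X0_in_S, of g] by (simp add: curve_def)
  then show "(fls_const z0 + \<sigma> (uu x0) * tt x0 z0) ^ n = pev g (fls_const x0 + \<sigma> (uu x0))" unfolding X Z .
qed

text \<open>Its zeros are the differences x - x0 at the affine points where the line of slope
  \<open>T\<close> through (x0, z0) meets the curve; 0 is among them when (x0, z0) lies on the
  curve.\<close>

definition rel_poly :: "'k fls \<Rightarrow> 'k fls poly"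
  where "rel_poly T = [:fls_const z0, T:] ^ n - pcompose (map_poly fls_const g) [:fls_const x0, 1:]"

lemma poly_rel_poly: "poly (rel_poly T) f = (fls_const z0 + f * T) ^ n - pev g (fls_const x0 + f)"
  by (simp add: rel_poly_def poly_pcompose pev_def)

lemma rel_poly_degree: "rel_poly T \<noteq> 0" "Polynomial.degree (rel_poly T) \<le> Suc n"
proof -
  have "Polynomial.degree (map_poly fls_const g) = Polynomial.degree g" by (rule degree_map_poly) simp
  then have d2: "Polynomial.degree (pcompose (map_poly fls_const g) [:fls_const x0, 1:]) = Suc n"
    using degree_g by (simp add: degree_pcompose)
  have d1: "Polynomial.degree ([:fls_const z0, T:] ^ n) \<le> n"
    using degree_power_le[of "[:fls_const z0, T:]" n] by (auto split: if_splits)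
  show "Polynomial.degree (rel_poly T) \<le> Suc n" unfolding rel_poly_def using d1 d2 by (intro degree_diff_le) auto
  show "rel_poly T \<noteq> 0" unfolding rel_poly_def using d1 d2 by auto
qed

lemma conjugates_finite: "finite ((\<lambda>\<sigma>. \<sigma> (uu x0)) ` gal_group E)"
proof (rule finite_subset)
  show "(\<lambda>\<sigma>. \<sigma> (uu x0)) ` gal_group E \<subseteq> {f. poly (rel_poly (tt x0 z0)) f = 0}"
    using conjugate(5) by (auto simp: poly_rel_poly)
qed (rule poly_roots_finite[OF rel_poly_degree(1)])

lemma emb_conjugate:
  assumes s: "\<sigma> \<in> gal_group E" and p: "place \<xi> \<eta>"
  shows "(fls_const z0 + emb \<xi> \<eta> (\<sigma> (uu x0)) * emb \<xi> \<eta> (tt x0 z0)) ^ n = pev g (fls_const x0 + emb \<xi> \<eta> (\<sigma> (uu x0)))"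
proof -
  note f = conjugate(1)[OF s]
  have nc: "nonconst \<xi>" using p by (simp add: place_def)
  have ft: "\<sigma> (uu x0) * tt x0 z0 \<in> S" using f by (intro S_closed tt_in_S)
  have "emb \<xi> \<eta> ((fls_const z0 + \<sigma> (uu x0) * tt x0 z0) ^ n) = emb \<xi> \<eta> (pev g (fls_const x0 + \<sigma> (uu x0)))"
    using conjugate(5)[OF s] by simp
  then show ?thesis
    using emb_power[OF p S_closed(1)[OF S_const ft]] emb_pev[OF p S_closed(1)[OF S_const f]]
      emb_add[OF p S_const ft] emb_add[OF p S_const f] emb_mult[OF p f tt_in_S] emb_const[OF nc] by simp
qed

text \<open>The function field is generated by x - x0 and the slope, and the slope is fixed; so
  agreement on x - x0 determines the whole expansion.\<close>

lemma conjugate_place: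
  assumes s: "\<sigma> \<in> gal_group E" and p: "place \<xi>0 \<eta>0" "place \<xi>1 \<eta>1"
    and t: "emb \<xi>1 \<eta>1 (tt x0 z0) = emb \<xi>0 \<eta>0 (tt x0 z0)"
    and u: "emb \<xi>1 \<eta>1 (\<sigma> (uu x0)) = emb \<xi>0 \<eta>0 (uu x0)" and f: "f \<in> S"
  shows "emb \<xi>1 \<eta>1 (\<sigma> f) = emb \<xi>0 \<eta>0 f"
proof -
  have a: "\<sigma> \<in> autos" using gal_group_autos[OF const_in_E s] .
  have nc: "nonconst \<xi>0" "nonconst \<xi>1" using p by (simp_all add: place_def)
  note c = conjugate[OF s]
  have "emb \<xi>1 \<eta>1 (\<sigma> X0) = fls_const x0 + emb \<xi>0 \<eta>0 (uu x0)"
    unfolding c(3) using emb_add[OF p(2) S_const c(1)] emb_const[OF nc(2)] u by simp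
  also have "\<dots> = \<xi>0" by (simp add: emb_uu[OF p(1)])
  finally have X: "emb \<xi>1 \<eta>1 (\<sigma> X0) = \<xi>0" .
  have ft: "\<sigma> (uu x0) * tt x0 z0 \<in> S" using c(1) by (intro S_closed tt_in_S)
  have "emb \<xi>1 \<eta>1 (\<sigma> Z0) = fls_const z0 + emb \<xi>0 \<eta>0 (uu x0) * emb \<xi>0 \<eta>0 (tt x0 z0)"
    unfolding c(4) using emb_add[OF p(2) S_const ft] emb_mult[OF p(2) c(1) tt_in_S] emb_const[OF nc(2)] u t by simp
  also have "emb \<xi>0 \<eta>0 (uu x0) * emb \<xi>0 \<eta>0 (tt x0 z0) = emb \<xi>0 \<eta>0 (Z0 - fls_const z0)"
    using emb_mult[OF p(1) uu_in_S tt_in_S, of x0 x0 z0] tt_uu[of x0 z0] unfolding mult.commute[of "uu x0"] by argo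
  also have "\<dots> = \<eta>0 - fls_const z0" using emb_diff[OF p(1) Z0_in_S S_const] emb_Z0[OF nc(1)] emb_const[OF nc(1)] by simp
  finally have Z: "emb \<xi>1 \<eta>1 (\<sigma> Z0) = \<eta>0" by simp
  show ?thesis using autos_place(2)[OF a p(2) f] unfolding X Z .
qed

lemma exists_conjugating:
  assumes gal: "galois_extension (subset_ring S) E" and p: "place \<xi>0 \<eta>0" "place \<xi>1 \<eta>1"
    and t: "emb \<xi>1 \<eta>1 (tt x0 z0) = emb \<xi>0 \<eta>0 (tt x0 z0)"
  obtains \<sigma> where "\<sigma> \<in> gal_group E" "\<And>f. f \<in> S \<Longrightarrow> emb \<xi>1 \<eta>1 (\<sigma> f) = emb \<xi>0 \<eta>0 f"
proof -
  have "\<exists>\<sigma>\<in>gal_group E. emb \<xi>1 \<eta>1 (\<sigma> (uu x0)) = emb \<xi>0 \<eta>0 (uu x0)"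
    using emb_agree_on_E[OF p t[symmetric]]
    by (intro galois_transitive[OF gal const_in_E p _ uu_in_S conjugates_finite]) auto
  then show ?thesis using that conjugate_place[OF _ p t] by blast
qed

text \<open>A pole of order k of the conjugate would give the right side of the relation a pole of
  order (n + 1) k, but the left side, an n-th power with regular slope, a pole of order at most n
  k.\<close>

lemma conjugate_regular:
  assumes s: "\<sigma> \<in> gal_group E" and p: "place \<xi> \<eta>" and T: "reg (emb \<xi> \<eta> (tt x0 z0))"
  shows "reg (emb \<xi> \<eta> (\<sigma> (uu x0)))"
proof (rule ccontr)
  let ?T = "emb \<xi> \<eta> (tt x0 z0)" and ?F = "emb \<xi> \<eta> (\<sigma> (uu x0))"
  assume "\<not> reg ?F"
  then have neg: "fls_subdegree ?F < 0" by simp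
  then have F0: "?F \<noteq> 0" by auto
  have eq: "(fls_const z0 + ?F * ?T) ^ n = pev g (fls_const x0 + ?F)" by (rule emb_conjugate[OF s p])
  have "fls_subdegree (fls_const x0 + ?F) = fls_subdegree ?F" using neg F0 by (intro fls_subdegree_add_eq2) auto
  then have sub: "fls_subdegree (pev g (fls_const x0 + ?F)) = int (Suc n) * fls_subdegree ?F" "pev g (fls_const x0 + ?F) \<noteq> 0"
  proof -
    have g0: "g \<noteq> 0" using degree_g by auto
    have *: "fls_subdegree (fls_const x0 + ?F) < 0" using neg \<open>fls_subdegree (fls_const x0 + ?F) = fls_subdegree ?F\<close> by simp
    show "fls_subdegree (pev g (fls_const x0 + ?F)) = int (Suc n) * fls_subdegree ?F" "pev g (fls_const x0 + ?F) \<noteq> 0"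
      using pev_subdegree_neg[OF * g0] \<open>fls_subdegree (fls_const x0 + ?F) = fls_subdegree ?F\<close> degree_g by simp_all
  qed
  have "(fls_const z0 * inverse ?F + ?T) * ?F = fls_const z0 + ?F * ?T" using F0 by (simp add: algebra_simps)
  then have "(fls_const z0 * inverse ?F + ?T) ^ n * ?F ^ n = pev g (fls_const x0 + ?F)" using eq by (simp flip: power_mult_distrib)
  then have "fls_subdegree ((fls_const z0 * inverse ?F + ?T) ^ n) + int n * fls_subdegree ?F = int (Suc n) * fls_subdegree ?F"
    using sub F0 by (metis fls_subdegree_mult fls_subdegree_pow mult_eq_0_iff)
  then have "fls_subdegree ((fls_const z0 * inverse ?F + ?T) ^ n) < 0" using neg by (simp add: algebra_simps)
  moreover have "reg ((fls_const z0 * inverse ?F + ?T) ^ n)"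
    using neg F0 T by (intro reg_power reg_add reg_mult) auto
  ultimately show False by simp
qed

lemma subdegree_tt_generic: "fls_subdegree (tt x0 z0) = - 1"
proof -
  have 1: "fls_subdegree (Z0 - fls_const z0) = - int (Suc n)" "Z0 - fls_const z0 \<noteq> 0"
  proof -
    show "fls_subdegree (Z0 - fls_const z0) = - int (Suc n)"
      using fls_subdegree_diff_eq1[OF Z0_nonzero, of "fls_const z0"] by (simp add: subdegree_Z0)
    then show "Z0 - fls_const z0 \<noteq> 0" by auto
  qed
  have "X0 \<noteq> 0" using subdegree_X0 n0 by auto
  then have "fls_subdegree (uu x0) = - int n"
    unfolding uu_def using fls_subdegree_diff_eq1[of X0 "fls_const x0"] n0 by (simp add: subdegree_X0)
  then show ?thesis unfolding tt_def divide_inverse using 1 uu_nonzero[of x0] by simp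
qed

subsection \<open>Points on the axis\<close>

text \<open>At (x0, 0) the slope z / (x - x0) behaves like T / T^n, a pole of order n - 1, whereas
  at infinity its pole is simple. An automorphism matching the two places would make all orders at
  (x0, 0) divisible by n - 1, yet z has order 1 there.\<close>

lemma not_galois_on_axis:
  assumes z: "z0 = 0" and r: "poly g x0 = 0"
  shows "\<not> galois_extension (subset_ring S) E"
proof
  assume gal: "galois_extension (subset_ring S) E"
  obtain G where G: "fps_nth G 0 = 0" "fps_nth G 1 \<noteq> 0" and pl1: "place (fls_const x0 + fps_to_fls (fps_compose G (fps_X ^ n))) fls_X"
    using place_at_root[OF r] by blast
  let ?e = "n - 1"
  define k where "k = n - 2"
  have k: "n = Suc (Suc k)" using n4 by (simp add: k_def)
  define W where "W = fps_compose (fps_shift 1 G) (fps_X ^ n)"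
  have Xn0: "fps_nth (fps_X ^ n :: 'k fps) 0 = 0" using n0 by (simp add: fps_power_zeroth)
  have "G = fps_X * fps_shift 1 G" by (rule fps_ext) (simp add: G)
  then have GW: "fps_compose G (fps_X ^ n) = fps_X ^ n * W" unfolding W_def using Xn0
    by (metis fps_compose_mult_distrib fps_X_fps_compose_startby0)
  have W0: "fps_nth W 0 = fps_nth G 1" by (simp add: W_def)
  obtain r where r: "r ^ ?e = fps_nth W 0" using exists_nth_root[of ?e "fps_nth W 0"] n4 by auto
  \<comment> \<open>An (n-1)-st root of the unit \<open>W\<close> makes the slope the exact (n-1)-st
    power of a series with a simple pole, and that series can be reparametrised to T^(-1).\<close>
  define V where "V = fps_radical (\<lambda>_ _. r) (Suc k) W"
  have VW: "V ^ ?e = W" and V0: "fps_nth V 0 = r"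
    using iffD1[OF power_radical[of W "\<lambda>_ _. r" k]] r W0 G by (simp_all add: V_def k)
  have r0: "r \<noteq> 0" using r W0 G n4 by (auto simp: power_0_left)
  let ?a = "fps_X * V"
  have "fps_nth ?a 0 = 0" "fps_nth ?a 1 \<noteq> 0" using V0 r0 by simp_all
  then have sa: "fls_subdegree (inverse (fps_to_fls ?a)) = - 1"
  proof -
    assume a: "fps_nth ?a 0 = 0" "fps_nth ?a 1 \<noteq> 0"
    have "subdegree ?a = 1" by (rule subdegreeI) (use a in auto)
    moreover have "?a \<noteq> 0" using a by (metis fps_zero_nth)
    ultimately show ?thesis by (simp add: fls_subdegree_fls_to_fps)
  qed
  obtain H where H: "H \<noteq> 0" "fps_nth H 0 = 0" "subdegree H = 1" "fc (inverse (fps_to_fls ?a)) H = fls_X_inv"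
    using fc_fls_inverse_reparam[OF sa] by blast
  let ?x1 = "fls_const x0 + fps_to_fls (fps_compose G (fps_X ^ n)) :: 'k fls"
  have "emb ?x1 fls_X (tt x0 z0) = fls_X / fps_to_fls (fps_X ^ n * W)"
    unfolding emb_tt[OF pl1] using z by (simp add: GW)
  also have "\<dots> = inverse (fps_to_fls ?a) ^ ?e"
  proof -
    have "fps_to_fls (fps_X ^ n * W) = fls_X * fps_to_fls ?a ^ ?e"
      unfolding VW[symmetric] by (simp add: k fls_times_fps_to_fls fps_to_fls_power power_mult_distrib)
    then show ?thesis by (simp add: field_simps)
  qed
  finally have T1: "emb ?x1 fls_X (tt x0 z0) = inverse (fps_to_fls ?a) ^ ?e" .
  have p1: "place (fc ?x1 H) (fc fls_X H)" using place_fc[OF pl1 H(1,2)] .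
  have t1: "emb (fc ?x1 H) (fc fls_X H) (tt x0 z0) = fls_X_inv ^ ?e"
    unfolding emb_fc[OF pl1 tt_in_S H(1,2)] T1 fls_compose_fps_power[OF H(1,2)] H(4) ..
  obtain K where K: "K \<noteq> 0" "fps_nth K 0 = 0" "subdegree K = 1" "fc (tt x0 z0) K = fls_X_inv"
    using fc_fls_inverse_reparam[OF subdegree_tt_generic] by blast
  \<comment> \<open>Substituting T^(n-1) for the parameter at infinity gives the slope the same
    expansion as at (x0, 0).\<close>
  let ?M = "fps_X ^ ?e :: 'k fps"
  have M: "?M \<noteq> 0" "fps_nth ?M 0 = 0" using n4 by (auto simp: fps_power_zeroth)
  have pg: "place (fc X0 K) (fc Z0 K)" using place_fc[OF place_generic K(1,2)] .
  have p0: "place (fc (fc X0 K) ?M) (fc (fc Z0 K) ?M)" using place_fc[OF pg M] .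
  have e0: "emb (fc (fc X0 K) ?M) (fc (fc Z0 K) ?M) f = fc (fc f K) ?M" if "f \<in> S" for f
    unfolding emb_fc[OF pg that M] emb_fc[OF place_generic that K(1,2)] emb_generic[OF that] ..
  have t0: "emb (fc (fc X0 K) ?M) (fc (fc Z0 K) ?M) (tt x0 z0) = fls_X_inv ^ ?e"
  proof -
    have "fc fls_X_inv ?M = inverse (fc fls_X ?M)" using fls_compose_fps_inverse[OF M, of fls_X] by (simp add: fls_inverse_X)
    also have "\<dots> = inverse (fls_X ^ ?e)" by (simp add: fps_to_fls_power)
    also have "\<dots> = fls_X_inv ^ ?e" by (simp flip: power_inverse add: fls_inverse_X)
    finally show ?thesis unfolding e0[OF tt_in_S] K(4) .
  qed
  obtain \<sigma> where s: "\<sigma> \<in> gal_group E"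
    "\<And>f. f \<in> S \<Longrightarrow> emb (fc ?x1 H) (fc fls_X H) (\<sigma> f) = emb (fc (fc X0 K) ?M) (fc (fc Z0 K) ?M) f"
    using exists_conjugating[OF gal p0 p1] t0 t1 by metis
  have "\<sigma> ` S = S" using autosD(7)[OF gal_group_autos[OF const_in_E s(1)]] by (simp add: bij_betw_def)
  then obtain f where f: "f \<in> S" "\<sigma> f = Z0" using Z0_in_S by (metis imageE)
  have "fc fls_X H = fc (fc f K) ?M"
    using s(2)[OF f(1)] f(2) e0[OF f(1)] emb_Z0[of "fc ?x1 H" "fc fls_X H"] p1 by (simp add: place_def)
  moreover have "fls_subdegree (fc fls_X H) = 1" using subdegree_fls_compose_fps[of H fls_X] H by simp
  moreover have "fls_subdegree (fc (fc f K) ?M) = fls_subdegree (fc f K) * int ?e"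
    using subdegree_fls_compose_fps[of ?M "fc f K"] M by simp
  ultimately have "int ?e dvd 1" by (metis dvd_triv_right)
  then show False using n4 by simp
qed

end

subsection \<open>Points off the axis\<close>

lemma pev_const_arg: "pev p (fls_const x) = fls_const (poly p x)"
  by (induction p) (auto simp: pev_pCons fls_plus_const)

lemma fps_to_fls_sum: "fps_to_fls (\<Sum>a\<in>A. f a) = (\<Sum>a\<in>A. fps_to_fls (f a))"
  by (induction A rule: infinite_finite_induct) (auto simp: fls_plus_const fps_to_fls_plus)

context projection
begin

lemma place_rel_poly:
  assumes p: "place \<xi> \<eta>"
  shows "poly (rel_poly (emb \<xi> \<eta> (tt x0 z0))) (emb \<xi> \<eta> (uu x0)) = 0"
proof -
  have nc: "nonconst \<xi>" using p by (simp add: place_def)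
  have "\<xi> - fls_const x0 \<noteq> 0" using nc by (auto simp: nonconst_def)
  then have "emb \<xi> \<eta> (uu x0) * emb \<xi> \<eta> (tt x0 z0) = \<eta> - fls_const z0"
    by (simp add: emb_uu[OF p] emb_tt[OF p])
  then show ?thesis using p by (simp add: poly_rel_poly emb_uu[OF p] place_def curve_def)
qed

lemma subdegree_uu_generic: "fls_subdegree (uu x0) = - int n"
proof -
  have "X0 \<noteq> 0" using subdegree_X0 n0 by auto
  then show ?thesis
    unfolding uu_def using fls_subdegree_diff_eq1[of X0 "fls_const x0"] n0 by (simp add: subdegree_X0)
qed

end

locale off_axis_galois = projection n g x0 z0 l m for n and g :: "'k::{alg_closed_field, field_char_0} poly" and x0 z0 l m +
  fixes \<zeta> :: 'k and Z :: "'k fps"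
  assumes gal: "galois_extension (subset_ring S) (quot (pencil (pt X0 Z0) l m))"
    and \<zeta>: "primitive_root_of_unity n \<zeta>"
    and z0: "z0 \<noteq> 0" and point: "z0 ^ n = poly g x0"
    and Z: "fps_nth Z 0 = z0" "\<And>w. w ^ n = 1 \<Longrightarrow> place (fls_const x0 + fls_X) (fls_const w * fps_to_fls Z)"
      "Z ^ n = fps_of_poly (pcompose g [:x0, 1:])"
begin

text \<open>\<open>\<psi> i\<close> is expansion at the point (x0, \<zeta>^i z0) of the vertical
  line through the centre, with parameter x - x0; \<open>\<psi> 0\<close> belongs to the centre
  itself.\<close>

abbreviation "\<xi> \<equiv> fls_const x0 + fls_X :: 'k fls"
abbreviation "\<eta> i \<equiv> fls_const (\<zeta> ^ i) * fps_to_fls Z"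
abbreviation "\<psi> i \<equiv> emb \<xi> (\<eta> i)"

lemma place_psi: "place \<xi> (\<eta> i)"
proof (rule Z(2))
  have "(\<zeta> ^ i) ^ n = (\<zeta> ^ n) ^ i" by (simp only: power_mult[symmetric] mult.commute)
  then show "(\<zeta> ^ i) ^ n = 1" using \<zeta> by (simp add: primitive_root_of_unity_def)
qed

lemma zeta_distinct: "i < n \<Longrightarrow> j < n \<Longrightarrow> \<zeta> ^ i = \<zeta> ^ j \<Longrightarrow> i = j"
  using primitive_root_power_inj[OF \<zeta>] by blast

lemma psi_uu: "\<psi> i (uu x0) = fls_X"
  by (simp add: emb_uu[OF place_psi])

lemma psi_tt: "\<psi> i (tt x0 z0) = fps_to_fls (fps_const (\<zeta> ^ i) * Z - fps_const z0) / fls_X"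
  by (simp add: emb_tt[OF place_psi] fls_times_fps_to_fls)

lemma subdegree_psi_tt:
  assumes "i < n" "i \<noteq> 0"
  shows "fls_subdegree (\<psi> i (tt x0 z0)) = - 1"
proof -
  let ?a = "fps_const (\<zeta> ^ i) * Z - fps_const z0"
  have "\<zeta> ^ i \<noteq> 1" using zeta_distinct[of i 0] assms by auto
  then have a0: "fps_nth ?a 0 \<noteq> 0" using Z(1) z0 by simp
  then have "subdegree ?a = 0" by simp
  moreover have "?a \<noteq> 0" using a0 by (metis fps_zero_nth)
  ultimately have "fls_subdegree (fps_to_fls ?a) = 0" "fps_to_fls ?a \<noteq> 0"
    unfolding fls_subdegree_fls_to_fps by (simp_all only: of_nat_0 fps_to_fls_eq_0_iff not_False_eq_True)
  then show ?thesis unfolding psi_tt divide_inverse using fls_subdegree_mult[of "fps_to_fls ?a" "inverse fls_X"]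
    by (simp only: fls_inverse_X) simp
qed

lemma reg_psi_tt_0: "reg (\<psi> 0 (tt x0 z0))"
proof -
  have "fps_nth (Z - fps_const z0) 0 = 0" using Z(1) by simp
  then have "Z - fps_const z0 = fps_X * fps_shift 1 (Z - fps_const z0)" by (intro fps_ext) auto
  then have "\<psi> 0 (tt x0 z0) = fps_to_fls (fps_X * fps_shift 1 (Z - fps_const z0)) / fls_X"
    unfolding psi_tt by simp
  also have "\<dots> = fps_to_fls (fps_shift 1 (Z - fps_const z0))"
    unfolding fls_times_fps_to_fls using nonzero_mult_div_cancel_left[OF fls_X_nonzero] by simp
  finally show ?thesis by simp
qed

text \<open>Over the pole of \<open>tt\<close> the curve has the unramified places \<open>\<psi> 1, \<dots>, \<psi> (n - 1)\<close> and the one at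
  infinity, whose embeddings are made to agree on \<open>tt\<close> by reparametrisation.\<close>

lemma exists_conjugate:
  "\<exists>\<sigma>\<in>gal_group E. fls_subdegree (\<sigma> (uu x0)) = 1 \<and> fls_subdegree (\<psi> 1 (\<sigma> (uu x0))) = - int n \<and>
     (\<forall>i<n. 2 \<le> i \<longrightarrow> fls_subdegree (\<psi> i (\<sigma> (uu x0))) = 1) \<and> reg (\<psi> 0 (\<sigma> (uu x0)))"
proof -
  have "\<exists>H. \<forall>i. i < n \<and> i \<noteq> 0 \<longrightarrow> H i \<noteq> 0 \<and> fps_nth (H i) 0 = 0 \<and> subdegree (H i) = 1 \<and> fc (\<psi> i (tt x0 z0)) (H i) = fls_X_inv"
    using fc_fls_inverse_reparam[OF subdegree_psi_tt] by (intro choice) metis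
  then obtain H where "\<And>i. i < n \<and> i \<noteq> 0 \<Longrightarrow> H i \<noteq> 0 \<and> fps_nth (H i) 0 = 0 \<and> subdegree (H i) = 1 \<and> fc (\<psi> i (tt x0 z0)) (H i) = fls_X_inv"
    by blast
  then have H: "H i \<noteq> 0" "fps_nth (H i) 0 = 0" "subdegree (H i) = 1" "fc (\<psi> i (tt x0 z0)) (H i) = fls_X_inv"
    if "i < n" "i \<noteq> 0" for i using that by blast+
  obtain K where K: "K \<noteq> 0" "fps_nth K 0 = 0" "subdegree K = 1" "fc (tt x0 z0) K = fls_X_inv"
    using fc_fls_inverse_reparam[OF subdegree_tt_generic] by blast
  define \<phi> where "\<phi> i = emb (fc \<xi> (H i)) (fc (\<eta> i) (H i))" for i
  define \<phi>P where "\<phi>P = emb (fc X0 K) (fc Z0 K)"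
  have p: "place (fc \<xi> (H i)) (fc (\<eta> i) (H i))" if "i < n" "i \<noteq> 0" for i
    using place_fc[OF place_psi H(1,2)[OF that]] .
  have pP: "place (fc X0 K) (fc Z0 K)" using place_fc[OF place_generic K(1,2)] .
  have phi: "\<phi> i f = fc (\<psi> i f) (H i)" if "i < n" "i \<noteq> 0" "f \<in> S" for i f
    unfolding \<phi>_def by (rule emb_fc[OF place_psi that(3) H(1,2)[OF that(1,2)]])
  have phiP: "\<phi>P f = fc f K" if "f \<in> S" for f
    unfolding \<phi>P_def emb_fc[OF place_generic that K(1,2)] emb_generic[OF that] ..
  have tphi: "\<phi> i (tt x0 z0) = fls_X_inv" if "i < n" "i \<noteq> 0" for i using phi[OF that tt_in_S] H(4)[OF that] by simp
  have tP: "\<phi>P (tt x0 z0) = fls_X_inv" using phiP[OF tt_in_S] K(4) by simp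
  have sphi: "fls_subdegree (\<phi> i f) = fls_subdegree (\<psi> i f)" if "i < n" "i \<noteq> 0" "f \<in> S" for i f
    using subdegree_fls_compose_fps[OF H(2)[OF that(1,2)], of "\<psi> i f"] phi[OF that] H(3)[OF that(1,2)] by simp
  have sP: "fls_subdegree (\<phi>P f) = fls_subdegree f" if "f \<in> S" for f
    using subdegree_fls_compose_fps[OF K(2), of f] phiP[OF that] K(3) by simp
  have uphi: "fls_subdegree (\<phi> i (uu x0)) = 1" if "i < n" "i \<noteq> 0" for i
    using sphi[OF that uu_in_S] psi_uu by simp
  have uP: "fls_subdegree (\<phi>P (uu x0)) = - int n" using sP[OF uu_in_S] subdegree_uu_generic by simp
  \<comment> \<open>Equal x - x0 and equal slope give equal expansions of z, and the constant term
    \<zeta>^i z0 reveals i.\<close>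
  have inj: "i = j" if ij: "i < n" "i \<noteq> 0" "j < n" "j \<noteq> 0" and eq: "\<phi> i (uu x0) = \<phi> j (uu x0)" for i j
  proof -
    have Z0: "\<phi> i Z0 = fls_const z0 + \<phi> i (uu x0) * fls_X_inv" if "i < n" "i \<noteq> 0" for i
    proof -
      have "uu x0 * tt x0 z0 \<in> S" by (intro S_closed uu_in_S tt_in_S)
      then show ?thesis
        using tphi[OF that] Z0_tt[of z0 x0] emb_add[OF p[OF that] S_const, of "uu x0 * tt x0 z0" z0]
          emb_mult[OF p[OF that] uu_in_S tt_in_S] emb_const p[OF that] by (simp add: \<phi>_def place_def)
    qed
    have nth: "\<phi> i Z0 $$ 0 = \<zeta> ^ i * z0" if "i < n" "i \<noteq> 0" for i
    proof -
      have "\<phi> i Z0 = fc (\<eta> i) (H i)" unfolding phi[OF that Z0_in_S] using emb_Z0 place_psi by (simp add: place_def)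
      also have "\<dots> = fls_const (\<zeta> ^ i) * fps_to_fls (fps_compose Z (H i))"
        using H[OF that] by (simp add: fls_compose_fps_mult)
      finally show ?thesis using Z(1) by simp
    qed
    have "\<phi> i Z0 = \<phi> j Z0" using Z0[OF ij(1,2)] Z0[OF ij(3,4)] eq by simp
    then have "\<zeta> ^ i * z0 = \<zeta> ^ j * z0" using nth[OF ij(1,2)] nth[OF ij(3,4)] by argo
    then show "i = j" using z0 zeta_distinct ij by simp
  qed
  let ?I = "{1..<n}"
  \<comment> \<open>The values of x - x0 in the fibre of slope T^(-1): at the centre, at infinity
    and at the n - 1 other points. Being n + 1 distinct zeros of \<open>rel_poly\<close>, they are
    all of them.\<close>
  let ?A = "insert 0 (insert (\<phi>P (uu x0)) ((\<lambda>i. \<phi> i (uu x0)) ` ?I))"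
  have rootsA: "poly (rel_poly fls_X_inv) a = 0" if "a \<in> ?A" for a
  proof -
    have "poly (rel_poly fls_X_inv) 0 = 0"
      using point by (simp add: poly_rel_poly pev_const_arg flip: fls_const_power)
    moreover have "poly (rel_poly fls_X_inv) (\<phi>P (uu x0)) = 0"
      using place_rel_poly[OF pP] tP by (simp add: \<phi>P_def)
    moreover have "poly (rel_poly fls_X_inv) (\<phi> i (uu x0)) = 0" if "i \<in> ?I" for i
      using place_rel_poly[OF p[of i]] tphi[of i] that by (simp add: \<phi>_def)
    ultimately show ?thesis using that by blast
  qed
  have cardA: "card ?A = Suc n"
  proof -
    have "card ((\<lambda>i. \<phi> i (uu x0)) ` ?I) = n - 1" by (subst card_image) (auto intro!: inj_onI inj)
    moreover have "\<phi>P (uu x0) \<notin> (\<lambda>i. \<phi> i (uu x0)) ` ?I"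
    proof
      assume "\<phi>P (uu x0) \<in> (\<lambda>i. \<phi> i (uu x0)) ` ?I"
      then obtain i where "i \<in> ?I" "\<phi>P (uu x0) = \<phi> i (uu x0)" by blast
      then show False using uP uphi[of i] by simp
    qed
    moreover have "0 \<notin> insert (\<phi>P (uu x0)) ((\<lambda>i. \<phi> i (uu x0)) ` ?I)"
    proof
      assume "0 \<in> insert (\<phi>P (uu x0)) ((\<lambda>i. \<phi> i (uu x0)) ` ?I)"
      then consider "\<phi>P (uu x0) = 0" | i where "i \<in> ?I" "\<phi> i (uu x0) = 0" by fastforce
      then show False
      proof cases
        case 1 then show ?thesis using uP n0 by simp
      next
        case 2 then show ?thesis using uphi[of i] by simp
      qed
    qed
    ultimately show ?thesis using n0 by simp
  qed
  have allroots: "b \<in> ?A" if "poly (rel_poly fls_X_inv) b = 0" for b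
  proof (rule poly_root_in_finite_set[OF rel_poly_degree(1) _ rootsA _ that])
    show "Polynomial.degree (rel_poly fls_X_inv) \<le> card ?A" unfolding cardA by (rule rel_poly_degree(2))
  qed auto
  have one: "1 < n" "(1::nat) \<noteq> 0" using n4 by simp_all
  obtain \<sigma> where s: "\<sigma> \<in> gal_group E" and "\<And>f. f \<in> S \<Longrightarrow> emb (fc \<xi> (H 1)) (fc (\<eta> 1) (H 1)) (\<sigma> f) = emb (fc X0 K) (fc Z0 K) f"
    using exists_conjugating[OF gal pP p[OF one]] tP tphi[OF one] unfolding \<phi>_def \<phi>P_def by metis
  then have s1: "\<And>f. f \<in> S \<Longrightarrow> \<phi> 1 (\<sigma> f) = \<phi>P f" by (simp only: \<phi>_def \<phi>P_def)
  note a = gal_group_autos[OF const_in_E s]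
  have sS: "\<sigma> ` S = S" using autosD(7)[OF a] by (simp add: bij_betw_def)
  let ?f = "\<sigma> (uu x0)"
  note f = conjugate(1,2)[OF s]
  \<comment> \<open>The value of the conjugate is one of the zeros just listed. It is not 0 because
    \<sigma> is injective. If it were the value at infinity, this place and \<open>\<phi> 1\<close>
    would agree after composition with \<sigma>, hence agree. The remaining zeros have order
    1.\<close>
  have gen: "fls_subdegree (emb x y ?f) = 1"
    if pl: "place x y" and T: "emb x y (tt x0 z0) = fls_X_inv" and ne: "emb x y (uu x0) \<noteq> \<phi> 1 (uu x0)" for x y
  proof -
    have "poly (rel_poly fls_X_inv) (emb x y ?f) = 0"
      using emb_conjugate[OF s pl] by (simp add: poly_rel_poly T)
    then have "emb x y ?f \<in> ?A" by (rule allroots)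
    moreover have "emb x y ?f \<noteq> 0" using emb_eq_0_iff[OF pl f(1)] f(2) by simp
    moreover have "emb x y ?f \<noteq> \<phi>P (uu x0)"
    proof
      assume u: "emb x y ?f = \<phi>P (uu x0)"
      have c: "emb x y (\<sigma> h) = \<phi> 1 (\<sigma> h)" if "h \<in> S" for h
        using conjugate_place[OF s pP pl _ _ that] T tP u s1[OF that] by (simp add: \<phi>P_def)
      obtain h where "h \<in> S" "uu x0 = \<sigma> h" using sS uu_in_S by blast
      then show False using c ne by simp
    qed
    ultimately obtain i where "i \<in> ?I" "emb x y ?f = \<phi> i (uu x0)" by blast
    then show ?thesis using uphi[of i] by simp
  qed
  have "fls_subdegree (\<phi>P ?f) = 1"
    unfolding \<phi>P_def
  proof (rule gen[OF pP])
    show "emb (fc X0 K) (fc Z0 K) (tt x0 z0) = fls_X_inv" using tP by (simp add: \<phi>P_def)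
    show "emb (fc X0 K) (fc Z0 K) (uu x0) \<noteq> \<phi> 1 (uu x0)" using uP uphi[OF one] unfolding \<phi>P_def by auto
  qed
  moreover have "fls_subdegree (\<psi> i ?f) = 1" if i: "i < n" "2 \<le> i" for i
  proof -
    have i0: "i \<noteq> 0" using i by simp
    have "fls_subdegree (\<phi> i ?f) = 1"
      unfolding \<phi>_def
    proof (rule gen[OF p[OF i(1) i0]])
      show "emb (fc \<xi> (H i)) (fc (\<eta> i) (H i)) (tt x0 z0) = fls_X_inv" using tphi[OF i(1) i0] by (simp only: \<phi>_def)
      have "\<phi> i (uu x0) \<noteq> \<phi> 1 (uu x0)" using inj[OF i(1) i0 one] i by auto
      then show "emb (fc \<xi> (H i)) (fc (\<eta> i) (H i)) (uu x0) \<noteq> \<phi> 1 (uu x0)" unfolding \<phi>_def .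
    qed
    then show ?thesis using sphi[OF i(1) i0 f(1)] by simp
  qed
  moreover have "fls_subdegree (\<psi> 1 ?f) = - int n"
    using s1[OF uu_in_S] uP sphi[OF one f(1)] by simp
  ultimately show ?thesis
    using s conjugate_regular[OF s place_psi reg_psi_tt_0] sP[OF f(1)] by (intro bexI[of _ \<sigma>]) auto
qed


text \<open>At finite points off the line x = x0 the slope is regular, and regularity of the slope
  is inherited by the conjugate.\<close>

lemma reg_elsewhere:
  assumes s: "\<sigma> \<in> gal_group E" and p: "place a b" and r: "reg a" "reg b" and c: "a $$ 0 \<noteq> x0"
  shows "reg (emb a b (uu x0 ^ n * \<sigma> (uu x0)))"
proof -
  have "reg (emb a b (tt x0 z0))"
    unfolding emb_tt[OF p] using r c by (intro reg_divide reg_diff) auto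
  then have "reg (emb a b (\<sigma> (uu x0)))" by (rule conjugate_regular[OF s p])
  moreover have "reg (emb a b (uu x0))" unfolding emb_uu[OF p] using r by (intro reg_diff) auto
  moreover have "emb a b (uu x0 ^ n * \<sigma> (uu x0)) = emb a b (uu x0) ^ n * emb a b (\<sigma> (uu x0))"
    using emb_mult[OF p _ conjugate(1)[OF s], of "uu x0 ^ n"] emb_power[OF p uu_in_S] by (simp add: S_closed uu_in_S)
  ultimately show ?thesis by (simp add: reg_mult reg_power)
qed

lemma psi_mult_conjugate:
  assumes s: "\<sigma> \<in> gal_group E"
  shows "\<psi> i (uu x0 ^ n * \<sigma> (uu x0)) = fls_X ^ n * \<psi> i (\<sigma> (uu x0))"
  using emb_mult[OF place_psi _ conjugate(1)[OF s], of "uu x0 ^ n" i] emb_power[OF place_psi uu_in_S] psi_uu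
  by (simp add: S_closed uu_in_S)

text \<open>Write f for the conjugate of x - x0 and h for (x - x0)^n f. The factor cancels the only
  finite pole of f, so h is a polynomial in x and z, and its order 1 - n^2 at infinity bounds the
  coefficient degrees. At \<open>\<psi> i\<close> with i \<noteq> 1 it vanishes to order n, and at
  \<open>\<psi> 2\<close> to order n + 1. These conditions make h, up to the factor c, the geometric
  sum (z^n - \<Lambda>^n) / (z - \<zeta> \<Lambda>).\<close>

lemma exists_linear_relation:
  "\<exists>\<sigma>\<in>gal_group E. \<exists>c \<Lambda>. c \<noteq> 0 \<and> Polynomial.degree \<Lambda> \<le> 1 \<and> poly \<Lambda> 0 = z0 \<and>
     \<sigma> (uu x0) * (Z0 - fls_const \<zeta> * pev \<Lambda> (uu x0)) = fls_const c * uu x0 \<and> fls_subdegree (\<sigma> (uu x0)) = 1 \<and>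
     (\<forall>i<n. i \<noteq> 1 \<longrightarrow> reg (\<psi> i (\<sigma> (uu x0))))"
proof -
  obtain \<sigma> where s: "\<sigma> \<in> gal_group E" and fP: "fls_subdegree (\<sigma> (uu x0)) = 1"
    and f1: "fls_subdegree (\<psi> 1 (\<sigma> (uu x0))) = - int n"
    and fi: "\<And>i. i < n \<Longrightarrow> 2 \<le> i \<Longrightarrow> fls_subdegree (\<psi> i (\<sigma> (uu x0))) = 1" and f0: "reg (\<psi> 0 (\<sigma> (uu x0)))"
    using exists_conjugate by blast
  define f where "f = \<sigma> (uu x0)"
  define h where "h = uu x0 ^ n * f"
  note fS = conjugate(1,2)[OF s, folded f_def]
  have hS: "h \<in> S" unfolding h_def by (intro S_closed uu_in_S fS)
  have h0: "h \<noteq> 0" using fS(2) uu_nonzero by (simp add: h_def)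
  have psih: "\<psi> i h = fls_X ^ n * \<psi> i f" for i using psi_mult_conjugate[OF s] by (simp add: h_def f_def)
  have regf: "reg (\<psi> i f)" if "i < n" "i \<noteq> 1" for i
  proof (cases "i = 0")
    case True then show ?thesis using f0 by (simp add: f_def)
  next
    case False then show ?thesis using fi[OF that(1)] that by (simp add: f_def)
  qed
  have subX: "fls_subdegree (fls_X ^ n :: 'k fls) = int n" by (simp add: fls_subdegree_pow)
  have regh: "reg (\<psi> i h)" if "i < n" for i
  proof (cases "i = 1")
    case True
    have "\<psi> 1 f \<noteq> 0" using f1 n0 by (auto simp: f_def)
    then have "fls_subdegree (\<psi> 1 h) = 0" unfolding psih using f1 subX by (simp add: f_def)
    then show ?thesis using True by simp
  next
    case False
    then show ?thesis unfolding psih using regf[OF that] subX by (intro reg_mult) auto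
  qed
  have gx0: "poly g x0 \<noteq> 0" using point z0 by (metis power_not_zero)
  have "\<exists>P. h = val P X0 Z0"
  proof (rule regular_function_is_polynomial[OF hS \<zeta>])
    fix c assume c: "poly g c \<noteq> 0"
    show "\<exists>Z. fps_nth Z 0 \<noteq> 0 \<and> (\<forall>i<n. place (fls_const c + fls_X) (fls_const (\<zeta> ^ i) * fps_to_fls Z) \<and>
        reg (emb (fls_const c + fls_X) (fls_const (\<zeta> ^ i) * fps_to_fls Z) h))"
    proof (cases "c = x0")
      case True
      show ?thesis unfolding True using Z(1) z0 place_psi regh by (intro exI[of _ Z]) simp
    next
      case False
      obtain y where y: "y ^ n = poly g c" using exists_nth_root[OF n0] by blast
      then have y0: "y \<noteq> 0" using c n0 by (metis power_0_left less_numeral_extra(3))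
      obtain Y where Y: "fps_nth Y 0 = y" "\<And>w. w ^ n = 1 \<Longrightarrow> place (fls_const c + fls_X) (fls_const w * fps_to_fls Y)"
        using place_at_regular[OF y y0] by blast
      have w: "(\<zeta> ^ i) ^ n = 1" for i
        using \<zeta> by (metis power_mult mult.commute power_one primitive_root_of_unity_def)
      have "reg (emb (fls_const c + fls_X) (fls_const (\<zeta> ^ i) * fps_to_fls Y) h)" for i
        unfolding h_def f_def
        using False by (intro reg_elsewhere[OF s Y(2)[OF w]] reg_add reg_mult) auto
      then show ?thesis using Y w y0 by (intro exI[of _ Y]) simp
    qed
  next
    fix c assume c: "poly g c = 0"
    obtain G where G: "fps_nth G 0 = 0" "place (fls_const c + fps_to_fls (fps_compose G (fps_X ^ n))) fls_X"
      using place_at_root[OF c] by blast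
    have "reg (emb (fls_const c + fps_to_fls (fps_compose G (fps_X ^ n))) fls_X h)"
      unfolding h_def f_def using c gx0 G(1) by (intro reg_elsewhere[OF s G(2)] reg_add) auto
    then show "\<exists>G. fps_nth G 0 = 0 \<and> place (fls_const c + fps_to_fls (fps_compose G (fps_X ^ n))) fls_X \<and>
        reg (emb (fls_const c + fps_to_fls (fps_compose G (fps_X ^ n))) fls_X h)" using G by blast
  qed
  then obtain P where P: "h = val P X0 Z0" by blast
  have subh: "fls_subdegree h = 1 - int n * int n"
    unfolding h_def using fP uu_nonzero[of x0] fS(2) subdegree_uu_generic by (simp add: f_def fls_subdegree_pow)
  define p where "p j = pcompose (P j) [:x0, 1:]" for j
  have degp: "Polynomial.degree (p j) \<le> n - 1 - j" if "j < n" for j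
  proof (cases "P j = 0")
    case False
    have "1 - int n * int n \<le> - int (n * Polynomial.degree (P j) + Suc n * j)"
      using val_subdegree_generic(2)[of j P, OF that False] subh P by simp
    then have "int (n * Polynomial.degree (P j) + Suc n * j) < int (n * n)" by simp
    then have "n * Polynomial.degree (P j) + Suc n * j < n * n" by (simp only: of_nat_less_iff)
    then have "n * (Polynomial.degree (P j) + j) < n * n" by (simp add: algebra_simps)
    then have "Polynomial.degree (P j) + j < n" by simp
    then show ?thesis by (simp add: p_def degree_pcompose)
  qed (simp add: p_def)
  let ?V = "\<lambda>i. \<Sum>j<n. fps_of_poly (p j) * (fps_const (\<zeta> ^ i) * Z) ^ j"
  have pevp: "pev (P j) (fls_const x0 + a) = pev (p j) a" for j a
    unfolding p_def pev_pcompose by (simp add: pev_pCons)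
  have V: "\<psi> i h = fps_to_fls (?V i)" for i
  proof -
    have "\<psi> i h = val P \<xi> (\<eta> i)" using emb_val[of \<xi> 1 "\<eta> i" P] place_psi P by (simp add: place_def)
    also have "\<dots> = (\<Sum>j<n. fps_to_fls (fps_of_poly (p j) * (fps_const (\<zeta> ^ i) * Z) ^ j))"
      unfolding val_def pevp pev_fps_X by (simp add: fls_times_fps_to_fls fps_to_fls_power)
    finally show ?thesis by (simp add: fps_to_fls_sum)
  qed
  have Vdvd: "fps_X ^ n dvd ?V i \<and> (i = 2 \<longrightarrow> fps_X ^ Suc n dvd ?V i)" if i: "i < n" "i \<noteq> 1" for i
  proof -
    obtain a where a: "\<psi> i f = fps_to_fls a" using regf[OF i] by (rule regE)
    have "fps_to_fls (?V i) = fps_to_fls (fps_X ^ n * a)"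
      unfolding V[symmetric] psih a by (simp add: fls_times_fps_to_fls fps_to_fls_power)
    then have Va: "?V i = fps_X ^ n * a" by (simp only: fps_to_fls_eq_iff)
    have "fps_X ^ Suc n dvd ?V i" if "i = 2"
    proof -
      have "fls_subdegree (\<psi> i f) = 1" using fi[of i] i that by (simp add: f_def)
      then have "fps_nth a 0 = 0" using nth0_pos[of "\<psi> i f"] a by simp
      then have "a = fps_X * fps_shift 1 a" by (intro fps_ext) auto
      then have "?V i = fps_X ^ n * (fps_X * fps_shift 1 a)" using Va by argo
      then have "?V i = fps_X ^ Suc n * fps_shift 1 a" by (simp only: power_Suc2 mult.assoc)
      then show ?thesis by (rule dvdI)
    qed
    then show ?thesis using Va by (metis dvdI)
  qed
  have nz: "\<exists>j<n. p j \<noteq> 0"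
  proof (rule ccontr)
    assume "\<not> ?thesis"
    then have "?V 1 = 0" by simp
    then have "\<psi> 1 h = 0" unfolding V by simp
    then show False using emb_eq_0_iff[OF place_psi hS] h0 by blast
  qed
  have zZ: "fps_nth Z 0 \<noteq> 0" using Z(1) z0 by simp
  have V2: "fps_X ^ Suc n dvd ?V 2" using Vdvd[of 2] n4 by simp
  obtain c \<Lambda> where L: "c \<noteq> 0" "Polynomial.degree \<Lambda> \<le> 1" "poly \<Lambda> 0 = z0"
    "\<And>j. j < n \<Longrightarrow> p j = Polynomial.smult (c * inverse \<zeta> ^ Suc j) (\<Lambda> ^ (n - 1 - j))"
    "fps_X ^ Suc n dvd fps_of_poly (\<Lambda> ^ n) - Z ^ n"
    using fourier_vanishing[OF n4 \<zeta> zZ degp _ V2 nz] Vdvd unfolding Z(1) by blast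
  let ?q = "pcompose g [:x0, 1:]"
  \<comment> \<open>Modulo T^(n+1) both sides agree, so only the top coefficient is left, and it is
    1 because \<open>g\<close> is monic. Thus z^n - \<Lambda>^n collapses to (x - x0)^(n+1).\<close>
  have q: "?q = \<Lambda> ^ n + Polynomial.monom 1 (Suc n)"
  proof -
    let ?r = "\<Lambda> ^ n - ?q + Polynomial.monom 1 (Suc n)"
    have "fps_of_poly ?r = (fps_of_poly (\<Lambda> ^ n) - Z ^ n) + fps_X ^ Suc n"
      by (simp add: Z(3) fps_of_poly_add fps_of_poly_diff fps_of_poly_monom')
    then have "fps_X ^ Suc n dvd fps_of_poly ?r" using L(5) by (metis dvd_add dvd_refl)
    moreover have "Polynomial.degree ?r < Suc n"
    proof -
      have dL: "Polynomial.degree (\<Lambda> ^ n) \<le> n" using degree_power_le[of \<Lambda> n] L(2) by (metis le_trans mult_le_mono1 mult_1)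
      have dq: "Polynomial.degree ?q = Suc n" using degree_g by (simp add: degree_pcompose)
      have cq: "Polynomial.coeff ?q (Suc n) = 1"
        using lead_coeff_comp[of "[:x0, 1:]" g] monic degree_g dq by simp
      have "Polynomial.degree ?r \<le> Suc n"
        using dL dq by (intro degree_add_le degree_diff_le) (auto simp: degree_monom_eq)
      moreover have "Polynomial.coeff ?r (Suc n) = 0" using dL cq by (simp add: coeff_eq_0)
      ultimately show ?thesis
        by (metis leading_coeff_0_iff le_neq_implies_less less_Suc_eq_0_disj degree_0)
    qed
    ultimately have "?r = 0" by (rule fps_X_power_dvd_poly)
    then show ?thesis by (simp add: algebra_simps)
  qed
  let ?L = "pev \<Lambda> (uu x0)"
  have z1: "\<zeta> \<noteq> 0" using primitive_root_nonzero[OF \<zeta>] .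
  have zn: "\<zeta> ^ n = 1" using \<zeta> by (simp add: primitive_root_of_unity_def)
  have hL: "h = fls_const c * (\<Sum>j<n. fls_const (inverse \<zeta> ^ Suc j) * ?L ^ (n - 1 - j) * Z0 ^ j)"
  proof -
    have "h = (\<Sum>j<n. pev (p j) (uu x0) * Z0 ^ j)"
      unfolding P val_def using pevp[of _ "uu x0"] X0_uu[of x0] by simp
    also have "\<dots> = (\<Sum>j<n. fls_const c * (fls_const (inverse \<zeta> ^ Suc j) * ?L ^ (n - 1 - j) * Z0 ^ j))"
      using L(4) by (intro sum.cong) (simp_all add: pev_smult pev_power mult.assoc flip: fls_const_mult_const)
    finally show ?thesis by (simp add: sum_distrib_left)
  qed
  let ?W = "fls_const (inverse \<zeta>) * Z0"
  have hW: "h * fls_const \<zeta> = fls_const c * (\<Sum>j<n. ?L ^ (n - 1 - j) * ?W ^ j)"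
  proof -
    have "fls_const (inverse \<zeta> ^ Suc j) * fls_const \<zeta> = fls_const (inverse \<zeta>) ^ j" for j
    proof -
      have "inverse \<zeta> ^ Suc j * \<zeta> = inverse \<zeta> ^ j" using z1 by (simp add: power_Suc2 mult.assoc del: power_Suc)
      then have "fls_const (inverse \<zeta> ^ Suc j) * fls_const \<zeta> = fls_const (inverse \<zeta> ^ j)" by (simp only: fls_const_mult_const)
      then show ?thesis by (simp only: fls_const_power)
    qed
    then have t: "fls_const (inverse \<zeta> ^ Suc j) * ?L ^ (n - 1 - j) * Z0 ^ j * fls_const \<zeta> = ?L ^ (n - 1 - j) * ?W ^ j" for j
      unfolding power_mult_distrib by (simp only: mult.commute[of _ "fls_const \<zeta>"] mult.assoc[symmetric]) (simp only: mult_ac)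
    show ?thesis unfolding hL mult.assoc[of "fls_const c"] sum_distrib_right by (simp only: t)
  qed
  have "h * (Z0 - fls_const \<zeta> * ?L) = fls_const c * uu x0 ^ Suc n"
  proof -
    have W: "fls_const \<zeta> * (?W - ?L) = Z0 - fls_const \<zeta> * ?L"
      using z1 by (simp add: right_diff_distrib flip: mult.assoc)
    have Wn: "?W ^ n = Z0 ^ n" using zn by (simp add: power_mult_distrib power_inverse flip: fls_const_power)
    have "Z0 ^ n = pev ?q (uu x0)"
      unfolding pev_pcompose using curve_generic X0_uu[of x0] by (simp add: curve_def pev_pCons)
    then have Zn: "Z0 ^ n = ?L ^ n + uu x0 ^ Suc n" unfolding q by (simp add: pev_add pev_power pev_monom)
    have "h * (Z0 - fls_const \<zeta> * ?L) = (h * fls_const \<zeta>) * (?W - ?L)" unfolding W[symmetric] by (simp only: mult.assoc)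
    also have "\<dots> = - (fls_const c * ((?L - ?W) * (\<Sum>j<n. ?L ^ (n - 1 - j) * ?W ^ j)))"
      unfolding hW by (simp add: algebra_simps)
    also have "\<dots> = fls_const c * uu x0 ^ Suc n"
      unfolding power_diff_sum Wn Zn by simp
    finally show ?thesis .
  qed
  then have "uu x0 ^ n * (f * (Z0 - fls_const \<zeta> * ?L)) = uu x0 ^ n * (fls_const c * uu x0)"
    unfolding h_def by (simp add: mult_ac)
  then have "f * (Z0 - fls_const \<zeta> * ?L) = fls_const c * uu x0" using uu_nonzero[of x0] by simp
  then show ?thesis using s L(1-3) fP regf unfolding f_def by blast
qed

text \<open>The conjugate f vanishes at infinity and at \<open>\<psi> i\<close> for i \<noteq> 1.
  There f times the slope takes the values c and c (\<zeta>^i - 1) / (\<zeta>^i - \<zeta>)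
  respectively, by the linear relation. Constant terms in (z0 + f t)^n = g(x0 + f), with t the
  slope, then give the hypotheses of \<open>no_moebius_symmetry\<close> for \<kappa> = c /
  z0.\<close>

lemma contradiction: False
proof -
  obtain \<sigma> c \<Lambda> where s: "\<sigma> \<in> gal_group E" and c: "c \<noteq> 0" and L: "Polynomial.degree \<Lambda> \<le> 1" "poly \<Lambda> 0 = z0"
    and rel: "\<sigma> (uu x0) * (Z0 - fls_const \<zeta> * pev \<Lambda> (uu x0)) = fls_const c * uu x0" and fP: "fls_subdegree (\<sigma> (uu x0)) = 1"
    and regf: "\<And>i. i < n \<Longrightarrow> i \<noteq> 1 \<Longrightarrow> reg (\<psi> i (\<sigma> (uu x0)))"
    using exists_linear_relation by blast
  define f where "f = \<sigma> (uu x0)"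
  note fS = conjugate(1,2)[OF s, folded f_def]
  let ?L = "pev \<Lambda> (uu x0)"
  have LS: "?L \<in> S" "fls_const \<zeta> * ?L \<in> S" "Z0 - fls_const \<zeta> * ?L \<in> S" by (intro S_closed uu_in_S)+
  have n1: "1 < n" using n4 by simp
  have fi: "(z0 + c * (\<zeta> ^ i - 1) / (\<zeta> ^ i - \<zeta>)) ^ n = z0 ^ n" if i: "i < n" "i \<noteq> 1" for i
  proof -
    let ?F = "\<psi> i f"
    let ?D = "\<eta> i - fls_const \<zeta> * pev \<Lambda> fls_X"
    have nc: "nonconst \<xi>" using place_psi by (simp add: place_def)
    have rF: "reg ?F" using regf[OF i] by (simp add: f_def)
    have rD: "reg ?D" unfolding pev_fps_X by (intro reg_diff reg_mult) auto
    have D0: "?D $$ 0 = z0 * (\<zeta> ^ i - \<zeta>)" using Z(1) L(2) by (simp add: pev_fps_X poly_0_coeff_0 algebra_simps)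
    have zi: "\<zeta> ^ i - \<zeta> \<noteq> 0" using zeta_distinct[OF i(1) n1] i by auto
    have psiD: "\<psi> i (Z0 - fls_const \<zeta> * ?L) = ?D"
      using emb_diff[OF place_psi Z0_in_S LS(2)] emb_mult[OF place_psi S_const LS(1)] emb_pev[OF place_psi uu_in_S]
        emb_Z0[OF nc] emb_const[OF nc] psi_uu by simp
    have r: "?F * ?D = fls_const c * fls_X"
      using emb_mult[OF place_psi fS(1) LS(3), of i] rel emb_mult[OF place_psi S_const uu_in_S, of i c x0]
        emb_const[OF nc] psi_uu psiD by (simp add: f_def)
    have F0: "?F $$ 0 = 0"
    proof -
      have "?F $$ 0 * ?D $$ 0 = 0" using nth0_mult[OF rF rD] unfolding r by simp
      then show ?thesis unfolding D0 using zi z0 by simp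
    qed
    let ?N = "fls_const c * (\<eta> i - fls_const z0)"
    have "fls_X * \<psi> i (tt x0 z0) = \<eta> i - fls_const z0"
      by (simp only: emb_tt[OF place_psi] add_diff_cancel_left' times_divide_eq_right nonzero_mult_div_cancel_left[OF fls_X_nonzero])
    moreover have "fls_X * (?F * \<psi> i (tt x0 z0) * ?D) = (?F * ?D) * (fls_X * \<psi> i (tt x0 z0))" by (simp only: mult_ac)
    ultimately have "fls_X * (?F * \<psi> i (tt x0 z0) * ?D) = fls_X * ?N" unfolding r by (simp only: mult_ac)
    then have FT: "?F * \<psi> i (tt x0 z0) * ?D = ?N" by (rule mult_left_cancel[OF fls_X_nonzero, THEN iffD1])
    have Dn0: "?D $$ 0 \<noteq> 0" unfolding D0 using zi z0 by simp
    then have Dnz: "?D \<noteq> 0" by (metis fls_zero_nth)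
    have FT': "?F * \<psi> i (tt x0 z0) = ?N / ?D" using FT Dnz by (simp add: field_simps)
    have rN: "reg ?N" by (intro reg_mult reg_diff) auto
    have rFT: "reg (?F * \<psi> i (tt x0 z0))" unfolding FT' using D0 zi z0 by (intro reg_divide[OF rN _ rD]) simp
    have N0: "?N $$ 0 = c * z0 * (\<zeta> ^ i - 1)" using Z(1) by (simp add: algebra_simps)
    have FT0: "(?F * \<psi> i (tt x0 z0)) $$ 0 = c * (\<zeta> ^ i - 1) / (\<zeta> ^ i - \<zeta>)"
      unfolding FT' nth0_divide[OF rN rD Dn0] D0 N0 using zi z0 by simp
    have "((fls_const z0 + ?F * \<psi> i (tt x0 z0)) ^ n) $$ 0 = pev g (fls_const x0 + ?F) $$ 0"
      using emb_conjugate[OF s place_psi, of i] by (simp add: f_def)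
    then have "(z0 + c * (\<zeta> ^ i - 1) / (\<zeta> ^ i - \<zeta>)) ^ n = poly g x0"
      using FT0 F0 rFT rF by (simp add: nth0_power nth0_pev reg_add)
    then show ?thesis using point by simp
  qed
  have fP': "(z0 + c) ^ n = z0 ^ n"
  proof -
    have "f * tt x0 z0 * uu x0 * (Z0 - fls_const \<zeta> * ?L) = fls_const c * uu x0 * (tt x0 z0 * uu x0)"
      using rel by (simp add: f_def mult_ac)
    then have "uu x0 * (f * tt x0 z0 * (Z0 - fls_const \<zeta> * ?L)) = uu x0 * (fls_const c * (Z0 - fls_const z0))"
      unfolding tt_uu by (simp add: mult_ac)
    then have r: "f * tt x0 z0 * (Z0 - fls_const \<zeta> * ?L) = fls_const c * (Z0 - fls_const z0)"
      using uu_nonzero[of x0] by simp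
    \<comment> \<open>After division by z the relation is regular at infinity: \<Lambda> has order
      at least -n and z has order -(n + 1), so \<Lambda> / z vanishes there.\<close>
    let ?I = "inverse Z0"
    have r': "f * tt x0 z0 * (1 - fls_const \<zeta> * (?L * ?I)) = fls_const c * (1 - fls_const z0 * ?I)"
    proof -
      have "f * tt x0 z0 * (1 - fls_const \<zeta> * (?L * ?I)) * Z0 = f * tt x0 z0 * (Z0 - fls_const \<zeta> * ?L)"
        using Z0_nonzero by (simp add: algebra_simps)
      also have "\<dots> = fls_const c * (1 - fls_const z0 * ?I) * Z0" unfolding r using Z0_nonzero by (simp add: algebra_simps)
      finally show ?thesis using Z0_nonzero by (rule mult_right_cancel[THEN iffD1, rotated])
    qed
    have sI: "fls_subdegree ?I = int (Suc n)" using subdegree_Z0 Z0_nonzero by simp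
    have L0: "\<Lambda> \<noteq> 0" using L(2) z0 by auto
    have sL: "fls_subdegree (?L * ?I) > 0"
    proof -
      have "fls_subdegree ?L = int (Polynomial.degree \<Lambda>) * - int n" "?L \<noteq> 0"
        using pev_subdegree_neg[OF _ L0, of "uu x0"] subdegree_uu_generic n0 by auto
      moreover have "int (Polynomial.degree \<Lambda>) * int n \<le> 1 * int n" using L(1) by (intro mult_right_mono) auto
      ultimately show ?thesis using sI Z0_nonzero by simp
    qed
    have rft: "reg (f * tt x0 z0)" using fP subdegree_tt_generic fS(2) f_def by (cases "tt x0 z0 = 0") auto
    have "(f * tt x0 z0 * (1 - fls_const \<zeta> * (?L * ?I))) $$ 0 = (fls_const c * (1 - fls_const z0 * ?I)) $$ 0" by (simp only: r')
    then have ft: "(f * tt x0 z0) $$ 0 = c"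
      using nth0_mult[OF rft, of "1 - fls_const \<zeta> * (?L * ?I)"] nth0_pos[OF sL] nth0_pos[of ?I] sI sL
      by (simp add: reg_diff reg_mult)
    have f0: "f $$ 0 = 0" "reg f" using fP nth0_pos[of f] by (simp_all add: f_def)
    have "((fls_const z0 + f * tt x0 z0) ^ n) $$ 0 = pev g (fls_const x0 + f) $$ 0"
      using conjugate(5)[OF s] by (simp add: f_def)
    then have "(z0 + c) ^ n = poly g x0"
      using ft rft f0 by (simp add: nth0_power nth0_pev reg_add)
    then show ?thesis using point by simp
  qed
  have div: "(1 + a / z0) ^ n = 1" if "(z0 + a) ^ n = z0 ^ n" for a
  proof -
    have "1 + a / z0 = (z0 + a) / z0" using z0 by (simp add: field_simps)
    then show ?thesis using that z0 by (simp add: power_divide)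
  qed
  show False
  proof (rule no_moebius_symmetry[OF n4 \<zeta>, of "c / z0"])
    show "c / z0 \<noteq> 0" using c z0 by simp
    show "(1 + c / z0) ^ n = 1" by (rule div[OF fP'])
    fix i assume "i < n" "i \<noteq> 1"
    then show "(1 + c / z0 * (\<zeta> ^ i - 1) / (\<zeta> ^ i - \<zeta>)) ^ n = 1"
      using div[OF fi] by (simp add: mult.commute)
  qed
qed

end

context superelliptic
begin

lemma no_affine_galois_point:
  assumes zeros: "zeros l m = point (vector [x0, 1, z0])" and on: "z0 ^ n = poly g x0"
    and gal: "galois_extension (subset_ring S) (quot (pencil (pt X0 Z0) l m))"
  shows False
proof -
  have pr: "projection n g x0 z0 l m" by unfold_locales (rule zeros)
  show False
  proof (cases "z0 = 0")
    case True
    then have "poly g x0 = 0" using on n0 by (simp add: power_0_left)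
    then show False using projection.not_galois_on_axis[OF pr True] gal by blast
  next
    case False
    obtain \<zeta> :: 'k where "primitive_root_of_unity n \<zeta>" using exists_primitive_root[OF n0] by blast
    moreover obtain Z where "fps_nth Z 0 = z0" "\<And>w. w ^ n = 1 \<Longrightarrow> place (fls_const x0 + fls_X) (fls_const w * fps_to_fls Z)"
      "Z ^ n = fps_of_poly (pcompose g [:x0, 1:])" using place_at_regular[OF on False] by blast
    ultimately have "off_axis_galois n g x0 z0 l m \<zeta> Z"
      using pr gal on False unfolding off_axis_galois_def off_axis_galois_axioms_def by blast
    then show False by (rule off_axis_galois.contradiction)
  qed
qed

end

section \<open>The point [0 : 0 : 1] as the inner Galois point\<close>

subsection \<open>The projection to the line\<close>

context superelliptic
begin

abbreviation "EL \<equiv> quot (pencil (pt X0 Z0) (axis 1 1) (axis 2 1))"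

lemma pencil_axis: "pencil (pt X0 Z0) (axis 1 1) (axis 2 1) = (\<lambda>i. if i = 1 then X0 else 1)"
  by (rule ext) (simp add: fls_hom.mp_eval_linear_form sum_3 axis_def)

lemma EL_subset_S: "EL \<subseteq> S"
proof
  fix e assume "e \<in> EL"
  then obtain A B where e: "e = ev (pencil (pt X0 Z0) (axis 1 1) (axis 2 1)) A / ev (pencil (pt X0 Z0) (axis 1 1) (axis 2 1)) B"
    by (elim quotE)
  have s: "(if i = 1 then X0 else 1) \<in> S" for i :: 2 by (simp add: S_closed)
  show "e \<in> S" unfolding e pencil_axis by (intro S_closed(6) emb_ev_S(1)[OF place_generic s])
qed

lemma X0_in_EL: "X0 \<in> EL"
proof -
  have "X0 = ev (pencil (pt X0 Z0) (axis 1 1) (axis 2 1)) (mp_var 1) / ev (pencil (pt X0 Z0) (axis 1 1) (axis 2 1)) (mp_var 2)"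
    unfolding pencil_axis fls_hom.mp_eval_var by simp
  also have "\<dots> \<in> EL"
    by (rule quotI[OF homogeneous_var homogeneous_var]) (simp add: pencil_axis fls_hom.mp_eval_var)
  finally show ?thesis .
qed

lemma subfield_EL: "subfield EL (subset_ring S)"
proof (rule subfield_subset_ring)
  show "field (subset_ring S)" unfolding S_def by (rule field_quot)
qed (use EL_subset_S in \<open>auto intro: quot_1 quot_add quot_uminus quot_mult quot_inverse\<close>)

text \<open>Algebraic elements are closed under the field operations, so it is enough to treat z, a
  root of X^n - g(x).\<close>

lemma algebraic_over_EL:
  assumes "f \<in> S"
  shows "ring.algebraic (subset_ring S) EL f"
proof -
  let ?R = "subset_ring S"
  interpret R: field ?R unfolding S_def by (rule field_quot)
  let ?A = "{x \<in> carrier ?R. (R.algebraic over EL) x}"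
  have sub: "subring ?A ?R" using R.subfield_of_algebraics[OF subfield_EL] by (rule subfieldE(1))
  have add: "a + b \<in> ?A" if "a \<in> ?A" "b \<in> ?A" for a b using subringE(7)[OF sub that] by simp
  have mult: "a * b \<in> ?A" if "a \<in> ?A" "b \<in> ?A" for a b using subringE(6)[OF sub that] by simp
  have one: "1 \<in> ?A" using subringE(3)[OF sub] by simp
  have zero: "0 \<in> ?A" using subringE(2)[OF sub] by simp
  have E: "e \<in> ?A" if "e \<in> EL" for e
    using R.algebraic_self[OF subfieldE(1)[OF subfield_EL] that] EL_subset_S that by auto
  have pow: "Z0 [^]\<^bsub>?R\<^esub> (k :: nat) = Z0 ^ k" for k by (induction k) (simp_all add: mult.commute)
  have Z: "Z0 \<in> ?A"
  proof -
    let ?c = "- pev g X0"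
    have c: "?c \<in> EL" by (intro quot_uminus quot_pev X0_in_EL)
    then have cS: "?c \<in> S" using EL_subset_S by blast
    \<comment> \<open>Coefficients are listed from the leading one down: this is X^n - g(x).\<close>
    let ?p = "1 # replicate (n - 1) 0 @ [?c]"
    have ev: "R.eval (replicate k 0 @ [?c]) Z0 = ?c" for k
      by (induction k) (simp_all add: pow)
    have "R.eval ?p Z0 = 0"
      using ev[of "n - 1"] n0 curve_generic by (simp add: pow curve_def)
    moreover have "?p \<in> carrier (EL [X]\<^bsub>?R\<^esub>)"
      unfolding univ_poly_def polynomial_def using c by (auto intro: quot_1 quot_0)
    ultimately have "R.algebraic EL Z0" using R.algebraicI[of ?p EL Z0] by (simp add: over_def)
    then show ?thesis using Z0_in_S by (simp add: over_def)
  qed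
  have Zk: "Z0 ^ k \<in> ?A" for k by (induction k) (use one mult Z in auto)
  obtain P D where f: "D \<noteq> 0" "f = val P X0 Z0 / pev D X0" using SE[OF assms] by blast
  have "(\<Sum>j\<in>J. pev (P j) X0 * Z0 ^ j) \<in> ?A" for J
  proof (induction J rule: infinite_finite_induct)
    case (insert j J)
    then show ?case using add[OF mult[OF E[OF quot_pev[OF X0_in_EL]] Zk]] by simp
  qed (use zero in simp_all)
  then have "val P X0 Z0 \<in> ?A" unfolding val_def .
  then have "val P X0 Z0 * inverse (pev D X0) \<in> ?A"
    by (rule mult[OF _ E[OF quot_inverse[OF quot_pev[OF X0_in_EL]]]])
  then have "f \<in> ?A" unfolding f(2) divide_inverse .
  then show ?thesis by (simp add: over_def)
qed

text \<open>The point (x, c z) lies on the curve and has coordinates in \<open>S\<close>, so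
  expansion at it maps \<open>S\<close> to itself; the same construction for 1/c provides
  preimages.\<close>

lemma deck_transformation:
  assumes "c ^ n = 1"
  shows "emb X0 (fls_const c * Z0) \<in> ring_iso (subset_ring S) (subset_ring S)"
    "e \<in> EL \<Longrightarrow> emb X0 (fls_const c * Z0) e = e"
proof -
  let ?s = "emb X0 (fls_const c * Z0)"
  have p: "place X0 (fls_const c * Z0)"
    unfolding place_def using curve_scale[OF curve_generic assms] nonconst_X0 by simp
  have c0: "c \<noteq> 0" using assms n0 by (auto simp: power_0_left)
  have closed: "?s f \<in> S" if f: "f \<in> S" for f
  proof -
    obtain P D where "D \<noteq> 0" "f = val P X0 Z0 / pev D X0" using SE[OF f] by blast
    then show ?thesis using emb_val[OF nonconst_X0] by (simp add: val_scale S_closed)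
  qed
  have surj: "\<exists>h\<in>S. ?s h = f" if f: "f \<in> S" for f
  proof -
    obtain P D where P: "D \<noteq> 0" "f = val P X0 Z0 / pev D X0" using SE[OF f] by blast
    let ?h = "val P X0 (fls_const (inverse c) * Z0) / pev D X0"
    have "?s ?h = val (\<lambda>j. Polynomial.smult (inverse c ^ j) (P j)) X0 (fls_const c * Z0) / pev D X0"
      unfolding val_scale[of P X0 "inverse c"] using emb_val[OF nonconst_X0 P(1)] .
    also have "\<dots> = val P X0 (fls_const (inverse c) * (fls_const c * Z0)) / pev D X0" unfolding val_scale ..
    also have "fls_const (inverse c) * (fls_const c * Z0) = Z0" using c0 by (simp flip: mult.assoc)
    finally show ?thesis using P(2) by (intro bexI[of _ ?h]) (auto simp: val_scale[of P X0 "inverse c"] S_closed)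
  qed
  show "?s \<in> ring_iso (subset_ring S) (subset_ring S)"
  proof (rule ring_iso_memI)
    show "bij_betw ?s (carrier (subset_ring S)) (carrier (subset_ring S))"
      unfolding subset_ring_simps bij_betw_def
    proof
      show "inj_on ?s S"
      proof (rule inj_onI)
        fix a b assume ab: "a \<in> S" "b \<in> S" "?s a = ?s b"
        then have "?s (a - b) = 0" by (simp add: emb_diff[OF p])
        then show "a = b" using emb_eq_0_iff[OF p, of "a - b"] ab S_closed(4) by simp
      qed
      show "?s ` S = S"
      proof (intro equalityI subsetI)
        show "f \<in> ?s ` S" if "f \<in> S" for f using surj[OF that] by blast
      qed (use closed in blast)
    qed
  qed (use closed p in \<open>auto simp: emb_add emb_mult emb_1 nonconst_X0\<close>)
  show "?s e = e" if "e \<in> EL"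
  proof -
    obtain A B where e: "e = ev (pencil (pt X0 Z0) (axis 1 1) (axis 2 1)) A / ev (pencil (pt X0 Z0) (axis 1 1) (axis 2 1)) B"
      using \<open>e \<in> EL\<close> by (elim quotE)
    have s: "(if i = 1 then X0 else 1) \<in> S" for i :: 2 by (simp add: S_closed)
    have s': "(\<lambda>i::2. ?s (if i = 1 then X0 else 1)) = (\<lambda>i. if i = 1 then X0 else 1)"
      by (rule ext) (simp add: emb_X0 emb_1 nonconst_X0)
    show ?thesis
      unfolding e pencil_axis emb_divide[OF p emb_ev_S(1)[OF p s] emb_ev_S(1)[OF p s]] emb_ev_S(2)[OF p s] s' ..
  qed
qed

text \<open>The deck transformation of one primitive root already has K(x) as its fixed field, by
  \<open>fixed_by_scaling\<close>.\<close>

lemma galois_axis_point: "pencil_galois (pt X0 Z0) (axis 1 1) (axis 2 1)"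
proof -
  obtain \<zeta> :: 'k where z: "primitive_root_of_unity n \<zeta>" using exists_primitive_root[OF n0] by blast
  then have zn: "\<zeta> ^ n = 1" by (simp add: primitive_root_of_unity_def)
  have "f \<in> EL" if f: "f \<in> S" and fixed: "emb X0 (fls_const \<zeta> * Z0) f = f" for f
  proof -
    obtain P D where P: "D \<noteq> 0" "f = val P X0 Z0 / pev D X0" using SE[OF f] by blast
    have "pev D X0 \<noteq> 0" using pev_nonzero[OF nonconst_X0 P(1)] .
    then have "val P X0 (fls_const \<zeta> * Z0) = val P X0 Z0"
      using fixed emb_val[OF nonconst_X0 P(1), of "fls_const \<zeta> * Z0" P] unfolding P(2) by simp
    then have "val P X0 Z0 = pev (P 0) X0" by (rule fixed_by_scaling(2)[OF z])
    then have "f = pev (P 0) X0 / pev D X0" unfolding P(2) by (rule arg_cong)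
    then show ?thesis using X0_in_EL by (simp add: quot_divide quot_pev)
  qed
  then have "{x \<in> S. \<forall>\<sigma>\<in>ring_iso (subset_ring S) (subset_ring S). (\<forall>e\<in>EL. \<sigma> e = e) \<longrightarrow> \<sigma> x = x} \<subseteq> EL"
    using deck_transformation[OF zn] by blast
  then have "{x \<in> S. \<forall>\<sigma>\<in>ring_iso (subset_ring S) (subset_ring S). (\<forall>e\<in>EL. \<sigma> e = e) \<longrightarrow> \<sigma> x = x} = EL"
    using EL_subset_S by blast
  then show ?thesis
    unfolding galois_extension_def S_def[symmetric] subset_ring_simps
    using subfield_EL algebraic_over_EL field_quot[of "pt X0 Z0", folded S_def] by blast
qed

subsection \<open>The inner Galois point of the normal form\<close>

lemma mp_value_NF_affine: "mp_value NF (vector [x, 1, z]) = z ^ n - poly g x"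
  unfolding mp_value_normal_form by (simp add: poly_altdef degree_g)

lemma mp_value_NF_infinity: "v $ 2 = 0 \<Longrightarrow> mp_value NF v = - (v $ 1 ^ Suc n)"
proof -
  assume "v $ 2 = 0"
  then have "(\<Sum>k\<le>Suc n. Polynomial.coeff g k * v $ 1 ^ k * v $ 2 ^ (Suc n - k)) =
    (\<Sum>k\<le>Suc n. if k = Suc n then Polynomial.coeff g k * v $ 1 ^ k else 0)"
    by (intro sum.cong) (auto simp: power_0_left)
  then show ?thesis unfolding mp_value_normal_form using \<open>v $ 2 = 0\<close> monic by (simp del: power_Suc)
qed

lemma axis_point: "zeros (axis 1 1) (axis 2 1) = point (axis 3 (1 :: 'k))"
proof (intro equalityI subsetI)
  fix v :: "'k ^ 3" assume "v \<in> zeros (axis 1 1) (axis 2 1)"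
  then have v: "v \<noteq> 0" "v $ 1 = 0" "v $ 2 = 0" by (auto simp: zeros_def mp_value_linear_form sum_3 axis_def)
  then have "v = v $ 3 *s axis 3 1" "v $ 3 \<noteq> 0" by (auto simp: vec_eq_iff forall_3 axis_def)
  then show "v \<in> point (axis 3 1)" unfolding point_def by blast
next
  fix v :: "'k ^ 3" assume "v \<in> point (axis 3 1)"
  then show "v \<in> zeros (axis 1 1) (axis 2 1)"
    by (auto simp: point_def zeros_def mp_value_linear_form sum_3 axis_def vec_eq_iff)
qed

text \<open>On the line at infinity the form reduces to -x^(n+1), so [0 : 0 : 1] is the only point
  of the curve there; all others are affine and excluded.\<close>

lemma galois_point_NF_cases:
  assumes "galois_point NF P" "on_curve NF P"
  shows "P = point (axis 3 1)"
proof -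
  obtain l m where lm: "P \<in> proj_plane" "P = zeros l m" "pencil_galois (pt X0 Z0) l m"
    using assms(1) unfolding galois_point_iff[OF generic_normal_form] by blast
  obtain v where v: "v \<noteq> 0" "P = point v" using lm(1) unfolding proj_plane_iff by blast
  have on: "mp_value NF w = 0" if "w \<in> P" for w using assms(2) that by (simp add: on_curve_def)
  show ?thesis
  proof (cases "v $ 2 = 0")
    case True
    have "v $ 1 = 0" using mp_value_NF_infinity[OF True] on[of v] v(2) point_self[of v] by (simp del: power_Suc)
    then have "v = v $ 3 *s axis 3 1" "v $ 3 \<noteq> 0" using True v(1) by (auto simp: vec_eq_iff forall_3 axis_def)
    then show ?thesis unfolding v(2) point_eq_iff by blast
  next
    case False
    let ?w = "vector [v $ 1 / v $ 2, 1, v $ 3 / v $ 2] :: 'k ^ 3"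
    have "v = v $ 2 *s ?w" using False by (auto simp: vec_eq_iff forall_3)
    then have Pw: "P = point ?w" unfolding v(2) point_eq_iff using False by blast
    have "mp_value NF ?w = 0" by (rule on, unfold Pw, rule point_self)
    then have "(v $ 3 / v $ 2) ^ n = poly g (v $ 1 / v $ 2)" unfolding mp_value_NF_affine by simp
    then show ?thesis using no_affine_galois_point[of l m "v $ 1 / v $ 2" "v $ 3 / v $ 2"] lm Pw by (simp add: S_def)
  qed
qed

lemma inner_galois_point_NF: "inner_galois_point NF P \<longleftrightarrow> P = point (axis 3 1)"
proof
  assume "inner_galois_point NF P"
  then show "P = point (axis 3 1)" using galois_point_NF_cases by (simp add: inner_galois_point_def)
next
  assume P: "P = point (axis 3 1)"
  have "point (axis 3 (1 :: 'k)) \<in> proj_plane" unfolding proj_plane_iff by (metis axis_eq_0_iff zero_neq_one)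
  then have "galois_point NF P"
    unfolding P galois_point_iff[OF generic_normal_form] using galois_axis_point axis_point by blast
  moreover have "on_curve NF P"
    unfolding on_curve_def P point_def using mp_value_NF_infinity n0 by (auto simp: axis_def)
  ultimately show "inner_galois_point NF P" by (simp add: inner_galois_point_def)
qed

end

section \<open>The projective group and the automorphisms of the curve\<close>

section \<open>The projective linear group\<close>

lemma GL3_simps [simp]: "carrier GL3 = {A. invertible A}" "mult GL3 = (**)" "one GL3 = mat 1"
  by (simp_all add: GL3_def)

lemma mat_vector: "mat c *v v = (c :: 'k::field) *s v" for v :: "'k::field ^ 3"
  by (simp add: vec_eq_iff matrix_vector_mult_def mat_def if_distrib[of "\<lambda>x. x * _"] cong: if_cong)

lemma mat_mult_commute:
  fixes A :: "'k::field ^ 3 ^ 3"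
  shows "mat c ** A = A ** mat c"
  by (simp add: matrix_eq matrix_vector_mul_assoc[symmetric] mat_vector vec.scale)

lemma mat_mult_mat: "mat a ** mat b = (mat (a * b) :: 'k::field ^ 3 ^ 3)"
  by (simp add: matrix_eq matrix_vector_mul_assoc[symmetric] mat_vector)

lemma invertible_mat: "c \<noteq> 0 \<Longrightarrow> invertible (mat c :: 'k::field ^ 3 ^ 3)"
  unfolding invertible_def by (intro exI[of _ "mat (inverse c)"]) (simp add: mat_mult_mat)

lemma group_GL3: "group (GL3 :: ('k::field ^ 3 ^ 3) monoid)"
proof (rule groupI)
  fix A :: "'k ^ 3 ^ 3" assume "A \<in> carrier GL3"
  then show "\<exists>B\<in>carrier GL3. B \<otimes>\<^bsub>GL3\<^esub> A = \<one>\<^bsub>GL3\<^esub>"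
    using invertible_matrix_inv[of A] matrix_inv_left[of A] by auto
qed (auto simp: invertible_mult matrix_mul_assoc invertible_mat)

lemma scalar_matrices_normal: "scalar_matrices \<lhd> (GL3 :: ('k::field ^ 3 ^ 3) monoid)"
proof (rule group.normalI[OF group_GL3])
  show "subgroup scalar_matrices (GL3 :: ('k ^ 3 ^ 3) monoid)"
  proof (rule group.subgroupI[OF group_GL3])
    show "scalar_matrices \<subseteq> carrier (GL3 :: ('k ^ 3 ^ 3) monoid)" by (auto simp: scalar_matrices_def invertible_mat)
    show "scalar_matrices \<noteq> ({} :: ('k ^ 3 ^ 3) set)" by (auto simp: scalar_matrices_def intro: exI[of _ 1])
    fix A :: "'k ^ 3 ^ 3" assume "A \<in> scalar_matrices"
    then obtain a where a: "A = mat a" "a \<noteq> 0" by (auto simp: scalar_matrices_def)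
    then have "inv\<^bsub>GL3\<^esub> A = mat (inverse a)"
      using invertible_mat by (intro group.inv_equality[OF group_GL3]) (auto simp: mat_mult_mat)
    then show "inv\<^bsub>GL3\<^esub> A \<in> scalar_matrices" using a by (auto simp: scalar_matrices_def)
    fix B :: "'k ^ 3 ^ 3" assume "B \<in> scalar_matrices"
    then obtain b where "B = mat b" "b \<noteq> 0" by (auto simp: scalar_matrices_def)
    then show "A \<otimes>\<^bsub>GL3\<^esub> B \<in> scalar_matrices" using a by (auto simp: scalar_matrices_def mat_mult_mat)
  qed
  show "\<forall>A\<in>carrier GL3. scalar_matrices #>\<^bsub>GL3\<^esub> A = A <#\<^bsub>GL3\<^esub> (scalar_matrices :: ('k ^ 3 ^ 3) set)"
    unfolding r_coset_def l_coset_def by (auto simp: scalar_matrices_def mat_mult_commute)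
qed

lemma proj_class_altdef: "proj_class A = {mat c ** A | c. c \<noteq> 0}"
  by (auto simp: proj_class_def r_coset_def scalar_matrices_def)

lemma proj_class_eq_iff: "proj_class A = proj_class B \<longleftrightarrow> (\<exists>c. c \<noteq> 0 \<and> A = mat c ** B)"
proof
  assume "proj_class A = proj_class B"
  moreover have "mat 1 ** A \<in> proj_class A" unfolding proj_class_altdef by (intro CollectI exI[of _ 1]) simp
  ultimately show "\<exists>c. c \<noteq> 0 \<and> A = mat c ** B" by (auto simp: proj_class_altdef)
next
  assume "\<exists>c. c \<noteq> 0 \<and> A = mat c ** B"
  then obtain c where c: "c \<noteq> 0" "A = mat c ** B" by blast
  show "proj_class A = proj_class B"
  proof (intro equalityI subsetI)
    fix C assume "C \<in> proj_class A"
    then obtain d where "d \<noteq> 0" "C = mat d ** (mat c ** B)" using c by (auto simp: proj_class_altdef)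
    then show "C \<in> proj_class B" using c(1) unfolding proj_class_altdef matrix_mul_assoc mat_mult_mat
      by (intro CollectI exI[of _ "d * c"]) auto
  next
    fix C assume "C \<in> proj_class B"
    then obtain d where d: "d \<noteq> 0" "C = mat d ** B" by (auto simp: proj_class_altdef)
    have "C = mat (d / c) ** A" using c(1) d(2) unfolding c(2) matrix_mul_assoc mat_mult_mat by simp
    then show "C \<in> proj_class A" using c(1) d(1) unfolding proj_class_altdef by (intro CollectI exI[of _ "d / c"]) auto
  qed
qed

lemma proj_class_eq_1_iff: "proj_class A = proj_class (mat 1) \<longleftrightarrow> (\<exists>c. c \<noteq> 0 \<and> (\<forall>v. A *v v = c *s v))"
  unfolding proj_class_eq_iff matrix_eq by (simp add: mat_vector)

lemma group_PGL3: "group (PGL3 :: ('k::field ^ 3 ^ 3) set monoid)"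
  unfolding PGL3_def by (rule normal.factorgroup_is_group[OF scalar_matrices_normal])

lemma carrier_PGL3: "carrier PGL3 = {proj_class A | A. invertible A}"
  by (auto simp: PGL3_def carrier_FactGroup proj_class_def)

lemma one_PGL3: "one PGL3 = proj_class (mat 1)"
  by (auto simp: PGL3_def proj_class_altdef scalar_matrices_def)

lemma mult_PGL3: "invertible A \<Longrightarrow> invertible B \<Longrightarrow> proj_class A \<otimes>\<^bsub>PGL3\<^esub> proj_class B = proj_class (A ** B)"
  using normal.rcos_sum[OF scalar_matrices_normal, of A B] by (simp add: PGL3_def proj_class_def)

text \<open>Powers are described by iterating the action on vectors, the form in which the
  diagonalisation takes them.\<close>

lemma pow_PGL3:
  assumes A: "invertible A"
  shows "\<exists>B. invertible B \<and> proj_class A [^]\<^bsub>PGL3\<^esub> (k :: nat) = proj_class B \<and> (\<forall>v. B *v v = ((*v) A ^^ k) v)"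
proof (induction k)
  case 0
  show ?case by (intro exI[of _ "mat 1"]) (simp add: one_PGL3 invertible_mat)
next
  case (Suc k)
  then obtain B where B: "invertible B" "proj_class A [^]\<^bsub>PGL3\<^esub> k = proj_class B" "\<And>v. B *v v = ((*v) A ^^ k) v" by blast
  have "(B ** A) *v v = ((*v) A ^^ Suc k) v" for v
    by (simp add: matrix_vector_mul_assoc[symmetric] B(3) funpow_swap1)
  then show ?case using B(1,2) A by (intro exI[of _ "B ** A"]) (simp add: mult_PGL3 invertible_mult)
qed

lemma pow_PGL3_eq_1_iff:
  assumes A: "invertible A"
  shows "proj_class A [^]\<^bsub>PGL3\<^esub> (k :: nat) = \<one>\<^bsub>PGL3\<^esub> \<longleftrightarrow> (\<exists>e. \<forall>v. ((*v) A ^^ k) v = e *s v)"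
proof -
  obtain B where B: "invertible B" "proj_class A [^]\<^bsub>PGL3\<^esub> k = proj_class B" "\<And>v. B *v v = ((*v) A ^^ k) v"
    using pow_PGL3[OF A] by blast
  have "e \<noteq> 0" if "\<forall>v. B *v v = e *s v" for e
  proof
    assume "e = 0"
    then have "B *v axis 1 1 = 0" using that by simp
    then have "axis 1 1 = (0 :: 'a ^ 3)" by (rule invertible_ker[OF B(1)])
    then show False by (simp add: axis_eq_0_iff)
  qed
  then show ?thesis unfolding B(2) one_PGL3 proj_class_eq_1_iff B(3)[symmetric] by blast
qed

subsection \<open>Automorphisms of a curve\<close>

definition aut_matrix :: "('k::field, 3) mpoly \<Rightarrow> 'k ^ 3 ^ 3 \<Rightarrow> bool"
  where "aut_matrix F A \<longleftrightarrow> invertible A \<and> (\<exists>c. c \<noteq> 0 \<and> transform_form A F = mp_const c * F)"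

lemma carrier_curve_Aut: "carrier (curve_Aut F) = {proj_class A | A. aut_matrix F A}"
  by (simp add: curve_Aut_def aut_matrix_def)

lemma aut_matrix_iff:
  fixes F :: "('k::field_char_0, 3) mpoly"
  shows "aut_matrix F A \<longleftrightarrow> invertible A \<and> (\<exists>c. c \<noteq> 0 \<and> (\<forall>v. mp_value F (A *v v) = c * mp_value F v))"
proof -
  have "transform_form A F = mp_const c * F \<longleftrightarrow> (\<forall>v. mp_value F (A *v v) = c * mp_value F v)" for c
  proof
    assume "transform_form A F = mp_const c * F"
    then have "mp_value (transform_form A F) v = mp_value (mp_const c * F) v" for v by simp
    then show "\<forall>v. mp_value F (A *v v) = c * mp_value F v" by (simp add: mp_value_transform mp_value_mult)
  next
    assume "\<forall>v. mp_value F (A *v v) = c * mp_value F v"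
    then show "transform_form A F = mp_const c * F"
      by (intro mp_value_ext) (simp add: mp_value_transform mp_value_mult)
  qed
  then show ?thesis by (simp add: aut_matrix_def)
qed

lemma aut_matrix_mult:
  fixes F :: "('k::field_char_0, 3) mpoly"
  assumes "aut_matrix F A" "aut_matrix F B"
  shows "aut_matrix F (A ** B)"
proof -
  obtain a b where ab: "a \<noteq> 0" "b \<noteq> 0" "\<And>v. mp_value F (A *v v) = a * mp_value F v" "\<And>v. mp_value F (B *v v) = b * mp_value F v"
    using assms unfolding aut_matrix_iff by blast
  then have "mp_value F ((A ** B) *v v) = (a * b) * mp_value F v" for v
    by (simp add: matrix_vector_mul_assoc[symmetric])
  then show ?thesis using ab(1,2) assms unfolding aut_matrix_iff by (metis invertible_mult mult_eq_0_iff)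
qed

lemma aut_matrix_inv:
  fixes F :: "('k::field_char_0, 3) mpoly"
  assumes "aut_matrix F A"
  shows "aut_matrix F (matrix_inv A)"
proof -
  have A: "invertible A" using assms by (simp add: aut_matrix_def)
  obtain a where a: "a \<noteq> 0" "\<And>v. mp_value F (A *v v) = a * mp_value F v" using assms unfolding aut_matrix_iff by blast
  have "mp_value F (matrix_inv A *v v) = inverse a * mp_value F v" for v
    using a(2)[of "matrix_inv A *v v"] a(1) by (simp add: matrix_inv_vector_right[OF A])
  then show ?thesis using a(1) invertible_matrix_inv[OF A] unfolding aut_matrix_iff by (metis inverse_nonzero_iff_nonzero)
qed

lemma subgroup_curve_Aut: "subgroup (carrier (curve_Aut F)) PGL3" for F :: "('k::field_char_0, 3) mpoly"
proof (rule group.subgroupI[OF group_PGL3])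
  show "carrier (curve_Aut F) \<subseteq> carrier PGL3" unfolding carrier_curve_Aut carrier_PGL3 aut_matrix_def by blast
  have "aut_matrix F (mat 1)" unfolding aut_matrix_iff using invertible_mat[of 1] by (auto intro: exI[of _ 1])
  then show "carrier (curve_Aut F) \<noteq> {}" unfolding carrier_curve_Aut by blast
  fix x assume "x \<in> carrier (curve_Aut F)"
  then obtain A where A: "aut_matrix F A" "x = proj_class A" unfolding carrier_curve_Aut by blast
  then have iA: "invertible A" by (simp add: aut_matrix_def)
  have "inv\<^bsub>PGL3\<^esub> x = proj_class (matrix_inv A)"
    unfolding A(2)
  proof (rule group.inv_equality[OF group_PGL3])
    show "proj_class (matrix_inv A) \<otimes>\<^bsub>PGL3\<^esub> proj_class A = \<one>\<^bsub>PGL3\<^esub>"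
      by (simp add: mult_PGL3 iA invertible_matrix_inv matrix_inv_left one_PGL3)
  qed (use iA invertible_matrix_inv in \<open>auto simp: carrier_PGL3\<close>)
  then show "inv\<^bsub>PGL3\<^esub> x \<in> carrier (curve_Aut F)" using aut_matrix_inv[OF A(1)] unfolding carrier_curve_Aut by blast
  fix y assume "y \<in> carrier (curve_Aut F)"
  then obtain B where B: "aut_matrix F B" "y = proj_class B" unfolding carrier_curve_Aut by blast
  then have "x \<otimes>\<^bsub>PGL3\<^esub> y = proj_class (A ** B)" using A iA by (simp add: mult_PGL3 aut_matrix_def)
  then show "x \<otimes>\<^bsub>PGL3\<^esub> y \<in> carrier (curve_Aut F)" using aut_matrix_mult[OF A(1) B(1)] unfolding carrier_curve_Aut by blast
qed

lemma curve_Aut_eq: "curve_Aut F = PGL3\<lparr>carrier := carrier (curve_Aut F)\<rparr>"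
  by (simp add: curve_Aut_def)

lemma group_curve_Aut: "group (curve_Aut F)" for F :: "('k::field_char_0, 3) mpoly"
  using subgroup.subgroup_is_group[OF subgroup_curve_Aut group_PGL3] curve_Aut_eq by metis

lemma curve_Aut_simps: "mult (curve_Aut F) = mult PGL3" "one (curve_Aut F) = one PGL3"
  by (simp_all add: curve_Aut_def)

lemma pow_curve_Aut: "x [^]\<^bsub>curve_Aut F\<^esub> (k :: nat) = x [^]\<^bsub>PGL3\<^esub> k"
  by (induction k) (simp_all add: curve_Aut_simps nat_pow_def)

section \<open>Finite cyclic groups\<close>

lemma root_of_unity_is_power:
  fixes z x :: "'k::field"
  assumes z: "primitive_root_of_unity N z" and x: "x ^ N = 1"
  shows "\<exists>i<N. x = z ^ i"
proof -
  have N: "N > 0" using z by (simp add: primitive_root_of_unity_def)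
  let ?p = "Polynomial.monom 1 N - 1 :: 'k poly"
  have d: "Polynomial.degree ?p \<le> N" by (intro degree_diff_le) (simp_all add: degree_monom_le)
  have "Polynomial.coeff ?p N = 1" using N by simp
  then have p0: "?p \<noteq> 0" by (metis coeff_0 zero_neq_one)
  have inj: "inj_on (\<lambda>i. z ^ i) {..<N}" using primitive_root_power_inj[OF z] by (auto intro: inj_onI)
  have roots: "poly ?p a = 0" if a: "a \<in> (\<lambda>i. z ^ i) ` {..<N}" for a
  proof -
    obtain i where "a = z ^ i" using a by blast
    moreover have "(z ^ i) ^ N = (z ^ N) ^ i" by (simp only: power_mult[symmetric] mult.commute)
    ultimately show ?thesis using z by (simp add: poly_monom primitive_root_of_unity_def)
  qed
  have "x \<in> (\<lambda>i. z ^ i) ` {..<N}"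
    by (rule poly_root_in_finite_set[OF p0 _ roots]) (use d x inj in \<open>auto simp: card_image poly_monom\<close>)
  then show ?thesis by blast
qed

text \<open>All values are powers of one primitive N-th root. An element whose value has the least
  positive exponent d generates: dividing an exponent by d leaves an element of smaller exponent,
  whose value is 1 and which is therefore trivial.\<close>

lemma cyclic_group_of_character:
  fixes G (structure) and \<phi> :: "'a \<Rightarrow> 'k::{alg_closed_field, field_char_0}"
  assumes G: "group G" and mult: "\<And>x y. x \<in> carrier G \<Longrightarrow> y \<in> carrier G \<Longrightarrow> \<phi> (x \<otimes> y) = \<phi> x * \<phi> y"
    and inj: "\<And>x. x \<in> carrier G \<Longrightarrow> \<phi> x = 1 \<Longrightarrow> x = \<one>" and N: "N > 0" and exp: "\<And>x. x \<in> carrier G \<Longrightarrow> \<phi> x ^ N = 1"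
  shows "cyclic_group G"
proof -
  interpret group G by fact
  obtain z :: 'k where z: "primitive_root_of_unity N z" using exists_primitive_root[OF N] by blast
  have zN: "z ^ N = 1" using z by (simp add: primitive_root_of_unity_def)
  have one: "\<phi> \<one> = 1" using mult[of \<one> \<one>] exp[of \<one>] N by (auto simp: power_0_left)
  let ?P = "\<lambda>i. i > 0 \<and> (\<exists>x\<in>carrier G. \<phi> x = z ^ i)"
  define d where "d = (LEAST i. ?P i)"
  have "?P N" using N zN one by (auto intro: bexI[of _ \<one>])
  then have d: "?P d" unfolding d_def by (rule LeastI)
  then obtain a where a: "a \<in> carrier G" "\<phi> a = z ^ d" by blast
  have pow: "\<phi> (x [^] (k :: nat)) = \<phi> x ^ k" if "x \<in> carrier G" for x k
    by (induction k) (use that one mult in \<open>auto simp: mult.commute\<close>)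
  have inv: "\<phi> (inv x) = inverse (\<phi> x)" if "x \<in> carrier G" for x
  proof -
    have "\<phi> x * \<phi> (inv x) = 1" using mult[of x "inv x"] that one by simp
    then show ?thesis by (simp add: inverse_unique)
  qed
  have gen: "\<exists>k::nat. x = a [^] k" if x: "x \<in> carrier G" for x
  proof -
    obtain i where i: "\<phi> x = z ^ i" using root_of_unity_is_power[OF z exp[OF x]] by blast
    let ?y = "x \<otimes> inv (a [^] (i div d))"
    have y: "?y \<in> carrier G" using x a(1) by simp
    have zn: "z \<noteq> 0" using primitive_root_nonzero[OF z] .
    have "z ^ i = z ^ (i mod d) * (z ^ d) ^ (i div d)" by (simp flip: power_mult power_add)
    then have chy: "\<phi> ?y = z ^ (i mod d)" using x a i zn by (simp add: mult inv pow)
    then have "\<not> 0 < i mod d" using not_less_Least[of "i mod d" ?P] d y unfolding d_def[symmetric]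
      by (metis mod_less_divisor)
    then have "\<phi> ?y = 1" using chy by simp
    then have "?y = \<one>" by (rule inj[OF y])
    then have "x = a [^] (i div d)" using x a(1) by (simp add: inv_equality inv_solve_right')
    then show ?thesis by blast
  qed
  have "carrier G = range (\<lambda>k::int. a [^] k)"
  proof
    show "carrier G \<subseteq> range (\<lambda>k::int. a [^] k)"
    proof
      fix x assume "x \<in> carrier G"
      then obtain k :: nat where "x = a [^] k" using gen by blast
      then have "x = a [^] int k" by (simp add: int_pow_int)
      then show "x \<in> range (\<lambda>k::int. a [^] k)" by blast
    qed
  qed (use a(1) in auto)
  then show ?thesis unfolding cyclic_group using a(1) by blast
qed

section \<open>Automorphisms of the normal form\<close>

lemma inner_galois_point_preimage:
  fixes F G :: "('k::field_char_0, 3) mpoly"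
  assumes gen: "generic F w" and M: "invertible M" and c: "c \<noteq> 0" and tr: "transform_form M G = mp_const c * F"
    and P: "inner_galois_point G P"
  shows "inner_galois_point F {v. M *v v \<in> P}"
proof -
  have P': "galois_point G P" "on_curve G P" using P by (simp_all add: inner_galois_point_def)
  have "mp_value G (M *v v) = c * mp_value F v" for v
    using arg_cong[OF tr, of "\<lambda>p. mp_value p v"] by (simp add: mp_value_transform mp_value_mult)
  then have "on_curve F {v. M *v v \<in> P}" using P'(2) c unfolding on_curve_def by force
  then show ?thesis
    using galois_point_preimage[OF gen generic_mact[OF gen M c tr] M P'(1)] by (simp add: inner_galois_point_def)
qed

context superelliptic
begin

text \<open>An automorphism permutes the inner Galois points, and there is only one.\<close>

lemma aut_fixes_axis_point:
  assumes "aut_matrix NF B"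
  shows "\<exists>k. k \<noteq> 0 \<and> B *v axis 3 1 = k *s axis 3 1"
proof -
  obtain c where c: "invertible B" "c \<noteq> 0" "transform_form B NF = mp_const c * NF"
    using assms by (auto simp: aut_matrix_def)
  have "inner_galois_point NF {v. B *v v \<in> point (axis 3 1)}"
    by (rule inner_galois_point_preimage[OF generic_normal_form c]) (simp add: inner_galois_point_NF)
  then have "{v. B *v v \<in> point (axis 3 1)} = point (axis 3 1)" by (simp only: inner_galois_point_NF)
  then have "B *v axis 3 1 \<in> point (axis 3 1)" using point_self[of "axis 3 1"] by blast
  then show ?thesis by (auto simp: point_def)
qed

text \<open>The fixed point [0 : 0 : 1] determines the third column. The other entries follow from
  comparing the transformed equation with the original one as polynomials in z for fixed x.\<close>

lemma aut_normal_form: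
  assumes "aut_matrix NF B"
  shows "B $ 1 $ 3 = 0" "B $ 2 $ 3 = 0" "B $ 2 $ 1 = 0" "B $ 3 $ 1 = 0" "B $ 3 $ 2 = 0" "B $ 2 $ 2 \<noteq> 0" "B $ 3 $ 3 \<noteq> 0"
    "poly g ((B $ 1 $ 1 / B $ 2 $ 2) * x + B $ 1 $ 2 / B $ 2 $ 2) = (B $ 3 $ 3 / B $ 2 $ 2) ^ n * poly g x"
proof -
  obtain k where k: "k \<noteq> 0" "B *v axis 3 1 = k *s axis 3 1" using aut_fixes_axis_point[OF assms] by blast
  have col: "B $ i $ 3 = (if i = 3 then k else 0)" for i
  proof -
    have "(B *v axis 3 1) $ i = B $ i $ 3" by (simp add: matrix_vector_mult_def sum_3 axis_def)
    then show ?thesis unfolding k(2) by (auto simp: axis_def)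
  qed
  show B13: "B $ 1 $ 3 = 0" and B23: "B $ 2 $ 3 = 0" and B33: "B $ 3 $ 3 \<noteq> 0" using col k(1) by simp_all
  obtain c where c: "c \<noteq> 0" "\<And>v. mp_value NF (B *v v) = c * mp_value NF v" using assms unfolding aut_matrix_iff by blast
  let ?q = "B $ 3 $ 3"
  let ?r = "\<lambda>x. B $ 3 $ 1 * x + B $ 3 $ 2" and ?s = "\<lambda>x. B $ 2 $ 1 * x + B $ 2 $ 2" and ?t = "\<lambda>x. B $ 1 $ 1 * x + B $ 1 $ 2"
  let ?G = "\<lambda>x. \<Sum>k\<le>Suc n. Polynomial.coeff g k * ?t x ^ k * ?s x ^ (Suc n - k)"
  have comp: "(B *v vector [x, 1, z]) $ 1 = ?t x" "(B *v vector [x, 1, z]) $ 2 = ?s x"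
    "(B *v vector [x, 1, z]) $ 3 = ?r x + ?q * z" for x z
    using B13 B23 by (simp_all add: matrix_vector_mult_def sum_3)
  have eq: "(?r x + ?q * z) ^ n * ?s x - ?G x = c * (z ^ n - poly g x)" for x z
    using c(2)[of "vector [x, 1, z]"] unfolding mp_value_NF_affine unfolding mp_value_normal_form comp .
  have r0: "?r x = 0" for x
  proof -
    let ?p = "Polynomial.smult (?s x) ([:?r x, ?q:] ^ n) - Polynomial.monom c n - [:?G x - c * poly g x:]"
    have "poly ?p z = 0" for z
      using eq[of x z] by (simp add: poly_monom algebra_simps del: sum.atMost_Suc)
    then have "?p = 0" by (metis (no_types, lifting) poly_0 poly_eq_poly_eq_iff ext)
    then have "pderiv ?p = 0" by (simp only: pderiv_0)
    \<comment> \<open>At the zero of the linear factor its n-th power contributes nothing to the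
      derivative, so the remaining term n c z^(n-1) must vanish at that zero, which is therefore
      0.\<close>
    then have e1: "poly (pderiv ?p) (- ?r x / ?q) = 0" by (simp only: poly_0)
    have e2: "poly (pderiv ?p) (- ?r x / ?q) = - (of_nat n * c * (- ?r x / ?q) ^ (n - 1))"
      using n4 B33 by (simp add: pderiv_diff pderiv_smult pderiv_power pderiv_monom pderiv_pCons poly_monom power_0_left)
    have "of_nat n * c * (- ?r x / ?q) ^ (n - 1) = 0" using e1 unfolding e2 by (simp only: neg_equal_0_iff_equal)
    then have "- ?r x / ?q = 0" using c(1) n0 by (simp only: mult_eq_0_iff of_nat_eq_0_iff power_eq_0_iff) simp
    then show "?r x = 0" using B33 by (simp only: divide_eq_0_iff neg_equal_0_iff_equal) simp
  qed
  show B32: "B $ 3 $ 2 = 0" using r0[of 0] by simp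
  show "B $ 3 $ 1 = 0" using r0[of 1] B32 by simp
  \<comment> \<open>Subtracting the identities at z = 0 and z = 1 removes g and shows that the
    second coordinate of the image is constant in x.\<close>
  have s: "?q ^ n * ?s x = c" for x
  proof -
    have "?q ^ n * ?s x - ?G x = c * (1 - poly g x)" using eq[of x 1] r0[of x] by simp
    moreover have "- ?G x = c * (- poly g x)" using eq[of x 0] r0[of x] n0 by (simp add: power_0_left)
    ultimately show ?thesis by (simp add: algebra_simps del: sum.atMost_Suc)
  qed
  show B22: "B $ 2 $ 2 \<noteq> 0" using s[of 0] c(1) by auto
  have "?q ^ n * ?s 1 = ?q ^ n * ?s 0" by (simp only: s)
  then show B21: "B $ 2 $ 1 = 0" using B33 by simp
  let ?w = "vector [?t x / B $ 2 $ 2, 1, 0] :: 'k ^ 3"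
  have "B *v vector [x, 1, 0] = B $ 2 $ 2 *s ?w"
    using comp[of x 0] r0[of x] B21 B22 by (simp add: vec_eq_iff forall_3)
  then have "c * (0 ^ n - poly g x) = B $ 2 $ 2 ^ Suc n * (0 ^ n - poly g (?t x / B $ 2 $ 2))"
    using c(2)[of "vector [x, 1, 0]"] mp_value_homogeneous_scale[OF homogeneous_normal_form, of n g "B $ 2 $ 2" ?w]
    unfolding mp_value_NF_affine by simp
  then have "c * poly g x = B $ 2 $ 2 ^ Suc n * poly g (?t x / B $ 2 $ 2)" using n0 by (simp add: power_0_left)
  then have "B $ 2 $ 2 * (?q ^ n * poly g x) = B $ 2 $ 2 * (B $ 2 $ 2 ^ n * poly g (?t x / B $ 2 $ 2))"
    using s[of 0] by (simp add: mult_ac)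
  then have "?q ^ n * poly g x = B $ 2 $ 2 ^ n * poly g (?t x / B $ 2 $ 2)" using B22 by simp
  then show "poly g ((B $ 1 $ 1 / B $ 2 $ 2) * x + B $ 1 $ 2 / B $ 2 $ 2) = (B $ 3 $ 3 / B $ 2 $ 2) ^ n * poly g x"
    using B22 by (simp add: power_divide add_divide_distrib nonzero_eq_divide_eq mult.commute)
qed

text \<open>If \<alpha> \<noteq> 1, moving the fixed point of x to \<alpha> x + \<beta> to the
  origin turns g into h with h(\<alpha> x) = \<mu>^n h(x). Squarefreeness keeps one of the two
  lowest coefficients of h nonzero, so \<mu>^n is 1 or \<alpha>; with \<alpha>^(n+1) = \<mu>^n this
  gives \<alpha>^(n+1) = 1 or \<alpha>^n = 1. The exponent n (n + 1) covers both cases, and a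
  further factor n covers \<mu>.\<close>

lemma affine_symmetry:
  assumes sym: "\<And>x. poly g (\<alpha> * x + \<beta>) = \<mu> ^ n * poly g x" and m: "\<mu> \<noteq> 0"
  shows "(\<alpha> / \<mu>) ^ (n * (n * Suc n)) = 1" "\<alpha> = \<mu> \<Longrightarrow> \<alpha> = 1 \<and> \<beta> = 0"
proof -
  have g: "pcompose g [:\<beta>, \<alpha>:] = Polynomial.smult (\<mu> ^ n) g"
  proof -
    have "poly (pcompose g [:\<beta>, \<alpha>:]) = poly (Polynomial.smult (\<mu> ^ n) g)"
      by (rule ext) (use sym in \<open>simp add: poly_pcompose add.commute mult.commute\<close>)
    then show ?thesis by (simp add: poly_eq_poly_eq_iff)
  qed
  have a0: "\<alpha> \<noteq> 0"
  proof
    assume "\<alpha> = 0"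
    then have "Polynomial.degree (pcompose g [:\<beta>, \<alpha>:]) = 0" by (simp add: degree_pcompose)
    then show False unfolding g using m degree_g by simp
  qed
  have lead: "\<alpha> ^ Suc n = \<mu> ^ n"
    using lead_coeff_comp[of "[:\<beta>, \<alpha>:]" g] a0 m degree_g monic unfolding g by (simp del: power_Suc)
  have "\<alpha> ^ (n * Suc n) = 1 \<or> \<alpha> = 1"
  proof (cases "\<alpha> = 1")
    case False
    define y where "y = \<beta> / (1 - \<alpha>)"
    have y: "\<alpha> * y + \<beta> = y" using False by (simp add: y_def field_simps)
    define h where "h = pcompose g [:y, 1:]"
    have "poly h (\<alpha> * x) = \<mu> ^ n * poly h x" for x
    proof -
      have "poly h (\<alpha> * x) = poly g (y + \<alpha> * x)" by (simp add: h_def poly_pcompose)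
      also have "y + \<alpha> * x = \<alpha> * (y + x) + \<beta>" using y by (simp add: algebra_simps)
      finally show ?thesis by (simp add: sym h_def poly_pcompose)
    qed
    then have "poly (pcompose h [:0, \<alpha>:]) = poly (Polynomial.smult (\<mu> ^ n) h)"
      by (intro ext) (simp add: poly_pcompose mult.commute)
    then have h: "pcompose h [:0, \<alpha>:] = Polynomial.smult (\<mu> ^ n) h" by (simp add: poly_eq_poly_eq_iff)
    have ck: "\<alpha> ^ k = \<mu> ^ n" if "Polynomial.coeff h k \<noteq> 0" for k
      using arg_cong[OF h, of "\<lambda>p. Polynomial.coeff p k"] that by (simp add: coeff_pcompose_linear)
    have h0: "Polynomial.coeff h 0 = poly g y" by (simp add: h_def poly_pcompose flip: poly_0_coeff_0)
    have "Polynomial.coeff h 1 = poly (pderiv h) 0" by (simp add: poly_0_coeff_0 coeff_pderiv)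
    also have "\<dots> = poly (pderiv g) y" by (simp add: h_def pderiv_pcompose poly_pcompose pderiv_pCons)
    finally have "Polynomial.coeff h 0 \<noteq> 0 \<or> Polynomial.coeff h 1 \<noteq> 0" using h0 sqf[of y] by auto
    then have "\<alpha> ^ Suc n = 1 \<or> \<alpha> ^ n = 1"
    proof
      assume "Polynomial.coeff h 0 \<noteq> 0"
      then show ?thesis using ck[of 0] lead by simp
    next
      assume "Polynomial.coeff h 1 \<noteq> 0"
      then have "\<alpha> * \<alpha> ^ n = \<alpha> * 1" using ck[of 1] lead by simp
      then show ?thesis using a0 by simp
    qed
    then show ?thesis by (metis power_mult power_one mult.commute)
  qed simp
  then have "\<alpha> ^ (n * Suc n) = 1" by (elim disjE) simp_all
  moreover have "\<mu> ^ (n * (n * Suc n)) = (\<alpha> ^ (n * Suc n)) ^ Suc n"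
    unfolding power_mult[of \<mu>] lead[symmetric] by (simp only: power_mult[symmetric] mult.commute)
  moreover have "\<alpha> ^ (n * (n * Suc n)) = (\<alpha> ^ (n * Suc n)) ^ n" by (simp only: power_mult[symmetric] mult.commute)
  ultimately show "(\<alpha> / \<mu>) ^ (n * (n * Suc n)) = 1" unfolding power_divide by simp
  assume "\<alpha> = \<mu>"
  then have "\<alpha> ^ n * \<alpha> = \<alpha> ^ n * 1" using lead by (simp add: mult.commute)
  then have a1: "\<alpha> = 1" using a0 by simp
  \<comment> \<open>A nontrivial translation preserving g would give it the same value at infinitely
    many points.\<close>
  have shift: "poly g (\<beta> * of_nat k) = poly g 0" for k
  proof (induction k)
    case (Suc k)
    have "poly g (\<beta> * of_nat (Suc k)) = poly g (\<alpha> * (\<beta> * of_nat k) + \<beta>)" by (simp add: a1 algebra_simps)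
    then show ?case unfolding sym using Suc a1 \<open>\<alpha> = \<mu>\<close> by simp
  qed simp
  have "\<beta> = 0"
  proof (rule ccontr)
    assume "\<beta> \<noteq> 0"
    then have "inj (\<lambda>k. \<beta> * (of_nat k :: 'k))" by (auto intro: injI)
    then have "infinite (range (\<lambda>k. \<beta> * (of_nat k :: 'k)))" by (rule range_inj_infinite)
    moreover have "range (\<lambda>k. \<beta> * (of_nat k :: 'k)) \<subseteq> {x. poly (g - [:poly g 0:]) x = 0}" using shift by auto
    moreover have "g - [:poly g 0:] \<noteq> 0"
    proof
      assume "g - [:poly g 0:] = 0"
      then have "Polynomial.degree g = Polynomial.degree [:poly g 0:]" by simp
      then show False using degree_g by simp
    qed
    ultimately show False using poly_roots_finite finite_subset by blast
  qed
  then show "\<alpha> = 1 \<and> \<beta> = 0" using a1 by simp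
qed

text \<open>The ratio \<alpha> / \<mu> of the affine map, in which \<open>B $ 2 $ 2\<close> cancels;
  scalar matrices do not change it, so it descends to projective classes.\<close>

definition character :: "'k ^ 3 ^ 3 \<Rightarrow> 'k" where "character B = B $ 1 $ 1 / B $ 3 $ 3"

lemma character_scale: "c \<noteq> 0 \<Longrightarrow> character (mat c ** B) = character B"
  by (simp add: character_def matrix_matrix_mult_def sum_3 mat_def)

lemma character_mult:
  assumes "aut_matrix NF A" "aut_matrix NF B"
  shows "character (A ** B) = character A * character B"
  using aut_normal_form[OF assms(1)] aut_normal_form[OF assms(2)]
  by (simp add: character_def matrix_matrix_mult_def sum_3)

lemma character_power: "aut_matrix NF B \<Longrightarrow> character B ^ (n * (n * Suc n)) = 1"
  using affine_symmetry(1)[of "B $ 1 $ 1 / B $ 2 $ 2" "B $ 1 $ 2 / B $ 2 $ 2" "B $ 3 $ 3 / B $ 2 $ 2"]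
    aut_normal_form[of B] by (simp add: character_def)

lemma character_kernel:
  assumes "aut_matrix NF B" "character B = 1"
  shows "B = mat (B $ 2 $ 2)"
proof -
  note B = aut_normal_form[OF assms(1)]
  have "B $ 1 $ 1 = B $ 3 $ 3" using assms(2) B by (simp add: character_def)
  then have "B $ 1 $ 1 / B $ 2 $ 2 = 1 \<and> B $ 1 $ 2 / B $ 2 $ 2 = 0"
    using B by (intro affine_symmetry(2)[of _ _ "B $ 3 $ 3 / B $ 2 $ 2"]) auto
  then have "B $ 1 $ 1 = B $ 2 $ 2" "B $ 1 $ 2 = 0" "B $ 3 $ 3 = B $ 2 $ 2"
    using B(6) \<open>B $ 1 $ 1 = B $ 3 $ 3\<close> by simp_all
  then show ?thesis using B by (simp add: vec_eq_iff forall_3 mat_def)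
qed

end

locale normalised_curve = superelliptic n g for n and g :: "'k::{alg_closed_field, field_char_0} poly" +
  fixes F :: "('k, 3) mpoly" and M :: "'k ^ 3 ^ 3" and c :: 'k
  assumes M: "invertible M" and c: "c \<noteq> 0" and F: "transform_form M F = mp_const c * NF"
begin

abbreviation "M' \<equiv> matrix_inv M"

lemma M': "invertible M'" by (rule invertible_matrix_inv[OF M])

lemma mp_value_F: "mp_value F (M *v v) = c * mp_value NF v"
  using arg_cong[OF F, of "\<lambda>p. mp_value p v"] by (simp add: mp_value_transform mp_value_mult)

lemma generic_F: "generic F (mact M (pt X0 Z0))"
  by (rule generic_mact[OF generic_normal_form M c F])

text \<open>Inner Galois points are carried along \<open>M\<close> and its inverse, so existence and
  uniqueness both come from the normal form.\<close>

lemma unique_inner_galois_point: "\<exists>!P. inner_galois_point F P"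
proof (rule ex1I)
  have "transform_form M' NF = mp_const (inverse c) * F"
  proof (rule mp_value_ext)
    fix v show "mp_value (transform_form M' NF) v = mp_value (mp_const (inverse c) * F) v"
      using mp_value_F[of "M' *v v"] c by (simp add: mp_value_transform mp_value_mult matrix_inv_vector_right[OF M])
  qed
  then show "inner_galois_point F {v. M' *v v \<in> point (axis 3 1)}"
    using c by (intro inner_galois_point_preimage[OF generic_F M', of "inverse c" NF]) (auto simp: inner_galois_point_NF)
  fix P assume "inner_galois_point F P"
  then have "inner_galois_point NF {v. M *v v \<in> P}"
    by (rule inner_galois_point_preimage[OF generic_normal_form M c F])
  then have "{v. M *v v \<in> P} = point (axis 3 1)" by (simp only: inner_galois_point_NF)
  then have "M' *v u \<in> point (axis 3 1) \<longleftrightarrow> M *v (M' *v u) \<in> P" for u by blast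
  then show "P = {v. M' *v v \<in> point (axis 3 1)}" by (auto simp: matrix_inv_vector_right[OF M])
qed

lemma aut_matrix_conjugate: "aut_matrix F A \<Longrightarrow> aut_matrix NF (M' ** A ** M)"
proof -
  assume A: "aut_matrix F A"
  then obtain a where a: "a \<noteq> 0" "\<And>v. mp_value F (A *v v) = a * mp_value F v" unfolding aut_matrix_iff by blast
  have "c * mp_value NF ((M' ** A ** M) *v v) = c * (a * mp_value NF v)" for v
    using mp_value_F[of "M' *v (A *v (M *v v))"] a(2)[of "M *v v"]
    by (auto simp: mp_value_F matrix_inv_vector_right[OF M] simp flip: matrix_vector_mul_assoc)
  then have "mp_value NF ((M' ** A ** M) *v v) = a * mp_value NF v" for v using c by (metis mult_left_cancel)
  moreover have "invertible (M' ** A ** M)" using A M M' by (simp add: invertible_mult aut_matrix_def)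
  ultimately show ?thesis using a(1) unfolding aut_matrix_iff by blast
qed

definition class_character :: "('k ^ 3 ^ 3) set \<Rightarrow> 'k"
  where "class_character x = character (M' ** (SOME A. aut_matrix F A \<and> x = proj_class A) ** M)"

lemma class_character:
  assumes "aut_matrix F A"
  shows "class_character (proj_class A) = character (M' ** A ** M)"
proof -
  define B where "B = (SOME B. aut_matrix F B \<and> proj_class A = proj_class B)"
  have "aut_matrix F B \<and> proj_class A = proj_class B" unfolding B_def by (rule someI[of _ A]) (use assms in simp)
  then obtain a where a: "a \<noteq> 0" "A = mat a ** B" using proj_class_eq_iff by blast
  have "M' ** A ** M = mat a ** (M' ** B ** M)"
    unfolding a(2) by (simp add: matrix_mul_assoc mat_mult_commute[of a M'])
  then have "character (M' ** A ** M) = character (M' ** B ** M)" using character_scale[OF a(1)] by simp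
  then show ?thesis by (simp only: class_character_def B_def)
qed

lemma cyclic_curve_Aut: "cyclic_group (curve_Aut F)"
proof (rule cyclic_group_of_character[OF group_curve_Aut, where \<phi> = class_character])
  show "n * (n * Suc n) > 0" using n0 by simp
  fix x assume "x \<in> carrier (curve_Aut F)"
  then obtain A where A: "aut_matrix F A" "x = proj_class A" unfolding carrier_curve_Aut by blast
  have iA: "invertible A" using A(1) by (simp add: aut_matrix_def)
  show "class_character x ^ (n * (n * Suc n)) = 1"
    unfolding A(2) class_character[OF A(1)] by (rule character_power[OF aut_matrix_conjugate[OF A(1)]])
  show "x = \<one>\<^bsub>curve_Aut F\<^esub>" if "class_character x = 1"
  proof -
    have "character (M' ** A ** M) = 1" using that unfolding A(2) class_character[OF A(1)] .
    then obtain b where b: "b \<noteq> 0" "M' ** A ** M = mat b"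
      using character_kernel[OF aut_matrix_conjugate[OF A(1)]] aut_normal_form(6)[OF aut_matrix_conjugate[OF A(1)]] by blast
    have "A *v v = b *s v" for v
    proof -
      have "A *v v = M *v ((M' ** A ** M) *v (M' *v v))"
        by (simp add: matrix_inv_vector_right[OF M] flip: matrix_vector_mul_assoc)
      then show ?thesis unfolding b(2) by (simp add: mat_vector vec.scale matrix_inv_vector_right[OF M])
    qed
    then show ?thesis unfolding A(2) curve_Aut_simps one_PGL3 proj_class_eq_1_iff using b(1) by blast
  qed
  fix y assume "y \<in> carrier (curve_Aut F)"
  then obtain B where B: "aut_matrix F B" "y = proj_class B" unfolding carrier_curve_Aut by blast
  have iB: "invertible B" using B(1) by (simp add: aut_matrix_def)
  have "M' ** (A ** B) ** M = (M' ** A ** M) ** (M' ** B ** M)"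
    by (rule matrix_vector_eqI) (simp add: matrix_inv_vector_right[OF M] flip: matrix_vector_mul_assoc)
  then show "class_character (x \<otimes>\<^bsub>curve_Aut F\<^esub> y) = class_character x * class_character y"
    unfolding A(2) B(2) curve_Aut_simps mult_PGL3[OF iA iB] class_character[OF A(1)] class_character[OF B(1)]
      class_character[OF aut_matrix_mult[OF A(1) B(1)]]
    by (simp add: character_mult[OF aut_matrix_conjugate[OF A(1)] aut_matrix_conjugate[OF B(1)]])
qed

lemma diag3_vector: "diag3 x y z *v v = vector [x * v $ 1, y * v $ 2, z * v $ 3]"
  by (simp add: diag3_def vec_eq_iff forall_3 matrix_vector_mult_def sum_3)

lemma diag3_mult: "diag3 u v w ** diag3 x y z = (diag3 (u * x) (v * y) (w * z) :: 'k ^ 3 ^ 3)"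
  by (rule matrix_vector_eqI) (simp add: matrix_vector_mul_assoc[symmetric] diag3_vector mult.assoc)

lemma diag3_1: "diag3 1 1 1 = (mat 1 :: 'k ^ 3 ^ 3)"
  by (rule matrix_vector_eqI) (simp add: diag3_vector vec_eq_iff forall_3)

text \<open>The third coordinate enters the normal form only through its n-th power, so multiplying
  it by a primitive n-th root of unity preserves the curve. A power of this map is scalar only when
  it is the identity, as it fixes the first coordinate.\<close>

lemma exists_homology: "\<exists>h\<in>carrier (curve_Aut F). homology n h"
proof -
  obtain \<zeta> :: 'k where z: "primitive_root_of_unity n \<zeta>" using exists_primitive_root[OF n0] by blast
  have zn: "\<zeta> ^ n = 1" and z0: "\<zeta> \<noteq> 0" using z primitive_root_nonzero[OF z] by (simp_all add: primitive_root_of_unity_def)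
  let ?D = "diag3 1 (\<zeta> ^ 0) (\<zeta> ^ 1)"
  let ?H = "M ** ?D ** M'"
  have "?D ** diag3 1 1 (inverse \<zeta>) = mat 1" "diag3 1 1 (inverse \<zeta>) ** ?D = mat 1"
    using z0 by (simp_all add: diag3_mult diag3_1)
  then have iD: "invertible ?D" unfolding invertible_def by blast
  have iH: "invertible ?H" using M M' iD by (simp add: invertible_mult)
  have "mp_value F (?H *v v) = 1 * mp_value F v" for v
  proof -
    have "mp_value F (?H *v v) = c * mp_value NF (?D *v (M' *v v))"
      using mp_value_F by (simp flip: matrix_vector_mul_assoc)
    also have "mp_value NF (?D *v w) = mp_value NF w" for w
      unfolding mp_value_normal_form diag3_vector using zn by (simp add: power_mult_distrib)
    also have "c * mp_value NF (M' *v v) = mp_value F v" by (simp add: matrix_inv_vector_right[OF M] flip: mp_value_F)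
    finally show ?thesis by simp
  qed
  then have aut: "aut_matrix F ?H" unfolding aut_matrix_iff using iH zero_neq_one by metis
  have pow: "((*v) ?H ^^ k) v = M *v vector [(M' *v v) $ 1, (M' *v v) $ 2, \<zeta> ^ k * (M' *v v) $ 3]" for k v
  proof (induction k)
    case 0
    have "vector [(M' *v v) $ 1, (M' *v v) $ 2, \<zeta> ^ 0 * (M' *v v) $ 3] = M' *v v" by (simp add: vec_eq_iff forall_3)
    then show ?case by (simp add: matrix_inv_vector_right[OF M])
  next
    case (Suc k)
    let ?u = "vector [(M' *v v) $ 1, (M' *v v) $ 2, \<zeta> ^ k * (M' *v v) $ 3] :: 'k ^ 3"
    have "((*v) ?H ^^ Suc k) v = ?H *v (M *v ?u)" using Suc by simp
    also have "\<dots> = M *v (?D *v (M' *v (M *v ?u)))" by (simp flip: matrix_vector_mul_assoc)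
    also have "\<dots> = M *v vector [(M' *v v) $ 1, (M' *v v) $ 2, \<zeta> ^ Suc k * (M' *v v) $ 3]"
      unfolding matrix_inv_vector_left[OF M] diag3_vector by (simp add: mult.assoc)
    finally show ?case .
  qed
  have scalar: "(\<exists>e. \<forall>v. ((*v) ?H ^^ k) v = e *s v) \<longleftrightarrow> n dvd k" for k
  proof
    assume "\<exists>e. \<forall>v. ((*v) ?H ^^ k) v = e *s v"
    then obtain e where e: "\<And>v. ((*v) ?H ^^ k) v = e *s v" by blast
    have eq: "vector [u $ 1, u $ 2, \<zeta> ^ k * u $ 3] = e *s u" for u :: "'k ^ 3"
    proof -
      have "M *v vector [u $ 1, u $ 2, \<zeta> ^ k * u $ 3] = M *v (e *s u)"
        using e[of "M *v u"] unfolding pow matrix_inv_vector_left[OF M] by (simp add: vec.scale)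
      then show ?thesis by (metis matrix_inv_vector_left[OF M])
    qed
    have "e = 1" using eq[of "vector [1, 0, 0]"] by (auto simp: vec_eq_iff forall_3)
    then have "\<zeta> ^ k = 1" using eq[of "vector [0, 0, 1]"] by (auto simp: vec_eq_iff forall_3)
    then show "n dvd k" using primitive_root_power_eq_1_iff[OF z] by blast
  next
    assume "n dvd k"
    then have "\<zeta> ^ k = 1" using primitive_root_power_eq_1_iff[OF z] by blast
    moreover have "vector [u $ 1, u $ 2, 1 * u $ 3] = u" for u :: "'k ^ 3" by (simp add: vec_eq_iff forall_3)
    ultimately have "((*v) ?H ^^ k) v = 1 *s v" for v unfolding pow by (simp add: matrix_inv_vector_right[OF M])
    then show "\<exists>e. \<forall>v. ((*v) ?H ^^ k) v = e *s v" by blast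
  qed
  interpret PGL: group "PGL3 :: ('k ^ 3 ^ 3) set monoid" by (rule group_PGL3)
  have car: "proj_class ?H \<in> carrier PGL3" unfolding carrier_PGL3 using iH by blast
  have "PGL.ord (proj_class ?H) dvd k \<longleftrightarrow> n dvd k" for k
    unfolding PGL.pow_eq_id[OF car, symmetric] pow_PGL3_eq_1_iff[OF iH] by (rule scalar)
  then have "PGL.ord (proj_class ?H) = n" by (meson dvd_antisym dvd_refl)
  then have "homology n (proj_class ?H)"
    unfolding homology_def using car M z by (intro conjI exI[of _ M] exI[of _ \<zeta>] exI[of _ 0] exI[of _ 1]) auto
  then show ?thesis using aut unfolding carrier_curve_Aut by blast
qed

end

theorem corollary51:
  fixes F :: "('k::{alg_closed_field, field_char_0}, 3) mpoly"
    and d l :: nat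
  assumes "d \<ge> 5"
    and "nonsingular_plane_curve d F"
    and "2 \<le> l" and "l \<le> d - 1"
    and "\<exists>g\<in>carrier (curve_Aut F). group.ord (curve_Aut F) g = l * (d - 1)"
  shows "cyclic_group (curve_Aut F)
    \<and> (\<exists>h\<in>carrier (curve_Aut F). homology (d - 1) h)
    \<and> (\<exists>!P. inner_galois_point F P)"
proof -
  define n where "n = d - 1"
  have n: "n \<ge> 4" "d = Suc n" using assms(1) by (simp_all add: n_def)
  interpret Aut: group "curve_Aut F" by (rule group_curve_Aut)
  obtain x where x: "x \<in> carrier (curve_Aut F)" "Aut.ord x = l * n" using assms(5) by (auto simp: n_def)
  then obtain A where A: "aut_matrix F A" "x = proj_class A" unfolding carrier_curve_Aut by blast
  have iA: "invertible A" using A(1) by (simp add: aut_matrix_def)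
  \<comment> \<open>The order of the class in the projective group is restated through scalar powers
    of a representing matrix, the input of \<open>homology_basis\<close>.\<close>
  have ord: "(\<exists>e. \<forall>v. ((*v) A ^^ k) v = e *s v) \<longleftrightarrow> l * n dvd k" for k
    using Aut.pow_eq_id[OF x(1), of k] unfolding x(2) unfolding A(2) pow_curve_Aut curve_Aut_simps pow_PGL3_eq_1_iff[OF iA] .
  obtain a where a: "\<And>v. mp_value F (A *v v) = a * mp_value F v" using A(1) unfolding aut_matrix_iff by blast
  have hom: "homogeneous (Suc n) F" using assms(2) n(2) by (simp add: nonsingular_plane_curve_def)
  have ns: "\<And>v. v \<noteq> 0 \<Longrightarrow> \<not> double_point F v" using nonsingular_imp_no_double_point[OF assms(2)] .
  have n2: "n \<ge> 2" using n(1) by simp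
  obtain b \<zeta> \<delta> where b: "invertible (cols b)" "primitive_root_of_unity n \<zeta>" "\<delta> \<noteq> 0"
    "((*v) A ^^ l) (b 1) = \<delta> *s b 1" "((*v) A ^^ l) (b 2) = \<delta> *s b 2"
    "((*v) A ^^ l) (b 3) = (\<zeta> * \<delta>) *s b 3"
    "\<And>v. mp_value F (((*v) A ^^ l) v) = \<delta> ^ Suc n * mp_value F v"
    by (rule homology_basis[OF iA a _ hom n2 assms(3) ord]) (erule ns, rule that)
  obtain M g c where M: "invertible M" "c \<noteq> 0" "transform_form M F = mp_const c * normal_form n g"
    "Polynomial.degree g = Suc n" "Polynomial.coeff g (Suc n) = 1" "\<And>x. poly g x = 0 \<Longrightarrow> poly (pderiv g) x \<noteq> 0"
    by (rule normal_form_exists[OF b _ hom n2]) (erule ns, rule that)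
  interpret normalised_curve n g F M c by unfold_locales (use n(1) M in auto)
  show ?thesis using cyclic_curve_Aut exists_homology unique_inner_galois_point unfolding n_def by blast
qed

end
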